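(* Let $n>1$ be an integer. Let $\mathbb{RP}^n$ be real projective space of diameter $\pi$, obtained as the quotient of a round $n$-sphere by the antipodal action, and let $\mathbb{S}_{\mathbb{RP}^n}=\mathbb{S}^1\vee\dots\vee\mathbb{S}^n$ be the wedge sum, with the gluing metric, of round spheres each of diameter $\pi$. With coefficients in $\mathbb{F}_2$: (1) For every $m\in\mathbb{N}$, $$d_{\mathrm{I}}\big(\mathrm{H}_m^{\mathrm{VR}}(\mathbb{RP}^n),\mathrm{H}_m^{\mathrm{VR}}(\mathbb{S}_{\mathbb{RP}^n})\big)<\frac{\pi}{4}.$$ (2) There are $k\in\mathbb{N}$ and a degree $\ell\in\mathbb{N}$ such that, for the Steenrod square $\mathrm{Sq}^k\colon \mathrm{H}^\ell(-;\mathbb{F}_2)\to\mathrm{H}^{\ell+k}(-;\mathbb{F}_2)$, $$d_{\mathrm{I}}\big(\mathrm{Im}_{\mathrm{Sq}^k}^{\mathrm{VR}}(\mathbb{RP}^n),\mathrm{Im}_{\mathrm{Sq}^k}^{\mathrm{VR}}(\mathbb{S}_{\mathbb{RP}^n})\big)\ge\frac{\pi}{3}.$$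
   Context: Homology and cohomology are reduced, with $\mathbb{F}_2$ coefficients (zero, in degrees $\ge 0$, for the empty space). Metrics: round spheres carry the geodesic distance; $\mathbb{S}^i$ denotes the round sphere of radius $1$ (diameter $\pi$), and $\mathbb{RP}^n$ is the quotient of the round sphere of radius $2$ by the antipodal map with the quotient metric $d([x],[x'])=\min\{d(x,x'),d(x,-x')\}$. The gluing metric on a wedge of pointed metric spaces $(\mathcal{X}_i,x_i)$ restricts to $d_{\mathcal{X}_i}$ on each $\mathcal{X}_i$ and is $d(x,x')=d_{\mathcal{X}_i}(x,x_i)+d_{\mathcal{X}_j}(x',x_j)$ for $x\in\mathcal{X}_i$, $x'\in\mathcal{X}_j$, $i\neq j$. For a metric space $\mathcal{X}$ and $r>0$, $\mathrm{VR}_r(\mathcal{X})$ is the geometric realization of the simplicial complex with vertices the points of $\mathcal{X}$ and simplices the finite subsets of diameter strictly less than $r$; $\mathrm{VR}_r(\mathcal{X})=\emptyset$ for $r\le 0$. $\mathrm{H}_m^{\mathrm{VR}}(\mathcal{X})$ is the functor $\mathbb{R}\to\mathrm{Vec}$, $r\mapsto\mathrm{H}_m(\mathrm{VR}_r(\mathcal{X}))$. For $\mathrm{Sq}^k\colon\mathrm{H}^\ell\to\mathrm{H}^{\ell+k}$, $\mathrm{Im}_{\mathrm{Sq}^k}^{\mathrm{VR}}(\mathcal{X})$ is the functor $\mathbb{R}^{\mathrm{op}}\to\mathrm{Vec}$ sending $r$ to the image of $\mathrm{Sq}^k\colon\mathrm{H}^\ell(\mathrm{VR}_r(\mathcal{X}))\to\mathrm{H}^{\ell+k}(\mathrm{VR}_r(\mathcal{X}))$,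 with structure maps restricted from cohomology. Interleaving distance: a $\delta$-interleaving ($\delta\ge0$) of $F,G\colon\mathbb{R}\to\mathrm{Vec}$ is a pair of natural families $\phi_r\colon F_r\to G_{r+\delta}$, $\psi_r\colon G_r\to F_{r+\delta}$ with $\psi_{r+\delta}\phi_r$ and $\phi_{r+\delta}\psi_r$ equal to the structure maps $F_r\to F_{r+2\delta}$, $G_r\to G_{r+2\delta}$; for functors on $\mathbb{R}^{\mathrm{op}}$ all arrows between indices are reversed ($\phi_r\colon F_{r+\delta}\to G_r$, etc.). $d_{\mathrm{I}}(F,G)$ is the infimum of $\delta\ge 0$ such that $F,G$ are $\delta$-interleaved. *)

theory Defs
  imports "HOL-Homology.Homology" "HOL-Library.Z2" "HOL-Library.Extended_Real"
begin

unbundle no m_inv_syntax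

section \<open>Vector spaces over the field with two elements\<close>

text \<open>
  Vector spaces over \<open>bit\<close> are records of type \<open>(bit, 'v) module\<close>; the ring
  multiplication and unit contained in such a record play no role.
\<close>

definition F2_functions :: "('i \<Rightarrow> bit) set \<Rightarrow> (bit, 'i \<Rightarrow> bit) module" where
  "F2_functions S = \<lparr>carrier = S, mult = undefined, one = undefined, zero = (\<lambda>i. 0),
     add = (\<lambda>f g i. f i + g i), smult = (\<lambda>c f i. c * f i)\<rparr>"

definition quotient_space :: "('c, 'v) module \<Rightarrow> 'v set \<Rightarrow> ('c, 'v set) module" where
  "quotient_space V N = \<lparr>carrier = a_rcosets\<^bsub>V\<^esub> N, mult = undefined, one = undefined, zero = N,
     add = set_add V, smult = (\<lambda>c A. \<Union>a\<in>A. N +>\<^bsub>V\<^esub> (c \<odot>\<^bsub>V\<^esub> a))\<rparr>"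

text \<open>
  The map into \<open>quotient_space W N\<close> induced by \<open>g\<close>. It is only used for \<open>g\<close> such that
  the cosets \<open>N + g a\<close> agree for all \<open>a\<close> in the argument \<open>A\<close>, so the union is one coset.
\<close>

definition quotient_map_induced ::
    "('c, 'w) module \<Rightarrow> 'w set \<Rightarrow> ('v \<Rightarrow> 'w) \<Rightarrow> 'v set \<Rightarrow> 'w set" where
  "quotient_map_induced W N g A = (\<Union>a\<in>A. N +>\<^bsub>W\<^esub> g a)"

definition linear_maps :: "('c, 'v) module \<Rightarrow> ('c, 'w) module \<Rightarrow> ('v \<Rightarrow> 'w) set" where
  "linear_maps V W = {f. f \<in> carrier V \<rightarrow> carrier W
     \<and> (\<forall>x\<in>carrier V. \<forall>y\<in>carrier V. f (x \<oplus>\<^bsub>V\<^esub> y) = f x \<oplus>\<^bsub>W\<^esub> f y)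
     \<and> (\<forall>c. \<forall>x\<in>carrier V. f (c \<odot>\<^bsub>V\<^esub> x) = c \<odot>\<^bsub>W\<^esub> f x)}"


section \<open>Reduced singular homology with coefficients in the field with two elements\<close>

definition basis_chain :: "'i \<Rightarrow> 'i \<Rightarrow> bit" where
  "basis_chain \<sigma> \<tau> = (if \<tau> = \<sigma> then 1 else 0)"

definition linear_extension :: "('i \<Rightarrow> 'j \<Rightarrow> bit) \<Rightarrow> ('i \<Rightarrow> bit) \<Rightarrow> 'j \<Rightarrow> bit" where
  "linear_extension h c \<tau> = (\<Sum>\<sigma> | c \<sigma> \<noteq> 0. c \<sigma> * h \<sigma> \<tau>)"

definition F2_chains :: "nat \<Rightarrow> 'a topology \<Rightarrow> (((nat \<Rightarrow> real) \<Rightarrow> 'a) \<Rightarrow> bit) set" where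
  "F2_chains p X = {c. finite {\<sigma>. c \<sigma> \<noteq> 0} \<and> {\<sigma>. c \<sigma> \<noteq> 0} \<subseteq> singular_simplex_set p X}"

definition F2_boundary ::
    "nat \<Rightarrow> (((nat \<Rightarrow> real) \<Rightarrow> 'a) \<Rightarrow> bit) \<Rightarrow> ((nat \<Rightarrow> real) \<Rightarrow> 'a) \<Rightarrow> bit" where
  "F2_boundary p = linear_extension (\<lambda>\<sigma> \<tau>. \<Sum>k\<le>p. basis_chain (singular_face p k \<sigma>) \<tau>)"

text \<open>In degree 0 the cycles are the kernel of the augmentation.\<close>

definition F2_cycles :: "nat \<Rightarrow> 'a topology \<Rightarrow> (((nat \<Rightarrow> real) \<Rightarrow> 'a) \<Rightarrow> bit) set" where
  "F2_cycles p X = {c \<in> F2_chains p X.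
     if p = 0 then (\<Sum>\<sigma> | c \<sigma> \<noteq> 0. c \<sigma>) = 0 else F2_boundary p c = (\<lambda>\<tau>. 0)}"

definition F2_boundaries :: "nat \<Rightarrow> 'a topology \<Rightarrow> (((nat \<Rightarrow> real) \<Rightarrow> 'a) \<Rightarrow> bit) set" where
  "F2_boundaries p X = F2_boundary (Suc p) ` F2_chains (Suc p) X"

definition F2_homology ::
    "nat \<Rightarrow> 'a topology \<Rightarrow> (bit, (((nat \<Rightarrow> real) \<Rightarrow> 'a) \<Rightarrow> bit) set) module" where
  "F2_homology p X = quotient_space (F2_functions (F2_cycles p X)) (F2_boundaries p X)"

definition F2_homology_induced :: "nat \<Rightarrow> 'b topology \<Rightarrow> ('a \<Rightarrow> 'b)
    \<Rightarrow> (((nat \<Rightarrow> real) \<Rightarrow> 'a) \<Rightarrow> bit) set \<Rightarrow> (((nat \<Rightarrow> real) \<Rightarrow> 'b) \<Rightarrow> bit) set" where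
  "F2_homology_induced p Y f =
     quotient_map_induced (F2_functions (F2_cycles p Y)) (F2_boundaries p Y)
       (linear_extension (\<lambda>\<sigma>. basis_chain (simplex_map p f \<sigma>)))"


section \<open>Reduced singular cohomology and Steenrod squares\<close>

text \<open>Cochains are extended by zero outside the singular simplices of the relevant dimension.\<close>

definition F2_cochains :: "nat \<Rightarrow> 'a topology \<Rightarrow> (((nat \<Rightarrow> real) \<Rightarrow> 'a) \<Rightarrow> bit) set" where
  "F2_cochains p X = {x. \<forall>\<sigma>. \<not> singular_simplex p X \<sigma> \<longrightarrow> x \<sigma> = 0}"

definition F2_coboundary :: "nat \<Rightarrow> 'a topology
    \<Rightarrow> (((nat \<Rightarrow> real) \<Rightarrow> 'a) \<Rightarrow> bit) \<Rightarrow> ((nat \<Rightarrow> real) \<Rightarrow> 'a) \<Rightarrow> bit" where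
  "F2_coboundary p X x \<sigma> =
     (if singular_simplex (Suc p) X \<sigma> then \<Sum>k\<le>Suc p. x (singular_face (Suc p) k \<sigma>) else 0)"

definition F2_cocycles :: "nat \<Rightarrow> 'a topology \<Rightarrow> (((nat \<Rightarrow> real) \<Rightarrow> 'a) \<Rightarrow> bit) set" where
  "F2_cocycles p X = {x \<in> F2_cochains p X. F2_coboundary p X x = (\<lambda>\<sigma>. 0)}"

text \<open>In degree 0 the coboundaries are the constant cochains (the image of the coaugmentation).\<close>

definition F2_coboundaries :: "nat \<Rightarrow> 'a topology \<Rightarrow> (((nat \<Rightarrow> real) \<Rightarrow> 'a) \<Rightarrow> bit) set" where
  "F2_coboundaries p X = (case p of
       0 \<Rightarrow> range (\<lambda>a \<sigma>. if singular_simplex 0 X \<sigma> then a else 0)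
     | Suc q \<Rightarrow> F2_coboundary q X ` F2_cochains q X)"

definition F2_cohomology ::
    "nat \<Rightarrow> 'a topology \<Rightarrow> (bit, (((nat \<Rightarrow> real) \<Rightarrow> 'a) \<Rightarrow> bit) set) module" where
  "F2_cohomology p X = quotient_space (F2_functions (F2_cocycles p X)) (F2_coboundaries p X)"

definition F2_cohomology_induced :: "nat \<Rightarrow> 'a topology \<Rightarrow> 'b topology \<Rightarrow> ('a \<Rightarrow> 'b)
    \<Rightarrow> (((nat \<Rightarrow> real) \<Rightarrow> 'b) \<Rightarrow> bit) set \<Rightarrow> (((nat \<Rightarrow> real) \<Rightarrow> 'a) \<Rightarrow> bit) set" where
  "F2_cohomology_induced p X Y f =
     quotient_map_induced (F2_functions (F2_cocycles p X)) (F2_coboundaries p X)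
       (\<lambda>y \<sigma>. if singular_simplex p X \<sigma> then y (simplex_map p f \<sigma>) else 0)"

fun iterated_face ::
    "nat \<Rightarrow> nat list \<Rightarrow> ((nat \<Rightarrow> real) \<Rightarrow> 'a) \<Rightarrow> (nat \<Rightarrow> real) \<Rightarrow> 'a" where
  "iterated_face n [] \<sigma> = \<sigma>"
| "iterated_face n (u # us) \<sigma> = iterated_face (n - 1) us (singular_face n u \<sigma>)"

text \<open>
  The face of an \<open>n\<close>-simplex opposite to the vertices in \<open>U\<close>. Vertices are removed in
  decreasing order, so that the numbers of those still to be removed do not change.
\<close>

definition delete_vertices ::
    "nat \<Rightarrow> nat set \<Rightarrow> ((nat \<Rightarrow> real) \<Rightarrow> 'a) \<Rightarrow> (nat \<Rightarrow> real) \<Rightarrow> 'a" where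
  "delete_vertices n U = iterated_face n (rev (sorted_list_of_set U))"

text \<open>
  Steenrod's cup-\<open>i\<close> product of cochains of degrees \<open>p\<close> and \<open>q\<close>, in the form given by
  Medina-Mardones: for an \<open>n\<close>-simplex, \<open>n = p + q - i\<close>, one sums over all
  \<open>U = {u\<^sub>1 < \<dots> < u\<^sub>r} \<subseteq> {0..n}\<close> with \<open>r = n - i\<close>, split into
  \<open>U\<^sup>0 = {u\<^sub>j | u\<^sub>j \<equiv> j mod 2}\<close> and \<open>U\<^sup>1 = U - U\<^sup>0\<close>. The summands in which the faces
  do not have dimensions \<open>p\<close> and \<open>q\<close> are left out.
  For \<open>i = 0\<close> this is the Alexander-Whitney cup product.
\<close>

definition matching_parity :: "nat set \<Rightarrow> nat set" where
  "matching_parity U = {u \<in> U. even (u + card {v \<in> U. v \<le> u})}"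

definition cup_i :: "nat \<Rightarrow> nat \<Rightarrow> nat \<Rightarrow> 'a topology \<Rightarrow> (((nat \<Rightarrow> real) \<Rightarrow> 'a) \<Rightarrow> bit)
    \<Rightarrow> (((nat \<Rightarrow> real) \<Rightarrow> 'a) \<Rightarrow> bit) \<Rightarrow> ((nat \<Rightarrow> real) \<Rightarrow> 'a) \<Rightarrow> bit" where
  "cup_i i p q X x y \<sigma> = (let n = p + q - i in
     if singular_simplex n X \<sigma> then
       \<Sum>U | U \<subseteq> {0..n} \<and> card (matching_parity U) = q - i \<and> card (U - matching_parity U) = p - i.
         x (delete_vertices n (matching_parity U) \<sigma>)
         * y (delete_vertices n (U - matching_parity U) \<sigma>)
     else 0)"

definition steenrod_cochain :: "nat \<Rightarrow> nat \<Rightarrow> 'a topology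
    \<Rightarrow> (((nat \<Rightarrow> real) \<Rightarrow> 'a) \<Rightarrow> bit) \<Rightarrow> ((nat \<Rightarrow> real) \<Rightarrow> 'a) \<Rightarrow> bit" where
  "steenrod_cochain k l X x = (if k \<le> l then cup_i (l - k) l l X x x else (\<lambda>\<sigma>. 0))"

definition steenrod_square :: "nat \<Rightarrow> nat \<Rightarrow> 'a topology
    \<Rightarrow> (((nat \<Rightarrow> real) \<Rightarrow> 'a) \<Rightarrow> bit) set \<Rightarrow> (((nat \<Rightarrow> real) \<Rightarrow> 'a) \<Rightarrow> bit) set" where
  "steenrod_square k l X =
     quotient_map_induced (F2_functions (F2_cocycles (l + k) X)) (F2_coboundaries (l + k) X)
       (steenrod_cochain k l X)"


section \<open>Vietoris--Rips complexes\<close>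

definition closed_simplex :: "'a set \<Rightarrow> ('a \<Rightarrow> real) set" where
  "closed_simplex s = {t. (\<forall>v. 0 \<le> t v) \<and> (\<forall>v. v \<notin> s \<longrightarrow> t v = 0) \<and> sum t s = 1}"

text \<open>
  The realization of a complex, given as the set of its (nonempty, finite) simplices, carries
  the weak topology determined by its closed simplices.
\<close>

definition geometric_realization :: "'a set set \<Rightarrow> ('a \<Rightarrow> real) topology" where
  "geometric_realization K = topology (\<lambda>U. U \<subseteq> (\<Union>s\<in>K. closed_simplex s) \<and>
     (\<forall>s\<in>K. openin (subtopology (powertop_real UNIV) (closed_simplex s)) (U \<inter> closed_simplex s)))"

lemma openin_geometric_realization:
  "openin (geometric_realization K) U \<longleftrightarrow> U \<subseteq> (\<Union>s\<in>K. closed_simplex s) \<and>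
     (\<forall>s\<in>K. openin (subtopology (powertop_real UNIV) (closed_simplex s)) (U \<inter> closed_simplex s))"
proof -
  have "istopology (\<lambda>U. U \<subseteq> (\<Union>s\<in>K. closed_simplex s) \<and>
     (\<forall>s\<in>K. openin (subtopology (powertop_real UNIV) (closed_simplex s)) (U \<inter> closed_simplex s)))"
    (is "istopology ?P")
    unfolding istopology_def
  proof (intro conjI allI impI)
    fix S T assume S: "?P S" and T: "?P T"
    show "S \<inter> T \<subseteq> (\<Union>s\<in>K. closed_simplex s)"
      using S by blast
    show "\<forall>s\<in>K. openin (subtopology (powertop_real UNIV) (closed_simplex s))
        (S \<inter> T \<inter> closed_simplex s)"
    proof
      fix s assume "s \<in> K"
      then have "openin (subtopology (powertop_real UNIV) (closed_simplex s))
          ((S \<inter> closed_simplex s) \<inter> (T \<inter> closed_simplex s))"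
        by (intro openin_Int S[THEN conjunct2, rule_format] T[THEN conjunct2, rule_format])
      moreover have "(S \<inter> closed_simplex s) \<inter> (T \<inter> closed_simplex s) = S \<inter> T \<inter> closed_simplex s"
        by blast
      ultimately show "openin (subtopology (powertop_real UNIV) (closed_simplex s))
          (S \<inter> T \<inter> closed_simplex s)"
        by simp
    qed
  next
    fix \<K> assume \<K>: "\<forall>S\<in>\<K>. ?P S"
    show "\<Union>\<K> \<subseteq> (\<Union>s\<in>K. closed_simplex s)"
      using \<K> by blast
    show "\<forall>s\<in>K. openin (subtopology (powertop_real UNIV) (closed_simplex s))
        (\<Union>\<K> \<inter> closed_simplex s)"
      unfolding Int_Union2 using \<K> by (intro ballI openin_Union) auto
  qed
  then show ?thesis
    by (simp add: geometric_realization_def)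
qed

definition vietoris_rips_complex :: "'a set \<Rightarrow> ('a \<Rightarrow> 'a \<Rightarrow> real) \<Rightarrow> real \<Rightarrow> 'a set set" where
  "vietoris_rips_complex M d r =
     {s. finite s \<and> s \<noteq> {} \<and> s \<subseteq> M \<and> Max {d x y |x y. x \<in> s \<and> y \<in> s} < r}"

definition VR :: "'a set \<Rightarrow> ('a \<Rightarrow> 'a \<Rightarrow> real) \<Rightarrow> real \<Rightarrow> ('a \<Rightarrow> real) topology" where
  "VR M d r = geometric_realization (vietoris_rips_complex M d r)"


section \<open>Functors on the real line and the interleaving distance\<close>

text \<open>
  For \<open>r \<le> s\<close>, the structure map \<open>structure_map F r s\<close> goes from \<open>obj F r\<close> to \<open>obj F s\<close> for a
  functor on the real line, and from \<open>obj F s\<close> to \<open>obj F r\<close> for a functor on its opposite.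
\<close>

record 'v real_functor =
  obj :: "real \<Rightarrow> (bit, 'v) module"
  structure_map :: "real \<Rightarrow> real \<Rightarrow> 'v \<Rightarrow> 'v"

definition VR_homology :: "nat \<Rightarrow> 'a set \<Rightarrow> ('a \<Rightarrow> 'a \<Rightarrow> real)
    \<Rightarrow> (((nat \<Rightarrow> real) \<Rightarrow> ('a \<Rightarrow> real)) \<Rightarrow> bit) set real_functor" where
  "VR_homology m M d = \<lparr>obj = (\<lambda>r. F2_homology m (VR M d r)),
     structure_map = (\<lambda>r s. F2_homology_induced m (VR M d s) id)\<rparr>"

definition VR_Sq_image :: "nat \<Rightarrow> nat \<Rightarrow> 'a set \<Rightarrow> ('a \<Rightarrow> 'a \<Rightarrow> real)
    \<Rightarrow> (((nat \<Rightarrow> real) \<Rightarrow> ('a \<Rightarrow> real)) \<Rightarrow> bit) set real_functor" where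
  "VR_Sq_image k l M d =
     \<lparr>obj = (\<lambda>r. (F2_cohomology (l + k) (VR M d r))
        \<lparr>carrier := steenrod_square k l (VR M d r) ` carrier (F2_cohomology l (VR M d r))\<rparr>),
      structure_map =
        (\<lambda>r s. F2_cohomology_induced (l + k) (VR M d r) (VR M d s) id)\<rparr>"

definition interleaved :: "real \<Rightarrow> 'v real_functor \<Rightarrow> 'w real_functor \<Rightarrow> bool" where
  "interleaved \<delta> F G \<longleftrightarrow> (\<exists>\<phi> \<psi>.
     (\<forall>r. \<phi> r \<in> linear_maps (obj F r) (obj G (r + \<delta>))) \<and>
     (\<forall>r. \<psi> r \<in> linear_maps (obj G r) (obj F (r + \<delta>))) \<and>
     (\<forall>r s. r \<le> s \<longrightarrow> (\<forall>x\<in>carrier (obj F r).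
        \<phi> s (structure_map F r s x) = structure_map G (r + \<delta>) (s + \<delta>) (\<phi> r x))) \<and>
     (\<forall>r s. r \<le> s \<longrightarrow> (\<forall>y\<in>carrier (obj G r).
        \<psi> s (structure_map G r s y) = structure_map F (r + \<delta>) (s + \<delta>) (\<psi> r y))) \<and>
     (\<forall>r. \<forall>x\<in>carrier (obj F r). \<psi> (r + \<delta>) (\<phi> r x) = structure_map F r (r + 2 * \<delta>) x) \<and>
     (\<forall>r. \<forall>y\<in>carrier (obj G r). \<phi> (r + \<delta>) (\<psi> r y) = structure_map G r (r + 2 * \<delta>) y))"

definition op_interleaved :: "real \<Rightarrow> 'v real_functor \<Rightarrow> 'w real_functor \<Rightarrow> bool" where
  "op_interleaved \<delta> F G \<longleftrightarrow> (\<exists>\<phi> \<psi>.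
     (\<forall>r. \<phi> r \<in> linear_maps (obj F (r + \<delta>)) (obj G r)) \<and>
     (\<forall>r. \<psi> r \<in> linear_maps (obj G (r + \<delta>)) (obj F r)) \<and>
     (\<forall>r s. r \<le> s \<longrightarrow> (\<forall>x\<in>carrier (obj F (s + \<delta>)).
        \<phi> r (structure_map F (r + \<delta>) (s + \<delta>) x) = structure_map G r s (\<phi> s x))) \<and>
     (\<forall>r s. r \<le> s \<longrightarrow> (\<forall>y\<in>carrier (obj G (s + \<delta>)).
        \<psi> r (structure_map G (r + \<delta>) (s + \<delta>) y) = structure_map F r s (\<psi> s y))) \<and>
     (\<forall>r. \<forall>x\<in>carrier (obj F (r + 2 * \<delta>)).
        \<psi> r (\<phi> (r + \<delta>) x) = structure_map F r (r + 2 * \<delta>) x) \<and>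
     (\<forall>r. \<forall>y\<in>carrier (obj G (r + 2 * \<delta>)).
        \<phi> r (\<psi> (r + \<delta>) y) = structure_map G r (r + 2 * \<delta>) y))"

text \<open>The distances are infinite if there is no interleaving.\<close>

definition interleaving_distance :: "'v real_functor \<Rightarrow> 'w real_functor \<Rightarrow> ereal" where
  "interleaving_distance F G = (INF \<delta>\<in>{\<delta>. 0 \<le> \<delta> \<and> interleaved \<delta> F G}. ereal \<delta>)"

definition op_interleaving_distance :: "'v real_functor \<Rightarrow> 'w real_functor \<Rightarrow> ereal" where
  "op_interleaving_distance F G = (INF \<delta>\<in>{\<delta>. 0 \<le> \<delta> \<and> op_interleaved \<delta> F G}. ereal \<delta>)"


section \<open>Projective spaces and wedges of spheres\<close>

text \<open>
  The \<open>n\<close>-sphere of radius \<open>R\<close> in the coordinates \<open>0, \<dots>, n\<close>; the geodesic distance is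
  \<open>R\<close> times the angle.
\<close>

definition round_sphere :: "real \<Rightarrow> nat \<Rightarrow> (nat \<Rightarrow> real) set" where
  "round_sphere R n = {x. (\<Sum>i\<le>n. (x i)\<^sup>2) = R\<^sup>2 \<and> (\<forall>i>n. x i = 0)}"

definition geodesic_dist :: "real \<Rightarrow> nat \<Rightarrow> (nat \<Rightarrow> real) \<Rightarrow> (nat \<Rightarrow> real) \<Rightarrow> real" where
  "geodesic_dist R n x y = R * arccos ((\<Sum>i\<le>n. x i * y i) / R\<^sup>2)"

definition projective_space :: "nat \<Rightarrow> (nat \<Rightarrow> real) set set" where
  "projective_space n = {{x, \<lambda>i. - x i} |x. x \<in> round_sphere 2 n}"

definition projective_dist :: "nat \<Rightarrow> (nat \<Rightarrow> real) set \<Rightarrow> (nat \<Rightarrow> real) set \<Rightarrow> real" where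
  "projective_dist n P Q = Min {geodesic_dist 2 n x y |x y. x \<in> P \<and> y \<in> Q}"

lemma projective_dist_eq:
  "projective_dist n {x, \<lambda>i. - x i} {y, \<lambda>i. - y i} =
     min (geodesic_dist 2 n x y) (geodesic_dist 2 n x (\<lambda>i. - y i))"
proof -
  have "geodesic_dist 2 n (\<lambda>i. - x i) y = geodesic_dist 2 n x (\<lambda>i. - y i)"
    and "geodesic_dist 2 n (\<lambda>i. - x i) (\<lambda>i. - y i) = geodesic_dist 2 n x y"
    by (simp_all add: geodesic_dist_def)
  then have "{geodesic_dist 2 n a b |a b. a \<in> {x, \<lambda>i. - x i} \<and> b \<in> {y, \<lambda>i. - y i}} =
      {geodesic_dist 2 n x y, geodesic_dist 2 n x (\<lambda>i. - y i)}"
    by force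
  then show ?thesis
    by (simp add: projective_dist_def)
qed

definition wedge_rel ::
    "'i set \<Rightarrow> ('i \<Rightarrow> 'a set) \<Rightarrow> ('i \<Rightarrow> 'a) \<Rightarrow> (('i \<times> 'a) \<times> ('i \<times> 'a)) set" where
  "wedge_rel I X b = {(p, q). p \<in> Sigma I X \<and> q \<in> Sigma I X
     \<and> (p = q \<or> snd p = b (fst p) \<and> snd q = b (fst q))}"

definition wedge :: "'i set \<Rightarrow> ('i \<Rightarrow> 'a set) \<Rightarrow> ('i \<Rightarrow> 'a) \<Rightarrow> ('i \<times> 'a) set set" where
  "wedge I X b = Sigma I X // wedge_rel I X b"

definition gluing_dist :: "('i \<Rightarrow> 'a \<Rightarrow> 'a \<Rightarrow> real) \<Rightarrow> ('i \<Rightarrow> 'a) \<Rightarrow> 'i \<times> 'a \<Rightarrow> 'i \<times> 'a \<Rightarrow> real" where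
  "gluing_dist d b p q = (if fst p = fst q then d (fst p) (snd p) (snd q)
     else d (fst p) (snd p) (b (fst p)) + d (fst q) (snd q) (b (fst q)))"

definition wedge_dist ::
    "('i \<Rightarrow> 'a \<Rightarrow> 'a \<Rightarrow> real) \<Rightarrow> ('i \<Rightarrow> 'a) \<Rightarrow> ('i \<times> 'a) set \<Rightarrow> ('i \<times> 'a) set \<Rightarrow> real" where
  "wedge_dist d b P Q = gluing_dist d b (SOME p. p \<in> P) (SOME q. q \<in> Q)"

lemma wedge_dist_eq:
  assumes "p \<in> Sigma I X" "q \<in> Sigma I X"
    and zero: "\<And>i. i \<in> I \<Longrightarrow> d i (b i) (b i) = 0"
    and sym: "\<And>i x y. d i x y = d i y x"
  shows "wedge_dist d b (wedge_rel I X b `` {p}) (wedge_rel I X b `` {q}) = gluing_dist d b p q"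
proof -
  have *: "(SOME p'. p' \<in> wedge_rel I X b `` {p}) \<in> wedge_rel I X b `` {p}"
    if "p \<in> Sigma I X" for p
    by (rule someI[of _ p]) (use that in \<open>simp add: wedge_rel_def\<close>)
  define p' q' where "p' = (SOME p'. p' \<in> wedge_rel I X b `` {p})"
    and "q' = (SOME q'. q' \<in> wedge_rel I X b `` {q})"
  have "(p, p') \<in> wedge_rel I X b" "(q, q') \<in> wedge_rel I X b"
    using *[OF assms(1)] *[OF assms(2)] by (simp_all add: p'_def q'_def)
  then have "p \<in> Sigma I X" "p' \<in> Sigma I X" "q \<in> Sigma I X" "q' \<in> Sigma I X"
    and p: "p' = p \<or> snd p = b (fst p) \<and> snd p' = b (fst p')"
    and q: "q' = q \<or> snd q = b (fst q) \<and> snd q' = b (fst q')"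
    by (auto simp: wedge_rel_def)
  then have "d (fst p) (b (fst p)) (b (fst p)) = 0" "d (fst p') (b (fst p')) (b (fst p')) = 0"
    "d (fst q) (b (fst q)) (b (fst q)) = 0" "d (fst q') (b (fst q')) (b (fst q')) = 0"
    by (auto simp: zero)
  moreover have "d (fst q) (b (fst q)) (snd q) = d (fst q) (snd q) (b (fst q))"
    by (rule sym)
  ultimately have "gluing_dist d b p' q' = gluing_dist d b p q"
    using p q by (elim disjE conjE) (simp_all add: gluing_dist_def)
  then show ?thesis
    by (simp add: wedge_dist_def p'_def q'_def)
qed

definition sphere_base_point :: "nat \<Rightarrow> nat \<Rightarrow> real" where
  "sphere_base_point i = (\<lambda>j. if j = 0 then 1 else 0)"

definition sphere_wedge :: "nat \<Rightarrow> (nat \<times> (nat \<Rightarrow> real)) set set" where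
  "sphere_wedge n = wedge {1..n} (round_sphere 1) sphere_base_point"

definition sphere_wedge_dist ::
    "(nat \<times> (nat \<Rightarrow> real)) set \<Rightarrow> (nat \<times> (nat \<Rightarrow> real)) set \<Rightarrow> real" where
  "sphere_wedge_dist = wedge_dist (geodesic_dist 1) sphere_base_point"

end

theory Submission
  imports Defs
begin

text \<open>
  Realizations of simplicial complexes are treated simplicially: after barycentric subdivision, a
  singular cycle is homotopic to an affine one.

  Let \<open>a = arccos (- 1 / (n + 1))\<close>. Up to scale \<open>a\<close>, every simplex of the Rips complex of the unit
  \<open>i\<close>-sphere, \<open>i \<le> n\<close>, lies in an open hemisphere, and acyclic carriers identify the homology of
  that complex with the one of the boundary of a cross-polytope. For \<open>r \<le> 2\<pi>/3\<close> the Rips complex of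
  projective space is doubly covered by that of its sphere. By the Gysin sequence its homology is a
  line in each degree \<open>1, \<dots>, n\<close>, detected by the powers of the first Stiefel-Whitney class. So, in
  such a degree, both persistence modules are constant lines on \<open>(0, a]\<close>. Beyond \<open>3\<pi>/4 < (a + \<pi>)/2\<close>
  their generators die, because the identity is contiguous to a map into a small cap, and beyond
  \<open>\<pi>\<close> everything vanishes. Hence they are interleaved for \<open>\<delta> = (\<pi> - a)/2 < \<pi>/4\<close>.

  The first Stiefel-Whitney class has nonzero square up to scale \<open>2\<pi>/3\<close> if \<open>n > 1\<close>, whereas up to
  scale \<open>\<pi>/2\<close> squares of classes of degree one vanish on each summand of the wedge. An interleaving
  for \<open>\<delta> < \<pi>/3\<close> would factor a nonzero map between the images of \<open>Sq\<^sup>1\<close> at some \<open>r\<close> and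
  \<open>r + 2\<delta> \<le> 2\<pi>/3\<close> through the zero space at \<open>r + \<delta> \<le> \<pi>/2\<close>.
\<close>


section \<open>Simplicial chains modulo two and acyclic carriers\<close>

section \<open>Chains with coefficients in the field with two elements\<close>

text \<open>The homology at scales between \<open>a\<close> and \<pi> is never computed. This window
  has length \<open>2\<delta>\<close>, so an interleaving may send every class at a scale beyond
  \<open>a\<close> to zero, provided that the generator of the line has died when it passes the
  midpoint \<open>a + \<delta>\<close>. Only a generator taken at a small scale has to be killed
  there, and for it one can move vertices into a cap. In degrees without a line both modules live in
  the window only, and zero maps interleave them. The Gysin sequence does not determine the homology
  of the quotient by itself: above degree \<open>n\<close> it merely identifies consecutive degrees,
  and injectivity in degree \<open>n\<close> rests on vanishing in degree \<open>n + 1\<close>. At a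
  very small scale, \<open>n + 1\<close> sections lift all simplices and force this vanishing; a
  comparison of two Gysin sequences carries it to larger scales. The value 2\<pi>/3 comes from the
  radius 2 of the covering sphere: at scale \<open>r\<close> lines are near if their angle is below
  \<open>r / 2\<close>, and three pairwise near lines have pairwise near representatives as long as
  the cosine of \<open>r / 2\<close> is at least 1/2.\<close>

class char2 = ab_group_add +
  assumes add_self [simp]: "x + x = 0"
begin

lemma add_self_left [simp]: "x + (x + y) = y"
  by (simp flip: add.assoc)

lemma minus_char2 [simp]: "- x = x"
  by (rule minus_unique) simp

lemma diff_char2 [simp]: "x - y = x + y"
  using diff_conv_add_uminus minus_char2 by presburger

lemma add_eq_0_char2: "x + y = 0 \<longleftrightarrow> x = y"
  by (metis add_self local.add_left_cancel)

end

instance bit :: char2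
  by standard (simp add: bit_eq_iff)

instance poly_mapping :: (type, char2) char2
  by standard (simp add: poly_mapping_eq_iff lookup_add fun_eq_iff)

type_synonym 'i mod2 = "'i \<Rightarrow>\<^sub>0 bit"

definition gen :: "'i \<Rightarrow> 'i mod2" where
  "gen x = Poly_Mapping.single x 1"

text \<open>Values in any group of exponent two are allowed: in chains, \<open>lin f\<close> is a
  map of chain groups; in \<open>bit\<close>, it is the evaluation of the cochain \<open>f\<close>.
  Both uses share the same rules.\<close>

definition lin :: "('i \<Rightarrow> 'b::char2) \<Rightarrow> 'i mod2 \<Rightarrow> 'b" where
  "lin f c = (\<Sum>x\<in>Poly_Mapping.keys c. f x)"

lemma keys_gen [simp]: "Poly_Mapping.keys (gen x) = {x}"
  by (simp add: gen_def)

lemma lin_gen [simp]: "lin f (gen x) = f x"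
  by (simp add: lin_def)

lemma lin_0 [simp]: "lin f 0 = 0"
  by (simp add: lin_def)

lemma keys_add_mod2:
  "Poly_Mapping.keys (c + d :: 'i mod2) =
     (Poly_Mapping.keys c - Poly_Mapping.keys d) \<union> (Poly_Mapping.keys d - Poly_Mapping.keys c)"
  by (auto simp: in_keys_iff lookup_add)

lemma lin_add: "lin f (c + d) = lin f c + lin f d"
proof -
  let ?C = "Poly_Mapping.keys c" and ?D = "Poly_Mapping.keys d"
  have "lin f c = sum f (?C - ?D) + sum f (?C \<inter> ?D)" "lin f d = sum f (?D - ?C) + sum f (?C \<inter> ?D)"
    unfolding lin_def by (subst sum.union_disjoint [symmetric]; auto intro: sum.cong)+
  moreover have "lin f (c + d) = sum f (?C - ?D) + sum f (?D - ?C)"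
    unfolding lin_def keys_add_mod2 by (subst sum.union_disjoint) auto
  ultimately show ?thesis
    by (simp add: algebra_simps)
qed

lemma lin_sum: "lin f (\<Sum>i\<in>I. c i) = (\<Sum>i\<in>I. lin f (c i))"
  by (induction I rule: infinite_finite_induct) (simp_all add: lin_add)

lemma lin_lin: "lin f (lin g c) = lin (\<lambda>x. lin f (g x)) c"
  by (subst (2 3) lin_def) (simp add: lin_sum)

lemma lin_cong: "(\<And>x. x \<in> Poly_Mapping.keys c \<Longrightarrow> f x = g x) \<Longrightarrow> lin f c = lin g c"
  by (simp add: lin_def)

lemma lin_fun_add: "lin (\<lambda>x. f x + g x) c = lin f c + lin g c"
  by (simp add: lin_def sum.distrib)

lemma lin_fun_sum: "lin (\<lambda>x. \<Sum>i\<in>I. f i x) c = (\<Sum>i\<in>I. lin (f i) c)"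
  by (simp add: lin_def sum.swap [of _ I])

lemma lin_fun_0 [simp]: "lin (\<lambda>x. 0) c = 0"
  by (simp add: lin_def)

lemma mod2_induct [case_names zero add]:
  assumes "P 0" and "\<And>x c. x \<notin> Poly_Mapping.keys c \<Longrightarrow> P c \<Longrightarrow> P (gen x + c)"
  shows "P (c :: 'i mod2)"
proof (induction "card (Poly_Mapping.keys c)" arbitrary: c rule: less_induct)
  case less
  show ?case
  proof (cases "c = 0")
    case True
    then show ?thesis using assms(1) by simp
  next
    case False
    then obtain x where x: "x \<in> Poly_Mapping.keys c"
      by (metis ex_in_conv keys_eq_empty)
    have keys: "Poly_Mapping.keys (gen x + c) = Poly_Mapping.keys c - {x}"
      using x by (auto simp: keys_add_mod2)
    have "card (Poly_Mapping.keys c - {x}) < card (Poly_Mapping.keys c)"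
      using x by (intro card_Diff1_less) auto
    then have "P (gen x + c)"
      by (intro less) (simp add: keys)
    then have "P (gen x + (gen x + c))"
      using assms(2) keys by blast
    then show ?thesis by (simp only: add_self_left)
  qed
qed

lemma lin_gen_id [simp]: "lin gen c = c"
  by (induction c rule: mod2_induct) (simp_all add: lin_add)

lemma keys_lin: "Poly_Mapping.keys (lin f c) \<subseteq> (\<Union>x\<in>Poly_Mapping.keys c. Poly_Mapping.keys (f x))"
  unfolding lin_def using keys_sum by fastforce

lemma lin_unique:
  assumes "\<And>x. x \<in> Poly_Mapping.keys c \<Longrightarrow> h (gen x) = f x" and "h 0 = 0"
    and "\<And>c d. h (c + d) = h c + h d"
  shows "h c = lin f c"
  using assms(1)
proof (induction c rule: mod2_induct)
  case (add x c)
  have "Poly_Mapping.keys (gen x + c) = insert x (Poly_Mapping.keys c)"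
    using add.hyps by (auto simp: keys_add_mod2)
  then show ?case
    using add by (simp add: assms(3) lin_add)
qed (simp add: assms)

definition chain_space :: "'i set \<Rightarrow> 'i mod2 set" where
  "chain_space S = {c. Poly_Mapping.keys c \<subseteq> S}"

lemma chains_0 [simp]: "0 \<in> chain_space S"
  by (simp add: chain_space_def)

lemma gen_chains [simp]: "gen x \<in> chain_space S \<longleftrightarrow> x \<in> S"
  by (simp add: chain_space_def)

lemma chains_add: "c \<in> chain_space S \<Longrightarrow> d \<in> chain_space S \<Longrightarrow> c + d \<in> chain_space S"
  by (auto simp: chain_space_def keys_add_mod2)

lemma chains_sum: "(\<And>i. i \<in> I \<Longrightarrow> c i \<in> chain_space S) \<Longrightarrow> (\<Sum>i\<in>I. c i) \<in> chain_space S"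
  by (induction I rule: infinite_finite_induct) (simp_all add: chains_add)

lemma chains_lin: "c \<in> chain_space S \<Longrightarrow> (\<And>x. x \<in> S \<Longrightarrow> f x \<in> chain_space T) \<Longrightarrow> lin f c \<in> chain_space T"
  unfolding lin_def by (rule chains_sum) (auto simp: chain_space_def)

lemma chains_mono: "c \<in> chain_space S \<Longrightarrow> S \<subseteq> T \<Longrightarrow> c \<in> chain_space T"
  by (auto simp: chain_space_def)

lemma chains_keysD: "c \<in> chain_space S \<Longrightarrow> x \<in> Poly_Mapping.keys c \<Longrightarrow> x \<in> S"
  by (auto simp: chain_space_def)

lemma lin_cong_chains: "c \<in> chain_space S \<Longrightarrow> (\<And>x. x \<in> S \<Longrightarrow> f x = g x) \<Longrightarrow> lin f c = lin g c"
  by (rule lin_cong) (auto simp: chain_space_def)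

lemma chains_induct [consumes 1, case_names zero add]:
  assumes "c \<in> chain_space S" "P 0"
    and "\<And>x c. x \<in> S \<Longrightarrow> c \<in> chain_space S \<Longrightarrow> P c \<Longrightarrow> P (gen x + c)"
  shows "P c"
proof -
  have "c \<in> chain_space S \<longrightarrow> P c"
  proof (induction c rule: mod2_induct)
    case (add x c)
    then have "Poly_Mapping.keys (gen x + c) = insert x (Poly_Mapping.keys c)"
      by (auto simp: keys_add_mod2)
    then show ?case
      using add assms(3) by (auto simp: chain_space_def)
  qed (use assms in simp)
  then show ?thesis using assms by blast
qed


section \<open>Ordered simplicial chains\<close>

text \<open>
  A list of length \<open>p\<close> is an ordered simplex of dimension \<open>p - 1\<close>. Since the empty list counts
  as a simplex, the chain complex is augmented and computes reduced homology.
\<close>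

primrec faces :: "'a list \<Rightarrow> 'a list mod2" where
  "faces [] = 0"
| "faces (x # xs) = gen xs + lin (\<lambda>ys. gen (x # ys)) (faces xs)"

abbreviation bd :: "'a list mod2 \<Rightarrow> 'a list mod2" where
  "bd \<equiv> lin faces"

abbreviation cone_from :: "'a \<Rightarrow> 'a list mod2 \<Rightarrow> 'a list mod2" where
  "cone_from x \<equiv> lin (\<lambda>ys. gen (x # ys))"

text \<open>The recursion that defines \<open>faces\<close>, extended linearly. From it follow both
  that boundaries are cycles and that cones are acyclic.\<close>

lemma bd_cone: "bd (cone_from x c) = c + cone_from x (bd c)"
  by (simp add: lin_lin lin_fun_add)

lemma bd_faces: "bd (faces xs) = 0"
  by (induction xs) (simp_all add: lin_add bd_cone)

lemma bd_bd [simp]: "bd (bd c) = 0"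
  by (simp add: lin_lin bd_faces)

lemma faces_keys:
  "ys \<in> Poly_Mapping.keys (faces xs) \<Longrightarrow> Suc (length ys) = length xs \<and> set ys \<subseteq> set xs"
proof (induction xs arbitrary: ys)
  case (Cons x xs)
  have "ys = xs \<or> ys \<in> Poly_Mapping.keys (cone_from x (faces xs))"
    using Cons.prems by (auto simp: keys_add_mod2)
  moreover have "\<exists>zs\<in>Poly_Mapping.keys (faces xs). ys = x # zs" if "ys \<in> Poly_Mapping.keys (cone_from x (faces xs))"
    using that keys_lin [of "\<lambda>ys. gen (x # ys)" "faces xs"] by auto
  ultimately consider "ys = xs" | zs where "zs \<in> Poly_Mapping.keys (faces xs)" "ys = x # zs"
    by blast
  then show ?case
    by cases (use Cons.IH in auto)
qed simp

lemma faces_length: "ys \<in> Poly_Mapping.keys (faces xs) \<Longrightarrow> length ys < length xs"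
  using faces_keys by fastforce

definition simplicial_complex :: "'a set set \<Rightarrow> bool" where
  "simplicial_complex K \<longleftrightarrow> {} \<in> K \<and> (\<forall>s\<in>K. \<forall>t\<subseteq>s. t \<in> K)"

lemma simplicial_complexD: "simplicial_complex K \<Longrightarrow> s \<in> K \<Longrightarrow> t \<subseteq> s \<Longrightarrow> t \<in> K"
  by (auto simp: simplicial_complex_def)

text \<open>The index counts vertices, so the homology in degree \<open>m\<close> is found at
  \<open>Suc m\<close>. Vertices may repeat, so that every simplicial map acts on lists by
  \<open>map\<close>.\<close>

definition osimplices :: "'a set set \<Rightarrow> nat \<Rightarrow> 'a list set" where
  "osimplices K p = {xs. length xs = p \<and> set xs \<in> K}"

definition cycles :: "'a set set \<Rightarrow> nat \<Rightarrow> 'a list mod2 set" where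
  "cycles K p = {c \<in> chain_space (osimplices K p). bd c = 0}"

definition boundaries :: "'a set set \<Rightarrow> nat \<Rightarrow> 'a list mod2 set" where
  "boundaries K p = bd ` chain_space (osimplices K (Suc p))"

lemma osimplices_mono: "K \<subseteq> L \<Longrightarrow> osimplices K p \<subseteq> osimplices L p"
  by (auto simp: osimplices_def)

lemma cycles_mono: "c \<in> cycles K p \<Longrightarrow> K \<subseteq> L \<Longrightarrow> c \<in> cycles L p"
  unfolding cycles_def using chains_mono osimplices_mono by blast

lemma boundaries_mono: "c \<in> boundaries K p \<Longrightarrow> K \<subseteq> L \<Longrightarrow> c \<in> boundaries L p"
  unfolding boundaries_def using chains_mono osimplices_mono by blast

lemma faces_chains: "simplicial_complex K \<Longrightarrow> xs \<in> osimplices K (Suc p) \<Longrightarrow> faces xs \<in> chain_space (osimplices K p)"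
  unfolding chain_space_def osimplices_def by (auto dest!: faces_keys intro: simplicial_complexD)

lemma bd_chains: "simplicial_complex K \<Longrightarrow> c \<in> chain_space (osimplices K (Suc p)) \<Longrightarrow> bd c \<in> chain_space (osimplices K p)"
  by (erule chains_lin) (rule faces_chains)

lemma boundaries_subset_cycles: "simplicial_complex K \<Longrightarrow> boundaries K p \<subseteq> cycles K p"
  by (auto simp: boundaries_def cycles_def bd_chains)

lemma cycles_0 [simp]: "0 \<in> cycles K p"
  by (simp add: cycles_def)

lemma boundaries_0 [simp]: "0 \<in> boundaries K p"
  unfolding boundaries_def by (rule image_eqI [of _ _ 0]) auto

lemma cycles_add: "c \<in> cycles K p \<Longrightarrow> d \<in> cycles K p \<Longrightarrow> c + d \<in> cycles K p"
  by (simp add: cycles_def chains_add lin_add)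

lemma boundaries_add: "c \<in> boundaries K p \<Longrightarrow> d \<in> boundaries K p \<Longrightarrow> c + d \<in> boundaries K p"
  unfolding boundaries_def by (auto simp: chains_add simp flip: lin_add)

lemma boundaries_add_cancel:
  "c \<in> boundaries K p \<Longrightarrow> c + d \<in> boundaries K p \<longleftrightarrow> d \<in> boundaries K p"
  by (metis boundaries_add add_self_left)

lemma boundaries_trans:
  "a + b \<in> boundaries K p \<Longrightarrow> b + c \<in> boundaries K p \<Longrightarrow> a + c \<in> boundaries K p"
  using boundaries_add [of "a + b" K p "b + c"] by (simp add: add.assoc)

lemma boundaries_sum:
  "(\<And>i. i \<in> I \<Longrightarrow> c i \<in> boundaries K p) \<Longrightarrow> (\<Sum>i\<in>I. c i) \<in> boundaries K p"
  by (induction I rule: infinite_finite_induct) (simp_all add: boundaries_add)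

lemma boundariesI: "c \<in> chain_space (osimplices K (Suc p)) \<Longrightarrow> bd c = z \<Longrightarrow> z \<in> boundaries K p"
  by (auto simp: boundaries_def)

definition acyclic_complex :: "'a set set \<Rightarrow> bool" where
  "acyclic_complex K \<longleftrightarrow> (\<forall>p. cycles K p \<subseteq> boundaries K p)"

lemma cone_chains:
  assumes "\<And>s. s \<in> K \<Longrightarrow> insert a s \<in> L" and "c \<in> chain_space (osimplices K p)"
  shows "cone_from a c \<in> chain_space (osimplices L (Suc p))"
  using assms(2) by (rule chains_lin) (auto simp: osimplices_def assms)

lemma acyclic_cone:
  assumes "\<And>s. s \<in> K \<Longrightarrow> insert a s \<in> K"
  shows "acyclic_complex K"
  unfolding acyclic_complex_def
proof (intro allI subsetI)
  fix p c assume "c \<in> cycles K p"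
  then have c: "c \<in> chain_space (osimplices K p)" "bd c = 0"
    by (auto simp: cycles_def)
  show "c \<in> boundaries K p"
    using cone_chains [OF assms c(1)] by (rule boundariesI) (simp_all add: bd_cone c)
qed

lemma acyclic_Pow: "s \<noteq> {} \<Longrightarrow> acyclic_complex (Pow s)"
  by (rule acyclic_cone [of _ "SOME a. a \<in> s"]) (auto intro: someI)

subsection \<open>Acyclic carriers\<close>

definition carried :: "'a set set \<Rightarrow> ('a set \<Rightarrow> 'b set set) \<Rightarrow> ('a list \<Rightarrow> 'b list mod2) \<Rightarrow> bool" where
  "carried K \<Phi> f \<longleftrightarrow> f [] = gen [] \<and>
     (\<forall>xs. set xs \<in> K \<longrightarrow> f xs \<in> chain_space (osimplices (\<Phi> (set xs)) (length xs)) \<and> bd (f xs) = lin f (faces xs))"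

text \<open>The empty simplex is exempt from acyclicity: a carried map fixes the empty list, which
  is its normalization on the augmentation.\<close>

definition carrier_on :: "'a set set \<Rightarrow> ('a set \<Rightarrow> 'b set set) \<Rightarrow> bool" where
  "carrier_on K \<Phi> \<longleftrightarrow> (\<forall>s\<in>K. \<forall>t\<subseteq>s. \<Phi> t \<subseteq> \<Phi> s) \<and>
     (\<forall>s\<in>K. simplicial_complex (\<Phi> s) \<and> (s \<noteq> {} \<longrightarrow> acyclic_complex (\<Phi> s)))"

lemma carrier_on_chains:
  assumes "carrier_on K \<Phi>" "set xs \<in> K" "ys \<in> Poly_Mapping.keys (faces xs)"
    and "c \<in> chain_space (osimplices (\<Phi> (set ys)) p)"
  shows "c \<in> chain_space (osimplices (\<Phi> (set xs)) p)"
proof -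
  have "\<Phi> (set ys) \<subseteq> \<Phi> (set xs)"
    using assms(1,2) faces_keys [OF assms(3)] unfolding carrier_on_def by blast
  then show ?thesis
    using assms(4) chains_mono osimplices_mono by blast
qed

lemma carrier_extend:
  assumes K: "simplicial_complex K" and \<Phi>: "carrier_on K \<Phi>" and xs: "set xs \<in> K" "xs \<noteq> []"
    and z: "z \<in> chain_space (osimplices (\<Phi> (set xs)) p)" "bd z = 0"
  shows "\<exists>d. d \<in> chain_space (osimplices (\<Phi> (set xs)) (Suc p)) \<and> bd d = z"
proof -
  have "z \<in> cycles (\<Phi> (set xs)) p"
    using z by (simp add: cycles_def)
  moreover have "acyclic_complex (\<Phi> (set xs))"
    using \<Phi> xs by (simp add: carrier_on_def)
  ultimately have "z \<in> boundaries (\<Phi> (set xs)) p"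
    unfolding acyclic_complex_def by blast
  then show ?thesis unfolding boundaries_def by blast
qed

text \<open>The acyclic carrier theorem by recursion on the length: the values on the faces of
  \<open>xs\<close> sum to a cycle in the acyclic carrier of \<open>xs\<close>, and some chain that
  it bounds is chosen.\<close>

function carried_map :: "('a set \<Rightarrow> 'b set set) \<Rightarrow> 'a list \<Rightarrow> 'b list mod2" where
  "carried_map \<Phi> xs = (if xs = [] then gen [] else
     (SOME d. d \<in> chain_space (osimplices (\<Phi> (set xs)) (length xs)) \<and>
        bd d = (\<Sum>ys\<in>Poly_Mapping.keys (faces xs). carried_map \<Phi> ys)))"
  by auto
termination
  by (relation "measure (\<lambda>(\<Phi>, xs). length xs)") (simp_all add: faces_length)

declare carried_map.simps [simp del]

lemma carried_map_Nil [simp]: "carried_map \<Phi> [] = gen []"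
  by (subst carried_map.simps) simp

lemma carried_map:
  assumes K: "simplicial_complex K" and \<Phi>: "carrier_on K \<Phi>"
  shows "carried K \<Phi> (carried_map \<Phi>)"
proof -
  let ?f = "carried_map \<Phi>"
  have *: "?f xs \<in> chain_space (osimplices (\<Phi> (set xs)) (length xs)) \<and> bd (?f xs) = lin ?f (faces xs)"
    if "set xs \<in> K" for xs
    using that
  proof (induction xs rule: length_induct)
    case (1 xs)
    show ?case
    proof (cases "xs = []")
      case True
      then show ?thesis
        using "1.prems" \<Phi> by (simp add: osimplices_def carrier_on_def simplicial_complex_def)
    next
      case False
      have face: "set ys \<in> K \<and> length ys < length xs \<and> Suc (length ys) = length xs"
        if "ys \<in> Poly_Mapping.keys (faces xs)" for ys
        using faces_keys [OF that] simplicial_complexD [OF K "1.prems"] by auto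
      have mem: "?f ys \<in> chain_space (osimplices (\<Phi> (set xs)) (length xs - 1))"
        and bdy: "bd (?f ys) = lin ?f (faces ys)"
        if "ys \<in> Poly_Mapping.keys (faces xs)" for ys
        using 1 face that carrier_on_chains [OF \<Phi> "1.prems" that] by (metis diff_Suc_1)+
      have "\<exists>d. d \<in> chain_space (osimplices (\<Phi> (set xs)) (Suc (length xs - 1))) \<and> bd d = lin ?f (faces xs)"
      proof (rule carrier_extend [OF K \<Phi> "1.prems" False])
        show "lin ?f (faces xs) \<in> chain_space (osimplices (\<Phi> (set xs)) (length xs - 1))"
          unfolding lin_def by (rule chains_sum) (rule mem)
        have "bd (lin ?f (faces xs)) = lin (\<lambda>ys. lin ?f (faces ys)) (faces xs)"
          unfolding lin_lin by (rule lin_cong) (rule bdy)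
        then show "bd (lin ?f (faces xs)) = 0"
          by (simp flip: lin_lin add: bd_faces)
      qed
      then have ex: "\<exists>d. d \<in> chain_space (osimplices (\<Phi> (set xs)) (length xs)) \<and>
          bd d = (\<Sum>ys\<in>Poly_Mapping.keys (faces xs). ?f ys)"
        using False by (simp add: lin_def)
      have "?f xs = (SOME d. d \<in> chain_space (osimplices (\<Phi> (set xs)) (length xs)) \<and>
          bd d = (\<Sum>ys\<in>Poly_Mapping.keys (faces xs). ?f ys))"
        using False by (subst carried_map.simps) simp
      then show ?thesis
        using someI_ex [OF ex] by (simp add: lin_def [of ?f])
    qed
  qed
  then show ?thesis
    by (auto simp: carried_def)
qed

text \<open>The same recursion one degree higher. For \<open>h\<close> the sum of two carried maps,
  \<open>h xs\<close> plus the values on the faces is a cycle in the carrier, and the chosen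
  fillings form a chain homotopy between the two maps.\<close>

function carried_homotopy ::
    "('a set \<Rightarrow> 'b set set) \<Rightarrow> ('a list \<Rightarrow> 'b list mod2) \<Rightarrow> 'a list \<Rightarrow> 'b list mod2" where
  "carried_homotopy \<Phi> h xs = (if xs = [] then 0 else
     (SOME d. d \<in> chain_space (osimplices (\<Phi> (set xs)) (Suc (length xs))) \<and>
        bd d = h xs + (\<Sum>ys\<in>Poly_Mapping.keys (faces xs). carried_homotopy \<Phi> h ys)))"
  by auto
termination
  by (relation "measure (\<lambda>(\<Phi>, h, xs). length xs)") (simp_all add: faces_length)

declare carried_homotopy.simps [simp del]

lemma carried_homotopy_Nil [simp]: "carried_homotopy \<Phi> h [] = 0"
  by (subst carried_homotopy.simps) simp

lemma carried_homotopy: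
  assumes K: "simplicial_complex K" and \<Phi>: "carrier_on K \<Phi>" and f: "carried K \<Phi> f" and g: "carried K \<Phi> g"
    and xs: "set xs \<in> K"
  defines "D \<equiv> carried_homotopy \<Phi> (\<lambda>xs. f xs + g xs)"
  shows "D xs \<in> chain_space (osimplices (\<Phi> (set xs)) (Suc (length xs)))"
    and "bd (D xs) = f xs + g xs + lin D (faces xs)"
proof -
  have "D xs \<in> chain_space (osimplices (\<Phi> (set xs)) (Suc (length xs))) \<and> bd (D xs) = f xs + g xs + lin D (faces xs)"
    using xs
  proof (induction xs rule: length_induct)
    case (1 xs)
    show ?case
    proof (cases "xs = []")
      case True
      then show ?thesis
        using f g by (simp add: D_def carried_def)
    next
      case False
      have face: "set ys \<in> K \<and> length ys < length xs \<and> Suc (length ys) = length xs"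
        if "ys \<in> Poly_Mapping.keys (faces xs)" for ys
        using faces_keys [OF that] simplicial_complexD [OF K "1.prems"] by auto
      have mem: "D ys \<in> chain_space (osimplices (\<Phi> (set xs)) (length xs))"
        and bdy: "bd (D ys) = f ys + g ys + lin D (faces ys)"
        if "ys \<in> Poly_Mapping.keys (faces xs)" for ys
        using 1 face that carrier_on_chains [OF \<Phi> "1.prems" that] by metis+
      have "\<exists>d. d \<in> chain_space (osimplices (\<Phi> (set xs)) (Suc (length xs))) \<and> bd d = f xs + g xs + lin D (faces xs)"
      proof (rule carrier_extend [OF K \<Phi> "1.prems" False])
        have "lin D (faces xs) \<in> chain_space (osimplices (\<Phi> (set xs)) (length xs))"
          unfolding lin_def by (rule chains_sum) (rule mem)
        then show "f xs + g xs + lin D (faces xs) \<in> chain_space (osimplices (\<Phi> (set xs)) (length xs))"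
          using f g "1.prems" by (simp add: carried_def chains_add)
        have "bd (lin D (faces xs)) = lin (\<lambda>ys. f ys + g ys + lin D (faces ys)) (faces xs)"
          unfolding lin_lin by (rule lin_cong) (rule bdy)
        also have "\<dots> = lin f (faces xs) + lin g (faces xs)"
          by (simp add: lin_fun_add bd_faces flip: lin_lin)
        finally show "bd (f xs + g xs + lin D (faces xs)) = 0"
          using f g "1.prems" by (simp add: carried_def lin_add)
      qed
      then have ex: "\<exists>d. d \<in> chain_space (osimplices (\<Phi> (set xs)) (Suc (length xs))) \<and>
          bd d = f xs + g xs + (\<Sum>ys\<in>Poly_Mapping.keys (faces xs). D ys)"
        by (simp add: lin_def [of D])
      have "D xs = (SOME d. d \<in> chain_space (osimplices (\<Phi> (set xs)) (Suc (length xs))) \<and>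
          bd d = f xs + g xs + (\<Sum>ys\<in>Poly_Mapping.keys (faces xs). D ys))"
        using False unfolding D_def by (subst carried_homotopy.simps) simp
      then show ?thesis
        using someI_ex [OF ex] by (simp add: lin_def [of D])
    qed
  qed
  then show "D xs \<in> chain_space (osimplices (\<Phi> (set xs)) (Suc (length xs)))"
    and "bd (D xs) = f xs + g xs + lin D (faces xs)" by auto
qed

lemma carried_chain:
  assumes "carried K \<Phi> f" "c \<in> chain_space (osimplices K p)" "\<And>s. s \<in> K \<Longrightarrow> \<Phi> s \<subseteq> L"
  shows "lin f c \<in> chain_space (osimplices L p)" and "bd (lin f c) = lin f (bd c)"
proof -
  show "lin f c \<in> chain_space (osimplices L p)"
  proof (rule chains_lin [OF assms(2)])
    fix x assume "x \<in> osimplices K p"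
    then show "f x \<in> chain_space (osimplices L p)"
      using assms(1,3) chains_mono [OF _ osimplices_mono, of "f x" "\<Phi> (set x)" p L]
      by (auto simp: osimplices_def carried_def)
  qed
  show "bd (lin f c) = lin f (bd c)"
    unfolding lin_lin using assms(2)
    by (rule lin_cong_chains) (use assms(1) in \<open>simp add: osimplices_def carried_def\<close>)
qed

lemma carried_cycle:
  assumes "carried K \<Phi> f" "c \<in> cycles K p" "\<And>s. s \<in> K \<Longrightarrow> \<Phi> s \<subseteq> L"
  shows "lin f c \<in> cycles L p"
  using assms(2) carried_chain [OF assms(1) _ assms(3)] unfolding cycles_def by (metis (mono_tags, lifting) lin_0 mem_Collect_eq)

lemma carried_boundary:
  assumes "carried K \<Phi> f" "c \<in> boundaries K p" "\<And>s. s \<in> K \<Longrightarrow> \<Phi> s \<subseteq> L"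
  shows "lin f c \<in> boundaries L p"
  using assms(2) carried_chain [OF assms(1) _ assms(3)] by (force simp: boundaries_def)

lemma carried_homologous:
  assumes K: "simplicial_complex K" and \<Phi>: "carrier_on K \<Phi>" and f: "carried K \<Phi> f" and g: "carried K \<Phi> g"
    and L: "\<And>s. s \<in> K \<Longrightarrow> \<Phi> s \<subseteq> L" and c: "c \<in> cycles K p"
  shows "lin f c + lin g c \<in> boundaries L p"
proof -
  define D where "D = carried_homotopy \<Phi> (\<lambda>xs. f xs + g xs)"
  have cc: "c \<in> chain_space (osimplices K p)" "bd c = 0" using c by (auto simp: cycles_def)
  note D = carried_homotopy [OF K \<Phi> f g, folded D_def]
  have "lin D c \<in> chain_space (osimplices L (Suc p))"
  proof (rule chains_lin [OF cc(1)])
    fix x assume "x \<in> osimplices K p"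
    then show "D x \<in> chain_space (osimplices L (Suc p))"
      using D(1) [of x] chains_mono [OF _ osimplices_mono] L [of "set x"] unfolding osimplices_def by fastforce
  qed
  moreover have "bd (lin D c) = lin (\<lambda>xs. f xs + g xs + lin D (faces xs)) c"
    unfolding lin_lin using cc(1) by (rule lin_cong_chains) (simp add: D osimplices_def)
  then have "bd (lin D c) = lin f c + lin g c"
    by (simp add: lin_fun_add cc flip: lin_lin)
  ultimately show ?thesis by (rule boundariesI)
qed

subsection \<open>Simplicial maps\<close>

abbreviation push :: "('a \<Rightarrow> 'b) \<Rightarrow> 'a list mod2 \<Rightarrow> 'b list mod2" where
  "push f \<equiv> lin (\<lambda>xs. gen (map f xs))"

lemma faces_map: "faces (map f xs) = push f (faces xs)"
  by (induction xs) (simp_all add: lin_add lin_lin)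

lemma bd_push: "bd (push f c) = push f (bd c)"
  by (simp add: lin_lin faces_map)

lemma push_push: "push f (push g c) = push (\<lambda>x. f (g x)) c"
  by (simp add: lin_lin comp_def)

lemma push_id: "push (\<lambda>x. x) c = c"
  by simp

lemma push_cong:
  assumes "c \<in> chain_space (osimplices K p)" "\<And>x s. s \<in> K \<Longrightarrow> x \<in> s \<Longrightarrow> f x = g x"
  shows "push f c = push g c"
  using assms(1) by (rule lin_cong_chains) (use assms(2) in \<open>auto simp: osimplices_def cong: map_cong\<close>)

lemma carried_push:
  assumes "\<And>s. s \<in> K \<Longrightarrow> f ` s \<in> \<Phi> s"
  shows "carried K \<Phi> (\<lambda>xs. gen (map f xs))"
  using assms by (auto simp: carried_def osimplices_def faces_map)

lemma push_chains:
  assumes "\<And>s. s \<in> K \<Longrightarrow> f ` s \<in> L" and "c \<in> chain_space (osimplices K p)"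
  shows "push f c \<in> chain_space (osimplices L p)"
  using assms(2) by (rule chains_lin) (auto simp: osimplices_def assms)

lemma push_cycles:
  assumes "\<And>s. s \<in> K \<Longrightarrow> f ` s \<in> L" and "c \<in> cycles K p"
  shows "push f c \<in> cycles L p"
  using assms push_chains [OF assms(1)] by (auto simp: cycles_def bd_push)

lemma push_boundaries:
  assumes "\<And>s. s \<in> K \<Longrightarrow> f ` s \<in> L" and "c \<in> boundaries K p"
  shows "push f c \<in> boundaries L p"
proof -
  obtain d where "d \<in> chain_space (osimplices K (Suc p))" "c = bd d"
    using assms(2) by (auto simp: boundaries_def)
  then show ?thesis
    by (intro boundariesI [of "push f d"] push_chains assms(1)) (simp_all add: bd_push)
qed

text \<open>The full simplex spanned by both images of \<open>s\<close> is a common acyclic carrier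
  of the two maps.\<close>

lemma contiguous_homologous:
  assumes K: "simplicial_complex K" and L: "simplicial_complex L" and fg: "\<And>s. s \<in> K \<Longrightarrow> f ` s \<union> g ` s \<in> L"
    and c: "c \<in> cycles K p"
  shows "push f c + push g c \<in> boundaries L p"
proof (rule carried_homologous [OF K, of "\<lambda>s. Pow (f ` s \<union> g ` s)"])
  show "carrier_on K (\<lambda>s. Pow (f ` s \<union> g ` s))"
    unfolding carrier_on_def
    by (auto simp: simplicial_complex_def intro!: acyclic_Pow; blast)
  show "Pow (f ` s \<union> g ` s) \<subseteq> L" if "s \<in> K" for s
    using simplicial_complexD [OF L fg [OF that]] by blast
qed (auto intro: carried_push c)


section \<open>Comparison of singular and simplicial homology of a realization\<close>

section \<open>Singular chains modulo two\<close>

text \<open>In degree 0 the boundary is zero and not the augmentation; reduced cycles of degree 0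
  are singled out by a separate condition wherever they occur.\<close>

definition sface :: "nat \<Rightarrow> ((nat \<Rightarrow> real) \<Rightarrow> 'a) \<Rightarrow> ((nat \<Rightarrow> real) \<Rightarrow> 'a) mod2" where
  "sface p \<sigma> = (if p = 0 then 0 else \<Sum>k\<le>p. gen (singular_face p k \<sigma>))"

abbreviation sbd :: "nat \<Rightarrow> ((nat \<Rightarrow> real) \<Rightarrow> 'a) mod2 \<Rightarrow> ((nat \<Rightarrow> real) \<Rightarrow> 'a) mod2" where
  "sbd p \<equiv> lin (sface p)"

abbreviation schains :: "nat \<Rightarrow> 'a topology \<Rightarrow> ((nat \<Rightarrow> real) \<Rightarrow> 'a) mod2 set" where
  "schains p X \<equiv> chain_space (singular_simplex_set p X)"

text \<open>Integral chains serve to import subdivision: its operators and homotopies are reduced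
  modulo two.\<close>

definition reduce :: "('i \<Rightarrow>\<^sub>0 int) \<Rightarrow> 'i mod2" where
  "reduce = Poly_Mapping.map of_int"

lemma lookup_reduce: "Poly_Mapping.lookup (reduce c) x = of_int (Poly_Mapping.lookup c x)"
  by (auto simp: reduce_def Poly_Mapping.map.rep_eq when_def)

lemma reduce_0 [simp]: "reduce 0 = 0"
  by (simp add: poly_mapping_eq_iff fun_eq_iff lookup_reduce)

lemma reduce_add: "reduce (a + b) = reduce a + reduce b"
  by (simp add: poly_mapping_eq_iff fun_eq_iff lookup_reduce lookup_add)

lemma reduce_diff: "reduce (a - b) = reduce a + reduce b"
  by (simp add: poly_mapping_eq_iff fun_eq_iff lookup_reduce lookup_add lookup_minus)

lemma reduce_sum: "reduce (\<Sum>i\<in>I. c i) = (\<Sum>i\<in>I. reduce (c i))"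
  by (induction I rule: infinite_finite_induct) (simp_all add: reduce_add)

lemma reduce_frag_of [simp]: "reduce (frag_of x) = gen x"
  by (auto simp: poly_mapping_eq_iff fun_eq_iff lookup_reduce gen_def lookup_single when_def)

lemma of_int_minus_one_power_bit: "(of_int ((- 1) ^ k) :: bit) = 1"
  by (cases "even k") simp_all

lemma reduce_cmul: "reduce (frag_cmul ((- 1) ^ k) c) = reduce c"
proof -
  have "(of_int ((- 1) ^ k * y) :: bit) = of_int y" for y
    unfolding of_int_mult of_int_minus_one_power_bit by simp
  then show ?thesis
    by (simp add: poly_mapping_eq_iff fun_eq_iff lookup_reduce)
qed

lemma keys_reduce: "Poly_Mapping.keys (reduce c) \<subseteq> Poly_Mapping.keys c"
  by (auto simp: in_keys_iff lookup_reduce)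

lemma reduce_boundary: "reduce (chain_boundary p c) = sbd p (reduce c)"
proof -
  have "Poly_Mapping.keys c \<subseteq> UNIV" by simp
  then show ?thesis
  proof (induction c rule: frag_induction)
    case (one x)
    then show ?case
      by (simp add: chain_boundary_of sface_def reduce_sum reduce_cmul del: sum.atMost_Suc)
  next
    case (diff a b)
    then show ?case
      by (simp add: chain_boundary_diff reduce_diff lin_add)
  qed simp
qed

definition lift_frag :: "'i mod2 \<Rightarrow> 'i \<Rightarrow>\<^sub>0 int" where
  "lift_frag c = (\<Sum>x\<in>Poly_Mapping.keys c. frag_of x)"

lemma reduce_lift_frag [simp]: "reduce (lift_frag c) = c"
  using lin_gen_id [of c] by (simp add: lift_frag_def reduce_sum lin_def)

lemma singular_chain_lift_frag: "c \<in> schains p X \<Longrightarrow> singular_chain p X (lift_frag c)"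
  unfolding lift_frag_def chain_space_def
  by (rule singular_chain_sum) (auto simp: singular_chain_of)

lemma reduce_schains: "singular_chain p X c \<Longrightarrow> reduce c \<in> schains p X"
  using keys_reduce by (fastforce simp: chain_space_def singular_chain_def)

lemma sface_schains: "singular_simplex (Suc p) X \<sigma> \<Longrightarrow> sface (Suc p) \<sigma> \<in> schains p X"
  unfolding sface_def
  using singular_simplex_singular_face [of "Suc p" X \<sigma>] by (auto intro!: chains_sum simp del: sum.atMost_Suc)

lemma sbd_schains: "c \<in> schains (Suc p) X \<Longrightarrow> sbd (Suc p) c \<in> schains p X"
  by (erule chains_lin) (simp add: sface_schains)

lemma sbd_0 [simp]: "sbd 0 c = 0"
  by (simp add: lin_def sface_def)

lemma sbd_sbd: "c \<in> schains (Suc p) X \<Longrightarrow> sbd p (sbd (Suc p) c) = 0"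
  using chain_boundary_boundary_alt [OF singular_chain_lift_frag, of c p X]
  by (metis reduce_0 reduce_boundary reduce_lift_frag)

text \<open>
  Lifting \<open>sbd p z\<close> to the integers agrees with the boundary of a lift of \<open>z\<close> only up to even
  chains, which the reduction of any additive map kills.
\<close>

lemma reduce_additive:
  fixes h :: "('i \<Rightarrow>\<^sub>0 int) \<Rightarrow> 'j \<Rightarrow>\<^sub>0 int"
  assumes h: "\<And>a b. h (a - b) = h a - h b"
  shows "reduce (h c) = lin (\<lambda>x. reduce (h (frag_of x))) (reduce c)"
proof -
  have h0: "h 0 = 0"
    using h [of 0 0] by simp
  have "Poly_Mapping.keys c \<subseteq> UNIV" by simp
  then show ?thesis
    by (induction c rule: frag_induction) (simp_all add: h h0 reduce_diff lin_add)
qed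

text \<open>Iterated subdivision, fine enough for the cover. As \<open>z\<close> may have a
  boundary, the homotopy formula keeps a term with \<open>E\<close>. The locality of
  \<open>E\<close>, which sends a simplex of any space \<open>Y\<close> to a chain of
  \<open>Y\<close>, later controls this term for affine boundaries.\<close>

lemma small_simplices:
  assumes \<C>: "\<And>U. U \<in> \<C> \<Longrightarrow> openin X U" and X: "topspace X \<subseteq> \<Union>\<C>" and z: "z \<in> schains p X"
  obtains z' d E where "z' \<in> schains p X" "d \<in> schains (Suc p) X"
    and "\<And>\<sigma>. \<sigma> \<in> Poly_Mapping.keys z' \<Longrightarrow> \<exists>V\<in>\<C>. \<sigma> \<in> standard_simplex p \<rightarrow> V"
    and "\<And>Y \<sigma>. singular_simplex (p - 1) Y \<sigma> \<Longrightarrow> E \<sigma> \<in> schains (Suc (p - 1)) Y"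
    and "z' + z = sbd (Suc p) d + lin E (sbd p z)"
proof -
  let ?c = "lift_frag z"
  have c: "singular_chain p X ?c"
    by (rule singular_chain_lift_frag [OF z])
  obtain n where n: "\<And>m f. n \<le> m \<Longrightarrow> f \<in> Poly_Mapping.keys ((singular_subdivision p ^^ m) ?c)
      \<Longrightarrow> \<exists>V\<in>\<C>. f \<in> standard_simplex p \<rightarrow> V"
    using sufficient_iterated_singular_subdivision_exists [OF \<C> X c] by blast
  obtain h where h0: "\<And>p. h p 0 = (0 :: 'a chain)"
    and hd: "\<And>p c1 c2. h p (c1 - c2) = h p c1 - h p c2"
    and hc: "\<And>p X c. singular_chain p X c \<Longrightarrow> singular_chain (Suc p) X (h p c)"
    and hb: "\<And>p X c. singular_chain p X c \<Longrightarrow>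
      chain_boundary (Suc p) (h p c) + h (p - Suc 0) (chain_boundary p c) = (singular_subdivision p ^^ n) c - c"
    using chain_homotopic_iterated_singular_subdivision [of n] by blast
  have sd: "singular_chain p X ((singular_subdivision p ^^ m) ?c)" for m
    by (induction m) (auto simp: c singular_chain_singular_subdivision)
  define E where "E = (\<lambda>\<sigma>. reduce (h (p - 1) (frag_of \<sigma>)))"
  show thesis
  proof
    show "reduce ((singular_subdivision p ^^ n) ?c) \<in> schains p X"
      by (rule reduce_schains [OF sd])
    show "reduce (h p ?c) \<in> schains (Suc p) X"
      by (rule reduce_schains [OF hc [OF c]])
    show "\<exists>V\<in>\<C>. \<sigma> \<in> standard_simplex p \<rightarrow> V"
      if  "\<sigma> \<in> Poly_Mapping.keys (reduce ((singular_subdivision p ^^ n) ?c))" for \<sigma>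
      by (rule n [OF order_refl subsetD [OF keys_reduce that]])
    show "E \<sigma> \<in> schains (Suc (p - 1)) Y" if "singular_simplex (p - 1) Y \<sigma>" for Y \<sigma>
      unfolding E_def using that by (intro reduce_schains hc) (simp add: singular_chain_of)
    have "reduce ((singular_subdivision p ^^ n) ?c) + z =
        reduce ((singular_subdivision p ^^ n) ?c - ?c)"
      by (simp add: reduce_diff)
    also have "\<dots> = sbd (Suc p) (reduce (h p ?c)) + lin E (sbd p z)"
      unfolding hb [OF c, symmetric] reduce_add reduce_boundary
      using reduce_additive [of "h (p - 1)" "chain_boundary p ?c", OF hd]
      by (simp add: reduce_boundary E_def)
    finally show "reduce ((singular_subdivision p ^^ n) ?c) + z =
        sbd (Suc p) (reduce (h p ?c)) + lin E (sbd p z)" .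
  qed
qed


section \<open>The realization of a simplicial complex\<close>

definition supp :: "('a \<Rightarrow> real) \<Rightarrow> 'a set" where
  "supp y = {v. y v \<noteq> 0}"

lemma topspace_geometric_realization:
  "topspace (geometric_realization K) = (\<Union>s\<in>K. closed_simplex s)"
proof (rule antisym)
  show "topspace (geometric_realization K) \<subseteq> (\<Union>s\<in>K. closed_simplex s)"
    using openin_geometric_realization openin_topspace by blast
  have "openin (geometric_realization K) (\<Union>s\<in>K. closed_simplex s)"
    unfolding openin_geometric_realization
  proof (intro conjI ballI order_refl)
    fix s assume "s \<in> K"
    then have "(\<Union>s\<in>K. closed_simplex s) \<inter> closed_simplex s = topspace (subtopology (powertop_real UNIV) (closed_simplex s))"
      by auto
    then show "openin (subtopology (powertop_real UNIV) (closed_simplex s)) ((\<Union>s\<in>K. closed_simplex s) \<inter> closed_simplex s)"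
      by (metis openin_topspace)
  qed
  then show "(\<Union>s\<in>K. closed_simplex s) \<subseteq> topspace (geometric_realization K)"
    by (rule openin_subset)
qed

lemma closed_simplexD:
  assumes "y \<in> closed_simplex s"
  shows "finite s" "0 \<le> y v" "v \<notin> s \<Longrightarrow> y v = 0" "sum y s = 1" "supp y \<subseteq> s"
proof -
  show *: "0 \<le> y v" "v \<notin> s \<Longrightarrow> y v = 0" "sum y s = 1" for v
    using assms by (auto simp: closed_simplex_def)
  show "finite s"
    using *(3) by (metis sum.infinite zero_neq_one)
  show "supp y \<subseteq> s"
    using *(2) by (auto simp: supp_def)
qed

lemma closed_simplex_supp:
  assumes "y \<in> closed_simplex s"
  shows "y \<in> closed_simplex (supp y)"
proof -
  have "sum y (supp y) = sum y s"
    by (rule sum.mono_neutral_left) (use closed_simplexD [OF assms] in \<open>auto simp: supp_def\<close>)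
  then show ?thesis
    using closed_simplexD [OF assms] by (simp add: closed_simplex_def supp_def)
qed

lemma closed_simplex_mono:
  assumes "s \<subseteq> t" "finite t"
  shows "closed_simplex s \<subseteq> closed_simplex t"
proof
  fix y assume y: "y \<in> closed_simplex s"
  have "sum y s = sum y t"
    by (rule sum.mono_neutral_left) (use closed_simplexD [OF y] assms in auto)
  then show "y \<in> closed_simplex t"
    using closed_simplexD [OF y] assms(1) by (auto simp: closed_simplex_def)
qed

lemma supp_nonempty: "y \<in> closed_simplex s \<Longrightarrow> supp y \<noteq> {}"
  by (drule closed_simplex_supp, drule closed_simplexD(4)) auto

lemma mem_realization_iff:
  assumes "simplicial_complex K"
  shows "y \<in> topspace (geometric_realization K) \<longleftrightarrow> supp y \<in> K \<and> y \<in> closed_simplex (supp y)"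
proof
  assume "y \<in> topspace (geometric_realization K)"
  then obtain s where s: "s \<in> K" "y \<in> closed_simplex s"
    by (auto simp: topspace_geometric_realization)
  then show "supp y \<in> K \<and> y \<in> closed_simplex (supp y)"
    using closed_simplex_supp [OF s(2)] simplicial_complexD [OF assms s(1) closed_simplexD(5) [OF s(2)]] by simp
qed (auto simp: topspace_geometric_realization)

lemma continuous_map_into_realization:
  assumes "continuous_map Z (powertop_real UNIV) f" "f \<in> topspace Z \<rightarrow> closed_simplex s" "s \<in> K"
  shows "continuous_map Z (geometric_realization K) f"
proof -
  have f: "continuous_map Z (subtopology (powertop_real UNIV) (closed_simplex s)) f"
    using assms(1,2) by (simp add: continuous_map_in_subtopology image_subset_iff_funcset)
  show ?thesis
    unfolding continuous_map_def
  proof (intro conjI allI impI)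
    show "f \<in> topspace Z \<rightarrow> topspace (geometric_realization K)"
      using assms by (auto simp: topspace_geometric_realization)
    fix U assume "openin (geometric_realization K) U"
    then have "openin (subtopology (powertop_real UNIV) (closed_simplex s)) (U \<inter> closed_simplex s)"
      using assms(3) by (simp add: openin_geometric_realization)
    then have "openin Z {x \<in> topspace Z. f x \<in> U \<inter> closed_simplex s}"
      by (rule openin_continuous_map_preimage [OF f])
    moreover have "{x \<in> topspace Z. f x \<in> U \<inter> closed_simplex s} = {x \<in> topspace Z. f x \<in> U}"
      using assms(2) by auto
    ultimately show "openin Z {x \<in> topspace Z. f x \<in> U}" by simp
  qed
qed

lemma openin_realization_coarse:
  assumes "openin (powertop_real UNIV) V"
  shows "openin (geometric_realization K) (V \<inter> topspace (geometric_realization K))"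
  unfolding openin_geometric_realization
proof (intro conjI ballI)
  fix s assume "s \<in> K"
  then have "V \<inter> topspace (geometric_realization K) \<inter> closed_simplex s = V \<inter> closed_simplex s"
    by (auto simp: topspace_geometric_realization)
  then show "openin (subtopology (powertop_real UNIV) (closed_simplex s))
      (V \<inter> topspace (geometric_realization K) \<inter> closed_simplex s)"
    using assms by (simp add: openin_subtopology_Int)
qed (simp add: topspace_geometric_realization)

lemma continuous_map_coordinate:
  "continuous_map (geometric_realization K) euclideanreal (\<lambda>y. y v)"
  unfolding continuous_map_def
proof (intro conjI allI impI)
  fix U :: "real set" assume U: "openin euclideanreal U"
  have "continuous_map (powertop_real UNIV) euclideanreal (\<lambda>y. y v)"
    by (rule continuous_map_product_projection) simp
  then have "openin (powertop_real UNIV) {y \<in> topspace (powertop_real UNIV). y v \<in> U}"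
    by (rule openin_continuous_map_preimage [OF _ U])
  from openin_realization_coarse [OF this, of K]
  show "openin (geometric_realization K) {y \<in> topspace (geometric_realization K). y v \<in> U}"
    by (simp add: Int_def conj_commute)
qed simp

lemma closedin_realization_finite_intersections:
  assumes Y: "Y \<subseteq> topspace (geometric_realization K)"
    and fin: "\<And>s. s \<in> K \<Longrightarrow> finite (Y \<inter> closed_simplex s)"
  shows "closedin (geometric_realization K) Y"
  unfolding closedin_def
proof
  show "openin (geometric_realization K) (topspace (geometric_realization K) - Y)"
    unfolding openin_geometric_realization
  proof (intro conjI ballI)
    fix s assume s: "s \<in> K"
    let ?S = "subtopology (powertop_real UNIV) (closed_simplex s)"
    have "Hausdorff_space ?S"
      by (intro Hausdorff_space_subtopology) (simp add: Hausdorff_space_product_topology)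
    then have "closedin ?S (Y \<inter> closed_simplex s)"
      by (rule closedin_Hausdorff_finite) (use fin [OF s] in auto)
    then have "openin ?S (topspace ?S - Y \<inter> closed_simplex s)"
      by (simp add: closedin_def)
    moreover have "(topspace (geometric_realization K) - Y) \<inter> closed_simplex s = topspace ?S - Y \<inter> closed_simplex s"
      using s by (auto simp: topspace_geometric_realization)
    ultimately show "openin ?S ((topspace (geometric_realization K) - Y) \<inter> closed_simplex s)"
      by simp
  qed (auto simp: topspace_geometric_realization)
qed (rule Y)

text \<open>Choose one point of \<open>C\<close> for each support. Every closed simplex contains
  only finitely many of them, so all subsets of this set are closed; if it were infinite, it would
  have no accumulation point.\<close>

lemma compactin_realization_finite_supports:
  assumes C: "compactin (geometric_realization K) C" and K: "simplicial_complex K"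
  shows "finite (supp ` C)"
proof (rule ccontr)
  assume inf: "infinite (supp ` C)"
  have "\<forall>s\<in>supp ` C. \<exists>y. y \<in> C \<and> supp y = s"
    by auto
  then obtain pick where pick: "\<And>s. s \<in> supp ` C \<Longrightarrow> pick s \<in> C \<and> supp (pick s) = s"
    by (metis bchoice)
  define Y where "Y = pick ` supp ` C"
  have YC: "Y \<subseteq> C"
    using pick by (auto simp: Y_def)
  have CT: "C \<subseteq> topspace (geometric_realization K)"
    by (rule compactin_subset_topspace [OF C])
  have injY: "inj_on supp Y"
    using pick by (auto simp: Y_def inj_on_def)
  have "inj_on pick (supp ` C)"
    using pick by (metis (no_types, lifting) inj_onI)
  then have infY: "infinite Y"
    using inf by (simp add: Y_def finite_image_iff)
  have closed: "closedin (geometric_realization K) Z" if "Z \<subseteq> Y" for Z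
  proof (rule closedin_realization_finite_intersections)
    show "Z \<subseteq> topspace (geometric_realization K)"
      using that YC CT by blast
    fix s assume "s \<in> K"
    show "finite (Z \<inter> closed_simplex s)"
    proof (cases "finite s")
      case True
      have "supp ` (Z \<inter> closed_simplex s) \<subseteq> Pow s"
        using closed_simplexD(5) by blast
      then have "finite (supp ` (Z \<inter> closed_simplex s))"
        using True by (simp add: finite_subset)
      moreover have "inj_on supp (Z \<inter> closed_simplex s)"
        using injY that by (meson Int_lower1 inj_on_subset)
      ultimately show ?thesis
        using finite_imageD by blast
    next
      case False
      then have "closed_simplex s = {}"
        using closed_simplexD(1) by blast
      then show ?thesis by simp
    qed
  qed
  obtain y where y: "y \<in> geometric_realization K derived_set_of Y"
    using compactin_imp_Bolzano_Weierstrass [OF C, of Y] infY YC by blast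
  then have "y \<in> geometric_realization K derived_set_of (Y - {y})"
    unfolding in_derived_set_of by (metis DiffI singletonD)
  moreover have "geometric_realization K derived_set_of (Y - {y}) \<subseteq> Y - {y}"
    using closed [of "Y - {y}"] by (simp add: closedin_contains_derived_set)
  ultimately show False by blast
qed

lemma continuous_map_realization_pasting:
  assumes "finite F" and K: "\<And>s. s \<in> F \<Longrightarrow> g s \<in> K"
    and clo: "\<And>s. s \<in> F \<Longrightarrow> closedin Z (A s)"
    and cov: "\<And>x. x \<in> topspace Z \<Longrightarrow> \<exists>s\<in>F. x \<in> A s"
    and cont: "continuous_map Z (powertop_real UNIV) f"
    and mem: "\<And>s x. s \<in> F \<Longrightarrow> x \<in> topspace Z \<Longrightarrow> x \<in> A s \<Longrightarrow> f x \<in> closed_simplex (g s)"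
  shows "continuous_map Z (geometric_realization K) f"
proof (rule pasting_lemma_closed [OF assms(1) clo])
  fix s assume s: "s \<in> F"
  show "continuous_map (subtopology Z (A s)) (geometric_realization K) f"
    by (rule continuous_map_into_realization [OF _ _ K [OF s]])
       (use cont mem s in \<open>auto simp: continuous_map_from_subtopology\<close>)
qed (use cov in blast)+


section \<open>Singular homology of a realization\<close>

definition delete_nth :: "nat \<Rightarrow> 'a list \<Rightarrow> 'a list" where
  "delete_nth k xs = take k xs @ drop (Suc k) xs"

lemma delete_nth_simps [simp]:
  "delete_nth 0 (x # xs) = xs" "delete_nth (Suc k) (x # xs) = x # delete_nth k xs"
  by (simp_all add: delete_nth_def)

lemma length_delete_nth: "k < length xs \<Longrightarrow> length (delete_nth k xs) = length xs - 1"
  by (simp add: delete_nth_def)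

lemma nth_delete_nth:
  "k < length xs \<Longrightarrow> i < length xs - 1 \<Longrightarrow> delete_nth k xs ! i = xs ! (if i < k then i else Suc i)"
  by (auto simp: delete_nth_def nth_append min_def)

lemma faces_conv_sum: "faces xs = (\<Sum>k<length xs. gen (delete_nth k xs))"
  by (induction xs) (simp_all add: sum.lessThan_Suc_shift lin_sum del: sum.lessThan_Suc)

text \<open>The barycentric weight of the positions whose entry satisfies \<open>P\<close>. Summing
  over positions allows repeated vertices, and the one function yields vertex coordinates, base
  points of a prism and heights in it.\<close>

primrec wt :: "('b \<Rightarrow> bool) \<Rightarrow> 'b list \<Rightarrow> (nat \<Rightarrow> real) \<Rightarrow> real" where
  "wt P [] t = 0"
| "wt P (x # xs) t = (if P x then t 0 else 0) + wt P xs (\<lambda>i. t (Suc i))"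

lemma wt_conv_sum: "wt P xs t = (\<Sum>j<length xs. if P (xs ! j) then t j else 0)"
  by (induction xs arbitrary: t) (simp_all add: sum.lessThan_Suc_shift del: sum.lessThan_Suc)

text \<open>Inserting a zero coordinate at \<open>k\<close> has the effect of deleting entry
  \<open>k\<close>; the formulas for faces of affine and of prism simplices rest on this.\<close>

lemma wt_simplical_face:
  "k < length xs \<Longrightarrow> wt P xs (simplical_face k t) = wt P (delete_nth k xs) t"
proof (induction xs arbitrary: k t)
  case (Cons x xs)
  show ?case
  proof (cases k)
    case 0
    then show ?thesis by (simp add: simplical_face_def)
  next
    case (Suc j)
    have "(\<lambda>i. simplical_face (Suc j) t (Suc i)) = simplical_face j (\<lambda>i. t (Suc i))"
      by (auto simp: simplical_face_def)
    then show ?thesis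
      using Cons Suc by (simp add: simplical_face_def)
  qed
qed simp

lemma wt_map: "wt P (map f xs) t = wt (\<lambda>x. P (f x)) xs t"
  by (induction xs arbitrary: t) simp_all

lemma wt_cong: "(\<And>x. x \<in> set xs \<Longrightarrow> P x = Q x) \<Longrightarrow> wt P xs t = wt Q xs t"
  by (simp add: wt_conv_sum)

lemma wt_nonneg: "(\<And>i. 0 \<le> t i) \<Longrightarrow> 0 \<le> wt P xs t"
  by (simp add: wt_conv_sum sum_nonneg)

lemma wt_none: "(\<And>x. x \<in> set xs \<Longrightarrow> \<not> P x) \<Longrightarrow> wt P xs t = 0"
  by (simp add: wt_conv_sum)

lemma wt_all: "(\<And>x. x \<in> set xs \<Longrightarrow> P x) \<Longrightarrow> wt P xs t = (\<Sum>j<length xs. t j)"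
  by (simp add: wt_conv_sum)

lemma sum_wt:
  assumes "finite S" "f ` set xs \<subseteq> S"
  shows "(\<Sum>v\<in>S. wt (\<lambda>x. f x = v) xs t) = (\<Sum>j<length xs. t j)"
proof -
  have "(\<Sum>v\<in>S. if f (xs ! j) = v then t j else 0) = t j" if "j < length xs" for j
    using assms that nth_mem by (simp add: image_subset_iff)
  then show ?thesis
    unfolding wt_conv_sum by (subst sum.swap) simp
qed

lemma standard_simplexD:
  assumes "t \<in> standard_simplex p"
  shows "0 \<le> t i" "(\<Sum>j<Suc p. t j) = 1" "i > p \<Longrightarrow> t i = 0"
  using assms by (auto simp: standard_simplex_def lessThan_Suc_atMost)

lemma standard_simplexI:
  assumes "\<And>i. 0 \<le> t i" "(\<Sum>j<Suc p. t j) = 1" "\<And>i. i > p \<Longrightarrow> t i = 0"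
  shows "t \<in> standard_simplex p"
proof -
  have "t i \<le> 1" for i
  proof (cases "i \<le> p")
    case True
    then have "t i \<le> (\<Sum>j<Suc p. t j)"
      by (intro member_le_sum) (use assms in auto)
    then show ?thesis using assms by simp
  qed (use assms in simp)
  then show ?thesis
    using assms by (auto simp: standard_simplex_def lessThan_Suc_atMost)
qed

abbreviation unit_vec :: "nat \<Rightarrow> nat \<Rightarrow> real" where
  "unit_vec i \<equiv> (\<lambda>j. if j = i then 1 else 0)"

lemma wt_unit:
  assumes "i < length xs"
  shows "wt P xs (unit_vec i) = (if P (xs ! i) then 1 else 0)"
proof -
  have "wt P xs (unit_vec i) = (\<Sum>j<length xs. if j = i then (if P (xs ! i) then 1 else 0) else 0)"
    unfolding wt_conv_sum by (rule sum.cong) auto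
  then show ?thesis
    using assms by simp
qed

lemma continuous_map_wt:
  "continuous_map (subtopology (powertop_real UNIV) S) euclideanreal (\<lambda>t. wt P xs t)"
  unfolding wt_conv_sum
proof (rule continuous_map_sum)
  fix j
  have "continuous_map (subtopology (powertop_real UNIV) S) euclideanreal (\<lambda>t. t j)"
    by (intro continuous_map_from_subtopology continuous_map_product_projection) simp
  then show "continuous_map (subtopology (powertop_real UNIV) S) euclideanreal (\<lambda>t. if P (xs ! j) then t j else 0)"
    by (cases "P (xs ! j)") auto
qed simp

subsection \<open>Affine simplices\<close>

definition affine_simplex :: "'a list \<Rightarrow> (nat \<Rightarrow> real) \<Rightarrow> 'a \<Rightarrow> real" where
  "affine_simplex xs = restrict (\<lambda>t v. wt (\<lambda>x. x = v) xs t) (standard_simplex (length xs - 1))"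

lemma affine_simplex_mem:
  assumes "t \<in> standard_simplex (length xs - 1)" "xs \<noteq> []"
  shows "affine_simplex xs t \<in> closed_simplex (set xs)"
  using assms sum_wt [of "set xs" "\<lambda>x. x" xs t] standard_simplexD [OF assms(1)]
  by (auto simp: affine_simplex_def closed_simplex_def intro: wt_nonneg wt_none)

lemma singular_simplex_affine_simplex:
  assumes "set xs \<in> K" "xs \<noteq> []"
  shows "singular_simplex (length xs - 1) (geometric_realization K) (affine_simplex xs)"
  unfolding singular_simplex_def
proof
  show "continuous_map (subtopology (powertop_real UNIV) (standard_simplex (length xs - 1)))
      (geometric_realization K) (affine_simplex xs)"
  proof (rule continuous_map_into_realization [OF _ _ assms(1)])
    have "continuous_map (subtopology (powertop_real UNIV) (standard_simplex (length xs - 1)))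
        (powertop_real UNIV) (\<lambda>t v. wt (\<lambda>x. x = v) xs t)"
      by (simp add: continuous_map_componentwise_UNIV continuous_map_wt)
    then show "continuous_map (subtopology (powertop_real UNIV) (standard_simplex (length xs - 1)))
        (powertop_real UNIV) (affine_simplex xs)"
      by (rule continuous_map_eq) (simp add: affine_simplex_def)
    show "affine_simplex xs \<in> topspace (subtopology (powertop_real UNIV) (standard_simplex (length xs - 1)))
        \<rightarrow> closed_simplex (set xs)"
      using affine_simplex_mem [OF _ assms(2)] by auto
  qed
qed (simp add: affine_simplex_def)

lemma singular_face_affine_simplex:
  assumes "length xs = Suc (Suc q)" "k \<le> Suc q"
  shows "singular_face (Suc q) k (affine_simplex xs) = affine_simplex (delete_nth k xs)"
  using assms simplical_face_in_standard_simplex [of "Suc q" k]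
  by (auto simp: singular_face_def affine_simplex_def fun_eq_iff length_delete_nth wt_simplical_face restrict_def)

abbreviation affine_chain :: "'a list mod2 \<Rightarrow> ((nat \<Rightarrow> real) \<Rightarrow> 'a \<Rightarrow> real) mod2" where
  "affine_chain \<equiv> lin (\<lambda>xs. gen (affine_simplex xs))"

lemma sface_affine_simplex:
  assumes "length xs = Suc (Suc q)"
  shows "sface (Suc q) (affine_simplex xs) = affine_chain (faces xs)"
  using assms by (simp add: sface_def faces_conv_sum lin_sum singular_face_affine_simplex
      lessThan_Suc_atMost del: sum.atMost_Suc sum.lessThan_Suc)

lemma affine_chain_schains:
  assumes "c \<in> chain_space (osimplices K (Suc p))"
  shows "affine_chain c \<in> schains p (geometric_realization K)"
  using assms by (rule chains_lin)
    (use singular_simplex_affine_simplex in \<open>fastforce simp: osimplices_def\<close>)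

lemma sbd_affine_chain:
  assumes "c \<in> chain_space (osimplices K (Suc (Suc q)))"
  shows "sbd (Suc q) (affine_chain c) = affine_chain (bd c)"
  unfolding lin_lin using assms
  by (rule lin_cong_chains) (simp add: osimplices_def sface_affine_simplex)

subsection \<open>Simplices inside a star\<close>

text \<open>A vertex of largest coordinate. Near a point \<open>y\<close> it stays in the support of
  \<open>y\<close>, so it can serve as a simplicial approximation.\<close>

definition top_vertex :: "('a \<Rightarrow> real) \<Rightarrow> 'a" where
  "top_vertex y = (SOME v. v \<in> supp y \<and> (\<forall>u. y u \<le> y v))"

lemma top_vertex:
  assumes "y \<in> closed_simplex s"
  shows "top_vertex y \<in> supp y" "y u \<le> y (top_vertex y)"
proof -
  have fin: "finite (supp y)" and ne: "supp y \<noteq> {}"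
    using closed_simplexD(1) [OF closed_simplex_supp [OF assms]] supp_nonempty [OF assms] by auto
  then have "Max (y ` supp y) \<in> y ` supp y"
    by (intro Max_in) auto
  then obtain v where v: "v \<in> supp y" "y v = Max (y ` supp y)"
    by auto
  have "y u \<le> y v" for u
  proof (cases "u \<in> supp y")
    case True
    then show ?thesis
      using v fin by simp
  next
    case False
    then show ?thesis
      using closed_simplexD(2) [OF assms, of v] by (simp add: supp_def)
  qed
  then have "\<exists>v. v \<in> supp y \<and> (\<forall>u. y u \<le> y v)"
    using v by blast
  from someI_ex [OF this] show "top_vertex y \<in> supp y" "y u \<le> y (top_vertex y)"
    unfolding top_vertex_def by auto
qed

definition corners :: "nat \<Rightarrow> ((nat \<Rightarrow> real) \<Rightarrow> 'a \<Rightarrow> real) \<Rightarrow> 'a list" where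
  "corners p \<sigma> = map (\<lambda>i. top_vertex (\<sigma> (unit_vec i))) [0..<Suc p]"

lemma length_corners [simp]: "length (corners p \<sigma>) = Suc p"
  by (simp add: corners_def)

lemma nth_corners: "i \<le> p \<Longrightarrow> corners p \<sigma> ! i = top_vertex (\<sigma> (unit_vec i))"
  unfolding corners_def using nth_map_upt [of i "Suc p" 0] by simp

lemma set_corners: "set (corners p \<sigma>) = (\<lambda>i. top_vertex (\<sigma> (unit_vec i))) ` {..p}"
  by (simp add: corners_def lessThan_Suc_atMost atLeast0LessThan del: upt_Suc)

text \<open>The requirement under which the straight-line homotopy from \<open>\<sigma>\<close> to
  the affine simplex on its corners stays in the realization.\<close>

definition starlike :: "'a set set \<Rightarrow> nat \<Rightarrow> ((nat \<Rightarrow> real) \<Rightarrow> 'a \<Rightarrow> real) set" where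
  "starlike K p = {\<sigma>. singular_simplex p (geometric_realization K) \<sigma> \<and>
     (\<forall>t\<in>standard_simplex p. supp (\<sigma> t) \<union> set (corners p \<sigma>) \<in> K)}"

lemma corners_singular_face:
  assumes "k \<le> Suc q"
  shows "corners q (singular_face (Suc q) k \<sigma>) = delete_nth k (corners (Suc q) \<sigma>)"
proof (rule nth_equalityI)
  fix i assume "i < length (corners q (singular_face (Suc q) k \<sigma>))"
  then have i: "i \<le> q" by simp
  have "simplical_face k (unit_vec i) = unit_vec (if i < k then i else Suc i)"
    by (auto simp: simplical_face_def fun_eq_iff)
  then show "corners q (singular_face (Suc q) k \<sigma>) ! i = delete_nth k (corners (Suc q) \<sigma>) ! i"
    using i assms by (simp add: nth_delete_nth nth_corners singular_face_def)
qed (use assms in \<open>simp add: length_delete_nth\<close>)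

lemma faces_corners:
  "faces (corners (Suc q) \<sigma>) = lin (\<lambda>\<tau>. gen (corners q \<tau>)) (sface (Suc q) \<sigma>)"
  by (simp add: sface_def faces_conv_sum lin_sum corners_singular_face
      lessThan_Suc_atMost del: sum.atMost_Suc sum.lessThan_Suc)

lemma corners_osimplices:
  assumes "simplicial_complex K" "\<sigma> \<in> starlike K p"
  shows "corners p \<sigma> \<in> osimplices K (Suc p)"
proof -
  have "unit_vec 0 \<in> standard_simplex p" by simp
  then have "supp (\<sigma> (unit_vec 0)) \<union> set (corners p \<sigma>) \<in> K"
    using assms(2) unfolding starlike_def by blast
  then have "set (corners p \<sigma>) \<in> K"
    by (rule simplicial_complexD [OF assms(1)]) simp
  then show ?thesis by (simp add: osimplices_def)
qed

abbreviation corner_chain :: "nat \<Rightarrow> ((nat \<Rightarrow> real) \<Rightarrow> 'a \<Rightarrow> real) mod2 \<Rightarrow> 'a list mod2" where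
  "corner_chain p \<equiv> lin (\<lambda>\<sigma>. gen (corners p \<sigma>))"

lemma bd_corner_chain: "bd (corner_chain (Suc q) z) = corner_chain q (sbd (Suc q) z)"
  by (simp add: lin_lin faces_corners)

lemma corner_chain_chains:
  assumes "simplicial_complex K" "z \<in> chain_space (starlike K p)"
  shows "corner_chain p z \<in> chain_space (osimplices K (Suc p))"
  using assms(2) by (rule chains_lin) (simp add: corners_osimplices [OF assms(1)])

lemma top_vertex_vertex: "top_vertex (\<lambda>v. if a = v then 1 else 0) = a"
proof -
  have "(\<lambda>v. if a = v then 1 else 0 :: real) \<in> closed_simplex {a}"
    by (simp add: closed_simplex_def)
  from top_vertex(1) [OF this] show ?thesis
    by (simp add: supp_def split: if_splits)
qed

lemma corners_affine_simplex:
  assumes "length xs = Suc p"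
  shows "corners p (affine_simplex xs) = xs"
proof (rule nth_equalityI)
  fix i assume "i < length (corners p (affine_simplex xs))"
  then show "corners p (affine_simplex xs) ! i = xs ! i"
    using assms top_vertex_vertex [of "xs ! i"]
    by (simp add: nth_corners affine_simplex_def wt_unit cong: if_cong)
qed (use assms in simp)

lemma starlikeI:
  assumes K: "simplicial_complex K" and \<sigma>: "singular_simplex p (geometric_realization K) \<sigma>"
    and s: "s \<in> K" "\<sigma> ` standard_simplex p \<subseteq> closed_simplex s"
  shows "\<sigma> \<in> starlike K p"
proof -
  have "set (corners p \<sigma>) \<subseteq> s"
  proof
    fix v assume "v \<in> set (corners p \<sigma>)"
    then obtain i where i: "i \<le> p" "v = top_vertex (\<sigma> (unit_vec i))"
      by (auto simp: set_corners)
    have "\<sigma> (unit_vec i) \<in> closed_simplex s"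
      using s(2) i by (auto simp: image_subset_iff)
    from top_vertex(1) [OF this] closed_simplexD(5) [OF this] show "v \<in> s"
      using i by auto
  qed
  moreover have "supp (\<sigma> t) \<subseteq> s" if "t \<in> standard_simplex p" for t
    using s(2) that closed_simplexD(5) by blast
  ultimately have "supp (\<sigma> t) \<union> set (corners p \<sigma>) \<in> K" if "t \<in> standard_simplex p" for t
    using that by (intro simplicial_complexD [OF K s(1)]) auto
  then show ?thesis
    using \<sigma> by (simp add: starlike_def)
qed

definition star_nbhd :: "'a set set \<Rightarrow> ('a \<Rightarrow> real) \<Rightarrow> ('a \<Rightarrow> real) set" where
  "star_nbhd K y = {b \<in> topspace (geometric_realization K). (\<forall>v\<in>supp y. 0 < b v) \<and>
     card (supp y) < (card (supp y) + 1) * (\<Sum>v\<in>supp y. b v)}"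

lemma openin_star_nbhd:
  assumes "finite (supp y)"
  shows "openin (geometric_realization K) (star_nbhd K y)"
proof -
  let ?X = "geometric_realization K"
  have "openin ?X {b \<in> topspace ?X. b v \<in> {0<..}}" for v
    by (rule openin_continuous_map_preimage [OF continuous_map_coordinate]) auto
  then have 1: "openin ?X (topspace ?X \<inter> (\<Inter>v\<in>supp y. {b \<in> topspace ?X. b v \<in> {0<..}}))"
    by (intro openin_Int_Inter) (use assms in auto)
  have "continuous_map ?X euclideanreal (\<lambda>b. (card (supp y) + 1) * (\<Sum>v\<in>supp y. b v))"
    by (intro continuous_map_real_mult continuous_map_sum continuous_map_coordinate assms) auto
  then have 2: "openin ?X {b \<in> topspace ?X. (card (supp y) + 1) * (\<Sum>v\<in>supp y. b v) \<in> {card (supp y)<..}}"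
    by (rule openin_continuous_map_preimage) auto
  have "star_nbhd K y = (topspace ?X \<inter> (\<Inter>v\<in>supp y. {b \<in> topspace ?X. b v \<in> {0<..}})) \<inter>
      {b \<in> topspace ?X. (card (supp y) + 1) * (\<Sum>v\<in>supp y. b v) \<in> {card (supp y)<..}}"
    by (auto simp: star_nbhd_def)
  then show ?thesis
    using openin_Int [OF 1 2] by simp
qed

text \<open>
  If the coordinates outside \<open>supp y\<close> add up to less than \<open>1 / (card (supp y) + 1)\<close>, none of
  them can be the largest one.
\<close>

lemma top_vertex_star_nbhd:
  assumes K: "simplicial_complex K" and fin: "finite (supp y)" and b: "b \<in> star_nbhd K y"
  shows "top_vertex b \<in> supp y"
proof (rule ccontr)
  assume out: "top_vertex b \<notin> supp y"
  let ?k = "real (card (supp y))" and ?S = "\<Sum>v\<in>supp y. b v"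
  have mem: "b \<in> closed_simplex (supp b)"
    using b mem_realization_iff [OF K] by (auto simp: star_nbhd_def)
  note top = top_vertex [OF mem] and cs = closed_simplexD [OF mem]
  have "?S + b (top_vertex b) = (\<Sum>v\<in>insert (top_vertex b) (supp y). b v)"
    using fin out by simp
  also have "\<dots> \<le> (\<Sum>v\<in>insert (top_vertex b) (supp y) \<union> supp b. b v)"
    by (rule sum_mono2) (use fin cs in auto)
  also have "\<dots> = (\<Sum>v\<in>supp b. b v)"
    by (rule sum.mono_neutral_right) (use fin cs in auto)
  finally have 1: "?S + b (top_vertex b) \<le> 1"
    using cs(4) by simp
  have "?S \<le> ?k * b (top_vertex b)"
    using sum_bounded_above [of "supp y" b "b (top_vertex b)"] top(2) by simp
  moreover have "?k * b (top_vertex b) \<le> ?k * (1 - ?S)"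
    using 1 by (intro mult_left_mono) auto
  ultimately have "(?k + 1) * ?S \<le> ?k"
    by (simp add: algebra_simps)
  moreover have "?k < (?k + 1) * ?S"
    using b by (simp add: star_nbhd_def add.commute)
  ultimately show False by simp
qed

text \<open>All corners lie in \<open>supp y\<close>, and \<open>supp y\<close> lies in the support
  of each point of the image.\<close>

lemma starlike_small:
  assumes K: "simplicial_complex K" and y: "finite (supp y)"
    and \<sigma>: "singular_simplex p (geometric_realization K) \<sigma>"
    and sub: "\<sigma> \<in> standard_simplex p \<rightarrow> star_nbhd K y"
  shows "\<sigma> \<in> starlike K p"
proof -
  have "supp (\<sigma> t) \<union> set (corners p \<sigma>) \<in> K" if t: "t \<in> standard_simplex p" for t
  proof -
    have "\<sigma> t \<in> star_nbhd K y"
      using sub t by blast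
    then have st: "supp (\<sigma> t) \<in> K" "supp y \<subseteq> supp (\<sigma> t)"
      using mem_realization_iff [OF K] by (auto simp: star_nbhd_def supp_def)
    have "set (corners p \<sigma>) \<subseteq> supp y"
    proof
      fix v assume "v \<in> set (corners p \<sigma>)"
      then obtain i where i: "i \<le> p" "v = top_vertex (\<sigma> (unit_vec i))"
        by (auto simp: set_corners)
      then have "\<sigma> (unit_vec i) \<in> star_nbhd K y"
        using sub by (auto simp: Pi_iff)
      then show "v \<in> supp y"
        using top_vertex_star_nbhd [OF K y] i by simp
    qed
    then show ?thesis
      using st by (simp add: Un_absorb2)
  qed
  then show ?thesis
    using \<sigma> by (simp add: starlike_def)
qed

lemma star_nbhd_cover:
  assumes K: "simplicial_complex K"
  shows "topspace (geometric_realization K) \<subseteq>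
    \<Union>{star_nbhd K y |y. y \<in> topspace (geometric_realization K)}"
proof
  fix y assume y: "y \<in> topspace (geometric_realization K)"
  then have cs: "y \<in> closed_simplex (supp y)"
    using mem_realization_iff [OF K] by blast
  have "0 < y v" if "v \<in> supp y" for v
    using that closed_simplexD(2) [OF cs, of v] by (simp add: supp_def)
  then have "y \<in> star_nbhd K y"
    using y closed_simplexD(4) [OF cs] by (simp add: star_nbhd_def)
  then show "y \<in> \<Union>{star_nbhd K y |y. y \<in> topspace (geometric_realization K)}"
    using y by blast
qed

subsection \<open>The prism operator\<close>

text \<open>
  The labels \<open>(x, False)\<close> and \<open>(x, True)\<close> stand for the copies of a vertex \<open>x\<close> in the bottom
  and in the top of the prism.
\<close>

primrec prism :: "'a list \<Rightarrow> ('a \<times> bool) list mod2" where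
  "prism [] = 0"
| "prism (x # xs) = gen ((x, False) # map (\<lambda>y. (y, True)) (x # xs)) + cone_from (x, False) (prism xs)"

lemma bd_prism:
  "bd (prism xs) = gen (map (\<lambda>y. (y, True)) xs) + gen (map (\<lambda>y. (y, False)) xs) + lin prism (faces xs)"
proof (induction xs)
  case (Cons x xs)
  let ?t = "\<lambda>y. (y, True)" and ?f = "\<lambda>y. (y, False)"
  have lin: "lin prism (cone_from x c) = cone_from (?f x) (cone_from (?t x) (push ?t c)) + cone_from (?f x) (lin prism c)" for c
    by (simp add: lin_lin lin_fun_add)
  have "bd (prism (x # xs)) = gen (map ?t (x # xs)) + cone_from (?f x) (faces (map ?t (x # xs)))
      + prism xs + cone_from (?f x) (bd (prism xs))"
    unfolding prism.simps lin_add bd_cone lin_gen by (simp add: add.assoc)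
  also have "faces (map ?t (x # xs)) = gen (map ?t xs) + cone_from (?t x) (push ?t (faces xs))"
    by (simp add: faces_map)
  finally show ?case
    unfolding Cons.IH faces.simps lin_add lin lin_gen by (simp add: lin_add algebra_simps)
qed simp

lemma prism_map: "prism (map f xs) = push (map_prod f id) (prism xs)"
  by (induction xs) (simp_all add: lin_add lin_lin comp_def)

lemma prism_keys:
  "l \<in> Poly_Mapping.keys (prism xs) \<Longrightarrow> length l = Suc (length xs) \<and> fst ` set l \<subseteq> set xs"
proof (induction xs arbitrary: l)
  case (Cons x xs)
  have "l = (x, False) # map (\<lambda>y. (y, True)) (x # xs) \<or> l \<in> Poly_Mapping.keys (cone_from (x, False) (prism xs))"
    using Cons.prems by (auto simp: keys_add_mod2)
  moreover have "\<exists>l'\<in>Poly_Mapping.keys (prism xs). l = (x, False) # l'"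
    if "l \<in> Poly_Mapping.keys (cone_from (x, False) (prism xs))"
    using that keys_lin [of "\<lambda>ys. gen ((x, False) # ys)" "prism xs"] by auto
  ultimately consider "l = (x, False) # map (\<lambda>y. (y, True)) (x # xs)"
    | l' where "l' \<in> Poly_Mapping.keys (prism xs)" "l = (x, False) # l'"
    by blast
  then show ?case
  proof cases
    case 2
    then show ?thesis using Cons.IH [of l'] by auto
  qed auto
qed simp

definition base_point :: "(nat \<times> bool) list \<Rightarrow> (nat \<Rightarrow> real) \<Rightarrow> nat \<Rightarrow> real" where
  "base_point l t i = wt (\<lambda>x. fst x = i) l t"

text \<open>At height \<open>wt snd l t\<close>, a point on the segment from \<open>\<sigma>\<close>
  to the affine map with vertices \<open>w\<close>, both taken at the base point. The list of all
  vertices with label \<open>False\<close> gives back \<open>\<sigma>\<close>, the one with label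
  \<open>True\<close> the affine simplex.\<close>

definition prism_simplex ::
    "(nat \<Rightarrow> 'a) \<Rightarrow> ((nat \<Rightarrow> real) \<Rightarrow> 'a \<Rightarrow> real) \<Rightarrow> (nat \<times> bool) list \<Rightarrow> (nat \<Rightarrow> real) \<Rightarrow> 'a \<Rightarrow> real" where
  "prism_simplex w \<sigma> l = restrict (\<lambda>t v. (1 - wt snd l t) * \<sigma> (base_point l t) v
     + wt snd l t * wt (\<lambda>x. w (fst x) = v) l t) (standard_simplex (length l - 1))"

lemma base_point_simplex:
  assumes "t \<in> standard_simplex (length l - 1)" "l \<noteq> []" "fst ` set l \<subseteq> {..p}"
  shows "base_point l t \<in> standard_simplex p"
proof (rule standard_simplexI)
  note t = standard_simplexD [OF assms(1)]
  show "0 \<le> base_point l t i" for i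
    unfolding base_point_def by (rule wt_nonneg) (rule t)
  show "base_point l t i = 0" if "i > p" for i
    unfolding base_point_def by (rule wt_none) (use assms(3) that in auto)
  show "(\<Sum>j<Suc p. base_point l t j) = 1"
    unfolding base_point_def using sum_wt [of "{..<Suc p}" fst l t] assms t(2)
    by (simp add: lessThan_Suc_atMost del: sum.lessThan_Suc)
qed

lemma wt_snd_bounds:
  assumes "t \<in> standard_simplex (length l - 1)" "l \<noteq> []"
  shows "0 \<le> wt snd l t" "wt snd l t \<le> 1"
proof -
  note t = standard_simplexD [OF assms(1)]
  show "0 \<le> wt snd l t"
    by (rule wt_nonneg) (rule t)
  have "wt snd l t \<le> (\<Sum>j<length l. t j)"
    unfolding wt_conv_sum by (rule sum_mono) (simp add: t)
  then show "wt snd l t \<le> 1"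
    using t(2) assms(2) by simp
qed

lemma prism_simplex_mem:
  assumes t: "t \<in> standard_simplex (length l - 1)" and l: "l \<noteq> []" "fst ` set l \<subseteq> {..p}"
    and s: "\<sigma> (base_point l t) \<in> closed_simplex s" and w: "w ` {..p} \<subseteq> s"
  shows "prism_simplex w \<sigma> l t \<in> closed_simplex s"
proof -
  note cs = closed_simplexD [OF s] and ts = standard_simplexD [OF t]
  note u = wt_snd_bounds [OF t l(1)]
  have "wt (\<lambda>x. w (fst x) = v) l t = 0" if "v \<notin> s" for v
    by (rule wt_none) (use l(2) w that in auto)
  moreover have "(\<Sum>v\<in>s. wt (\<lambda>x. w (fst x) = v) l t) = 1"
    using sum_wt [of s "\<lambda>x. w (fst x)" l t] ts(2) l w cs(1) by (force simp: image_subset_iff)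
  moreover have "0 \<le> wt (\<lambda>x. w (fst x) = v) l t" for v
    by (rule wt_nonneg) (rule ts)
  ultimately show ?thesis
    using t u cs by (simp add: prism_simplex_def closed_simplex_def sum.distrib flip: sum_distrib_left)
qed

lemma continuous_map_base_point:
  "continuous_map (subtopology (powertop_real UNIV) S) (powertop_real UNIV) (base_point l)"
  by (simp add: continuous_map_componentwise_UNIV base_point_def continuous_map_wt)

text \<open>Continuity into the weak topology: the compact image of \<open>\<sigma>\<close> meets
  only finitely many supports, and where the support lies inside a fixed one of them, a closed
  condition, the values stay in one closed simplex. These finitely many closed pieces are
  pasted.\<close>

lemma singular_simplex_prism_simplex:
  assumes K: "simplicial_complex K" and \<sigma>: "\<sigma> \<in> starlike K p"
    and l: "l \<noteq> []" "fst ` set l \<subseteq> {..p}" and w: "w ` {..p} \<subseteq> set (corners p \<sigma>)"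
  shows "singular_simplex (length l - 1) (geometric_realization K) (prism_simplex w \<sigma> l)"
  unfolding singular_simplex_def
proof
  let ?X = "geometric_realization K"
  let ?D = "\<lambda>p. subtopology (powertop_real UNIV) (standard_simplex p)"
  let ?Z = "?D (length l - 1)"
  have cont: "continuous_map (?D p) ?X \<sigma>" and star: "\<And>t. t \<in> standard_simplex p \<Longrightarrow> supp (\<sigma> t) \<union> set (corners p \<sigma>) \<in> K"
    using \<sigma> by (auto simp: starlike_def singular_simplex_def)
  have base: "continuous_map ?Z (?D p) (base_point l)"
    using base_point_simplex [OF _ l] continuous_map_base_point
    by (auto simp: continuous_map_in_subtopology)
  have comp: "continuous_map ?Z ?X (\<lambda>t. \<sigma> (base_point l t))"
    using continuous_map_compose [OF base cont] by (simp add: comp_def)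
  have coord: "continuous_map ?Z euclideanreal (\<lambda>t. \<sigma> (base_point l t) v)" for v
    using continuous_map_compose [OF comp continuous_map_coordinate] by (simp add: comp_def)
  have bmem: "\<sigma> (base_point l t) \<in> closed_simplex (supp (\<sigma> (base_point l t)))"
    if "t \<in> standard_simplex (length l - 1)" for t
    using comp that mem_realization_iff [OF K, of "\<sigma> (base_point l t)"] by (auto simp: continuous_map_def Pi_iff)
  define F where "F = supp ` \<sigma> ` standard_simplex p"
  define A where "A s = {t \<in> topspace ?Z. supp (\<sigma> (base_point l t)) \<subseteq> s}" for s
  show "continuous_map ?Z ?X (prism_simplex w \<sigma> l)"
  proof (rule continuous_map_realization_pasting [of F "\<lambda>s. s \<union> set (corners p \<sigma>)" K ?Z A])
    have "compactin (?D p) (standard_simplex p)"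
      by (simp add: compactin_subtopology compactin_standard_simplex)
    then have "compactin ?X (\<sigma> ` standard_simplex p)"
      by (rule image_compactin [OF _ cont])
    then show "finite F"
      unfolding F_def by (rule compactin_realization_finite_supports [OF _ K])
    show "s \<union> set (corners p \<sigma>) \<in> K" if "s \<in> F" for s
      using that star by (auto simp: F_def)
    show "closedin ?Z (A s)" for s
    proof -
      have "A s = topspace ?Z \<inter> (\<Inter>v\<in>-s. {t \<in> topspace ?Z. \<sigma> (base_point l t) v \<in> {0}})"
        by (auto simp: A_def supp_def)
      moreover have "closedin ?Z {t \<in> topspace ?Z. \<sigma> (base_point l t) v \<in> {0}}" for v
        by (rule closedin_continuous_map_preimage [OF coord]) simp
      then have "closedin ?Z (\<Inter>(insert (topspace ?Z) ((\<lambda>v. {t \<in> topspace ?Z. \<sigma> (base_point l t) v \<in> {0}}) ` (-s))))"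
        by (intro closedin_Inter) auto
      ultimately show ?thesis by simp
    qed
    show "\<exists>s\<in>F. t \<in> A s" if "t \<in> topspace ?Z" for t
      using that base_point_simplex [OF _ l] by (auto simp: F_def A_def)
    show "continuous_map ?Z (powertop_real UNIV) (prism_simplex w \<sigma> l)"
    proof (rule continuous_map_eq)
      show "continuous_map ?Z (powertop_real UNIV) (\<lambda>t v. (1 - wt snd l t) * \<sigma> (base_point l t) v
          + wt snd l t * wt (\<lambda>x. w (fst x) = v) l t)"
        unfolding continuous_map_componentwise_UNIV
        by (intro allI continuous_map_add continuous_map_real_mult continuous_map_diff coord continuous_map_wt continuous_map_canonical_const)
    qed (simp add: prism_simplex_def)
    show "prism_simplex w \<sigma> l t \<in> closed_simplex (s \<union> set (corners p \<sigma>))"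
      if "s \<in> F" "t \<in> topspace ?Z" "t \<in> A s" for s t
    proof -
      have t: "t \<in> standard_simplex (length l - 1)"
        using that by simp
      have "finite s"
        using that(1) bmem mem_realization_iff [OF K] cont closed_simplexD(1) 
        by (fastforce simp: F_def continuous_map_def Pi_iff)
      then have "\<sigma> (base_point l t) \<in> closed_simplex (s \<union> set (corners p \<sigma>))"
        using bmem [OF t] that(3) closed_simplex_mono [of "supp (\<sigma> (base_point l t))" "s \<union> set (corners p \<sigma>)"]
        by (auto simp: A_def)
      then show ?thesis
        by (rule prism_simplex_mem [where p = p, OF t l]) (use w in blast)
    qed
  qed
qed (simp add: prism_simplex_def)

lemma singular_face_prism_simplex:
  assumes "length l = Suc (Suc q)" "k \<le> Suc q"
  shows "singular_face (Suc q) k (prism_simplex w \<sigma> l) = prism_simplex w \<sigma> (delete_nth k l)"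
proof -
  have base: "base_point l (simplical_face k t) = base_point (delete_nth k l) t" for t
    using assms by (simp add: base_point_def [abs_def] wt_simplical_face)
  show ?thesis
  proof
    fix t
    show "singular_face (Suc q) k (prism_simplex w \<sigma> l) t = prism_simplex w \<sigma> (delete_nth k l) t"
      using assms simplical_face_in_standard_simplex [of "Suc q" k t]
      by (simp add: singular_face_def prism_simplex_def length_delete_nth wt_simplical_face base)
  qed
qed

lemma sface_prism_simplex:
  assumes "length l = Suc (Suc q)"
  shows "sface (Suc q) (prism_simplex w \<sigma> l) = lin (\<lambda>l. gen (prism_simplex w \<sigma> l)) (faces l)"
  using assms by (simp add: sface_def faces_conv_sum lin_sum singular_face_prism_simplex
      lessThan_Suc_atMost del: sum.atMost_Suc sum.lessThan_Suc)

lemma prism_simplex_bottom: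
  assumes "\<sigma> \<in> extensional (standard_simplex p)"
  shows "prism_simplex w \<sigma> (map (\<lambda>i. (i, False)) [0..<Suc p]) = \<sigma>"
proof
  fix t
  let ?l = "map (\<lambda>i. (i, False)) [0..<Suc p]"
  show "prism_simplex w \<sigma> ?l t = \<sigma> t"
  proof (cases "t \<in> standard_simplex p")
    case True
    have "base_point ?l t i = t i" for i
    proof -
      have "base_point ?l t i = (\<Sum>j<Suc p. if j = i then t j else 0)"
        unfolding base_point_def wt_map wt_conv_sum by (rule sum.cong) (auto simp del: upt_Suc)
      also have "\<dots> = t i"
        using standard_simplexD(3) [OF True, of i] by (simp add: sum.delta less_Suc_eq_le)
      finally show ?thesis .
    qed
    then have "base_point ?l t = t" by blast
    moreover have "wt snd ?l t = 0"
      by (rule wt_none) auto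
    ultimately show ?thesis
      using True by (simp add: prism_simplex_def del: upt_Suc)
  qed (use assms in \<open>simp add: prism_simplex_def extensional_def\<close>)
qed

lemma prism_simplex_top:
  "prism_simplex w \<sigma> (map (\<lambda>i. (i, True)) [0..<Suc p]) = affine_simplex (map w [0..<Suc p])"
proof
  fix t
  let ?l = "map (\<lambda>i. (i, True)) [0..<Suc p]"
  show "prism_simplex w \<sigma> ?l t = affine_simplex (map w [0..<Suc p]) t"
  proof (cases "t \<in> standard_simplex p")
    case True
    have "wt snd ?l t = (\<Sum>j<length ?l. t j)"
      by (rule wt_all) auto
    then have "wt snd ?l t = 1"
      using standard_simplexD(2) [OF True] by simp
    then show ?thesis
      using True by (simp add: prism_simplex_def affine_simplex_def wt_map del: upt_Suc)
  qed (simp add: prism_simplex_def affine_simplex_def)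
qed

lemma prism_simplex_singular_face:
  assumes "l \<noteq> []" "fst ` set l \<subseteq> {..q}" "k \<le> Suc q" 
    and w: "\<And>i. i \<le> q \<Longrightarrow> w' i = w (if i < k then i else Suc i)"
  shows "prism_simplex w \<sigma> (map (map_prod (\<lambda>i. if i < k then i else Suc i) id) l) =
    prism_simplex w' (singular_face (Suc q) k \<sigma>) l"
proof
  fix t
  let ?\<delta> = "\<lambda>i. if i < k then i else Suc i" and ?l = "map (map_prod (\<lambda>i. if i < k then i else Suc i) id) l"
  show "prism_simplex w \<sigma> ?l t = prism_simplex w' (singular_face (Suc q) k \<sigma>) l t"
  proof (cases "t \<in> standard_simplex (length l - 1)")
    case True
    have "base_point ?l t i = simplical_face k (base_point l t) i" for i
      unfolding base_point_def wt_map simplical_face_def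
      by (auto simp: intro!: wt_cong wt_none split: if_splits)
    then have "base_point ?l t = simplical_face k (base_point l t)" by blast
    moreover have "wt (\<lambda>x. w (fst x) = v) ?l t = wt (\<lambda>x. w' (fst x) = v) l t" for v
      unfolding wt_map by (rule wt_cong) (use assms(2) w in auto)
    moreover have "wt snd ?l t = wt snd l t"
      unfolding wt_map by simp
    ultimately show ?thesis
      using True base_point_simplex [OF True assms(1,2)] by (simp add: prism_simplex_def singular_face_def)
  qed (simp add: prism_simplex_def)
qed

definition star_prism :: "nat \<Rightarrow> ((nat \<Rightarrow> real) \<Rightarrow> 'a \<Rightarrow> real) \<Rightarrow> ((nat \<Rightarrow> real) \<Rightarrow> 'a \<Rightarrow> real) mod2" where
  "star_prism p \<sigma> = lin (\<lambda>l. gen (prism_simplex (\<lambda>i. corners p \<sigma> ! i) \<sigma> l)) (prism [0..<Suc p])"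

lemma star_prism_schains:
  assumes K: "simplicial_complex K" and \<sigma>: "\<sigma> \<in> starlike K p"
  shows "star_prism p \<sigma> \<in> schains (Suc p) (geometric_realization K)"
  unfolding star_prism_def
proof (rule chains_lin)
  show "prism [0..<Suc p] \<in> chain_space {l. length l = Suc (Suc p) \<and> fst ` set l \<subseteq> {..p}}"
    using prism_keys [of _ "[0..<Suc p]"] 
    by (auto simp: chain_space_def lessThan_Suc_atMost atLeast0LessThan simp del: upt_Suc prism.simps)
  fix l :: "(nat \<times> bool) list" assume "l \<in> {l. length l = Suc (Suc p) \<and> fst ` set l \<subseteq> {..p}}"
  then show "gen (prism_simplex (\<lambda>i. corners p \<sigma> ! i) \<sigma> l) \<in> schains (Suc p) (geometric_realization K)"
    using singular_simplex_prism_simplex [OF K \<sigma>, of l "\<lambda>i. corners p \<sigma> ! i"] by fastforce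
qed

lemma delete_nth_upt:
  assumes "k \<le> Suc q"
  shows "delete_nth k [0..<Suc (Suc q)] = map (\<lambda>i. if i < k then i else Suc i) [0..<Suc q]"
  by (rule nth_equalityI) (use assms in \<open>auto simp: length_delete_nth nth_delete_nth simp del: upt_Suc\<close>)

text \<open>The combinatorial formula \<open>bd_prism\<close> read in the realization. The sides are
  prisms over the faces because corners and prism simplices are compatible with face maps.\<close>

lemma sbd_star_prism:
  assumes "\<sigma> \<in> starlike K p"
  shows "sbd (Suc p) (star_prism p \<sigma>) = gen (affine_simplex (corners p \<sigma>)) + gen \<sigma> + lin (star_prism (p - 1)) (sface p \<sigma>)"
proof -
  let ?w = "\<lambda>i. corners p \<sigma> ! i" and ?L = "[0..<Suc p]"
  let ?R = "lin (\<lambda>l. gen (prism_simplex ?w \<sigma> l))"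
  have "sbd (Suc p) (star_prism p \<sigma>) = ?R (bd (prism ?L))"
    unfolding star_prism_def lin_lin
    by (rule lin_cong) (use prism_keys [of _ ?L] in \<open>auto simp: sface_prism_simplex simp del: upt_Suc prism.simps\<close>)
  also have "\<dots> = gen (prism_simplex ?w \<sigma> (map (\<lambda>i. (i, True)) ?L)) + gen (prism_simplex ?w \<sigma> (map (\<lambda>i. (i, False)) ?L))
      + ?R (lin prism (faces ?L))"
    unfolding bd_prism lin_add lin_gen ..
  also have "map ?w ?L = corners p \<sigma>"
    using map_nth [of "corners p \<sigma>"] by simp
  then have "prism_simplex ?w \<sigma> (map (\<lambda>i. (i, True)) ?L) = affine_simplex (corners p \<sigma>)"
    unfolding prism_simplex_top by simp
  also have "prism_simplex ?w \<sigma> (map (\<lambda>i. (i, False)) ?L) = \<sigma>"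
    by (rule prism_simplex_bottom) (use assms in \<open>simp add: starlike_def singular_simplex_def\<close>)
  also have "?R (lin prism (faces ?L)) = lin (star_prism (p - 1)) (sface p \<sigma>)"
  proof (cases p)
    case 0
    then show ?thesis by (simp add: sface_def)
  next
    case (Suc q)
    have "?R (prism (delete_nth k ?L)) = star_prism q (singular_face (Suc q) k \<sigma>)" if k: "k \<le> Suc q" for k
    proof -
      have "?R (prism (delete_nth k ?L)) =
          lin (\<lambda>l. gen (prism_simplex ?w \<sigma> (map (map_prod (\<lambda>i. if i < k then i else Suc i) id) l))) (prism [0..<Suc q])"
        unfolding Suc delete_nth_upt [OF k] prism_map by (simp add: lin_lin del: upt_Suc prism.simps)
      also have "\<dots> = star_prism q (singular_face (Suc q) k \<sigma>)"
        unfolding star_prism_def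
      proof (rule lin_cong)
        fix l assume l: "l \<in> Poly_Mapping.keys (prism [0..<Suc q])"
        have "prism_simplex ?w \<sigma> (map (map_prod (\<lambda>i. if i < k then i else Suc i) id) l) =
            prism_simplex (\<lambda>i. corners q (singular_face (Suc q) k \<sigma>) ! i) (singular_face (Suc q) k \<sigma>) l"
        proof (rule prism_simplex_singular_face [OF _ _ k])
          show "corners q (singular_face (Suc q) k \<sigma>) ! i = corners p \<sigma> ! (if i < k then i else Suc i)" if "i \<le> q" for i
            using that k by (simp add: corners_singular_face nth_delete_nth Suc)
        qed (use prism_keys [OF l] in \<open>auto simp del: upt_Suc\<close>)
        then show "gen (prism_simplex ?w \<sigma> (map (map_prod (\<lambda>i. if i < k then i else Suc i) id) l)) =
            gen (prism_simplex (\<lambda>i. corners q (singular_face (Suc q) k \<sigma>) ! i) (singular_face (Suc q) k \<sigma>) l)"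
          by simp
      qed
      finally show ?thesis .
    qed
    then have "(\<Sum>k<Suc (Suc q). ?R (prism (delete_nth k ?L))) = (\<Sum>k<Suc (Suc q). star_prism q (singular_face (Suc q) k \<sigma>))"
      by (intro sum.cong) auto
    then show ?thesis
      by (simp add: Suc faces_conv_sum lin_sum sface_def lessThan_Suc_atMost del: upt_Suc prism.simps sum.lessThan_Suc sum.atMost_Suc)
  qed
  finally show ?thesis .
qed

subsection \<open>Comparison of singular and simplicial homology\<close>

lemma affine_chain_homologous_corner_chain:
  assumes K: "simplicial_complex K" and z: "z \<in> chain_space (starlike K p)" "sbd p z = 0"
  shows "z + affine_chain (corner_chain p z) = sbd (Suc p) (lin (star_prism p) z)"
proof -
  have "sbd (Suc p) (lin (star_prism p) z) =
      lin (\<lambda>\<sigma>. gen (affine_simplex (corners p \<sigma>)) + gen \<sigma> + lin (star_prism (p - 1)) (sface p \<sigma>)) z"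
    unfolding lin_lin using z(1) by (rule lin_cong_chains) (rule sbd_star_prism)
  also have "\<dots> = affine_chain (corner_chain p z) + z + lin (star_prism (p - 1)) (sbd p z)"
    by (simp add: lin_fun_add lin_lin)
  finally show ?thesis
    using z(2) by (simp add: add.commute)
qed

lemma corner_chain_affine_chain:
  assumes "c \<in> chain_space (osimplices K (Suc p))"
  shows "corner_chain p (affine_chain c) = c"
proof -
  have "corner_chain p (affine_chain c) = lin gen c"
    unfolding lin_lin lin_gen using assms
    by (rule lin_cong_chains) (simp add: osimplices_def corners_affine_simplex)
  then show ?thesis by simp
qed

lemma starlike_subdivision:
  assumes K: "simplicial_complex K" and z: "z \<in> schains p (geometric_realization K)"
  obtains z' d E where "z' \<in> chain_space (starlike K p)" "d \<in> schains (Suc p) (geometric_realization K)"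
    and "\<And>Y \<sigma>. singular_simplex (p - 1) Y \<sigma> \<Longrightarrow> E \<sigma> \<in> schains (Suc (p - 1)) Y"
    and "z' + z = sbd (Suc p) d + lin E (sbd p z)"
proof -
  let ?X = "geometric_realization K"
  have fin: "finite (supp y)" if "y \<in> topspace ?X" for y
    using that mem_realization_iff [OF K] closed_simplexD(1) by blast
  obtain z' d E where z': "z' \<in> schains p ?X" and d: "d \<in> schains (Suc p) ?X"
    and small: "\<And>\<sigma>. \<sigma> \<in> Poly_Mapping.keys z' \<Longrightarrow>
      \<exists>V\<in>{star_nbhd K y |y. y \<in> topspace ?X}. \<sigma> \<in> standard_simplex p \<rightarrow> V"
    and E: "\<And>Y \<sigma>. singular_simplex (p - 1) Y \<sigma> \<Longrightarrow> E \<sigma> \<in> schains (Suc (p - 1)) Y"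
    and eq: "z' + z = sbd (Suc p) d + lin E (sbd p z)"
  proof (rule small_simplices [OF _ star_nbhd_cover [OF K] z])
    show "openin ?X U" if "U \<in> {star_nbhd K y |y. y \<in> topspace ?X}" for U
      using that openin_star_nbhd fin by blast
  qed (use that in blast)
  have "\<sigma> \<in> starlike K p" if \<sigma>: "\<sigma> \<in> Poly_Mapping.keys z'" for \<sigma>
  proof -
    obtain y where y: "y \<in> topspace ?X" "\<sigma> \<in> standard_simplex p \<rightarrow> star_nbhd K y"
      using small [OF \<sigma>] by blast
    have "singular_simplex p ?X \<sigma>"
      using chains_keysD [OF z' \<sigma>] by simp
    then show ?thesis
      using starlike_small [OF K fin [OF y(1)] _ y(2)] by simp
  qed
  then have "z' \<in> chain_space (starlike K p)"
    by (auto simp: chain_space_def)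
  then show thesis
    using that d E eq by blast
qed

lemma lin_const_sface: "lin (\<lambda>\<sigma>. c) (sface (Suc 0) \<sigma>) = 0"
  by (simp add: sface_def lin_add)

text \<open>In degree 0, where \<open>sbd\<close> vanishes, \<open>aug\<close> supplies the cycle
  condition of reduced homology; it survives the passage to small simplices because the two ends of
  an edge cancel.\<close>

lemma singular_cycle_affine:
  fixes K :: "'a set set"
  assumes K: "simplicial_complex K" and z: "z \<in> schains p (geometric_realization K)" "sbd p z = 0"
    and aug: "p = 0 \<Longrightarrow> lin (\<lambda>\<sigma>. gen []) z = (0 :: 'a list mod2)"
  obtains c d where "c \<in> cycles K (Suc p)" "d \<in> schains (Suc p) (geometric_realization K)"
    and "z + affine_chain c = sbd (Suc p) d"
proof -
  obtain z' d E where z': "z' \<in> chain_space (starlike K p)"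
    and d: "d \<in> schains (Suc p) (geometric_realization K)"
    and "z' + z = sbd (Suc p) d + lin E (sbd p z)"
    by (rule starlike_subdivision [OF K z(1)])
  then have eq: "z' + z = sbd (Suc p) d"
    using z(2) by simp
  then have z'_eq: "z' = z + sbd (Suc p) d"
    by (metis add.commute add_self_left)
  have cyc: "sbd p z' = 0"
    unfolding z'_eq lin_add using z(2) sbd_sbd [OF d] by simp
  have "corner_chain p z' \<in> cycles K (Suc p)"
    unfolding cycles_def
  proof (intro CollectI conjI corner_chain_chains [OF K z'])
    show "bd (corner_chain p z') = 0"
    proof (cases p)
      case 0
      have "bd (corner_chain p z') = lin (\<lambda>\<sigma>. gen []) z'"
        by (simp add: lin_lin 0 corners_def)
      also have "\<dots> = 0"
        using aug 0 by (simp add: z'_eq lin_add lin_lin lin_const_sface)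
      finally show ?thesis .
    next
      case (Suc q)
      then show ?thesis
        using cyc by (simp add: bd_corner_chain)
    qed
  qed
  moreover have "lin (star_prism p) z' + d \<in> schains (Suc p) (geometric_realization K)"
    using d by (intro chains_add chains_lin [OF z'] star_prism_schains [OF K])
  moreover have "z + affine_chain (corner_chain p z') = sbd (Suc p) (lin (star_prism p) z' + d)"
    using affine_chain_homologous_corner_chain [OF K z' cyc] unfolding lin_add eq [symmetric]
    by (metis (no_types, lifting) add.commute add.left_commute add_self_left)
  ultimately show thesis by (rule that)
qed

text \<open>Subdividing the bounding chain alters its boundary; adding \<open>E\<close> of the
  affine cycle repairs this. By locality that correction stays in closed simplices and so is
  starlike, and the corners of the corrected chain form a simplicial chain with boundary
  \<open>c\<close>.\<close>

lemma affine_boundary_imp_boundary: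
  assumes K: "simplicial_complex K" and c: "c \<in> cycles K (Suc p)"
    and z: "z \<in> schains (Suc p) (geometric_realization K)" "sbd (Suc p) z = affine_chain c"
  shows "c \<in> boundaries K (Suc p)"
proof -
  obtain z' d E where z': "z' \<in> chain_space (starlike K (Suc p))"
    and d: "d \<in> schains (Suc (Suc p)) (geometric_realization K)"
    and E: "\<And>Y \<sigma>. singular_simplex p Y \<sigma> \<Longrightarrow> E \<sigma> \<in> schains (Suc p) Y"
    and eq: "z' + z = sbd (Suc (Suc p)) d + lin E (sbd (Suc p) z)"
    by (rule starlike_subdivision [OF K z(1), unfolded diff_Suc_1]) (rule that; (assumption | blast))
  have cc: "c \<in> chain_space (osimplices K (Suc p))"
    using c by (simp add: cycles_def)
  have "lin E (affine_chain c) \<in> chain_space (starlike K (Suc p))"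
    unfolding lin_lin lin_gen using cc
  proof (rule chains_lin)
    fix xs assume "xs \<in> osimplices K (Suc p)"
    then have xs: "set xs \<in> K" "length xs = Suc p" by (auto simp: osimplices_def)
    let ?Y = "subtopology (geometric_realization K) (closed_simplex (set xs))"
    have "singular_simplex p ?Y (affine_simplex xs)"
      unfolding singular_simplex_subtopology
      using singular_simplex_affine_simplex [OF xs(1)] affine_simplex_mem [of _ xs] xs by fastforce
    then have "E (affine_simplex xs) \<in> schains (Suc p) ?Y"
      by (rule E)
    moreover have "\<sigma> \<in> starlike K (Suc p)" if "singular_simplex (Suc p) ?Y \<sigma>" for \<sigma>
      using that xs(1) by (intro starlikeI [OF K]) (auto simp: singular_simplex_subtopology)
    ultimately show "E (affine_simplex xs) \<in> chain_space (starlike K (Suc p))"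
      by (auto simp: chain_space_def)
  qed
  then have w: "z' + lin E (affine_chain c) \<in> chain_space (starlike K (Suc p))"
    by (rule chains_add [OF z'])
  have weq: "z' + lin E (affine_chain c) = z + sbd (Suc (Suc p)) d"
    using eq unfolding z(2) by (metis (no_types, lifting) add.commute add.left_commute add_self_left)
  have "bd (corner_chain (Suc p) (z' + lin E (affine_chain c))) = corner_chain p (affine_chain c)"
    unfolding bd_corner_chain weq lin_add [of "sface _"] sbd_sbd [OF d] z(2) by simp
  then show ?thesis
    using corner_chain_chains [OF K w] corner_chain_affine_chain [OF cc] by (intro boundariesI) auto
qed

subsection \<open>Translation to functions\<close>

lemma lookup_gen: "Poly_Mapping.lookup (gen x) = basis_chain x"
  by (auto simp: gen_def basis_chain_def fun_eq_iff lookup_single when_def)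

lemma lookup_lin: "Poly_Mapping.lookup (lin f c) y = lin (\<lambda>x. Poly_Mapping.lookup (f x) y) c"
  by (simp add: lin_def lookup_sum)

lemma support_lookup: "{x. Poly_Mapping.lookup c x \<noteq> (0::bit)} = Poly_Mapping.keys c"
  by (auto simp: in_keys_iff)

lemma lookup_keys_bit: "x \<in> Poly_Mapping.keys c \<Longrightarrow> Poly_Mapping.lookup c x = (1::bit)"
  by (simp add: in_keys_iff)

lemma linear_extension_lookup:
  "linear_extension (\<lambda>x. Poly_Mapping.lookup (f x)) (Poly_Mapping.lookup c) = Poly_Mapping.lookup (lin f c)"
proof
  fix y
  have "linear_extension (\<lambda>x. Poly_Mapping.lookup (f x)) (Poly_Mapping.lookup c) y =
      (\<Sum>x\<in>Poly_Mapping.keys c. Poly_Mapping.lookup c x * Poly_Mapping.lookup (f x) y)"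
    by (simp only: linear_extension_def support_lookup)
  also have "\<dots> = lin (\<lambda>x. Poly_Mapping.lookup (f x) y) c"
    unfolding lin_def by (rule sum.cong) (simp_all add: lookup_keys_bit)
  finally show "linear_extension (\<lambda>x. Poly_Mapping.lookup (f x)) (Poly_Mapping.lookup c) y = Poly_Mapping.lookup (lin f c) y"
    by (simp add: lookup_lin)
qed

lemma F2_chains_eq: "F2_chains p X = Poly_Mapping.lookup ` schains p X"
proof
  show "F2_chains p X \<subseteq> Poly_Mapping.lookup ` schains p X"
  proof
    fix c assume c: "c \<in> F2_chains p X"
    then have l: "Poly_Mapping.lookup (Abs_poly_mapping c) = c"
      by (simp add: F2_chains_def)
    moreover have "Abs_poly_mapping c \<in> schains p X"
      using c unfolding chain_space_def support_lookup [symmetric] l by (simp add: F2_chains_def)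
    ultimately show "c \<in> Poly_Mapping.lookup ` schains p X"
      by (metis imageI)
  qed
  show "Poly_Mapping.lookup ` schains p X \<subseteq> F2_chains p X"
  proof clarify
    fix c assume "c \<in> schains p X"
    then show "Poly_Mapping.lookup c \<in> F2_chains p X"
      unfolding F2_chains_def mem_Collect_eq support_lookup chain_space_def by simp
  qed
qed

lemma F2_boundary_lookup:
  "F2_boundary (Suc p) (Poly_Mapping.lookup c) = Poly_Mapping.lookup (sbd (Suc p) c)"
proof -
  have eq: "(\<lambda>\<sigma> \<tau>. \<Sum>k\<le>Suc p. basis_chain (singular_face (Suc p) k \<sigma>) \<tau>) = (\<lambda>\<sigma>. Poly_Mapping.lookup (sface (Suc p) \<sigma>))"
    by (intro ext) (simp only: sface_def nat.distinct if_False lookup_sum lookup_gen)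
  show ?thesis
    unfolding F2_boundary_def eq by (rule linear_extension_lookup)
qed

lemma F2_boundaries_eq:
  "F2_boundaries p X = Poly_Mapping.lookup ` sbd (Suc p) ` schains (Suc p) X"
  by (simp add: F2_boundaries_def F2_chains_eq image_image F2_boundary_lookup)

lemma F2_cycles_eq:
  "F2_cycles p X = Poly_Mapping.lookup `
     {c \<in> schains p X. if p = 0 then lin (\<lambda>\<sigma>. 1::bit) c = 0 else sbd p c = 0}"
proof -
  have 1: "(\<Sum>\<sigma> | Poly_Mapping.lookup c \<sigma> \<noteq> 0. Poly_Mapping.lookup c \<sigma>) = lin (\<lambda>\<sigma>. 1::bit) c"
    for c :: "((nat \<Rightarrow> real) \<Rightarrow> 'a) mod2"
    unfolding support_lookup lin_def by (rule sum.cong) (simp_all only: lookup_keys_bit)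
  have 2: "F2_boundary p (Poly_Mapping.lookup c) = (\<lambda>\<tau>. 0) \<longleftrightarrow> sbd p c = 0"
    if "p \<noteq> 0" for c :: "((nat \<Rightarrow> real) \<Rightarrow> 'a) mod2"
    using that F2_boundary_lookup [of "p - 1" c] by (auto simp: poly_mapping_eq_iff fun_eq_iff)
  show ?thesis
    unfolding F2_cycles_def F2_chains_eq Compr_image_eq 1 using 2 by (cases "p = 0") simp_all
qed

text \<open>Translates between the two forms of the augmentation: the multiple of the empty list in
  the simplicial setting and the value in \<open>bit\<close> in the singular one.\<close>

lemma lin_gen_Nil: "lin (\<lambda>\<sigma>. gen []) c = (0 :: 'a list mod2) \<longleftrightarrow> lin (\<lambda>\<sigma>. 1::bit) c = 0"
proof -
  have "lin (\<lambda>\<sigma>. gen ([] :: 'a list)) c = (if lin (\<lambda>\<sigma>. 1::bit) c = 0 then 0 else gen [])"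
    by (induction c rule: mod2_induct) (auto simp: lin_add)
  moreover have "gen [] \<noteq> (0 :: 'a list mod2)"
    by (metis keys_gen keys_zero empty_not_insert)
  ultimately show ?thesis by simp
qed

abbreviation affine_cycle :: "'a list mod2 \<Rightarrow> ((nat \<Rightarrow> real) \<Rightarrow> 'a \<Rightarrow> real) \<Rightarrow> bit" where
  "affine_cycle c \<equiv> Poly_Mapping.lookup (affine_chain c)"

lemma affine_cycle_F2_cycles:
  assumes "c \<in> cycles K (Suc p)"
  shows "affine_cycle c \<in> F2_cycles p (geometric_realization K)"
proof -
  have c: "c \<in> chain_space (osimplices K (Suc p))" "bd c = 0"
    using assms by (auto simp: cycles_def)
  have "if p = 0 then lin (\<lambda>\<sigma>. 1::bit) (affine_chain c) = 0 else sbd p (affine_chain c) = 0"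
  proof (cases p)
    case 0
    have "bd c = lin (\<lambda>\<sigma>. gen []) c"
      using c(1) by (rule lin_cong_chains) (auto simp: osimplices_def 0 length_Suc_conv)
    from trans [OF sym [OF this] c(2)] have "lin (\<lambda>\<sigma>. 1::bit) c = 0"
      by (rule lin_gen_Nil [THEN iffD1])
    then show ?thesis by (simp add: 0 lin_lin)
  next
    case (Suc q)
    then show ?thesis
      using sbd_affine_chain [of c K q] c by simp
  qed
  then show ?thesis
    unfolding F2_cycles_eq using affine_chain_schains [OF c(1)] by auto
qed

lemma affine_cycle_F2_boundaries:
  assumes K: "simplicial_complex K" and c: "c \<in> cycles K (Suc p)"
  shows "affine_cycle c \<in> F2_boundaries p (geometric_realization K) \<longleftrightarrow> c \<in> boundaries K (Suc p)"
proof
  assume "affine_cycle c \<in> F2_boundaries p (geometric_realization K)"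
  then obtain z where "z \<in> schains (Suc p) (geometric_realization K)" "sbd (Suc p) z = affine_chain c"
    unfolding F2_boundaries_eq by (metis (no_types, lifting) image_iff lookup_inject)
  then show "c \<in> boundaries K (Suc p)"
    by (rule affine_boundary_imp_boundary [OF K c])
next
  assume "c \<in> boundaries K (Suc p)"
  then obtain b where b: "b \<in> chain_space (osimplices K (Suc (Suc p)))" "c = bd b"
    by (auto simp: boundaries_def)
  then have "affine_chain c = sbd (Suc p) (affine_chain b)"
    by (simp add: sbd_affine_chain)
  then show "affine_cycle c \<in> F2_boundaries p (geometric_realization K)"
    unfolding F2_boundaries_eq using affine_chain_schains [OF b(1)] by (simp add: image_iff) blast
qed

lemma F2_cycle_homologous_affine:
  assumes K: "simplicial_complex K" and z: "z \<in> F2_cycles p (geometric_realization K)"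
  obtains c where "c \<in> cycles K (Suc p)"
    "(\<lambda>\<sigma>. z \<sigma> + affine_cycle c \<sigma>) \<in> F2_boundaries p (geometric_realization K)"
proof -
  obtain y where y: "z = Poly_Mapping.lookup y" "y \<in> schains p (geometric_realization K)"
    "if p = 0 then lin (\<lambda>\<sigma>. 1::bit) y = 0 else sbd p y = 0"
    using z unfolding F2_cycles_eq by auto
  then obtain c d where c: "c \<in> cycles K (Suc p)"
    and d: "d \<in> schains (Suc p) (geometric_realization K)" "y + affine_chain c = sbd (Suc p) d"
    using singular_cycle_affine [OF K y(2)] by (metis lin_gen_Nil sbd_0)
  have "(\<lambda>\<sigma>. z \<sigma> + affine_cycle c \<sigma>) = Poly_Mapping.lookup (sbd (Suc p) d)"
    unfolding y(1) d(2) [symmetric] by (intro ext) (simp only: lookup_add)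
  then show thesis
    using that c d(1) unfolding F2_boundaries_eq by blast
qed


section \<open>Simplicial homology by Mayer-Vietoris, wedge and covering arguments\<close>

section \<open>Computing simplicial homology\<close>

definition hom_zero :: "'a set set \<Rightarrow> nat \<Rightarrow> bool" where
  "hom_zero K p \<longleftrightarrow> cycles K p \<subseteq> boundaries K p"

text \<open>Over two elements a line has a single nonzero class, so a generator \<open>z\<close> and
  the test on \<open>z' + z\<close> describe it.\<close>

definition hom_line :: "'a set set \<Rightarrow> nat \<Rightarrow> bool" where
  "hom_line K p \<longleftrightarrow> (\<exists>z\<in>cycles K p. z \<notin> boundaries K p \<and>
     (\<forall>z'\<in>cycles K p. z' \<in> boundaries K p \<or> z' + z \<in> boundaries K p))"

definition homology_iso :: "('a list mod2 \<Rightarrow> 'b list mod2) \<Rightarrow> 'a set set \<Rightarrow> 'b set set \<Rightarrow> nat \<Rightarrow> bool" where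
  "homology_iso f K L p \<longleftrightarrow> (\<forall>z w. f (z + w) = f z + f w) \<and>
     (\<forall>z\<in>cycles K p. f z \<in> cycles L p \<and> (f z \<in> boundaries L p \<longleftrightarrow> z \<in> boundaries K p)) \<and>
     (\<forall>z\<in>cycles L p. \<exists>w\<in>cycles K p. z + f w \<in> boundaries L p)"

lemma homology_iso_hom_zero:
  assumes "homology_iso f K L p"
  shows "hom_zero K p \<longleftrightarrow> hom_zero L p"
proof
  assume K: "hom_zero K p"
  show "hom_zero L p"
    unfolding hom_zero_def
  proof
    fix z assume "z \<in> cycles L p"
    then obtain w where w: "w \<in> cycles K p" "z + f w \<in> boundaries L p"
      using assms by (auto simp: homology_iso_def)
    then have "f w \<in> boundaries L p"
      using K assms by (auto simp: homology_iso_def hom_zero_def)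
    then show "z \<in> boundaries L p"
      using w(2) boundaries_add_cancel [of "f w" L p z] by (simp add: add.commute)
  qed
next
  assume "hom_zero L p"
  then show "hom_zero K p"
    using assms by (auto simp: homology_iso_def hom_zero_def)
qed

lemma homology_iso_hom_line:
  assumes iso: "homology_iso f K L p" and K: "hom_line K p"
  shows "hom_line L p"
proof -
  obtain z where z: "z \<in> cycles K p" "z \<notin> boundaries K p"
    "\<And>w. w \<in> cycles K p \<Longrightarrow> w \<in> boundaries K p \<or> w + z \<in> boundaries K p"
    using K by (auto simp: hom_line_def)
  have f: "f (u + v) = f u + f v" "u \<in> cycles K p \<Longrightarrow> f u \<in> cycles L p"
    "u \<in> cycles K p \<Longrightarrow> f u \<in> boundaries L p \<longleftrightarrow> u \<in> boundaries K p" for u v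
    using iso by (auto simp: homology_iso_def)
  have "y \<in> boundaries L p \<or> y + f z \<in> boundaries L p" if y: "y \<in> cycles L p" for y
  proof -
    obtain w where w: "w \<in> cycles K p" "y + f w \<in> boundaries L p"
      using iso y by (auto simp: homology_iso_def)
    from z(3) [OF w(1)] show ?thesis
    proof
      assume "w \<in> boundaries K p"
      then have "f w \<in> boundaries L p" using f w by simp
      then show ?thesis
        using boundaries_add [OF w(2), of "f w"] by (simp add: add.assoc)
    next
      assume "w + z \<in> boundaries K p"
      then have "f w + f z \<in> boundaries L p"
        using f(3) [OF cycles_add [OF w(1) z(1)]] by (simp add: f(1))
      then show ?thesis
        using boundaries_trans [OF w(2), of "f z"] by simp
    qed
  qed
  then show ?thesis
    unfolding hom_line_def using f z by blast
qed

lemma homology_iso_id: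
  assumes "K \<subseteq> L" and "\<And>z. z \<in> cycles L p \<Longrightarrow> \<exists>w\<in>cycles K p. z + w \<in> boundaries L p"
    and "\<And>z. z \<in> cycles K p \<Longrightarrow> z \<in> boundaries L p \<Longrightarrow> z \<in> boundaries K p"
  shows "homology_iso (\<lambda>z. z) K L p"
  using assms cycles_mono [OF _ assms(1)] boundaries_mono [OF _ assms(1)] unfolding homology_iso_def by blast

lemma hom_line_inverse:
  assumes iso: "homology_iso (\<lambda>z. z) K L p" and L: "hom_line L p"
  shows "hom_line K p"
proof -
  obtain z where z: "z \<in> cycles L p" "z \<notin> boundaries L p"
    "\<And>w. w \<in> cycles L p \<Longrightarrow> w \<in> boundaries L p \<or> w + z \<in> boundaries L p"
    using L by (auto simp: hom_line_def)
  have K: "u \<in> cycles L p" "u \<in> boundaries L p \<longleftrightarrow> u \<in> boundaries K p" if "u \<in> cycles K p" for u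
    using iso that by (auto simp: homology_iso_def)
  obtain w where w: "w \<in> cycles K p" "z + w \<in> boundaries L p"
    using iso z(1) by (auto simp: homology_iso_def)
  have "w \<notin> boundaries K p"
  proof
    assume "w \<in> boundaries K p"
    then have "w \<in> boundaries L p" using K w by simp
    from boundaries_add [OF w(2) this] show False
      using z(2) by (simp add: add.assoc)
  qed
  moreover have "y \<in> boundaries K p \<or> y + w \<in> boundaries K p" if y: "y \<in> cycles K p" for y
    using z(3) [OF K(1) [OF y]]
  proof
    assume "y + z \<in> boundaries L p"
    then have "y + w \<in> boundaries L p"
      by (rule boundaries_trans) (rule w(2))
    then show ?thesis
      using K(2) [OF cycles_add [OF y w(1)]] by simp
  qed (use K(2) [OF y] in simp)
  ultimately show ?thesis
    unfolding hom_line_def using w(1) by blast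
qed

lemma carried_mono:
  assumes "carried L \<Phi> f" "K \<subseteq> L" "\<And>s. s \<in> K \<Longrightarrow> \<Phi> s \<subseteq> \<Psi> s"
  shows "carried K \<Psi> f"
  unfolding carried_def
proof (intro conjI allI impI)
  show "f [] = gen []"
    using assms(1) by (simp add: carried_def)
  fix xs assume xs: "set xs \<in> K"
  then have *: "f xs \<in> chain_space (osimplices (\<Phi> (set xs)) (length xs))" "bd (f xs) = lin f (faces xs)"
    using assms(1,2) by (auto simp: carried_def)
  show "f xs \<in> chain_space (osimplices (\<Psi> (set xs)) (length xs))"
    using *(1) osimplices_mono [OF assms(3) [OF xs]] by (rule chains_mono)
  show "bd (f xs) = lin f (faces xs)"
    by (rule *(2))
qed

lemma carried_gen:
  assumes "\<And>s. s \<in> K \<Longrightarrow> s \<in> \<Phi> s"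
  shows "carried K \<Phi> gen"
  using carried_push [of K "\<lambda>x. x" \<Phi>] assms by simp

lemma carrier_on_subset:
  assumes "carrier_on L \<Phi>" "K \<subseteq> L"
  shows "carrier_on K \<Phi>"
  unfolding carrier_on_def
proof (intro conjI ballI)
  fix s assume "s \<in> K"
  then have s: "s \<in> L" using assms(2) by auto
  show "\<forall>t\<subseteq>s. \<Phi> t \<subseteq> \<Phi> s" "simplicial_complex (\<Phi> s)" "s \<noteq> {} \<longrightarrow> acyclic_complex (\<Phi> s)"
    using assms(1) s by (auto simp: carrier_on_def)
qed

lemma carrier_on_hull:
  assumes K: "simplicial_complex K" and L: "simplicial_complex L"
    and mono: "\<And>s t. s \<in> L \<Longrightarrow> t \<subseteq> s \<Longrightarrow> h t \<subseteq> h s"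
    and acyc: "\<And>s. s \<in> L \<Longrightarrow> s \<noteq> {} \<Longrightarrow> acyclic_complex (K \<inter> Pow (h s))"
  shows "carrier_on L (\<lambda>s. K \<inter> Pow (h s))"
  unfolding carrier_on_def
proof (intro conjI ballI allI impI acyc)
  show "K \<inter> Pow (h t) \<subseteq> K \<inter> Pow (h s)" if "s \<in> L" "t \<subseteq> s" for s t
    using mono [OF that] by auto
  show "simplicial_complex (K \<inter> Pow (h s))" for s
    using K by (auto simp: simplicial_complex_def)
qed

text \<open>\<open>h\<close> is to be thought of as a convex hull. Restricted to hulls of simplices
  of \<open>L\<close>, both complexes are acyclic, so the hulls carry a chain map from
  \<open>L\<close> to \<open>K\<close> that inverts the inclusion on homology.\<close>

locale hull_carrier =
  fixes K L :: "'a set set" and h :: "'a set \<Rightarrow> 'a set"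
  assumes K: "simplicial_complex K" and L: "simplicial_complex L" and KL: "K \<subseteq> L"
    and h_mono: "\<And>s t. s \<in> L \<Longrightarrow> t \<subseteq> s \<Longrightarrow> h t \<subseteq> h s"
    and h_subset: "\<And>s. s \<in> L \<Longrightarrow> s \<subseteq> h s"
    and acyclic_K: "\<And>s. s \<in> L \<Longrightarrow> s \<noteq> {} \<Longrightarrow> acyclic_complex (K \<inter> Pow (h s))"
    and acyclic_L: "\<And>s. s \<in> L \<Longrightarrow> s \<noteq> {} \<Longrightarrow> acyclic_complex (L \<inter> Pow (h s))"
begin

abbreviation "\<rho> \<equiv> carried_map (\<lambda>s. K \<inter> Pow (h s))"

lemma carrier_K: "carrier_on L (\<lambda>s. K \<inter> Pow (h s))"
  using K L h_mono acyclic_K by (rule carrier_on_hull)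

lemma carrier_L: "carrier_on L (\<lambda>s. L \<inter> Pow (h s))"
  using L L h_mono acyclic_L by (rule carrier_on_hull)

lemma carried_\<rho>: "carried L (\<lambda>s. K \<inter> Pow (h s)) \<rho>"
  by (rule carried_map [OF L carrier_K])

lemma \<rho>_cycles: "z \<in> cycles L p \<Longrightarrow> lin \<rho> z \<in> cycles K p"
  by (rule carried_cycle [OF carried_\<rho>]) auto

lemma \<rho>_boundaries: "z \<in> boundaries L p \<Longrightarrow> lin \<rho> z \<in> boundaries K p"
  by (rule carried_boundary [OF carried_\<rho>]) auto

lemma \<rho>_homologous:
  assumes "z \<in> cycles L p"
  shows "z + lin \<rho> z \<in> boundaries L p"
proof -
  have "lin gen z + lin \<rho> z \<in> boundaries L p"
  proof (rule carried_homologous [OF L carrier_L _ _ _ assms])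
    show "carried L (\<lambda>s. L \<inter> Pow (h s)) gen"
      by (rule carried_gen) (use h_subset in simp)
    show "carried L (\<lambda>s. L \<inter> Pow (h s)) \<rho>"
      by (rule carried_mono [OF carried_\<rho>]) (use KL in auto)
  qed auto
  then show ?thesis by simp
qed

lemma \<rho>_homologous_K:
  assumes "z \<in> cycles K p"
  shows "z + lin \<rho> z \<in> boundaries K p"
proof -
  have "lin gen z + lin \<rho> z \<in> boundaries K p"
  proof (rule carried_homologous [OF K, of "\<lambda>s. K \<inter> Pow (h s)"])
    show "carrier_on K (\<lambda>s. K \<inter> Pow (h s))"
      using carrier_K KL by (rule carrier_on_subset)
    show "carried K (\<lambda>s. K \<inter> Pow (h s)) gen"
      by (rule carried_gen) (use h_subset KL in auto)
    show "carried K (\<lambda>s. K \<inter> Pow (h s)) \<rho>"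
      by (rule carried_mono [OF carried_\<rho> KL]) auto
  qed (use assms in auto)
  then show ?thesis by simp
qed

lemma inclusion_iso: "homology_iso (\<lambda>z. z) K L p"
proof (rule homology_iso_id [OF KL])
  show "\<exists>w\<in>cycles K p. z + w \<in> boundaries L p" if "z \<in> cycles L p" for z
    using \<rho>_cycles \<rho>_homologous that by blast
  show "z \<in> boundaries K p" if "z \<in> cycles K p" "z \<in> boundaries L p" for z
    using boundaries_add [OF \<rho>_homologous_K [OF that(1)] \<rho>_boundaries [OF that(2)]]
    by (simp add: add.assoc)
qed

end

subsection \<open>Suspensions and cross-polytopes\<close>

definition restrict_chain :: "'i set \<Rightarrow> 'i mod2 \<Rightarrow> 'i mod2" where
  "restrict_chain S = lin (\<lambda>x. if x \<in> S then gen x else 0)"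

lemma restrict_chain:
  assumes "c \<in> chain_space (S \<union> T)"
  shows "restrict_chain S c \<in> chain_space S" "c + restrict_chain S c \<in> chain_space T"
proof -
  show "restrict_chain S c \<in> chain_space S"
    unfolding restrict_chain_def using assms by (rule chains_lin) auto
  have "c + restrict_chain S c = lin (\<lambda>x. gen x + (if x \<in> S then gen x else 0)) c"
    by (simp add: restrict_chain_def lin_fun_add)
  also have "\<dots> \<in> chain_space T"
    using assms by (rule chains_lin) auto
  finally show "c + restrict_chain S c \<in> chain_space T" .
qed

lemma osimplices_Un: "osimplices (A \<union> B) p = osimplices A p \<union> osimplices B p"
  by (auto simp: osimplices_def)

lemma chains_Int: "c \<in> chain_space (osimplices A p) \<Longrightarrow> c \<in> chain_space (osimplices B p) \<Longrightarrow>
    c \<in> chain_space (osimplices (A \<inter> B) p)"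
  by (auto simp: chain_space_def osimplices_def)

lemma chain_split:
  assumes "c \<in> chain_space (osimplices (A \<union> B) p)"
  obtains a b where "a \<in> chain_space (osimplices A p)" "b \<in> chain_space (osimplices B p)" "c = a + b"
  using restrict_chain [OF assms [unfolded osimplices_Un]] that
  by (metis add.commute add_self_left)

lemma cycle_boundary: "acyclic_complex A \<Longrightarrow> z \<in> chain_space (osimplices A p) \<Longrightarrow> bd z = 0 \<Longrightarrow> z \<in> boundaries A p"
  by (auto simp: acyclic_complex_def cycles_def)

context
  fixes A B :: "'a set set"
  assumes A: "simplicial_complex A" and B: "simplicial_complex B"
    and acyc: "acyclic_complex A" "acyclic_complex B"
begin

text \<open>Half of the Mayer-Vietoris isomorphism for two acyclic pieces: a chain \<open>w\<close>
  of the intersection with the same boundary splits \<open>a + b\<close> into two cycles, each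
  inside one piece.\<close>

lemma suspension_boundary:
  assumes a: "a \<in> chain_space (osimplices A (Suc p))" and b: "b \<in> chain_space (osimplices B (Suc p))"
    and eq: "bd a = bd b" "bd a \<in> boundaries (A \<inter> B) p"
  shows "a + b \<in> boundaries (A \<union> B) (Suc p)"
proof -
  obtain w where w: "w \<in> chain_space (osimplices (A \<inter> B) (Suc p))" "bd w = bd a"
    using eq(2) by (auto simp: boundaries_def)
  have wA: "w \<in> chain_space (osimplices A (Suc p))" and wB: "w \<in> chain_space (osimplices B (Suc p))"
    using w(1) chains_mono osimplices_mono by (metis inf_le1, metis inf_le2)
  have "a + w \<in> boundaries A (Suc p)"
    by (rule cycle_boundary [OF acyc(1) chains_add [OF a wA]]) (simp add: lin_add w(2))
  then have "a + w \<in> boundaries (A \<union> B) (Suc p)"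
    by (rule boundaries_mono) simp
  moreover have "w + b \<in> boundaries B (Suc p)"
    by (rule cycle_boundary [OF acyc(2) chains_add [OF wB b]]) (simp add: lin_add w(2) eq(1))
  then have "w + b \<in> boundaries (A \<union> B) (Suc p)"
    by (rule boundaries_mono) simp
  ultimately show ?thesis by (rule boundaries_trans)
qed

lemma suspension_split:
  assumes "z \<in> cycles (A \<union> B) (Suc p)"
  obtains a b where "a \<in> chain_space (osimplices A (Suc p))" "b \<in> chain_space (osimplices B (Suc p))"
    and "z = a + b" "bd a = bd b" "bd a \<in> cycles (A \<inter> B) p"
proof -
  obtain a b where ab: "a \<in> chain_space (osimplices A (Suc p))" "b \<in> chain_space (osimplices B (Suc p))" "z = a + b"
    using assms chain_split unfolding cycles_def by blast
  have eq: "bd a = bd b"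
    using assms by (simp add: ab(3) cycles_def lin_add add_eq_0_char2)
  moreover have "bd a \<in> cycles (A \<inter> B) p"
    unfolding cycles_def
    using chains_Int [OF bd_chains [OF A ab(1)] bd_chains [OF B ab(2), folded eq]] by simp
  ultimately show thesis
    using that ab by blast
qed

lemma suspension_hom_zero:
  assumes "hom_zero (A \<inter> B) p"
  shows "hom_zero (A \<union> B) (Suc p)"
  unfolding hom_zero_def
proof
  fix z assume "z \<in> cycles (A \<union> B) (Suc p)"
  then obtain a b where ab: "a \<in> chain_space (osimplices A (Suc p))" "b \<in> chain_space (osimplices B (Suc p))"
    "z = a + b" "bd a = bd b" "bd a \<in> cycles (A \<inter> B) p"
    by (rule suspension_split)
  then show "z \<in> boundaries (A \<union> B) (Suc p)"
    using suspension_boundary [OF ab(1,2,4)] assms by (auto simp: hom_zero_def)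
qed

text \<open>The generator is the sum of fillings \<open>a\<close> and \<open>b\<close> of
  \<open>y\<close> in the two pieces. Were it the boundary of \<open>c1 + c2\<close>, then
  \<open>a + bd c1 = b + bd c2\<close> would fill \<open>y\<close> in the intersection.\<close>

lemma suspension_hom_line:
  assumes "hom_line (A \<inter> B) p"
  shows "hom_line (A \<union> B) (Suc p)"
proof -
  obtain y where y: "y \<in> cycles (A \<inter> B) p" "y \<notin> boundaries (A \<inter> B) p"
    "\<And>w. w \<in> cycles (A \<inter> B) p \<Longrightarrow> w \<in> boundaries (A \<inter> B) p \<or> w + y \<in> boundaries (A \<inter> B) p"
    using assms by (auto simp: hom_line_def)
  have "y \<in> cycles A p" "y \<in> cycles B p"
    using y(1) cycles_mono by (metis inf_le1, metis inf_le2)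
  then have "y \<in> boundaries A p" "y \<in> boundaries B p"
    using acyc unfolding acyclic_complex_def by auto
  then obtain a b where a: "a \<in> chain_space (osimplices A (Suc p))" "y = bd a"
    and b: "b \<in> chain_space (osimplices B (Suc p))" "y = bd b"
    unfolding boundaries_def by blast
  have "a + b \<in> chain_space (osimplices (A \<union> B) (Suc p))"
    using a(1) b(1) by (intro chains_add) (auto elim: chains_mono simp: osimplices_Un)
  then have cyc: "a + b \<in> cycles (A \<union> B) (Suc p)"
    using a(2) b(2) by (simp add: cycles_def lin_add)
  have "a + b \<notin> boundaries (A \<union> B) (Suc p)"
  proof
    assume "a + b \<in> boundaries (A \<union> B) (Suc p)"
    then obtain c where "c \<in> chain_space (osimplices (A \<union> B) (Suc (Suc p)))" "a + b = bd c"
      by (auto simp: boundaries_def)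
    then obtain c1 c2 where c: "c1 \<in> chain_space (osimplices A (Suc (Suc p)))"
      "c2 \<in> chain_space (osimplices B (Suc (Suc p)))" "a + b = bd c1 + bd c2"
      using chain_split by (metis lin_add)
    then have eq: "a + bd c1 = b + bd c2"
      by (metis (no_types, lifting) add.commute add.left_commute add_self_left)
    have "a + bd c1 \<in> chain_space (osimplices (A \<inter> B) (Suc p))"
      by (rule chains_Int, rule chains_add [OF a(1) bd_chains [OF A c(1)]],
          unfold eq, rule chains_add [OF b(1) bd_chains [OF B c(2)]])
    then have "y \<in> boundaries (A \<inter> B) p"
      by (rule boundariesI) (simp add: lin_add a(2))
    then show False using y(2) by simp
  qed
  moreover have "z \<in> boundaries (A \<union> B) (Suc p) \<or> z + (a + b) \<in> boundaries (A \<union> B) (Suc p)"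
    if z: "z \<in> cycles (A \<union> B) (Suc p)" for z
  proof -
    obtain a' b' where ab: "a' \<in> chain_space (osimplices A (Suc p))" "b' \<in> chain_space (osimplices B (Suc p))"
      "z = a' + b'" "bd a' = bd b'" "bd a' \<in> cycles (A \<inter> B) p"
      using z by (rule suspension_split)
    from y(3) [OF ab(5)] show ?thesis
    proof
      assume "bd a' \<in> boundaries (A \<inter> B) p"
      then show ?thesis
        using suspension_boundary [OF ab(1,2,4)] ab(3) by simp
    next
      assume *: "bd a' + y \<in> boundaries (A \<inter> B) p"
      have "(a' + a) + (b' + b) \<in> boundaries (A \<union> B) (Suc p)"
      proof (rule suspension_boundary [OF chains_add [OF ab(1) a(1)] chains_add [OF ab(2) b(1)]])
        show "bd (a' + a) = bd (b' + b)"
          using ab(4) a(2) b(2) by (simp add: lin_add)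
        show "bd (a' + a) \<in> boundaries (A \<inter> B) p"
          using * by (simp add: lin_add a(2))
      qed
      then show ?thesis
        using ab(3) by (simp add: algebra_simps)
    qed
  qed
  ultimately show ?thesis
    unfolding hom_line_def using cyc by blast
qed

end

lemma hom_zero_0:
  assumes "{v} \<in> K"
  shows "hom_zero K 0"
  unfolding hom_zero_def
proof
  fix z assume "z \<in> cycles K 0"
  then have z: "z \<in> chain_space {[] :: 'a list}"
    unfolding cycles_def by (auto elim!: chains_mono simp: osimplices_def)
  have "cone_from v z \<in> chain_space (osimplices K (Suc 0))"
    using z by (rule chains_lin) (use assms in \<open>auto simp: osimplices_def\<close>)
  moreover have "bd z = 0"
    using lin_cong_chains [OF z, of faces "\<lambda>_. 0"] by simp
  ultimately show "z \<in> boundaries K 0"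
    by (intro boundariesI [of "cone_from v z"]) (simp_all add: bd_cone)
qed

text \<open>\<open>(i, True)\<close> and \<open>(i, False)\<close> are the two vertices on axis
  \<open>i\<close>, of which a simplex contains at most one. The complex is the boundary of the
  \<open>m\<close>-dimensional polytope, a sphere of dimension \<open>m - 1\<close>, whose class has
  length \<open>m\<close>.\<close>

definition cross_polytope :: "nat \<Rightarrow> (nat \<times> bool) set set" where
  "cross_polytope m = {s. fst ` s \<subseteq> {..<m} \<and> inj_on fst s}"

lemma simplicial_complex_cross_polytope: "simplicial_complex (cross_polytope m)"
  unfolding simplicial_complex_def cross_polytope_def by (auto intro: inj_on_subset)

text \<open>Leaving out one of the two vertices on the last axis gives a cone with the other one as
  apex, and the two cones intersect in the previous cross-polytope. The induction starts from the
  empty sphere, whose only reduced class is the empty list.\<close>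

lemma cross_polytope_homology:
  "hom_line (cross_polytope m) m \<and> (\<forall>p. p \<noteq> m \<longrightarrow> hom_zero (cross_polytope m) p)"
proof (induction m)
  case 0
  have K: "cross_polytope 0 = {{}}"
    by (auto simp: cross_polytope_def)
  have os: "osimplices {{} :: (nat \<times> bool) set} p = (if p = 0 then {[]} else {})" for p
    by (auto simp: osimplices_def)
  have e: "chain_space {} = {0 :: (nat \<times> bool) list mod2}"
    by (auto simp: chain_space_def)
  have b: "boundaries {{} :: (nat \<times> bool) set} p = {0}" for p
    by (simp add: boundaries_def os e)
  have n: "gen [] \<noteq> (0 :: (nat \<times> bool) list mod2)"
    by (metis keys_gen keys_zero empty_not_insert)
  have c: "z = 0 \<or> z = gen []" if "z \<in> chain_space {[] :: (nat \<times> bool) list}" for z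
    using that by (induction rule: chains_induct) auto
  have "gen [] \<in> cycles {{} :: (nat \<times> bool) set} 0"
    by (simp add: cycles_def os)
  moreover have "z = 0 \<or> z = gen []" if "z \<in> cycles {{} :: (nat \<times> bool) set} 0" for z
    using that c by (simp add: cycles_def os)
  ultimately have "hom_line (cross_polytope 0) 0"
    unfolding K hom_line_def b by (metis add_self n singleton_iff)
  moreover have "hom_zero (cross_polytope 0) p" if "p \<noteq> 0" for p
    using that by (auto simp: K hom_zero_def b cycles_def os e)
  ultimately show ?case by blast
next
  case (Suc m)
  define A where "A c = {s \<in> cross_polytope (Suc m). (m, c) \<notin> s}" for c
  have complex: "simplicial_complex (A c)" for c
    using simplicial_complex_cross_polytope [of "Suc m"] unfolding simplicial_complex_def A_def by blast
  have "insert (m, \<not> c) s \<in> A c" if "s \<in> A c" for s c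
  proof -
    have "fst x \<noteq> m" if "x \<in> s" "x \<noteq> (m, \<not> c)" for x
      using that \<open>s \<in> A c\<close> by (cases x) (auto simp: A_def)
    then have "inj_on fst (insert (m, \<not> c) s)"
      using that by (auto simp: A_def cross_polytope_def inj_on_def)
    then show ?thesis
      using that by (auto simp: A_def cross_polytope_def)
  qed
  then have acyc: "acyclic_complex (A c)" for c
    by (rule acyclic_cone)
  have Int: "A True \<inter> A False = cross_polytope m"
  proof -
    have "m \<notin> fst ` s \<longleftrightarrow> (m, True) \<notin> s \<and> (m, False) \<notin> s" for s :: "(nat \<times> bool) set"
    proof -
      have "m \<in> fst ` s \<longleftrightarrow> (\<exists>c. (m, c) \<in> s)"
        by force
      then show ?thesis
        by (simp add: ex_bool_eq)
    qed
    moreover have "fst ` s \<subseteq> {..<m} \<longleftrightarrow> fst ` s \<subseteq> {..<Suc m} \<and> m \<notin> fst ` s" for s :: "(nat \<times> bool) set"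
      unfolding lessThan_Suc by blast
    ultimately show ?thesis
      by (auto simp: A_def cross_polytope_def)
  qed
  have Un: "A True \<union> A False = cross_polytope (Suc m)"
    by (auto simp: A_def cross_polytope_def dest: inj_onD [where x = "(m, True)" and y = "(m, False)"])
  have "hom_zero (cross_polytope (Suc m)) 0"
    by (rule hom_zero_0 [of "(0, True)"]) (auto simp: cross_polytope_def)
  moreover have "hom_zero (cross_polytope (Suc m)) (Suc q)" if "q \<noteq> m" for q
    using suspension_hom_zero [OF complex complex acyc acyc, of True False q] Suc that
    by (simp add: Int Un)
  moreover have "hom_line (cross_polytope (Suc m)) (Suc m)"
    using suspension_hom_line [OF complex complex acyc acyc, of True False m] Suc
    by (simp add: Int Un)
  ultimately show ?case
    by (metis not0_implies_Suc)
qed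

subsection \<open>Clique complexes\<close>

text \<open>The empty set is included for the augmentation. The relation is tested on diagonal pairs
  too, which makes all vertices disappear at scales \<open>r \<le> 0\<close>.\<close>

definition clique :: "'a set \<Rightarrow> ('a \<Rightarrow> 'a \<Rightarrow> bool) \<Rightarrow> 'a set set" where
  "clique M N = {s. finite s \<and> s \<subseteq> M \<and> (\<forall>x\<in>s. \<forall>y\<in>s. N x y)}"

lemma simplicial_complex_clique: "simplicial_complex (clique M N)"
  by (auto simp: simplicial_complex_def clique_def finite_subset subset_iff)

lemma cliqueD: "s \<in> clique M N \<Longrightarrow> x \<in> s \<Longrightarrow> x \<in> M" "s \<in> clique M N \<Longrightarrow> x \<in> s \<Longrightarrow> y \<in> s \<Longrightarrow> N x y"
  by (auto simp: clique_def)

lemma clique_mono: "M \<subseteq> M' \<Longrightarrow> (\<And>x y. x \<in> M \<Longrightarrow> y \<in> M \<Longrightarrow> N x y \<Longrightarrow> N' x y) \<Longrightarrow> clique M N \<subseteq> clique M' N'"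
  unfolding clique_def by blast

lemma clique_Int_Pow: "clique M N \<inter> Pow W = clique (M \<inter> W) N"
  by (auto simp: clique_def)

lemma clique_image:
  assumes "s \<in> clique M N" "\<And>x. x \<in> M \<Longrightarrow> f x \<in> M'"
    and "\<And>x y. x \<in> M \<Longrightarrow> y \<in> M \<Longrightarrow> N x y \<Longrightarrow> N' (f x) (f y)"
  shows "f ` s \<in> clique M' N'"
  using assms(1) by (auto simp: clique_def subset_iff intro!: assms(2,3))

subsection \<open>Wedges\<close>

text \<open>
  A simplex meeting two summands of a wedge spans a simplex together with the base point. Hence the
  identity and the sum of the retractions onto the summands have a common acyclic carrier.
\<close>

locale wedge_complex =
  fixes I :: "'i set" and W :: "'i \<Rightarrow> 'a set" and b :: 'a and N :: "'a \<Rightarrow> 'a \<Rightarrow> bool"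
  assumes finite_I: "finite I" and I_ne: "I \<noteq> {}"
    and base: "\<And>i. i \<in> I \<Longrightarrow> b \<in> W i"
    and disjoint: "\<And>i j x. i \<in> I \<Longrightarrow> j \<in> I \<Longrightarrow> i \<noteq> j \<Longrightarrow> x \<in> W i \<Longrightarrow> x \<in> W j \<Longrightarrow> x = b"
    and N_base: "N b b"
    and N_sym: "\<And>x y. N x y \<Longrightarrow> N y x"
    and N_cross: "\<And>i j x y. i \<in> I \<Longrightarrow> j \<in> I \<Longrightarrow> i \<noteq> j \<Longrightarrow> x \<in> W i \<Longrightarrow> y \<in> W j \<Longrightarrow> N x y \<Longrightarrow> N x b"
begin

abbreviation "K \<equiv> clique (\<Union>i\<in>I. W i) N"

abbreviation "S i \<equiv> clique (W i) N"

definition ret :: "'i \<Rightarrow> 'a \<Rightarrow> 'a" where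
  "ret i x = (if x \<in> W i then x else b)"

lemma ret_mem: "i \<in> I \<Longrightarrow> ret i x \<in> W i"
  by (simp add: ret_def base)

lemma N_ret:
  assumes i: "i \<in> I" and x: "x \<in> (\<Union>i\<in>I. W i)" and y: "y \<in> (\<Union>i\<in>I. W i)" and N: "N x y"
  shows "N (ret i x) (ret i y)"
proof -
  have *: "N u b" if u: "u \<in> W i" and v: "v \<in> (\<Union>i\<in>I. W i)" "v \<notin> W i" and uv: "N u v" for u v
  proof -
    obtain j where "j \<in> I" "v \<in> W j" using v by auto
    then show ?thesis
      using N_cross [OF i, of j u v] u v(2) uv by auto
  qed
  show ?thesis
    using * [of x y] * [of y x] N N_base N_sym x y by (auto simp: ret_def)
qed

lemma ret_simplex: "i \<in> I \<Longrightarrow> s \<in> K \<Longrightarrow> ret i ` s \<in> S i"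
  by (rule clique_image [of s "\<Union>i\<in>I. W i" N]) (use ret_mem N_ret in auto)

lemma S_subset: "i \<in> I \<Longrightarrow> S i \<subseteq> K"
  by (rule clique_mono) auto

lemma ret_other: "i \<in> I \<Longrightarrow> j \<in> I \<Longrightarrow> i \<noteq> j \<Longrightarrow> x \<in> W j \<Longrightarrow> ret i x = b"
  using disjoint by (auto simp: ret_def)

definition mixed :: "'a set \<Rightarrow> bool" where
  "mixed s \<longleftrightarrow> \<not> (\<exists>i\<in>I. s \<subseteq> W i)"

definition \<Phi> :: "'a set \<Rightarrow> 'a set set" where
  "\<Phi> s = Pow (if mixed s then insert b s else s)"

lemma mixed_insert:
  assumes s: "s \<in> K" "mixed s"
  shows "insert b s \<in> K"
proof -
  have "N x b" if x: "x \<in> s" for x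
  proof -
    obtain i where i: "i \<in> I" "x \<in> W i"
      using cliqueD(1) [OF s(1) x] by auto
    obtain y where y: "y \<in> s" "y \<notin> W i"
      using s(2) i(1) by (auto simp: mixed_def)
    then obtain j where j: "j \<in> I" "y \<in> W j"
      using cliqueD(1) [OF s(1)] by auto
    then show ?thesis
      using N_cross [OF i(1) j(1) _ i(2) j(2) cliqueD(2) [OF s(1) x y(1)]] i(2) y(2) by auto
  qed
  then show ?thesis
    using s(1) N_base N_sym base I_ne by (auto simp: clique_def)
qed

lemma carrier_\<Phi>: "carrier_on K \<Phi>"
  unfolding carrier_on_def
proof (intro conjI ballI allI impI)
  show "\<Phi> t \<subseteq> \<Phi> s" if "t \<subseteq> s" for s t
  proof -
    have "mixed t \<Longrightarrow> mixed s"
      using that by (meson mixed_def subset_trans)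
    then show ?thesis
      using that by (auto simp: \<Phi>_def)
  qed
  show "simplicial_complex (\<Phi> s)" for s
    by (auto simp: simplicial_complex_def \<Phi>_def)
  show "acyclic_complex (\<Phi> s)" if "s \<noteq> {}" for s
    unfolding \<Phi>_def by (rule acyclic_Pow) (use that in simp)
qed

lemma \<Phi>_subset: "s \<in> K \<Longrightarrow> \<Phi> s \<subseteq> K"
  using mixed_insert simplicial_complex_clique [of "\<Union>i\<in>I. W i" N]
  by (auto simp: \<Phi>_def simplicial_complex_def)

text \<open>On a simplex of one summand the other \<open>card I - 1\<close> retractions are
  constant; the two constant terms cancel them modulo two, so that the total is the identity
  there.\<close>

definition retractions :: "'a list \<Rightarrow> 'a list mod2" where
  "retractions xs = (\<Sum>i\<in>I. gen (map (ret i) xs)) + (\<Sum>i\<in>I. gen (map (\<lambda>x. b) xs)) + gen (map (\<lambda>x. b) xs)"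

lemma retractions_unmixed:
  assumes "i \<in> I" "set xs \<subseteq> W i"
  shows "retractions xs = gen xs"
proof -
  let ?c = "gen (map (\<lambda>x. b) xs)"
  have "(\<Sum>j\<in>I. gen (map (ret j) xs)) = gen (map (ret i) xs) + (\<Sum>j\<in>I-{i}. gen (map (ret j) xs))"
    using finite_I assms(1) by (rule sum.remove)
  also have "map (ret i) xs = xs"
    using assms(2) by (intro map_idI) (auto simp: ret_def)
  also have "(\<Sum>j\<in>I-{i}. gen (map (ret j) xs)) = (\<Sum>j\<in>I-{i}. ?c)"
  proof (rule sum.cong)
    fix j assume "j \<in> I - {i}"
    then have "map (ret j) xs = map (\<lambda>x. b) xs"
      using assms ret_other [of j i] by (intro map_cong) auto
    then show "gen (map (ret j) xs) = ?c" by (simp only:)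
  qed simp
  finally have 1: "(\<Sum>j\<in>I. gen (map (ret j) xs)) = gen xs + (\<Sum>j\<in>I-{i}. ?c)" .
  have 2: "(\<Sum>j\<in>I. ?c) = ?c + (\<Sum>j\<in>I-{i}. ?c)"
    using finite_I assms(1) by (rule sum.remove)
  show ?thesis
    unfolding retractions_def 1 2 by (simp add: algebra_simps)
qed

lemma carried_retractions: "carried K \<Phi> retractions"
  unfolding carried_def
proof (intro conjI allI impI)
  show "retractions [] = gen []"
    using retractions_unmixed [of _ "[]"] I_ne by auto
  fix xs assume xs: "set xs \<in> K"
  show "bd (retractions xs) = lin retractions (faces xs)"
    by (simp add: retractions_def [abs_def] lin_add lin_sum lin_fun_add lin_fun_sum faces_map)
  show "retractions xs \<in> chain_space (osimplices (\<Phi> (set xs)) (length xs))"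
  proof (cases "mixed (set xs)")
    case False
    then show ?thesis
      by (auto simp: mixed_def retractions_unmixed osimplices_def \<Phi>_def)
  next
    case True
    have "map (ret i) xs \<in> osimplices (\<Phi> (set xs)) (length xs)" for i
      using True by (auto simp: osimplices_def \<Phi>_def ret_def)
    moreover have "map (\<lambda>x. b) xs \<in> osimplices (\<Phi> (set xs)) (length xs)"
      using True by (auto simp: osimplices_def \<Phi>_def)
    ultimately show ?thesis
      unfolding retractions_def by (intro chains_add chains_sum) simp_all
  qed
qed

lemma const_boundary:
  assumes "z \<in> cycles K p"
  shows "push (\<lambda>x. b) z \<in> boundaries K p"
proof -
  have b: "{b} \<in> K"
    using base I_ne N_base by (auto simp: clique_def)
  have "push (\<lambda>x. b) z \<in> cycles (Pow {b}) p"
    using assms by (rule push_cycles [rotated]) auto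
  then have "push (\<lambda>x. b) z \<in> boundaries (Pow {b}) p"
    using acyclic_Pow [of "{b}"] by (auto simp: acyclic_complex_def)
  then show ?thesis
    by (rule boundaries_mono) (use b simplicial_complex_clique [of "\<Union>i\<in>I. W i" N] in \<open>auto simp: simplicial_complex_def\<close>)
qed

lemma wedge_decomposition:
  assumes z: "z \<in> cycles K p"
  shows "z + (\<Sum>i\<in>I. push (ret i) z) \<in> boundaries K p"
proof -
  have "lin gen z + lin retractions z \<in> boundaries K p"
  proof (rule carried_homologous [OF simplicial_complex_clique carrier_\<Phi> _ carried_retractions \<Phi>_subset z])
    show "carried K \<Phi> gen"
      by (rule carried_gen) (auto simp: \<Phi>_def)
  qed
  moreover have "lin retractions z = (\<Sum>i\<in>I. push (ret i) z) + (\<Sum>i\<in>I. push (\<lambda>x. b) z) + push (\<lambda>x. b) z"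
    unfolding retractions_def [abs_def] by (simp add: lin_fun_add lin_fun_sum)
  moreover have "(\<Sum>i\<in>I. push (\<lambda>x. b) z) + push (\<lambda>x. b) z \<in> boundaries K p"
    by (intro boundaries_add boundaries_sum const_boundary z)
  ultimately have "z + ((\<Sum>i\<in>I. push (ret i) z) + ((\<Sum>i\<in>I. push (\<lambda>x. b) z) + push (\<lambda>x. b) z)) \<in> boundaries K p"
    and "(\<Sum>i\<in>I. push (\<lambda>x. b) z) + push (\<lambda>x. b) z \<in> boundaries K p"
    by (simp_all add: add.assoc)
  from boundaries_add [OF this] show ?thesis
    by (simp add: add.assoc)
qed

lemma ret_cycles: "i \<in> I \<Longrightarrow> z \<in> cycles K p \<Longrightarrow> push (ret i) z \<in> cycles (S i) p"
  by (rule push_cycles [of K]) (rule ret_simplex)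

lemma ret_boundaries: "i \<in> I \<Longrightarrow> z \<in> boundaries K p \<Longrightarrow> push (ret i) z \<in> boundaries (S i) p"
  by (rule push_boundaries [of K]) (rule ret_simplex)

lemma ret_summand: "z \<in> chain_space (osimplices (S i) p) \<Longrightarrow> push (ret i) z = z"
  using push_cong [of z "S i" p "ret i" "\<lambda>x. x"] by (simp add: clique_def ret_def subset_iff)

lemma boundary_iff:
  assumes z: "z \<in> cycles K p"
  shows "z \<in> boundaries K p \<longleftrightarrow> (\<forall>i\<in>I. push (ret i) z \<in> boundaries (S i) p)"
proof
  assume *: "\<forall>i\<in>I. push (ret i) z \<in> boundaries (S i) p"
  have "(\<Sum>i\<in>I. push (ret i) z) \<in> boundaries K p"
    by (rule boundaries_sum, rule boundaries_mono [OF _ S_subset]) (use * in auto)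
  from boundaries_add [OF wedge_decomposition [OF z] this] show "z \<in> boundaries K p"
    by (simp add: add.assoc)
qed (simp add: ret_boundaries)

lemma wedge_hom_zero:
  assumes "\<And>i. i \<in> I \<Longrightarrow> hom_zero (S i) p"
  shows "hom_zero K p"
  unfolding hom_zero_def
proof
  fix z assume z: "z \<in> cycles K p"
  show "z \<in> boundaries K p"
    unfolding boundary_iff [OF z]
  proof
    fix i assume i: "i \<in> I"
    show "push (ret i) z \<in> boundaries (S i) p"
      using ret_cycles [OF i z] assms [OF i] by (auto simp: hom_zero_def)
  qed
qed

lemma summand_iso:
  assumes j: "j \<in> I" and zero: "\<And>i. i \<in> I \<Longrightarrow> i \<noteq> j \<Longrightarrow> hom_zero (S i) p"
  shows "homology_iso (\<lambda>z. z) (S j) K p"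
proof (rule homology_iso_id [OF S_subset [OF j]])
  fix z assume z: "z \<in> cycles (S j) p" "z \<in> boundaries K p"
  have "push (ret j) z = z"
    by (rule ret_summand [of _ _ p]) (use z(1) in \<open>simp add: cycles_def\<close>)
  then show "z \<in> boundaries (S j) p"
    using ret_boundaries [OF j z(2)] by simp
next
  fix z assume z: "z \<in> cycles K p"
  let ?w = "push (ret j) z"
  have w: "?w \<in> cycles (S j) p"
    by (rule ret_cycles [OF j z])
  have eq: "(\<Sum>i\<in>I. push (ret i) z) = ?w + (\<Sum>i\<in>I-{j}. push (ret i) z)"
    using finite_I j by (rule sum.remove)
  have rest: "(\<Sum>i\<in>I-{j}. push (ret i) z) \<in> boundaries K p"
  proof (rule boundaries_sum)
    fix i assume i: "i \<in> I - {j}"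
    then have "push (ret i) z \<in> boundaries (S i) p"
      using ret_cycles [of i, OF _ z] zero [of i] by (auto simp: hom_zero_def)
    then show "push (ret i) z \<in> boundaries K p"
      by (rule boundaries_mono) (use S_subset i in auto)
  qed
  have "z + ?w \<in> boundaries K p"
    using boundaries_add [OF wedge_decomposition [OF z] rest] by (simp add: eq add.assoc)
  then show "\<exists>w\<in>cycles (S j) p. z + w \<in> boundaries K p"
    using w by blast
qed

end


section \<open>Double covers\<close>

text \<open>
  Given a function \<open>nr\<close> that lifts a vertex of the base to the sheet through a given point, and a
  section \<open>s\<close> on vertices, \<open>lift_list\<close> lifts an ordered simplex starting from \<open>s\<close> of its first
  vertex. The cochain deciding whether an edge is lifted to an edge between values of the section
  represents the first Stiefel-Whitney class, and \<open>cap_list\<close> is the cap product with it.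
\<close>

definition lift_list :: "('a \<Rightarrow> 'b \<Rightarrow> 'a) \<Rightarrow> ('b \<Rightarrow> 'a) \<Rightarrow> 'b list \<Rightarrow> 'a list" where
  "lift_list nr s xs = map (nr (s (hd xs))) xs"

fun cap_list :: "('a \<Rightarrow> 'b \<Rightarrow> 'a) \<Rightarrow> ('b \<Rightarrow> 'a) \<Rightarrow> 'b list \<Rightarrow> 'b list mod2" where
  "cap_list nr s (u # v # vs) = (if nr (s u) v = s v then 0 else gen (v # vs))"
| "cap_list nr s _ = 0"

text \<open>\<open>T\<close> is the deck transformation and \<open>nr x v\<close> the neighbour of
  \<open>x\<close> above \<open>v\<close>. \<open>N_unique\<close> separates the sheets;
  \<open>N_triangle\<close> says that a path of two edges upstairs whose ends are adjacent
  downstairs closes up, so that triangles, and hence all cliques, lift.\<close>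

locale double_cover =
  fixes M :: "'a set" and T :: "'a \<Rightarrow> 'a" and q :: "'a \<Rightarrow> 'b" and nr :: "'a \<Rightarrow> 'b \<Rightarrow> 'a"
    and N :: "'a \<Rightarrow> 'a \<Rightarrow> bool" and N' :: "'b \<Rightarrow> 'b \<Rightarrow> bool"
  assumes T_mem: "x \<in> M \<Longrightarrow> T x \<in> M" and T_T: "x \<in> M \<Longrightarrow> T (T x) = x"
    and q_eq: "x \<in> M \<Longrightarrow> y \<in> M \<Longrightarrow> q x = q y \<longleftrightarrow> y = x \<or> y = T x"
    and N_refl: "x \<in> M \<Longrightarrow> N x x" and N_sym: "x \<in> M \<Longrightarrow> y \<in> M \<Longrightarrow> N x y \<Longrightarrow> N y x"
    and N_T: "x \<in> M \<Longrightarrow> y \<in> M \<Longrightarrow> N x y \<Longrightarrow> N (T x) (T y)"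
    and N_unique: "x \<in> M \<Longrightarrow> y \<in> M \<Longrightarrow> N x y \<Longrightarrow> \<not> N x (T y)"
    and N_triangle: "x \<in> M \<Longrightarrow> y \<in> M \<Longrightarrow> z \<in> M \<Longrightarrow> N x y \<Longrightarrow> N y z \<Longrightarrow> N x z \<or> N x (T z) \<Longrightarrow> N x z"
    and N'_iff: "x \<in> M \<Longrightarrow> y \<in> M \<Longrightarrow> N' (q x) (q y) \<longleftrightarrow> N x y \<or> N x (T y)"
    and nr: "x \<in> M \<Longrightarrow> v \<in> q ` M \<Longrightarrow> N' (q x) v \<Longrightarrow> nr x v \<in> M \<and> q (nr x v) = v \<and> N x (nr x v)"
begin

abbreviation "S \<equiv> clique M N"
abbreviation "P \<equiv> clique (q ` M) N'"

definition sect :: "('b \<Rightarrow> 'a) \<Rightarrow> bool" where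
  "sect s \<longleftrightarrow> (\<forall>v\<in>q ` M. s v \<in> M \<and> q (s v) = v)"

lemma S_complex: "simplicial_complex S" and P_complex: "simplicial_complex P"
  by (rule simplicial_complex_clique)+

lemma q_T: "x \<in> M \<Longrightarrow> q (T x) = q x"
  using q_eq [OF _ T_mem, of x x] by simp

lemma T_neq: "x \<in> M \<Longrightarrow> T x \<noteq> x"
  using N_refl N_unique [of x x] by metis

lemma nr_eqI:
  assumes "x \<in> M" "y \<in> M" "N x y"
  shows "nr x (q y) = y"
proof -
  have "N' (q x) (q y)"
    using N'_iff assms by simp
  then have *: "nr x (q y) \<in> M" "q (nr x (q y)) = q y" "N x (nr x (q y))"
    using nr [OF assms(1), of "q y"] assms(2) by auto
  then have "nr x (q y) = y \<or> nr x (q y) = T y"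
    using q_eq [OF assms(2) *(1)] by simp
  then show ?thesis
    using N_unique [OF assms] *(3) by auto
qed

lemma nr_self: "x \<in> M \<Longrightarrow> nr x (q x) = x"
  by (rule nr_eqI) (auto simp: N_refl)

lemma nr_T:
  assumes x: "x \<in> M" and v: "v \<in> q ` M" "N' (q x) v"
  shows "nr (T x) v = T (nr x v)"
proof -
  note * = nr [OF x v]
  have "nr (T x) (q (T (nr x v))) = T (nr x v)"
    by (rule nr_eqI) (use * T_mem x N_T in auto)
  then show ?thesis
    using * q_T by simp
qed

text \<open>By \<open>N_triangle\<close>, adjacent starting points see the same point above a common
  neighbour. This makes the lifts of the faces of a simplex coherent.\<close>

lemma nr_change:
  assumes "x \<in> M" "y \<in> M" "N x y" "v \<in> q ` M" "N' (q x) v" "N' (q y) v"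
  shows "nr x v = nr y v"
proof -
  note * = nr [OF assms(2,4,6)]
  have "N x (nr y v) \<or> N x (T (nr y v))"
    using N'_iff [OF assms(1), of "nr y v"] * assms(5) by simp
  then have "N x (nr y v)"
    using N_triangle [OF assms(1,2) _ assms(3)] * by blast
  then show ?thesis
    using nr_eqI [OF assms(1), of "nr y v"] * by simp
qed

lemma nr_list:
  assumes a: "a \<in> M" and xs: "set xs \<in> P" "q a \<in> set xs"
  shows "map (nr a) xs \<in> osimplices S (length xs)" "map q (map (nr a) xs) = xs"
proof -
  have *: "nr a v \<in> M \<and> q (nr a v) = v \<and> N a (nr a v)" if "v \<in> set xs" for v
    using nr [OF a] cliqueD [OF xs(1)] that xs(2) by auto
  have "N (nr a v) (nr a w)" if "v \<in> set xs" "w \<in> set xs" for v w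
  proof (rule N_triangle [of _ a])
    show "N (nr a v) a"
      using N_sym a * that by blast
    have "N' (q (nr a v)) (q (nr a w))"
      using cliqueD(2) [OF xs(1) that] * that by simp
    then show "N (nr a v) (nr a w) \<or> N (nr a v) (T (nr a w))"
      using N'_iff * that by blast
  qed (use a * that in auto)
  then show "map (nr a) xs \<in> osimplices S (length xs)"
    using * by (auto simp: osimplices_def clique_def)
  show "map q (map (nr a) xs) = xs"
    using * by (simp add: map_idI)
qed

definition L :: "('b \<Rightarrow> 'a) \<Rightarrow> 'b list mod2 \<Rightarrow> 'a list mod2" where
  "L s = lin (\<lambda>xs. gen (lift_list nr s xs))"

text \<open>The transfer: the sum of both lifts of a simplex. For the empty list the two lifts
  coincide and cancel.\<close>

definition TR :: "('b \<Rightarrow> 'a) \<Rightarrow> 'b list mod2 \<Rightarrow> 'a list mod2" where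
  "TR s c = L s c + push T (L s c)"

abbreviation CAP :: "('b \<Rightarrow> 'a) \<Rightarrow> 'b list mod2 \<Rightarrow> 'b list mod2" where
  "CAP s \<equiv> lin (cap_list nr s)"

lemma L_add: "L s (c + d) = L s c + L s d"
  by (simp add: L_def lin_add)

lemma TR_add: "TR s (c + d) = TR s c + TR s d"
  by (simp add: TR_def L_add lin_add algebra_simps)

lemma L_0 [simp]: "L s 0 = 0" and TR_0 [simp]: "TR s 0 = 0"
  by (simp_all add: L_def TR_def)

context
  fixes s assumes s: "sect s"
begin

lemma s_mem: "v \<in> q ` M \<Longrightarrow> s v \<in> M" "v \<in> q ` M \<Longrightarrow> q (s v) = v"
  using s by (auto simp: sect_def)

lemma s_cases: "x \<in> M \<Longrightarrow> s (q x) = x \<or> s (q x) = T x"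
  using q_eq s_mem by (metis imageI)

lemma lift_list:
  assumes "set xs \<in> P"
  shows "lift_list nr s xs \<in> osimplices S (length xs)" "map q (lift_list nr s xs) = xs"
proof -
  have "lift_list nr s xs \<in> osimplices S (length xs) \<and> map q (lift_list nr s xs) = xs"
  proof (cases xs)
    case Nil
    then show ?thesis by (simp add: lift_list_def osimplices_def clique_def)
  next
    case (Cons v vs)
    then have "v \<in> q ` M"
      using cliqueD(1) [OF assms, of v] by simp
    then show ?thesis
      using nr_list [of "s v" xs] s_mem [of v] assms Cons by (simp add: lift_list_def)
  qed
  then show "lift_list nr s xs \<in> osimplices S (length xs)" "map q (lift_list nr s xs) = xs"
    by auto
qed

lemma L_chains: "c \<in> chain_space (osimplices P p) \<Longrightarrow> L s c \<in> chain_space (osimplices S p)"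
  unfolding L_def by (erule chains_lin) (use lift_list(1) in \<open>auto simp: osimplices_def\<close>)

lemma push_q_L: 
  assumes "c \<in> chain_space (osimplices P p)"
  shows "push q (L s c) = c"
proof -
  have "push q (L s c) = lin gen c"
    unfolding L_def lin_lin lin_gen using assms
    by (rule lin_cong_chains) (use lift_list(2) in \<open>simp add: osimplices_def\<close>)
  then show ?thesis by simp
qed

lemma T_simplex: "t \<in> S \<Longrightarrow> T ` t \<in> S"
  by (rule clique_image [of t M N]) (use T_mem N_T in auto)

lemma push_T_chains: "c \<in> chain_space (osimplices S p) \<Longrightarrow> push T c \<in> chain_space (osimplices S p)"
  by (rule push_chains [of S]) (rule T_simplex)

lemma push_T_T:
  assumes "c \<in> chain_space (osimplices S p)"
  shows "push T (push T c) = c"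
proof -
  have "push (\<lambda>x. T (T x)) c = push (\<lambda>x. x) c"
    using assms by (rule push_cong) (use T_T cliqueD(1) in fastforce)
  then show ?thesis by (simp add: push_push)
qed

lemma push_q_T:
  assumes "c \<in> chain_space (osimplices S p)"
  shows "push q (push T c) = push q c"
  unfolding push_push using assms by (rule push_cong) (use q_T cliqueD(1) in fastforce)

lemma push_q_chains: "c \<in> chain_space (osimplices S p) \<Longrightarrow> push q c \<in> chain_space (osimplices P p)"
proof (rule push_chains [of S])
  show "q ` t \<in> P" if "t \<in> S" for t
    using that by (rule clique_image) (use N'_iff in auto)
qed

lemma TR_chains: "c \<in> chain_space (osimplices P p) \<Longrightarrow> TR s c \<in> chain_space (osimplices S p)"
  unfolding TR_def by (intro chains_add push_T_chains L_chains)

lemma push_q_TR: "c \<in> chain_space (osimplices P p) \<Longrightarrow> push q (TR s c) = 0"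
  by (simp add: TR_def lin_add push_q_T [OF L_chains])

lemma CAP_chains: "c \<in> chain_space (osimplices P (Suc p)) \<Longrightarrow> CAP s c \<in> chain_space (osimplices P p)"
proof (erule chains_lin)
  fix xs assume xs: "xs \<in> osimplices P (Suc p)"
  then show "cap_list nr s xs \<in> chain_space (osimplices P p)"
  proof (cases "(nr, s, xs)" rule: cap_list.cases)
    case (1 nr s u v vs)
    then show ?thesis
      using xs simplicial_complexD [OF P_complex, of "set xs" "set (v # vs)"]
      by (auto simp: osimplices_def)
  qed auto
qed

text \<open>A lift starts from the section at the first vertex, so only the face without that vertex
  can be lifted differently. If the first edge leaves the section, this face lands on the other
  sheet, and the difference of its two lifts is a transfer.\<close>

lemma faces_lift_list:
  assumes xs: "set xs \<in> P"
  shows "faces (lift_list nr s xs) = L s (faces xs) + TR s (cap_list nr s xs)"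
proof (cases "(nr, s, xs)" rule: cap_list.cases)
  case (1 nr' s' u v vs)
  then have xs_eq: "xs = u # v # vs" and [simp]: "nr' = nr" "s' = s" by auto
  have uM: "u \<in> q ` M" and vM: "v \<in> q ` M" and wM: "\<And>w. w \<in> set xs \<Longrightarrow> w \<in> q ` M"
    using cliqueD(1) [OF xs] xs_eq by auto
  have rel: "\<And>w w'. w \<in> set xs \<Longrightarrow> w' \<in> set xs \<Longrightarrow> N' w w'"
    using cliqueD(2) [OF xs] by auto
  have su: "nr (s u) u = s u"
    using nr_self s_mem [OF uM] by metis
  have tail: "gen (map (nr (s u)) (v # vs)) = gen (lift_list nr s (v # vs)) + TR s (cap_list nr s xs)"
  proof (cases "nr (s u) v = s v")
    case True
    have "N (s u) (s v)"
      using nr [OF s_mem(1) [OF uM] vM] rel s_mem [OF uM] True xs_eq by simp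
    then have eq: "map (nr (s u)) (v # vs) = map (nr (s v)) (v # vs)"
      using nr_change [OF s_mem(1) [OF uM] s_mem(1) [OF vM]] wM rel s_mem uM vM xs_eq by simp
    show ?thesis
      unfolding lift_list_def list.sel eq xs_eq cap_list.simps using True by simp
  next
    case False
    have nrv: "nr (s u) v \<in> M" "q (nr (s u) v) = v" "N (s u) (nr (s u) v)"
      using nr [OF s_mem(1) [OF uM] vM] rel s_mem [OF uM] xs_eq by auto
    then have Tsv: "nr (s u) v = T (s v)"
      using q_eq [OF s_mem(1) [OF vM] nrv(1)] s_mem(2) [OF vM] False by auto
    have "nr (s u) w = T (nr (s v) w)" if "w \<in> set (v # vs)" for w
    proof -
      have w: "w \<in> set xs" using that xs_eq by auto
      have "nr (s u) w = nr (T (s v)) w"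
        using nr_change [OF s_mem(1) [OF uM] T_mem [OF s_mem(1) [OF vM]] _ wM [OF w]] nrv(3)
          rel w s_mem uM vM q_T xs_eq by (simp add: Tsv)
      also have "\<dots> = T (nr (s v) w)"
        using nr_T [OF s_mem(1) [OF vM] wM [OF w]] rel w s_mem vM xs_eq by simp
      finally show ?thesis .
    qed
    then have "map (nr (s u)) (v # vs) = map T (lift_list nr s (v # vs))"
      unfolding lift_list_def by simp
    then show ?thesis
      using False by (simp add: xs_eq TR_def L_def del: list.map)
  qed
  have "faces (lift_list nr s xs) = gen (map (nr (s u)) (v # vs)) + cone_from (s u) (push (nr (s u)) (faces (v # vs)))"
    unfolding lift_list_def xs_eq list.sel list.map(2) [of _ u] su faces.simps(2) [of "s u"] faces_map ..
  also have "cone_from (s u) (push (nr (s u)) (faces (v # vs))) = L s (cone_from u (faces (v # vs)))"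
    unfolding L_def lin_lin lin_gen lift_list_def by (simp add: su)
  finally show ?thesis
    unfolding tail xs_eq faces.simps(2) [of u] L_add by (simp add: L_def add_ac del: faces.simps)
qed (auto simp: lift_list_def L_def)

text \<open>\<open>L\<close> is a right inverse of \<open>push q\<close> on chains, but not a chain
  map. The defect is the transfer of \<open>CAP\<close>, which is therefore the connecting map of
  the Gysin sequence.\<close>

lemma bd_L:
  assumes "c \<in> chain_space (osimplices P p)"
  shows "bd (L s c) = L s (bd c) + TR s (CAP s c)"
proof -
  have "bd (L s c) = lin (\<lambda>xs. faces (lift_list nr s xs)) c"
    by (simp add: L_def lin_lin)
  also have "\<dots> = lin (\<lambda>xs. L s (faces xs) + TR s (cap_list nr s xs)) c"
    using assms by (rule lin_cong_chains) (rule faces_lift_list, simp add: osimplices_def)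
  also have "\<dots> = L s (bd c) + TR s (CAP s c)"
    by (simp add: L_def TR_def lin_fun_add lin_lin)
  finally show ?thesis .
qed

lemma push_T_TR:
  assumes "c \<in> chain_space (osimplices P p)"
  shows "push T (TR s c) = TR s c"
  using push_T_T [OF L_chains [OF assms]] by (simp add: TR_def lin_add add.commute)

lemma bd_TR_Suc:
  assumes "c \<in> chain_space (osimplices P (Suc p))"
  shows "bd (TR s c) = TR s (bd c)"
  using bd_L [OF assms] push_T_TR [OF CAP_chains [OF assms]]
  by (simp add: TR_def [of s c] TR_def [of s "bd c"] lin_add bd_push algebra_simps)

text \<open>A left inverse of both \<open>L\<close> and \<open>TR\<close> in positive lengths.\<close>

definition select :: "'a list \<Rightarrow> 'b list mod2" where
  "select ys = (if ys \<noteq> [] \<and> hd ys = s (q (hd ys)) then gen (map q ys) else 0)"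

lemma select_TR:
  assumes "c \<in> chain_space (osimplices P (Suc p))"
  shows "lin select (TR s c) = c"
proof -
  have "lin select (TR s c) = lin (\<lambda>xs. select (lift_list nr s xs) + select (map T (lift_list nr s xs))) c"
    by (simp add: TR_def L_def lin_add lin_fun_add lin_lin)
  also have "\<dots> = lin gen c"
    using assms
  proof (rule lin_cong_chains)
    fix xs assume xs: "xs \<in> osimplices P (Suc p)"
    then obtain v vs where v: "xs = v # vs" "set xs \<in> P"
      by (auto simp: osimplices_def length_Suc_conv)
    have vM: "v \<in> q ` M"
      using cliqueD(1) [OF v(2)] v(1) by simp
    have "nr (s v) v = s v"
      using nr_self s_mem [OF vM] by metis
    then have hd: "hd (lift_list nr s xs) = s v"
      by (simp add: lift_list_def v)
    have ne: "lift_list nr s xs \<noteq> []"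
      by (simp add: lift_list_def v)
    have "select (map T (lift_list nr s xs)) = 0"
      using ne hd s_mem [OF vM] T_neq [OF s_mem(1) [OF vM]] q_T [OF s_mem(1) [OF vM]]
      by (simp add: select_def hd_map)
    moreover have "select (lift_list nr s xs) = gen xs"
      using ne hd s_mem [OF vM] lift_list(2) [OF v(2)] by (simp add: select_def)
    ultimately show "select (lift_list nr s xs) + select (map T (lift_list nr s xs)) = gen xs"
      by simp
  qed
  finally show ?thesis by simp
qed

lemma TR_inject:
  assumes "c \<in> chain_space (osimplices P (Suc p))" "d \<in> chain_space (osimplices P (Suc p))" "TR s c = TR s d"
  shows "c = d"
  using trans [OF select_TR [OF assms(1), symmetric, unfolded assms(3)] select_TR [OF assms(2)]] .

text \<open>Apply \<open>bd_L\<close> twice to \<open>bd (bd (L s c)) = 0\<close>. The transfer is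
  injective on nonempty lists only, which explains the three \<open>Suc\<close>.\<close>

lemma bd_CAP:
  assumes c: "c \<in> chain_space (osimplices P (Suc (Suc (Suc p))))"
  shows "CAP s (bd c) = bd (CAP s c)"
proof (rule TR_inject)
  note b = bd_chains [OF P_complex c]
  show "CAP s (bd c) \<in> chain_space (osimplices P (Suc p))"
    by (rule CAP_chains [OF b])
  show "bd (CAP s c) \<in> chain_space (osimplices P (Suc p))"
    by (rule bd_chains [OF P_complex CAP_chains [OF c]])
  have "bd (bd (L s c)) = TR s (CAP s (bd c)) + TR s (bd (CAP s c))"
    unfolding bd_L [OF c] lin_add bd_L [OF b] bd_TR_Suc [OF CAP_chains [OF c]] by simp
  then show "TR s (CAP s (bd c)) = TR s (bd (CAP s c))"
    by (simp add: add_eq_0_char2)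
qed

text \<open>Exactness in the middle on the level of chains: a simplex upstairs either starts on the
  section, and is the lift of its image, or starts on the other sheet, and is this lift plus the
  transfer.\<close>

lemma chain_decomposition:
  assumes "v \<in> chain_space (osimplices S p)"
  obtains b where "b \<in> chain_space (osimplices P p)" "v = L s (push q v) + TR s b"
proof -
  have "\<exists>b. b \<in> chain_space (osimplices P p) \<and> v = L s (push q v) + TR s b"
    using assms
  proof (induction v rule: chains_induct)
    case zero
    then show ?case by (intro exI [of _ 0]) simp
  next
    case (add ys v)
    then obtain b where b: "b \<in> chain_space (osimplices P p)" "v = L s (push q v) + TR s b"
      by blast
    have ys: "set ys \<in> S" "length ys = p"
      using add.hyps by (auto simp: osimplices_def)
    have qys: "map q ys \<in> osimplices P p"
      using push_q_chains [of "gen ys" p] add.hyps by simp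
    have "gen ys = L s (gen (map q ys)) \<or> gen ys = L s (gen (map q ys)) + TR s (gen (map q ys))"
    proof (cases ys)
      case (Cons y zs)
      have yM: "z \<in> M" "N y z" if "z \<in> set ys" for z
        using cliqueD [OF ys(1)] that Cons by auto
      have y: "y \<in> M" using yM Cons by simp
      have id: "map (nr y) (map q ys) = ys"
        using nr_eqI [OF y yM] by (simp add: map_idI)
      from s_cases [OF y] show ?thesis
      proof
        assume "s (q y) = y"
        then have "lift_list nr s (map q ys) = ys"
          using id by (simp add: lift_list_def Cons)
        then show ?thesis by (simp add: L_def)
      next
        assume "s (q y) = T y"
        then have "lift_list nr s (map q ys) = map (nr (T y)) (map q ys)"
          by (simp add: lift_list_def Cons)
        also have "\<dots> = map T (map (nr y) (map q ys))"
          using nr_T [OF y] N'_iff [OF y yM(1)] yM by auto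
        finally have "lift_list nr s (map q ys) = map T ys"
          unfolding id .
        moreover have "map T (map T ys) = ys"
          using T_T yM(1) by (simp add: map_idI)
        ultimately have "TR s (gen (map q ys)) = L s (gen (map q ys)) + gen ys"
          by (simp add: TR_def L_def del: map_map)
        then show ?thesis by simp
      qed
    qed (simp add: L_def lift_list_def)
    then show ?case
    proof
      assume e: "gen ys = L s (gen (map q ys))"
      have "L s (gen (map q ys)) + (L s (push q v) + TR s b) = L s (push q (gen ys + v)) + TR s b"
        by (simp add: lin_add L_add add.assoc)
      then have "gen ys + v = L s (push q (gen ys + v)) + TR s b"
        by (metis e b(2))
      then show ?thesis
        using b(1) by blast
    next
      assume e: "gen ys = L s (gen (map q ys)) + TR s (gen (map q ys))"
      have "(L s (gen (map q ys)) + TR s (gen (map q ys))) + (L s (push q v) + TR s b) =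
          L s (push q (gen ys + v)) + TR s (gen (map q ys) + b)"
        by (simp add: lin_add L_add TR_add algebra_simps)
      then have "gen ys + v = L s (push q (gen ys + v)) + TR s (gen (map q ys) + b)"
        by (metis e b(2))
      then show ?thesis
        using b(1) qys chains_add [of "gen (map q ys)" _ b] by (metis gen_chains)
    qed
  qed
  then show thesis using that by blast
qed

text \<open>A filling \<open>v\<close> of the transfer of \<open>w\<close> is pushed down to a
  cycle; decomposing \<open>v\<close> and comparing boundaries exhibits \<open>w\<close> as the cap
  product of this cycle up to a boundary.\<close>

lemma gysin_lift:
  assumes w: "w \<in> chain_space (osimplices P (Suc p))" and tr: "TR s w \<in> boundaries S (Suc p)"
  obtains z where "z \<in> cycles P (Suc (Suc p))" "CAP s z + w \<in> boundaries P (Suc p)"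
proof -
  obtain v where v: "v \<in> chain_space (osimplices S (Suc (Suc p)))" "bd v = TR s w"
    using tr by (auto simp: boundaries_def)
  have z: "push q v \<in> cycles P (Suc (Suc p))"
    using push_q_chains [OF v(1)] push_q_TR [OF w] by (simp add: cycles_def bd_push v(2))
  then have zc: "push q v \<in> chain_space (osimplices P (Suc (Suc p)))" "bd (push q v) = 0"
    by (auto simp: cycles_def)
  obtain b where b: "b \<in> chain_space (osimplices P (Suc (Suc p)))" "v = L s (push q v) + TR s b"
    using chain_decomposition [OF v(1)] .
  have "TR s w = bd (L s (push q v) + TR s b)"
    using v(2) b(2) by simp
  also have "\<dots> = TR s (CAP s (push q v) + bd b)"
    unfolding lin_add bd_L [OF zc(1)] bd_TR_Suc [OF b(1)] TR_add zc(2) by simp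
  finally have "w = CAP s (push q v) + bd b"
    by (rule TR_inject [OF w chains_add [OF CAP_chains [OF zc(1)] bd_chains [OF P_complex b(1)]]])
  then have "CAP s (push q v) + w = bd b"
    by simp
  then show thesis
    using that z b(1) boundariesI by metis
qed

text \<open>The lift of \<open>z\<close> has the transfer of \<open>CAP s z\<close> as its boundary.
  If \<open>CAP s z\<close> is the boundary of \<open>u\<close>, adding the transfer of
  \<open>u\<close> makes the lift a cycle without changing its image.\<close>

lemma gysin_exact:
  assumes z: "z \<in> cycles P (Suc p)" and cap: "CAP s z \<in> boundaries P p"
  obtains y where "y \<in> cycles S (Suc p)" "push q y = z"
proof -
  have zc: "z \<in> chain_space (osimplices P (Suc p))" "bd z = 0"
    using z by (auto simp: cycles_def)
  obtain u where u: "u \<in> chain_space (osimplices P (Suc p))" "CAP s z = bd u"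
    using cap by (auto simp: boundaries_def)
  have "bd (L s z + TR s u) = 0"
    unfolding lin_add bd_L [OF zc(1)] bd_TR_Suc [OF u(1)] by (simp add: zc(2) u(2))
  moreover have "L s z + TR s u \<in> chain_space (osimplices S (Suc p))"
    by (intro chains_add L_chains TR_chains zc u)
  moreover have "push q (L s z + TR s u) = z"
    by (simp add: lin_add push_q_L [OF zc(1)] push_q_TR [OF u(1)])
  ultimately show thesis
    using that [of "L s z + TR s u"] by (simp add: cycles_def)
qed

end

end

subsection \<open>Consequences of the Gysin sequence\<close>

text \<open>Evaluation of the \<open>m\<close>-th power of the Stiefel-Whitney class.\<close>

primrec ev :: "('a \<Rightarrow> 'b \<Rightarrow> 'a) \<Rightarrow> ('b \<Rightarrow> 'a) \<Rightarrow> nat \<Rightarrow> 'b list mod2 \<Rightarrow> bit" where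
  "ev nr s 0 c = lin (\<lambda>xs. 1) c"
| "ev nr s (Suc m) c = ev nr s m (lin (cap_list nr s) c)"

lemma ev_add: "ev nr s m (c + d) = ev nr s m c + ev nr s m d"
  by (induction m arbitrary: c d) (simp_all add: lin_add)

lemma ev_0_zero [simp]: "ev nr s m 0 = 0"
  by (induction m) simp_all

lemma bd_length_1:
  assumes "c \<in> chain_space (osimplices K (Suc 0))"
  shows "bd c = 0 \<longleftrightarrow> lin (\<lambda>xs. 1::bit) c = 0"
proof -
  have "bd c = lin (\<lambda>\<sigma>. gen []) c"
    using assms by (rule lin_cong_chains) (auto simp: osimplices_def length_Suc_conv)
  then show ?thesis
    by (simp only: lin_gen_Nil)
qed

lemma augmentation_bd:
  assumes "c \<in> chain_space (osimplices K (Suc (Suc 0)))"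
  shows "lin (\<lambda>xs. 1::bit) (bd c) = 0"
proof -
  have "lin (\<lambda>xs. 1::bit) (bd c) = lin (\<lambda>xs. 0) c"
    unfolding lin_lin using assms
    by (rule lin_cong_chains) (auto simp: osimplices_def length_Suc_conv lin_add)
  then show ?thesis by simp
qed

text \<open>Unreduced in degree 0: the zeroth power of the class is the augmentation, and it is
  nonzero on a single vertex, which is not a reduced cycle.\<close>

definition general_cycles :: "'a set set \<Rightarrow> nat \<Rightarrow> 'a list mod2 set" where
  "general_cycles K m = {c \<in> chain_space (osimplices K (Suc m)). m > 0 \<longrightarrow> bd c = 0}"

lemma general_cycles_Suc: "general_cycles K (Suc m) = cycles K (Suc (Suc m))"
  by (simp add: general_cycles_def cycles_def)

lemma cycles_general: "c \<in> cycles K (Suc m) \<Longrightarrow> c \<in> general_cycles K m"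
  by (simp add: general_cycles_def cycles_def)

context double_cover
begin

context
  fixes s assumes s: "sect s"
begin

lemma CAP_boundaries:
  assumes "z \<in> boundaries P (Suc (Suc p))"
  shows "CAP s z \<in> boundaries P (Suc p)"
proof -
  obtain c where c: "c \<in> chain_space (osimplices P (Suc (Suc (Suc p))))" "z = bd c"
    using assms by (auto simp: boundaries_def)
  show ?thesis
    by (rule boundariesI [OF CAP_chains [OF s c(1)]]) (simp add: c(2) bd_CAP [OF s c(1)])
qed

lemma CAP_general_cycles:
  assumes "z \<in> cycles P (Suc (Suc m))"
  shows "CAP s z \<in> general_cycles P m"
proof -
  have z: "z \<in> chain_space (osimplices P (Suc (Suc m)))" "bd z = 0"
    using assms by (auto simp: cycles_def)
  have "bd (CAP s z) = 0" if m: "m > 0"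
  proof -
    obtain k where "m = Suc k" using m by (cases m) auto
    then show ?thesis
      using bd_CAP [OF s, of z k] z by simp
  qed
  then show ?thesis
    using CAP_chains [OF s z(1)] by (simp add: general_cycles_def)
qed

lemma ev_boundaries: "z \<in> boundaries P (Suc m) \<Longrightarrow> ev nr s m z = 0"
proof (induction m arbitrary: z)
  case 0
  then show ?case
    using augmentation_bd by (auto simp: boundaries_def)
next
  case (Suc m)
  then show ?case
    using CAP_boundaries by simp
qed

lemma TR_length_0:
  assumes "c \<in> chain_space (osimplices P 0)"
  shows "TR s c = 0"
proof -
  have "L s c = lin (\<lambda>xs. gen []) c"
    unfolding L_def using assms by (rule lin_cong_chains) (simp add: osimplices_def lift_list_def)
  then show ?thesis
    by (simp add: TR_def lin_lin)
qed

lemma TR_cycles: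
  assumes "w \<in> general_cycles P m"
  shows "TR s w \<in> cycles S (Suc m)"
proof -
  have w: "w \<in> chain_space (osimplices P (Suc m))" "m > 0 \<Longrightarrow> bd w = 0"
    using assms by (auto simp: general_cycles_def)
  have "TR s (bd w) = 0"
  proof (cases "m = 0")
    case True
    then show ?thesis
      using bd_chains [OF P_complex w(1)] TR_length_0 by simp
  qed (use w in simp)
  then show ?thesis
    using TR_chains [OF s w(1)] bd_TR_Suc [OF s w(1)] by (simp add: cycles_def)
qed

lemma push_q_boundaries: "y \<in> boundaries S p \<Longrightarrow> push q y \<in> boundaries P p"
proof -
  assume "y \<in> boundaries S p"
  then obtain d where "d \<in> chain_space (osimplices S (Suc p))" "y = bd d"
    by (auto simp: boundaries_def)
  then show ?thesis
    by (intro boundariesI [OF push_q_chains [OF s]]) (simp_all add: bd_push)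
qed

lemma push_q_cycles: "y \<in> cycles S p \<Longrightarrow> push q y \<in> cycles P p"
  using push_q_chains [OF s] by (simp add: cycles_def bd_push)

text \<open>Climbs the Gysin sequence from a single vertex: while the homology upstairs vanishes,
  the transfer of \<open>w\<close> bounds, so \<open>w\<close> is a cap product up to a boundary,
  and \<open>ev\<close> is preserved along the cap product.\<close>

lemma ev_surjective:
  assumes M: "M \<noteq> {}" and S: "\<And>k. k < n \<Longrightarrow> hom_zero S (Suc k)" and "m \<le> n"
  shows "\<exists>z\<in>general_cycles P m. ev nr s m z = 1"
  using \<open>m \<le> n\<close>
proof (induction m)
  case 0
  obtain x where x: "x \<in> M" using M by auto
  then have "{q x} \<in> P"
    using N_refl N'_iff by (simp add: clique_def)
  then have "gen [q x] \<in> general_cycles P 0"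
    by (simp add: general_cycles_def osimplices_def)
  then show ?case by (intro bexI [of _ "gen [q x]"]) simp_all
next
  case (Suc m)
  then obtain w where w: "w \<in> general_cycles P m" "ev nr s m w = 1"
    by auto
  have "TR s w \<in> boundaries S (Suc m)"
    using TR_cycles [OF w(1)] S [of m] Suc.prems by (auto simp: hom_zero_def)
  then obtain z where z: "z \<in> cycles P (Suc (Suc m))" "CAP s z + w \<in> boundaries P (Suc m)"
    using gysin_lift [OF s] w(1) by (auto simp: general_cycles_def)
  have "ev nr s m (CAP s z) = 1"
    using ev_boundaries [OF z(2)] w(2) by (simp only: ev_add add_eq_0_char2)
  then show ?case
    using z(1) by (intro bexI [of _ z]) (simp_all add: general_cycles_Suc)
qed

text \<open>Descends the Gysin sequence: by induction the cap product of \<open>z\<close> bounds, so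
  \<open>z\<close> comes from a cycle upstairs, and that one bounds.\<close>

lemma ev_injective_below:
  assumes S: "\<And>k. k < n \<Longrightarrow> hom_zero S (Suc k)" and "m < n"
    and "z \<in> cycles P (Suc m)" "ev nr s m z = 0"
  shows "z \<in> boundaries P (Suc m)"
  using \<open>m < n\<close> assms(3,4)
proof (induction m arbitrary: z)
  case 0
  have z: "z \<in> chain_space (osimplices P (Suc 0))" "bd z = 0"
    using 0 by (auto simp: cycles_def)
  \<comment> \<open>A single vertex has no edge on which the class could be evaluated, so the lift
    of a reduced cycle of vertices is again a cycle.\<close>
  have "CAP s z = lin (\<lambda>xs. 0) z"
    using z(1) by (rule lin_cong_chains) (auto simp: osimplices_def length_Suc_conv)
  then have "L s z \<in> cycles S (Suc 0)"
    using L_chains [OF s z(1)] bd_L [OF s z(1)] z(2) by (simp add: cycles_def)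
  then have "L s z \<in> boundaries S (Suc 0)"
    using S 0 by (auto simp: hom_zero_def)
  from push_q_boundaries [OF this] show ?case
    by (simp add: push_q_L [OF s z(1)])
next
  case (Suc m)
  have cap: "CAP s z \<in> cycles P (Suc m)"
  proof -
    have *: "CAP s z \<in> general_cycles P m"
      using CAP_general_cycles Suc.prems by simp
    have "bd (CAP s z) = 0" if "m = 0"
      using bd_length_1 [of "CAP s z" P] * Suc.prems(3) that by (simp add: general_cycles_def)
    then show ?thesis
      using * by (auto simp: general_cycles_def cycles_def)
  qed
  have "CAP s z \<in> boundaries P (Suc m)"
    using Suc.IH [OF _ cap] Suc.prems by simp
  then obtain y where y: "y \<in> cycles S (Suc (Suc m))" "push q y = z"
    using gysin_exact [OF s Suc.prems(2)] by blast
  then have "y \<in> boundaries S (Suc (Suc m))"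
    using S [of "Suc m"] Suc.prems(1) by (auto simp: hom_zero_def)
  from push_q_boundaries [OF this] show ?case
    by (simp add: y)
qed

text \<open>The vanishing in degree \<open>n + 1\<close> makes the transfer injective in degree
  \<open>n\<close>. As its target is a line, any two nonzero classes downstairs coincide, and
  \<open>ev\<close> is nonzero on one such class.\<close>

lemma ev_injective_top:
  assumes M: "M \<noteq> {}" and S: "\<And>k. k < n \<Longrightarrow> hom_zero S (Suc k)" "hom_line S (Suc n)"
    and P: "hom_zero P (Suc (Suc n))" and n: "n > 0"
    and z: "z \<in> cycles P (Suc n)" "ev nr s n z = 0"
  shows "z \<in> boundaries P (Suc n)"
proof -
  have inj: "w \<in> boundaries P (Suc n)" if w: "w \<in> cycles P (Suc n)" "TR s w \<in> boundaries S (Suc n)" for w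
  proof -
    obtain y where y: "y \<in> cycles P (Suc (Suc n))" "CAP s y + w \<in> boundaries P (Suc n)"
      using gysin_lift [OF s _ w(2)] w(1) by (auto simp: cycles_def)
    have "y \<in> boundaries P (Suc (Suc n))"
      using P y(1) by (auto simp: hom_zero_def)
    then have "CAP s y \<in> boundaries P (Suc n)"
      by (rule CAP_boundaries)
    then show ?thesis
      using boundaries_add_cancel y(2) by blast
  qed
  obtain m where m: "n = Suc m" using n gr0_conv_Suc by auto
  obtain z1 where "z1 \<in> general_cycles P n" "ev nr s n z1 = 1"
    using ev_surjective [OF M S(1) order_refl] by blast
  then have z1: "z1 \<in> cycles P (Suc n)" "ev nr s n z1 = 1"
    using m general_cycles_Suc by auto
  obtain g where g: "\<And>w. w \<in> cycles S (Suc n) \<Longrightarrow> w \<in> boundaries S (Suc n) \<or> w + g \<in> boundaries S (Suc n)"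
    using S(2) by (auto simp: hom_line_def)
  have no: "TR s z1 \<notin> boundaries S (Suc n)"
    using inj [OF z1(1)] ev_boundaries [of z1 n] z1(2) by auto
  show ?thesis
  proof (rule ccontr)
    assume "z \<notin> boundaries P (Suc n)"
    then have "TR s z \<notin> boundaries S (Suc n)"
      using inj z(1) by blast
    then have "TR s z + g \<in> boundaries S (Suc n)" "TR s z1 + g \<in> boundaries S (Suc n)"
      using no g TR_cycles cycles_general z(1) z1(1) by blast+
    then have "TR s (z + z1) \<in> boundaries S (Suc n)"
      unfolding TR_add using boundaries_trans [of "TR s z" g _ _ "TR s z1"] by (simp add: add.commute)
    then have "z + z1 \<in> boundaries P (Suc n)"
      by (rule inj [OF cycles_add [OF z(1) z1(1)]])
    from ev_boundaries [OF this] show False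
      using z(2) z1(2) by (simp add: ev_add)
  qed
qed

lemma cover_homology:
  assumes M: "M \<noteq> {}" and S: "\<And>k. k < n \<Longrightarrow> hom_zero S (Suc k)" "hom_line S (Suc n)"
    and P: "hom_zero P (Suc (Suc n))" and m: "0 < m" "m \<le> n"
  shows "hom_line P (Suc m)"
    and "\<And>z. z \<in> cycles P (Suc m) \<Longrightarrow> z \<in> boundaries P (Suc m) \<longleftrightarrow> ev nr s m z = 0"
proof -
  show *: "z \<in> boundaries P (Suc m) \<longleftrightarrow> ev nr s m z = 0" if z: "z \<in> cycles P (Suc m)" for z
  proof
    assume ev: "ev nr s m z = 0"
    show "z \<in> boundaries P (Suc m)"
    proof (cases "m = n")
      case True
      then show ?thesis
        using ev_injective_top [OF M S P _ _ ] z ev m by blast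
    next
      case False
      then show ?thesis
        using ev_injective_below [OF S(1) _ z ev] m by auto
    qed
  qed (rule ev_boundaries)
  obtain k where k: "m = Suc k" using m gr0_conv_Suc by auto
  obtain z where z: "z \<in> cycles P (Suc m)" "ev nr s m z = 1"
    using ev_surjective [OF M S(1) m(2)] k general_cycles_Suc by auto
  have "w \<in> boundaries P (Suc m) \<or> w + z \<in> boundaries P (Suc m)" if w: "w \<in> cycles P (Suc m)" for w
    using * [OF w] * [OF cycles_add [OF w z(1)]] z(2) by (cases "ev nr s m w") (simp_all add: ev_add)
  then show "hom_line P (Suc m)"
    unfolding hom_line_def using z * [OF z(1)] by (intro bexI [of _ z]) auto
qed

lemma cover_hom_zero_1:
  assumes "hom_zero S (Suc 0)"
  shows "hom_zero P (Suc 0)"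
  unfolding hom_zero_def
proof
  fix z assume z: "z \<in> cycles P (Suc 0)"
  then have "ev nr s 0 z = 0"
    using bd_length_1 [of z P] by (simp add: cycles_def)
  then show "z \<in> boundaries P (Suc 0)"
    using ev_injective_below [of 1 0 z] assms z by simp
qed

end

text \<open>
  If finitely many sections are such that every simplex of the base is lifted by one of them,
  the corresponding cap products compose to zero: this is the vanishing of products of length
  exceeding the Lusternik-Schnirelmann category.
\<close>

lemma foldr_CAP_add: "foldr (\<lambda>s. CAP s) ss (c + d) = foldr (\<lambda>s. CAP s) ss c + foldr (\<lambda>s. CAP s) ss d"
  by (induction ss) (simp_all add: lin_add)

lemma foldr_CAP_0: "foldr (\<lambda>s. CAP s) ss 0 = 0"
  by (induction ss) simp_all

lemma cap_list_set: "ys \<in> Poly_Mapping.keys (cap_list nr s xs) \<Longrightarrow> set ys \<subseteq> set xs"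
  by (cases "(nr, s, xs)" rule: cap_list.cases) (auto split: if_splits)

lemma foldr_CAP_set: "c \<in> chain_space {xs. set xs \<subseteq> U} \<Longrightarrow> foldr (\<lambda>s. CAP s) ss c \<in> chain_space {xs. set xs \<subseteq> U}"
proof (induction ss)
  case (Cons s ss)
  have "foldr (\<lambda>s. CAP s) ss c \<in> chain_space {xs. set xs \<subseteq> U}"
    using Cons by simp
  then have "CAP s (foldr (\<lambda>s. CAP s) ss c) \<in> chain_space {xs. set xs \<subseteq> U}"
  proof (rule chains_lin)
    fix x assume "x \<in> {xs. set xs \<subseteq> U}"
    then show "cap_list nr s x \<in> chain_space {xs. set xs \<subseteq> U}"
      using cap_list_set [of _ s x] by (fastforce simp: chain_space_def)
  qed
  then show ?case by simp
qed simp

text \<open>If all edges within \<open>U\<close> lift inside the section \<open>s\<close>, its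
  cochain is zero on them. Cap products stay supported in \<open>U\<close>, so the factor for
  \<open>s\<close> annihilates the chain at whatever position it stands.\<close>

lemma foldr_CAP_vanish:
  assumes c: "c \<in> chain_space {xs. set xs \<subseteq> U}" and s: "s \<in> set ss"
    and U: "\<And>u v. u \<in> U \<Longrightarrow> v \<in> U \<Longrightarrow> nr (s u) v = s v"
  shows "foldr (\<lambda>s. CAP s) ss c = 0"
  using s
proof (induction ss)
  case (Cons t ss)
  show ?case
  proof (cases "s \<in> set ss")
    case True
    then show ?thesis using Cons.IH by simp
  next
    case False
    then have "t = s" using Cons.prems by simp
    have "CAP s (foldr (\<lambda>s. CAP s) ss c) = lin (\<lambda>xs. 0) (foldr (\<lambda>s. CAP s) ss c)"
      using foldr_CAP_set [OF c]
    proof (rule lin_cong_chains)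
      fix x assume "x \<in> {xs. set xs \<subseteq> U}"
      then show "cap_list nr s x = 0"
        using U by (cases "(nr, s, x)" rule: cap_list.cases) auto
    qed
    then show ?thesis by (simp add: \<open>t = s\<close>)
  qed
qed simp

text \<open>Where the homology upstairs vanishes in all higher degrees, every cycle is an iterated
  cap product up to a boundary, and the section of each factor may be prescribed.\<close>

lemma foldr_CAP_boundary:
  assumes S: "\<And>k. k \<ge> p \<Longrightarrow> hom_zero S (Suc k)" and ss: "\<And>s. s \<in> set ss \<Longrightarrow> sect s"
    and z: "z \<in> cycles P (Suc p)"
  shows "\<exists>z'. z' \<in> cycles P (Suc (p + length ss)) \<and> z + foldr (\<lambda>s. CAP s) ss z' \<in> boundaries P (Suc p)"
  using ss S z
proof (induction ss arbitrary: p z)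
  case Nil
  then show ?case by (intro exI [of _ z]) simp
next
  case (Cons s ss)
  have s: "sect s" using Cons.prems by simp
  have zc: "z \<in> chain_space (osimplices P (Suc p))"
    using Cons.prems by (simp add: cycles_def)
  have "TR s z \<in> boundaries S (Suc p)"
    using TR_cycles [OF s cycles_general [OF Cons.prems(3)]] Cons.prems(2) [of p] by (auto simp: hom_zero_def)
  then obtain y where y: "y \<in> cycles P (Suc (Suc p))" "CAP s y + z \<in> boundaries P (Suc p)"
    using gysin_lift [OF s zc] by blast
  obtain z' where z': "z' \<in> cycles P (Suc (Suc p + length ss))"
    "y + foldr (\<lambda>s. CAP s) ss z' \<in> boundaries P (Suc (Suc p))"
    using Cons.IH [of "Suc p" y] Cons.prems y(1) by auto
  have "CAP s y + CAP s (foldr (\<lambda>s. CAP s) ss z') \<in> boundaries P (Suc p)"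
    using CAP_boundaries [OF s z'(2)] by (simp add: lin_add)
  moreover have "z + CAP s y \<in> boundaries P (Suc p)"
    using y(2) by (simp add: add.commute)
  ultimately have "z + CAP s (foldr (\<lambda>s. CAP s) ss z') \<in> boundaries P (Suc p)"
    using boundaries_trans by blast
  then show ?case
    using z'(1) by auto
qed

lemma cover_hom_zero_above:
  assumes S: "\<And>k. k \<ge> p \<Longrightarrow> hom_zero S (Suc k)" and ss: "\<And>s. s \<in> set ss \<Longrightarrow> sect s"
    and cover: "\<And>t. t \<in> P \<Longrightarrow> \<exists>s\<in>set ss. \<forall>u\<in>t. \<forall>v\<in>t. nr (s u) v = s v"
  shows "hom_zero P (Suc p)"
  unfolding hom_zero_def
proof
  fix z assume "z \<in> cycles P (Suc p)"
  then obtain z' where z': "z' \<in> cycles P (Suc (p + length ss))"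
    "z + foldr (\<lambda>s. CAP s) ss z' \<in> boundaries P (Suc p)"
    using foldr_CAP_boundary [OF S ss] by blast
  have vanish: "foldr (\<lambda>s. CAP s) ss c = 0" if "c \<in> chain_space (osimplices P k)" for c k
    using that
  proof (induction rule: chains_induct)
    case (add xs c)
    have "set xs \<in> P" using add.hyps by (simp add: osimplices_def)
    then obtain s where "s \<in> set ss" "\<forall>u\<in>set xs. \<forall>v\<in>set xs. nr (s u) v = s v"
      using cover by blast
    then have "foldr (\<lambda>s. CAP s) ss (gen xs) = 0"
      by (intro foldr_CAP_vanish [of _ "set xs" s]) auto
    then show ?case
      using add.IH by (simp add: foldr_CAP_add)
  qed (rule foldr_CAP_0)
  have "foldr (\<lambda>s. CAP s) ss z' = 0"
    by (rule vanish) (use z'(1) in \<open>auto simp: cycles_def\<close>)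
  then show "z \<in> boundaries P (Suc p)"
    using z'(2) by simp
qed

end

text \<open>A five-lemma argument for two double covers, one inside the other.\<close>

locale double_cover_pair = small: double_cover M T q nr N0 N0' + big: double_cover M T q nr N N'
  for M :: "'a set" and T and q :: "'a \<Rightarrow> 'b" and nr N0 N0' N N' +
  assumes N0_N: "\<And>x y. x \<in> M \<Longrightarrow> y \<in> M \<Longrightarrow> N0 x y \<Longrightarrow> N x y"
begin

lemma S_subset: "small.S \<subseteq> big.S"
  by (rule clique_mono) (use N0_N in auto)

lemma P_subset: "small.P \<subseteq> big.P"
proof (rule clique_mono)
  show "N' x y" if xy: "x \<in> q ` M" "y \<in> q ` M" "N0' x y" for x y
  proof -
    obtain a b where ab: "a \<in> M" "b \<in> M" "x = q a" "y = q b"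
      using xy by blast
    then show ?thesis
      using xy(3) small.N'_iff [OF ab(1,2)] big.N'_iff [OF ab(1,2)] N0_N [OF ab(1,2)]
        N0_N [OF ab(1) small.T_mem [OF ab(2)]] by auto
  qed
qed simp

text \<open>Surjectivity downstairs by induction on the degree, starting from the fact that both
  complexes have the same vertices. The cap product of \<open>z\<close> comes from a small
  \<open>w\<close>, whose transfer bounds upstairs at the large and hence at the small scale; so
  \<open>w\<close> is the cap product of a small \<open>z0\<close>. Then \<open>z + z0\<close> comes
  from upstairs, where cycles can be made small.\<close>

lemma cycle_from_small:
  assumes iso: "\<And>p. homology_iso (\<lambda>z. z) small.S big.S p" and s: "small.sect s"
    and z: "z \<in> general_cycles big.P m"
  shows "\<exists>w\<in>general_cycles small.P m. z + w \<in> boundaries big.P (Suc m)"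
  using z
proof (induction m arbitrary: z)
  case 0
  have "osimplices big.P (Suc 0) \<subseteq> osimplices small.P (Suc 0)"
    using small.N'_iff small.N_refl by (auto simp: osimplices_def clique_def length_Suc_conv)
  then have "z \<in> general_cycles small.P 0"
    using 0 by (auto simp: general_cycles_def elim: chains_mono)
  then show ?case
    by (intro bexI [of _ z]) simp_all
next
  case (Suc m)
  let ?CAP = "lin (cap_list nr s)"
  have sb: "big.sect s"
    using s by simp
  have z: "z \<in> cycles big.P (Suc (Suc m))"
    using Suc.prems by (simp add: general_cycles_Suc)
  have zc: "z \<in> chain_space (osimplices big.P (Suc (Suc m)))" "bd z = 0"
    using z by (auto simp: cycles_def)
  obtain w where w: "w \<in> general_cycles small.P m" "?CAP z + w \<in> boundaries big.P (Suc m)"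
    using Suc.IH [OF big.CAP_general_cycles [OF sb z]] by blast
  then obtain u where u: "u \<in> chain_space (osimplices big.P (Suc (Suc m)))" "?CAP z + w = bd u"
    unfolding boundaries_def by blast
  have wc: "w \<in> chain_space (osimplices small.P (Suc m))"
    using w(1) by (simp add: general_cycles_def)
  have "small.TR s w = big.TR s (?CAP z) + big.TR s (bd u)"
    unfolding u(2) [symmetric] big.TR_add by simp
  also have "\<dots> = bd (big.L s z + big.TR s u)"
    unfolding lin_add big.bd_L [OF sb zc(1)] big.bd_TR_Suc [OF sb u(1)] by (simp add: zc(2))
  finally have "small.TR s w = bd (big.L s z + big.TR s u)" .
  then have "small.TR s w \<in> boundaries big.S (Suc m)"
    using big.L_chains [OF sb zc(1)] big.TR_chains [OF sb u(1)] by (metis boundariesI chains_add)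
  moreover have "small.TR s w \<in> cycles small.S (Suc m)"
    by (rule small.TR_cycles [OF s w(1)])
  ultimately have "small.TR s w \<in> boundaries small.S (Suc m)"
    using iso [of "Suc m"] by (auto simp: homology_iso_def)
  then obtain z0 where z0: "z0 \<in> cycles small.P (Suc (Suc m))" "?CAP z0 + w \<in> boundaries small.P (Suc m)"
    using small.gysin_lift [OF s wc] by blast
  have z0b: "z0 \<in> cycles big.P (Suc (Suc m))"
    using z0(1) P_subset by (rule cycles_mono)
  have "?CAP z + ?CAP z0 \<in> boundaries big.P (Suc m)"
    using boundaries_trans [OF w(2), of "?CAP z0"] boundaries_mono [OF z0(2) P_subset] by (simp add: add.commute)
  then obtain y where y: "y \<in> cycles big.S (Suc (Suc m))" "push q y = z + z0"
    using big.gysin_exact [OF sb cycles_add [OF z z0b]] by (metis lin_add)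
  obtain y0 where y0: "y0 \<in> cycles small.S (Suc (Suc m))" "y + y0 \<in> boundaries big.S (Suc (Suc m))"
    using iso [of "Suc (Suc m)"] y(1) by (auto simp: homology_iso_def)
  have "z + (z0 + push q y0) \<in> boundaries big.P (Suc (Suc m))"
    using big.push_q_boundaries [OF sb y0(2)] by (simp add: lin_add y(2) add.assoc)
  moreover have "z0 + push q y0 \<in> cycles small.P (Suc (Suc m))"
    by (rule cycles_add [OF z0(1) small.push_q_cycles [OF s y0(1)]])
  ultimately show ?case
    unfolding general_cycles_Suc by blast
qed

lemma hom_zero_big:
  assumes iso: "\<And>p. homology_iso (\<lambda>z. z) small.S big.S p" and s: "small.sect s"
    and small: "hom_zero small.P (Suc (Suc m))"
  shows "hom_zero big.P (Suc (Suc m))"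
  unfolding hom_zero_def
proof
  fix z assume "z \<in> cycles big.P (Suc (Suc m))"
  then obtain w where w: "w \<in> cycles small.P (Suc (Suc m))" "z + w \<in> boundaries big.P (Suc (Suc m))"
    using cycle_from_small [OF iso s, of z "Suc m"] by (auto simp: general_cycles_Suc)
  then have "w \<in> boundaries small.P (Suc (Suc m))"
    using small by (auto simp: hom_zero_def)
  then have "w \<in> boundaries big.P (Suc (Suc m))"
    using P_subset by (rule boundaries_mono)
  then show "z \<in> boundaries big.P (Suc (Suc m))"
    using w(2) boundaries_add_cancel [of w big.P _ z] by (simp add: add.commute)
qed

end


section \<open>Angles, hemispheres and Rips complexes on the round sphere and its quotient\<close>

section \<open>Geometry of round spheres\<close>

locale sphere =
  fixes R :: real and n :: nat
  assumes R: "R > 0"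
begin

text \<open>The inner product is scaled such that the points of the sphere have norm one.\<close>

definition ip :: "(nat \<Rightarrow> real) \<Rightarrow> (nat \<Rightarrow> real) \<Rightarrow> real" where
  "ip x y = (\<Sum>i\<le>n. x i * y i) / R\<^sup>2"

abbreviation "sph \<equiv> round_sphere R n"

lemma ip_commute: "ip x y = ip y x"
  by (simp add: ip_def mult.commute)

lemma ip_combine_left: "ip (\<lambda>i. a * x i + b * y i) z = a * ip x z + b * ip y z"
  by (simp add: ip_def sum.distrib sum_distrib_left add_divide_distrib algebra_simps)

lemma ip_combine_right: "ip z (\<lambda>i. a * x i + b * y i) = a * ip z x + b * ip z y"
  unfolding ip_commute [of z] by (rule ip_combine_left)

lemma ip_scale_left: "ip (\<lambda>i. x i / c) z = ip x z / c"
  using ip_combine_left [of "1 / c" x 0 x z] by simp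

lemma ip_scale_right: "ip z (\<lambda>i. x i / c) = ip z x / c"
  unfolding ip_commute [of z] by (rule ip_scale_left)

lemma ip_minus_left: "ip (\<lambda>i. - x i) z = - ip x z"
  using ip_combine_left [of "-1" x 0 x z] by simp

lemma ip_minus_right: "ip z (\<lambda>i. - x i) = - ip z x"
  unfolding ip_commute [of z] by (rule ip_minus_left)

lemma ip_sum_left: "ip (\<lambda>i. \<Sum>v\<in>s. c v * v i) z = (\<Sum>v\<in>s. c v * ip v z)"
  by (simp add: ip_def sum_distrib_left sum_distrib_right sum_divide_distrib mult.assoc sum.swap [of _ "{..n}"])

lemma ip_nonneg: "0 \<le> ip x x"
  using R by (simp add: ip_def sum_nonneg)

lemma ip_Cauchy_Schwarz: "(ip x y)\<^sup>2 \<le> ip x x * ip y y"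
proof -
  have "(\<Sum>i\<le>n. x i * y i)\<^sup>2 \<le> (\<Sum>i\<le>n. (x i)\<^sup>2) * (\<Sum>i\<le>n. (y i)\<^sup>2)"
    by (rule Cauchy_Schwarz_ineq_sum)
  then have "(\<Sum>i\<le>n. x i * y i)\<^sup>2 / (R\<^sup>2)\<^sup>2 \<le> (\<Sum>i\<le>n. (x i)\<^sup>2) * (\<Sum>i\<le>n. (y i)\<^sup>2) / (R\<^sup>2)\<^sup>2"
    by (rule divide_right_mono) simp
  then show ?thesis
    by (simp add: ip_def power_divide power2_eq_square)
qed

lemma sph_iff: "x \<in> sph \<longleftrightarrow> ip x x = 1 \<and> (\<forall>i>n. x i = 0)"
  using R by (auto simp: round_sphere_def ip_def power2_eq_square)

lemma sphD: "x \<in> sph \<Longrightarrow> ip x x = 1" "x \<in> sph \<Longrightarrow> i > n \<Longrightarrow> x i = 0"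
  by (auto simp: sph_iff)

lemma ip_bounds:
  assumes "x \<in> sph" "y \<in> sph"
  shows "\<bar>ip x y\<bar> \<le> 1" "ip x y \<le> 1" "-1 \<le> ip x y"
proof -
  have "(ip x y)\<^sup>2 \<le> 1"
    using ip_Cauchy_Schwarz [of x y] assms by (simp add: sphD)
  then show "\<bar>ip x y\<bar> \<le> 1"
    by (simp add: abs_square_le_1)
  then show "ip x y \<le> 1" "-1 \<le> ip x y" by auto
qed

definition normalize :: "(nat \<Rightarrow> real) \<Rightarrow> nat \<Rightarrow> real" where
  "normalize x = (\<lambda>i. x i / sqrt (ip x x))"

lemma normalize_sph:
  assumes "ip x x > 0" "\<And>i. i > n \<Longrightarrow> x i = 0"
  shows "normalize x \<in> sph"
  using assms by (simp add: sph_iff normalize_def ip_scale_left ip_scale_right)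

lemma ip_normalize_left: "ip (normalize x) y = ip x y / sqrt (ip x x)"
  by (simp add: normalize_def ip_scale_left)

lemma ip_normalize_right: "ip y (normalize x) = ip y x / sqrt (ip x x)"
  by (simp add: normalize_def ip_scale_right)

text \<open>Cauchy-Schwarz for the components of \<open>x\<close> and \<open>z\<close> orthogonal to
  \<open>y\<close>. In terms of angles it is the triangle inequality on the sphere.\<close>

lemma ip_triangle:
  assumes "x \<in> sph" "y \<in> sph" "z \<in> sph"
  shows "\<bar>ip x z - ip x y * ip y z\<bar> \<le> sqrt (1 - (ip x y)\<^sup>2) * sqrt (1 - (ip y z)\<^sup>2)"
proof -
  let ?u = "\<lambda>i. 1 * x i + (- ip x y) * y i" and ?v = "\<lambda>i. 1 * z i + (- ip y z) * y i"
  have "(ip ?u ?v)\<^sup>2 \<le> ip ?u ?u * ip ?v ?v"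
    by (rule ip_Cauchy_Schwarz)
  moreover have "ip ?u ?v = ip x z - ip x y * ip y z"
    unfolding ip_combine_left ip_combine_right using sphD(1) [OF assms(2)] ip_commute [of y z] by simp
  moreover have "ip ?u ?u = 1 - (ip x y)\<^sup>2" "ip ?v ?v = 1 - (ip y z)\<^sup>2"
    unfolding ip_combine_left ip_combine_right
    using sphD(1) [OF assms(1)] sphD(1) [OF assms(2)] sphD(1) [OF assms(3)] ip_commute [of y z] ip_commute [of x y]
    by (simp_all add: power2_eq_square algebra_simps)
  ultimately have "(ip x z - ip x y * ip y z)\<^sup>2 \<le> (1 - (ip x y)\<^sup>2) * (1 - (ip y z)\<^sup>2)"
    by simp
  then have "sqrt ((ip x z - ip x y * ip y z)\<^sup>2) \<le> sqrt ((1 - (ip x y)\<^sup>2) * (1 - (ip y z)\<^sup>2))"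
    by (rule real_sqrt_le_mono)
  then show ?thesis
    by (simp add: real_sqrt_mult)
qed

text \<open>The double angle formula: two points within angle \<open>arccos C\<close> of
  \<open>p\<close> are within twice that angle of each other.\<close>

lemma ip_cap:
  assumes "x \<in> sph" "y \<in> sph" "p \<in> sph" "0 \<le> C" "C \<le> ip x p" "C \<le> ip y p"
  shows "2 * C\<^sup>2 - 1 \<le> ip x y"
proof -
  have b: "ip x p \<le> 1" "ip y p \<le> 1"
    using ip_bounds assms by auto
  have "C\<^sup>2 \<le> (ip x p)\<^sup>2" "C\<^sup>2 \<le> (ip y p)\<^sup>2"
    using assms by (auto intro: power_mono)
  then have "sqrt (1 - (ip x p)\<^sup>2) * sqrt (1 - (ip p y)\<^sup>2) \<le> sqrt (1 - C\<^sup>2) * sqrt (1 - C\<^sup>2)"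
    using assms b by (intro mult_mono real_sqrt_le_mono) (auto simp: ip_commute abs_square_le_1)
  also have "\<dots> = 1 - C\<^sup>2"
    using assms b by (simp add: abs_square_le_1)
  finally have "\<bar>ip x y - ip x p * ip p y\<bar> \<le> 1 - C\<^sup>2"
    using ip_triangle [OF assms(1,3,2)] by linarith
  moreover have "C * C \<le> ip x p * ip p y"
    using assms by (intro mult_mono) (auto simp: ip_commute)
  ultimately show ?thesis
    by (simp add: power2_eq_square)
qed

text \<open>The right-hand side is the chord from \<open>x\<close> to \<open>y\<close> on the unit
  sphere.\<close>

lemma ip_diff:
  assumes "x \<in> sph" "y \<in> sph" "z \<in> sph"
  shows "\<bar>ip x z - ip y z\<bar> \<le> sqrt (2 - 2 * ip x y)"
proof -
  let ?u = "\<lambda>i. 1 * x i + (- 1) * y i"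
  have "(ip ?u z)\<^sup>2 \<le> ip ?u ?u * ip z z"
    by (rule ip_Cauchy_Schwarz)
  moreover have "ip ?u z = ip x z - ip y z" "ip ?u ?u = 2 - 2 * ip x y"
    unfolding ip_combine_left ip_combine_right using assms ip_commute [of x y] by (simp_all add: sphD)
  ultimately have "(ip x z - ip y z)\<^sup>2 \<le> 2 - 2 * ip x y"
    using assms by (simp add: sphD)
  then have "sqrt ((ip x z - ip y z)\<^sup>2) \<le> sqrt (2 - 2 * ip x y)"
    by (rule real_sqrt_le_mono)
  then show ?thesis by simp
qed

lemma coordinate_diff:
  assumes "x \<in> sph" "y \<in> sph" "i \<le> n"
  shows "(x i - y i)\<^sup>2 \<le> R\<^sup>2 * (2 - 2 * ip x y)"
proof -
  let ?u = "\<lambda>i. 1 * x i + (- 1) * y i"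
  have "(?u i)\<^sup>2 \<le> (\<Sum>i\<le>n. (?u i)\<^sup>2)"
    by (rule member_le_sum) (use assms in auto)
  also have "\<dots> = R\<^sup>2 * ip ?u ?u"
    using R by (simp add: ip_def power2_eq_square)
  also have "ip ?u ?u = 2 - 2 * ip x y"
    unfolding ip_combine_left ip_combine_right using assms ip_commute [of x y] by (simp add: sphD)
  finally show ?thesis by simp
qed

lemma big_coordinate:
  assumes "x \<in> sph"
  shows "\<exists>i\<le>n. R\<^sup>2 \<le> (real n + 1) * (x i)\<^sup>2"
proof (rule ccontr)
  assume no: "\<not> ?thesis"
  have "(real n + 1) * (x i)\<^sup>2 < R\<^sup>2" if "i \<le> n" for i
    using that no not_le by blast
  then have "(\<Sum>i\<le>n. (real n + 1) * (x i)\<^sup>2) < (\<Sum>i\<le>n. R\<^sup>2)"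
    by (intro sum_strict_mono) auto
  moreover have "(\<Sum>i\<le>n. (x i)\<^sup>2) = R\<^sup>2"
    using assms by (simp add: round_sphere_def)
  ultimately show False
    by (simp add: add.commute flip: sum_distrib_left)
qed

subsection \<open>Contraction towards a point\<close>

definition contract :: "(nat \<Rightarrow> real) \<Rightarrow> real \<Rightarrow> (nat \<Rightarrow> real) \<Rightarrow> nat \<Rightarrow> real" where
  "contract p t x = normalize (\<lambda>i. (1 - t) * x i + t * p i)"

text \<open>The squared norm of the point at parameter \<open>t\<close> on the segment between two
  unit vectors with inner product \<open>a\<close>.\<close>

definition contract_norm :: "real \<Rightarrow> real \<Rightarrow> real" where
  "contract_norm a t = (1 - t)\<^sup>2 + t\<^sup>2 + 2 * t * (1 - t) * a"

lemma contract_norm_pos: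
  assumes "0 \<le> t" "t \<le> 1" "0 \<le> a"
  shows "0 < contract_norm a t"
proof -
  have "0 < (1 - t)\<^sup>2 + t\<^sup>2"
    by (simp add: sum_power2_gt_zero_iff)
  moreover have "0 \<le> 2 * t * (1 - t) * a"
    using assms by simp
  ultimately show ?thesis
    unfolding contract_norm_def by linarith
qed

lemma ip_contract_norm:
  assumes "x \<in> sph" "p \<in> sph"
  shows "ip (\<lambda>i. (1 - t) * x i + t * p i) (\<lambda>i. (1 - t) * x i + t * p i) = contract_norm (ip x p) t"
  unfolding ip_combine_left ip_combine_right contract_norm_def
  using assms ip_commute [of p x] by (simp add: sphD power2_eq_square algebra_simps)

lemma ip_contract:
  assumes "x \<in> sph" "y \<in> sph" "p \<in> sph"
  shows "ip (contract p t x) (contract p t' y) =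
    ((1 - t) * (1 - t') * ip x y + (1 - t) * t' * ip x p + t * (1 - t') * ip y p + t * t') /
    (sqrt (contract_norm (ip x p) t) * sqrt (contract_norm (ip y p) t'))"
  unfolding contract_def ip_normalize_left ip_normalize_right ip_contract_norm [OF assms(1,3)] ip_contract_norm [OF assms(2,3)]
  unfolding ip_combine_left ip_combine_right
  using assms ip_commute [of p y] by (simp add: sphD algebra_simps)

text \<open>Contraction inside the closed hemisphere around \<open>p\<close> does not increase
  angles. The new inner product has the form \<open>(A * u + w) / D\<close> with \<open>u\<close>
  the old one; the inequality between arithmetic and geometric mean gives
  \<open>D \<le> A + w\<close>, which settles \<open>0 \<le> u\<close>, and \<open>A \<le> D\<close>
  settles \<open>u < 0\<close>.\<close>

lemma contract_lipschitz:
  assumes "x \<in> sph" "y \<in> sph" "p \<in> sph" "0 \<le> ip x p" "0 \<le> ip y p" "0 \<le> t" "t \<le> 1"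
  shows "ip x y \<le> ip (contract p t x) (contract p t y)"
proof -
  define A where "A = (1 - t)\<^sup>2"
  define w where "w = t * (1 - t) * (ip x p + ip y p) + t\<^sup>2"
  define D where "D = sqrt (contract_norm (ip x p) t) * sqrt (contract_norm (ip y p) t)"
  have A0: "0 \<le> A" and w0: "0 \<le> w"
    using assms by (simp_all add: A_def w_def)
  have pos: "0 < contract_norm (ip x p) t" "0 < contract_norm (ip y p) t"
    using assms contract_norm_pos by auto
  have D0: "0 < D"
    using pos by (simp add: D_def)
  have "D \<le> (contract_norm (ip x p) t + contract_norm (ip y p) t) / 2"
    unfolding D_def real_sqrt_mult [symmetric] using pos by (intro arith_geo_mean_sqrt) auto
  also have "\<dots> = A + w"
    by (simp add: A_def w_def contract_norm_def field_simps power2_eq_square)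
  finally have D1: "D \<le> A + w" .
  have "A \<le> contract_norm (ip x p) t" "A \<le> contract_norm (ip y p) t"
    using assms by (simp_all add: A_def contract_norm_def)
  then have "sqrt A * sqrt A \<le> D"
    unfolding D_def using A0 by (intro mult_mono real_sqrt_le_mono) auto
  then have D2: "A \<le> D" using A0 by simp
  have u: "ip x y \<le> 1" using ip_bounds assms by simp
  have "ip x y * D \<le> A * ip x y + w"
  proof (cases "0 \<le> ip x y")
    case True
    have "ip x y * D \<le> ip x y * (A + w)"
      using True D1 by (intro mult_left_mono)
    also have "\<dots> \<le> A * ip x y + w"
      using mult_right_mono [OF u w0] by (simp add: algebra_simps)
    finally show ?thesis .
  next
    case False
    have "ip x y * D \<le> ip x y * A"
      using False D2 by (intro mult_left_mono_neg) auto
    then show ?thesis using w0 by (simp add: mult.commute)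
  qed
  then have "ip x y \<le> (A * ip x y + w) / D"
    using D0 by (simp add: pos_le_divide_eq)
  moreover have "ip (contract p t x) (contract p t y) = (A * ip x y + w) / D"
    unfolding ip_contract [OF assms(1-3)] by (simp add: A_def w_def D_def power2_eq_square algebra_simps)
  ultimately show ?thesis by simp
qed

lemma contract_0: "x \<in> sph \<Longrightarrow> p \<in> sph \<Longrightarrow> contract p 0 x = x"
  by (simp add: contract_def normalize_def sphD)

lemma contract_1: "p \<in> sph \<Longrightarrow> contract p 1 x = p"
  by (simp add: contract_def normalize_def sphD)

lemma contract_near:
  assumes "x \<in> sph" "y \<in> sph" "p \<in> sph" "0 \<le> ip x p" "0 \<le> ip y p" "0 \<le> t" "t \<le> 1" "\<kappa> < ip x y"
  shows "eventually (\<lambda>t'. \<kappa> < ip (contract p t x) (contract p t' y)) (at t within {0..1})"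
proof -
  have "((\<lambda>t'. ip (contract p t x) (contract p t' y)) \<longlongrightarrow> ip (contract p t x) (contract p t y)) (at t within {0..1})"
    unfolding ip_contract [OF assms(1-3)] contract_norm_def
    using contract_norm_pos [OF assms(6,7,4)] contract_norm_pos [OF assms(6,7,5)]
    by (intro tendsto_intros) (auto simp: contract_norm_def)
  moreover have "\<kappa> < ip (contract p t x) (contract p t y)"
    using contract_lipschitz [OF assms(1-7)] assms(8) by simp
  ultimately show ?thesis
    by (rule order_tendstoD)
qed

abbreviation "Rips C \<kappa> \<equiv> clique C (\<lambda>x y. \<kappa> < ip x y)"

text \<open>A cycle involves finitely many points, and the strict inequality defining edges is an
  open condition; so for \<open>t'\<close> near \<open>t\<close> the two contractions are contiguous
  on the cycle. Connectedness of the unit interval links the identity at 0 with the constant map at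
  1.\<close>

lemma acyclic_Rips:
  assumes C: "C \<subseteq> sph" and p: "p \<in> C" "\<And>x. x \<in> C \<Longrightarrow> 0 \<le> ip x p"
    and closed: "\<And>x t. x \<in> C \<Longrightarrow> 0 \<le> t \<Longrightarrow> t \<le> 1 \<Longrightarrow> contract p t x \<in> C" and \<kappa>: "\<kappa> < 1"
  shows "acyclic_complex (Rips C \<kappa>)"
  unfolding acyclic_complex_def
proof (intro allI subsetI)
  fix k z assume z: "z \<in> cycles (Rips C \<kappa>) k"
  define V where "V = (\<Union>xs\<in>Poly_Mapping.keys z. set xs)"
  have psph: "p \<in> sph" using C p by auto
  have Vfin: "finite V"
    by (simp add: V_def)
  have zV: "z \<in> cycles (Rips (C \<inter> V) \<kappa>) k"
  proof -
    have "set xs \<in> Rips (C \<inter> V) \<kappa>" "length xs = k" if "xs \<in> Poly_Mapping.keys z" for xs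
      using that chains_keysD [of z "osimplices (Rips C \<kappa>) k" xs] z
      by (auto simp: cycles_def V_def osimplices_def clique_def)
    then show ?thesis
      using z by (auto simp: cycles_def chain_space_def osimplices_def)
  qed
  let ?K = "Rips C \<kappa>"
  define Q where "Q t t' \<longleftrightarrow> push (contract p t) z + push (contract p t') z \<in> boundaries ?K k" for t t'
  have "Q 0 1"
  proof (rule connected_equivalence_relation [of "{0..1::real}"])
    show "Q y x" if "Q x y" for x y
      using that by (simp add: Q_def add.commute)
    show "Q x z" if "Q x y" "Q y z" for x y z
      using that boundaries_trans unfolding Q_def by blast
    fix t :: real assume "t \<in> {0..1}"
    then have t: "0 \<le> t" "t \<le> 1" by auto
    have "eventually (\<lambda>t'. \<forall>x\<in>C \<inter> V. \<forall>y\<in>C \<inter> V. \<kappa> < ip x y \<longrightarrow> \<kappa> < ip (contract p t x) (contract p t' y)) (at t within {0..1})"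
    proof (intro eventually_ball_finite ballI)
      fix x y assume xy: "x \<in> C \<inter> V" "y \<in> C \<inter> V"
      show "eventually (\<lambda>t'. \<kappa> < ip x y \<longrightarrow> \<kappa> < ip (contract p t x) (contract p t' y)) (at t within {0..1})"
      proof (cases "\<kappa> < ip x y")
        case True
        then show ?thesis
          using contract_near [of x y p t \<kappa>] xy C p t psph by auto
      qed simp
    qed (use Vfin in auto)
    then obtain e where e: "e > 0" and near: "\<And>t' x y. t' \<in> {0..1} \<Longrightarrow> t' \<noteq> t \<Longrightarrow> dist t' t < e \<Longrightarrow>
        x \<in> C \<inter> V \<Longrightarrow> y \<in> C \<inter> V \<Longrightarrow> \<kappa> < ip x y \<Longrightarrow> \<kappa> < ip (contract p t x) (contract p t' y)"
      unfolding eventually_at by blast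
    have "Q t t'" if t': "t' \<in> {0..1} \<inter> ball t e" for t'
    proof (cases "t' = t")
      case True
      then show ?thesis by (simp add: Q_def)
    next
      case False
      have t'1: "0 \<le> t'" "t' \<le> 1" "dist t' t < e"
        using t' by (auto simp: dist_commute)
      show ?thesis
        unfolding Q_def
      proof (rule contiguous_homologous [OF simplicial_complex_clique simplicial_complex_clique _ zV])
        fix s assume s: "s \<in> Rips (C \<inter> V) \<kappa>"
        have *: "\<kappa> < ip (contract p r x) (contract p r' y)" if "x \<in> s" "y \<in> s" "r \<in> {t, t'}" "r' \<in> {t, t'}" for x y r r'
        proof -
          have xy: "x \<in> C \<inter> V" "y \<in> C \<inter> V" "\<kappa> < ip x y" "\<kappa> < ip y x"
            using cliqueD [OF s] that by auto
          have same: "\<kappa> < ip (contract p r x) (contract p r y)" if "r \<in> {t, t'}" for r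
            using contract_lipschitz [of x y p r] xy that t t'1 C p psph by (auto simp: subset_iff)
          show ?thesis
            using same near [OF _ False t'1(3) xy(1,2,3)] near [OF _ False t'1(3) xy(2,1,4)] that t' 
            by (auto simp: ip_commute)
        qed
        have "contract p r x \<in> C" if "x \<in> s" "r \<in> {t, t'}" for x r
          using cliqueD(1) [OF s that(1)] closed that t t'1 by auto
        then show "contract p t ` s \<union> contract p t' ` s \<in> ?K"
          using s * by (auto simp: clique_def)
      qed
    qed
    then show "\<exists>U. openin (top_of_set {0..1}) U \<and> t \<in> U \<and> (\<forall>t'\<in>U. Q t t')"
      using t e by (intro exI [of _ "{0..1} \<inter> ball t e"]) (auto simp: openin_open_Int)
  qed (auto simp: Q_def)
  moreover have "push (contract p 0) z = push (\<lambda>x. x) z"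
  proof (rule push_cong)
    show "z \<in> chain_space (osimplices ?K k)" using z by (simp add: cycles_def)
    show "contract p 0 x = x" if "s \<in> ?K" "x \<in> s" for x s
      using cliqueD(1) [OF that] C psph contract_0 by auto
  qed
  moreover have "push (contract p 1) z = push (\<lambda>x. p) z"
  proof -
    have "contract p 1 = (\<lambda>x. p)"
      using contract_1 [OF psph] by blast
    then show ?thesis by simp
  qed
  moreover have "push (\<lambda>x. p) z \<in> boundaries ?K k"
  proof -
    have "push (\<lambda>x. p) z \<in> cycles (Pow {p}) k"
      using z by (rule push_cycles [rotated]) auto
    then have "push (\<lambda>x. p) z \<in> boundaries (Pow {p}) k"
      using acyclic_Pow [of "{p}"] by (auto simp: acyclic_complex_def)
    moreover have "Pow {p} \<subseteq> ?K"
      using p \<kappa> sphD [OF psph] by (auto simp: clique_def subset_singleton_iff)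
    ultimately show ?thesis by (rule boundaries_mono)
  qed
  ultimately show "z \<in> boundaries ?K k"
    using boundaries_add_cancel [of "push (\<lambda>x. p) z" ?K k z] by (simp add: Q_def add.commute)
qed

end

context sphere
begin

subsection \<open>Open hemispheres and convex hulls\<close>

text \<open>The finite sets contained in an open hemisphere: the Cech complex of radius a quarter of a great circle.\<close>

definition hemispherical :: "(nat \<Rightarrow> real) set set" where
  "hemispherical = {s. finite s \<and> s \<subseteq> sph \<and> (\<exists>h. \<forall>v\<in>s. 0 < ip h v)}"

lemma hemisphericalI: "finite s \<Longrightarrow> s \<subseteq> sph \<Longrightarrow> (\<And>v. v \<in> s \<Longrightarrow> 0 < ip h v) \<Longrightarrow> s \<in> hemispherical"
  by (auto simp: hemispherical_def)

lemma simplicial_complex_hemispherical: "simplicial_complex hemispherical"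
  unfolding simplicial_complex_def hemispherical_def by (auto simp: finite_subset subset_iff)

definition combination :: "((nat \<Rightarrow> real) \<Rightarrow> real) \<Rightarrow> (nat \<Rightarrow> real) set \<Rightarrow> nat \<Rightarrow> real" where
  "combination c s = (\<lambda>i. \<Sum>v\<in>s. c v * v i)"

definition sph_hull :: "(nat \<Rightarrow> real) set \<Rightarrow> (nat \<Rightarrow> real) set" where
  "sph_hull s = {y \<in> sph. \<exists>c. (\<forall>v\<in>s. 0 \<le> c v) \<and> y = combination c s}"

lemma ip_combination_left: "ip (combination c s) z = (\<Sum>v\<in>s. c v * ip v z)"
  unfolding combination_def by (rule ip_sum_left)

lemma ip_combination_right: "ip z (combination c s) = (\<Sum>v\<in>s. c v * ip z v)"
  using ip_combination_left [of c s z] by (simp add: ip_commute)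

lemma combination_outside: "s \<subseteq> sph \<Longrightarrow> i > n \<Longrightarrow> combination c s i = 0"
  unfolding combination_def by (rule sum.neutral) (auto simp: sphD)

lemma sph_hull_sph: "sph_hull s \<subseteq> sph"
  by (auto simp: sph_hull_def)

lemma sph_hull_mono:
  assumes "finite s" "t \<subseteq> s"
  shows "sph_hull t \<subseteq> sph_hull s"
proof
  fix y assume "y \<in> sph_hull t"
  then obtain c where c: "y \<in> sph" "\<forall>v\<in>t. 0 \<le> c v" "y = combination c t"
    by (auto simp: sph_hull_def)
  have "combination c t = combination (\<lambda>v. if v \<in> t then c v else 0) s"
    unfolding combination_def using assms
    by (intro ext sum.mono_neutral_cong_left) auto
  then show "y \<in> sph_hull s"
    unfolding sph_hull_def using c by (intro CollectI conjI exI [of _ "\<lambda>v. if v \<in> t then c v else 0"]) auto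
qed

lemma sph_hull_superset:
  assumes "finite s" "s \<subseteq> sph"
  shows "s \<subseteq> sph_hull s"
proof
  fix y assume y: "y \<in> s"
  have "combination (\<lambda>v. if v = y then 1 else 0) s = y"
  proof
    fix i
    have "combination (\<lambda>v. if v = y then 1 else 0) s i = (\<Sum>v\<in>s. if v = y then v i else 0)"
      unfolding combination_def by (rule sum.cong) auto
    also have "\<dots> = y i"
      using assms y by simp
    finally show "combination (\<lambda>v. if v = y then 1 else 0) s i = y i" .
  qed
  then show "y \<in> sph_hull s"
    unfolding sph_hull_def using assms y
    by (intro CollectI conjI exI [of _ "\<lambda>v. if v = y then 1 else 0"]) auto
qed

lemma sph_hull_positive:
  assumes s: "finite s" "\<And>v. v \<in> s \<Longrightarrow> 0 < ip h v" and y: "y \<in> sph_hull s"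
  shows "0 < ip h y"
proof -
  obtain c where c: "y \<in> sph" "\<And>v. v \<in> s \<Longrightarrow> 0 \<le> c v" "y = combination c s"
    using y by (auto simp: sph_hull_def)
  have "\<exists>v\<in>s. c v \<noteq> 0"
  proof (rule ccontr)
    assume "\<not> ?thesis"
    then have "combination c s = (\<lambda>i. 0)"
      by (simp add: combination_def)
    then have "ip y y = 0"
      by (simp add: c(3) ip_def)
    then show False
      using sphD [OF c(1)] by simp
  qed
  then obtain v where v: "v \<in> s" "0 < c v"
    using c(2) by (metis less_eq_real_def)
  have "0 < (\<Sum>v\<in>s. c v * ip h v)"
  proof (rule sum_pos2 [OF s(1) v(1)])
    show "0 < c v * ip h v" using v s(2) by simp
    show "0 \<le> c u * ip h u" if "u \<in> s" for u
      using c(2) [OF that] s(2) [OF that] by simp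
  qed
  then show ?thesis
    by (simp add: c(3) ip_combination_right)
qed

lemma normalize_combination:
  assumes s: "s \<subseteq> sph" and c: "\<And>v. v \<in> s \<Longrightarrow> 0 \<le> c v" and pos: "0 < ip (combination c s) (combination c s)"
  shows "normalize (combination c s) \<in> sph_hull s"
proof -
  let ?r = "sqrt (ip (combination c s) (combination c s))"
  have "normalize (combination c s) \<in> sph"
    using pos combination_outside [OF s] by (intro normalize_sph)
  moreover have "normalize (combination c s) = combination (\<lambda>v. c v / ?r) s"
    unfolding normalize_def by (simp add: combination_def sum_divide_distrib)
  ultimately show ?thesis
    unfolding sph_hull_def using c ip_nonneg
    by (intro CollectI conjI exI [of _ "\<lambda>v. c v / ?r"]) auto
qed

lemma contract_sph_hull:
  assumes s: "s \<subseteq> sph" and x: "x \<in> sph_hull s" and p: "p \<in> sph_hull s" and xp: "0 \<le> ip x p"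
    and t: "0 \<le> t" "t \<le> 1"
  shows "contract p t x \<in> sph_hull s"
proof -
  obtain c where c: "x \<in> sph" "\<And>v. v \<in> s \<Longrightarrow> 0 \<le> c v" "x = combination c s"
    using x by (auto simp: sph_hull_def)
  obtain d where d: "p \<in> sph" "\<And>v. v \<in> s \<Longrightarrow> 0 \<le> d v" "p = combination d s"
    using p by (auto simp: sph_hull_def)
  have eq: "(\<lambda>i. (1 - t) * x i + t * p i) = combination (\<lambda>v. (1 - t) * c v + t * d v) s"
    unfolding c(3) d(3) combination_def
    by (simp add: sum_distrib_left distrib_right sum.distrib mult.assoc)
  have "normalize (combination (\<lambda>v. (1 - t) * c v + t * d v) s) \<in> sph_hull s"
  proof (rule normalize_combination [OF s])
    show "0 \<le> (1 - t) * c v + t * d v" if "v \<in> s" for v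
      using c(2) [OF that] d(2) [OF that] t by simp
    show "0 < ip (combination (\<lambda>v. (1 - t) * c v + t * d v) s) (combination (\<lambda>v. (1 - t) * c v + t * d v) s)"
      unfolding eq [symmetric] ip_contract_norm [OF c(1) d(1)] using contract_norm_pos [OF t xp] .
  qed
  then show ?thesis
    by (simp add: contract_def eq)
qed

text \<open>
  The perceptron algorithm: as long as some vertex has a nonpositive inner product with the current
  combination, adding it increases the square of the norm by at most one.
\<close>

lemma perceptron:
  assumes s: "finite s" "s \<subseteq> sph"
    and no: "\<And>c. (\<And>v. v \<in> s \<Longrightarrow> 0 \<le> c v) \<Longrightarrow> \<exists>v\<in>s. ip (combination c s) v \<le> 0"
  shows "\<exists>c. (\<forall>v\<in>s. 0 \<le> c v) \<and> sum c s = real k \<and> ip (combination c s) (combination c s) \<le> real k"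
proof (induction k)
  case 0
  show ?case
    by (rule exI [of _ "\<lambda>v. 0"]) (simp add: combination_def ip_def)
next
  case (Suc k)
  then obtain c where c: "\<And>v. v \<in> s \<Longrightarrow> 0 \<le> c v" "sum c s = real k" "ip (combination c s) (combination c s) \<le> real k"
    by blast
  obtain w where w: "w \<in> s" "ip (combination c s) w \<le> 0"
    using no c(1) by blast
  define d where "d = c(w := c w + 1)"
  have dsum: "(\<Sum>v\<in>s. d v * f v) = (\<Sum>v\<in>s. c v * f v) + f w" for f :: "_ \<Rightarrow> real"
  proof -
    have "(\<Sum>v\<in>s. d v * f v) = (\<Sum>v\<in>s. c v * f v + (if v = w then f v else 0))"
      by (rule sum.cong) (auto simp: d_def algebra_simps)
    then show ?thesis
      using s(1) w(1) by (simp add: sum.distrib)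
  qed
  have "combination d s = (\<lambda>i. 1 * combination c s i + 1 * w i)"
    unfolding combination_def dsum by simp
  then have "ip (combination d s) (combination d s) =
      ip (combination c s) (combination c s) + 2 * ip (combination c s) w + ip w w"
    by (simp only: ip_combine_left ip_combine_right ip_commute [of w "combination c s"]) simp
  also have "\<dots> \<le> real (Suc k)"
    using c(3) w s(2) by (simp add: sphD subset_iff)
  finally have "ip (combination d s) (combination d s) \<le> real (Suc k)" .
  moreover have "sum d s = real (Suc k)"
    using dsum [of "\<lambda>v. 1"] c(2) by simp
  moreover have "\<forall>v\<in>s. 0 \<le> d v"
    using c(1) w(1) by (simp add: d_def add_nonneg_nonneg)
  ultimately show ?case by blast
qed

text \<open>If no combination were positive on \<open>s\<close>, the perceptron would run forever.
  After \<open>k\<close> steps its sum has squared norm at most \<open>k\<close>, but inner product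
  at least \<open>\<gamma> * k\<close> with \<open>h\<close>, against Cauchy-Schwarz for large
  \<open>k\<close>. Unlike \<open>h\<close>, the center lies in the hull, so that contractions
  towards it stay there.\<close>

lemma hemispherical_center:
  assumes "s \<in> hemispherical" "s \<noteq> {}"
  obtains p where "p \<in> sph_hull s" "\<And>x. x \<in> sph_hull s \<Longrightarrow> 0 < ip x p"
proof -
  obtain h where s: "finite s" "s \<subseteq> sph" and h: "\<And>v. v \<in> s \<Longrightarrow> 0 < ip h v"
    using assms by (auto simp: hemispherical_def)
  define \<gamma> where "\<gamma> = Min (ip h ` s)"
  have \<gamma>: "0 < \<gamma>" "\<And>v. v \<in> s \<Longrightarrow> \<gamma> \<le> ip h v"
    using s assms(2) h by (auto simp: \<gamma>_def)
  have "\<exists>c. (\<forall>v\<in>s. 0 \<le> c v) \<and> (\<forall>v\<in>s. 0 < ip (combination c s) v)"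
  proof (rule ccontr)
    assume "\<not> ?thesis"
    then have no: "\<exists>v\<in>s. ip (combination c s) v \<le> 0" if "\<And>v. v \<in> s \<Longrightarrow> 0 \<le> c v" for c
      using that by (meson not_le)
    have bound: "\<gamma>\<^sup>2 * real k \<le> ip h h" if "k > 0" for k
    proof -
      obtain c where c: "\<forall>v\<in>s. 0 \<le> c v" "sum c s = real k" "ip (combination c s) (combination c s) \<le> real k"
        using perceptron [OF s no] by blast
      have "\<gamma> * real k = (\<Sum>v\<in>s. c v * \<gamma>)"
        unfolding c(2) [symmetric] sum_distrib_left by (rule sum.cong) (simp_all add: mult.commute)
      also have "\<dots> \<le> (\<Sum>v\<in>s. c v * ip h v)"
        using c(1) \<gamma>(2) by (intro sum_mono mult_left_mono) auto
      also have "\<dots> = ip h (combination c s)"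
        by (simp add: ip_combination_right)
      finally have "(\<gamma> * real k)\<^sup>2 \<le> (ip h (combination c s))\<^sup>2"
        using \<gamma>(1) by (intro power_mono) auto
      also have "\<dots> \<le> ip h h * ip (combination c s) (combination c s)"
        by (rule ip_Cauchy_Schwarz)
      also have "\<dots> \<le> ip h h * real k"
        using c(3) ip_nonneg by (intro mult_left_mono) auto
      finally show ?thesis
        using that by (simp add: power2_eq_square)
    qed
    obtain k :: nat where k: "ip h h / \<gamma>\<^sup>2 < real k"
      using reals_Archimedean2 by blast
    then have "0 < k"
      using ip_nonneg [of h] \<gamma>(1) by (metis divide_nonneg_nonneg gr0I less_le_not_le of_nat_0 zero_le_power2)
    moreover have "ip h h < \<gamma>\<^sup>2 * real k"
      using k \<gamma>(1) by (simp add: pos_divide_less_eq mult.commute)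
    ultimately show False
      using bound [of k] by simp
  qed
  then obtain c where c: "\<And>v. v \<in> s \<Longrightarrow> 0 \<le> c v" "\<And>v. v \<in> s \<Longrightarrow> 0 < ip (combination c s) v"
    by blast
  obtain v where v: "v \<in> s" using assms(2) by auto
  have "ip (combination c s) (combination c s) \<noteq> 0"
    using ip_Cauchy_Schwarz [of "combination c s" v] c(2) [OF v] by (metis less_irrefl mult_zero_left not_le zero_less_power2)
  then have pos: "0 < ip (combination c s) (combination c s)"
    using ip_nonneg [of "combination c s"] by linarith
  show thesis
  proof
    show "normalize (combination c s) \<in> sph_hull s"
      using s(2) c(1) pos by (rule normalize_combination)
    show "0 < ip x (normalize (combination c s))" if "x \<in> sph_hull s" for x
      using sph_hull_positive [OF s(1) c(2) that] pos
      by (simp add: ip_normalize_right ip_commute)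
  qed
qed

text \<open>
  The coordinates of the vertices form the matrix \<open>\<Sum>v\<in>s. c v * v i * v j\<close>, whose trace is the sum
  of the \<open>c v\<close>; its Hilbert-Schmidt norm is bounded below by the trace.
\<close>

lemma trace_inequality:
  assumes s: "s \<subseteq> sph"
  shows "(sum c s)\<^sup>2 \<le> (real n + 1) * (\<Sum>u\<in>s. \<Sum>v\<in>s. c u * c v * (ip u v)\<^sup>2)"
proof -
  define A where "A i j = (\<Sum>v\<in>s. c v * v i * v j) / R\<^sup>2" for i j
  have "(\<Sum>i\<le>n. A i i) = (\<Sum>v\<in>s. c v * ip v v)"
    by (simp add: A_def ip_def sum_distrib_left mult.assoc sum.swap [of _ "{..n}"] flip: sum_divide_distrib)
  also have "\<dots> = sum c s"
    using s by (intro sum.cong) (auto simp: sphD)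
  finally have trace: "(\<Sum>i\<le>n. A i i) = sum c s" .
  have "(sum c s)\<^sup>2 \<le> (\<Sum>i\<le>n. (A i i)\<^sup>2) * card {..n}"
    unfolding trace [symmetric] by (rule sum_squared_le_sum_of_squares)
  also have "\<dots> \<le> (\<Sum>i\<le>n. \<Sum>j\<le>n. (A i j)\<^sup>2) * card {..n}"
    by (intro mult_right_mono sum_mono member_le_sum) auto
  also have "(\<Sum>i\<le>n. \<Sum>j\<le>n. (A i j)\<^sup>2) = (\<Sum>u\<in>s. \<Sum>v\<in>s. c u * c v * (ip u v)\<^sup>2)"
  proof -
    have A2: "(A i j)\<^sup>2 = (\<Sum>u\<in>s. \<Sum>v\<in>s. c u * c v * ((u i * v i) * (u j * v j)) / (R\<^sup>2)\<^sup>2)" for i j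
      unfolding A_def power_divide power2_eq_square [of "sum _ s"] sum_product sum_divide_distrib
      by (intro sum.cong refl) (simp add: algebra_simps)
    have ip2: "(ip u v)\<^sup>2 = (\<Sum>i\<le>n. \<Sum>j\<le>n. ((u i * v i) * (u j * v j)) / (R\<^sup>2)\<^sup>2)" for u v
      unfolding ip_def power_divide power2_eq_square [of "sum _ {..n}"] sum_product sum_divide_distrib
      by (intro sum.cong refl) (simp add: power2_eq_square)
    have swap: "(\<Sum>i\<le>n. \<Sum>j\<le>n. \<Sum>u\<in>s. \<Sum>v\<in>s. f i j u v) = (\<Sum>u\<in>s. \<Sum>v\<in>s. \<Sum>i\<le>n. \<Sum>j\<le>n. f i j u v)"
      for f :: "nat \<Rightarrow> nat \<Rightarrow> (nat \<Rightarrow> real) \<Rightarrow> (nat \<Rightarrow> real) \<Rightarrow> real"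
    proof -
      have "(\<Sum>i\<le>n. \<Sum>j\<le>n. \<Sum>u\<in>s. \<Sum>v\<in>s. f i j u v) = (\<Sum>i\<le>n. \<Sum>u\<in>s. \<Sum>j\<le>n. \<Sum>v\<in>s. f i j u v)"
        by (intro sum.cong refl sum.swap)
      also have "\<dots> = (\<Sum>i\<le>n. \<Sum>u\<in>s. \<Sum>v\<in>s. \<Sum>j\<le>n. f i j u v)"
        by (intro sum.cong refl sum.swap)
      also have "\<dots> = (\<Sum>u\<in>s. \<Sum>i\<le>n. \<Sum>v\<in>s. \<Sum>j\<le>n. f i j u v)"
        by (rule sum.swap)
      also have "\<dots> = (\<Sum>u\<in>s. \<Sum>v\<in>s. \<Sum>i\<le>n. \<Sum>j\<le>n. f i j u v)"
        by (intro sum.cong refl sum.swap)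
      finally show ?thesis .
    qed
    have "(\<Sum>i\<le>n. \<Sum>j\<le>n. (A i j)\<^sup>2) = (\<Sum>u\<in>s. \<Sum>v\<in>s. \<Sum>i\<le>n. \<Sum>j\<le>n. c u * c v * ((u i * v i) * (u j * v j)) / (R\<^sup>2)\<^sup>2)"
      unfolding A2 by (rule swap)
    also have "\<dots> = (\<Sum>u\<in>s. \<Sum>v\<in>s. c u * c v * (ip u v)\<^sup>2)"
      unfolding ip2 sum_distrib_left by simp
    finally show ?thesis .
  qed
  finally show ?thesis by (simp add: mult.commute add.commute)
qed

text \<open>Outside all open hemispheres the perceptron runs forever. If all inner products lie
  between \<open>- \<epsilon>\<close> and 1, their squares are bounded by a linear function of them,
  and the trace inequality yields \<open>k \<le> (n + 1) * (\<epsilon> * k + 1)\<close> for all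
  \<open>k\<close>. For \<open>\<epsilon> < 1 / (n + 1)\<close> this is absurd, which is where the
  critical cosine comes from.\<close>

lemma Rips_hemispherical:
  assumes \<kappa>: "- 1 / (real n + 1) \<le> \<kappa>"
  shows "Rips sph \<kappa> \<subseteq> hemispherical"
proof
  fix s assume s: "s \<in> Rips sph \<kappa>"
  then have fin: "finite s" and sub: "s \<subseteq> sph" and far: "\<And>u v. u \<in> s \<Longrightarrow> v \<in> s \<Longrightarrow> \<kappa> < ip u v"
    by (auto simp: clique_def)
  show "s \<in> hemispherical"
  proof (rule ccontr)
    assume not: "s \<notin> hemispherical"
    then have ne: "s \<noteq> {}"
      by (auto simp: hemispherical_def)
    have no: "\<exists>v\<in>s. ip (combination c s) v \<le> 0" for c
      using not fin sub by (auto simp: hemispherical_def not_less)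
    define m where "m = Min ((\<lambda>(u, v). ip u v) ` (s \<times> s))"
    have "m \<in> (\<lambda>(u, v). ip u v) ` (s \<times> s)"
      unfolding m_def by (rule Min_in) (use fin ne in auto)
    then have m1: "\<kappa> < m" using far by auto
    have m2: "m \<le> ip u v" if "u \<in> s" "v \<in> s" for u v
      unfolding m_def by (rule Min_le) (use fin that in auto)
    \<comment> \<open>As the minimum over a finite set, \<open>m\<close> exceeds
      \<open>\<kappa>\<close> strictly, so \<open>\<epsilon>\<close> stays below
      \<open>1 / (n + 1)\<close> even at the critical scale.\<close>
    define \<epsilon> where "\<epsilon> = max 0 (- m)"
    have \<epsilon>: "0 \<le> \<epsilon>" "\<epsilon> < 1 / (real n + 1)"
      using m1 \<kappa> by (auto simp: \<epsilon>_def)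
    have bound: "real k \<le> (real n + 1) * (\<epsilon> * real k + 1)" if k: "k > 0" for k
    proof -
      obtain c where c: "\<And>v. v \<in> s \<Longrightarrow> 0 \<le> c v" "sum c s = real k" "ip (combination c s) (combination c s) \<le> real k"
        using perceptron [OF fin sub no] by blast
      have pt: "(ip u v)\<^sup>2 \<le> \<epsilon> + (1 - \<epsilon>) * ip u v" if "u \<in> s" "v \<in> s" for u v
      proof -
        have "(ip u v + \<epsilon>) * (ip u v - 1) \<le> 0"
          using m2 [OF that] ip_bounds(2) [of u v] that sub by (intro mult_nonneg_nonpos) (auto simp: \<epsilon>_def)
        then show ?thesis
          by (simp add: power2_eq_square algebra_simps)
      qed
      have "(\<Sum>u\<in>s. \<Sum>v\<in>s. c u * c v * (ip u v)\<^sup>2) \<le> (\<Sum>u\<in>s. \<Sum>v\<in>s. c u * c v * (\<epsilon> + (1 - \<epsilon>) * ip u v))"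
        using c(1) pt by (intro sum_mono mult_left_mono) auto
      also have "\<dots> = (\<Sum>u\<in>s. \<Sum>v\<in>s. \<epsilon> * (c u * c v) + (1 - \<epsilon>) * (c u * (c v * ip v u)))"
        by (intro sum.cong refl, subst ip_commute) (simp add: algebra_simps)
      also have "\<dots> = \<epsilon> * (sum c s)\<^sup>2 + (1 - \<epsilon>) * ip (combination c s) (combination c s)"
        unfolding ip_combination_left ip_combination_right power2_eq_square sum_product
        by (simp add: sum_distrib_left sum.distrib)
      also have "\<dots> \<le> \<epsilon> * (real k)\<^sup>2 + 1 * real k"
      proof -
        have "(1 - \<epsilon>) * ip (combination c s) (combination c s) \<le> 1 * real k"
          using c(3) \<epsilon> ip_nonneg by (intro mult_mono) auto
        then show ?thesis by (simp add: c(2))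
      qed
      finally have "(real n + 1) * (\<Sum>u\<in>s. \<Sum>v\<in>s. c u * c v * (ip u v)\<^sup>2) \<le> (real n + 1) * (\<epsilon> * (real k)\<^sup>2 + real k)"
        by (intro mult_left_mono) auto
      from order_trans [OF trace_inequality [OF sub, of c, unfolded c(2)] this]
      have "(real k)\<^sup>2 \<le> (real n + 1) * (\<epsilon> * (real k)\<^sup>2 + real k)" .
      also have "\<dots> = ((real n + 1) * (\<epsilon> * real k + 1)) * real k"
        by (simp add: power2_eq_square algebra_simps)
      finally show ?thesis
        using k by (simp add: power2_eq_square)
    qed
    have d: "0 < 1 - (real n + 1) * \<epsilon>"
      using \<epsilon>(2) by (simp add: field_simps)
    obtain k :: nat where k: "(real n + 1) / (1 - (real n + 1) * \<epsilon>) < real k"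
      using reals_Archimedean2 by blast
    then have "0 < k"
      using d by (metis divide_nonneg_pos gr0I less_le_not_le of_nat_0 of_nat_0_le_iff add_nonneg_nonneg zero_le_one)
    moreover have "real n + 1 < (1 - (real n + 1) * \<epsilon>) * real k"
      using k d by (simp add: pos_divide_less_eq mult.commute)
    ultimately show False
      using bound [of k] by (simp add: algebra_simps)
  qed
qed

text \<open>Over the hull of a hemispherical set, the Rips complex contracts towards the center,
  while the hemispherical complex is a cone with the center as apex.\<close>

lemma hull_carrier_Rips:
  assumes "- 1 / (real n + 1) \<le> \<kappa>" "\<kappa> < 1"
  shows "hull_carrier (Rips sph \<kappa>) hemispherical sph_hull"
proof
  show "simplicial_complex (Rips sph \<kappa>)"
    by (rule simplicial_complex_clique)
  show "simplicial_complex hemispherical"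
    by (rule simplicial_complex_hemispherical)
  show "Rips sph \<kappa> \<subseteq> hemispherical"
    by (rule Rips_hemispherical [OF assms(1)])
  fix s assume s: "s \<in> hemispherical"
  then have s': "finite s" "s \<subseteq> sph"
    by (auto simp: hemispherical_def)
  show "sph_hull t \<subseteq> sph_hull s" if "t \<subseteq> s" for t
    using sph_hull_mono s'(1) that .
  show "s \<subseteq> sph_hull s"
    using sph_hull_superset s' .
  assume ne: "s \<noteq> {}"
  obtain p where p: "p \<in> sph_hull s" "\<And>x. x \<in> sph_hull s \<Longrightarrow> 0 < ip x p"
    using hemispherical_center [OF s ne] by blast
  have "acyclic_complex (Rips (sph_hull s) \<kappa>)"
  proof (rule acyclic_Rips [OF sph_hull_sph p(1) _ _ assms(2)])
    show "0 \<le> ip x p" if "x \<in> sph_hull s" for x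
      using p(2) [OF that] by simp
    then show "contract p t x \<in> sph_hull s" if "x \<in> sph_hull s" "0 \<le> t" "t \<le> 1" for x t
      using contract_sph_hull [OF s'(2) that(1) p(1)] that by blast
  qed
  then show "acyclic_complex (Rips sph \<kappa> \<inter> Pow (sph_hull s))"
    using sph_hull_sph [of s] by (simp add: clique_Int_Pow Int_absorb1)
  obtain h where h: "\<And>v. v \<in> s \<Longrightarrow> 0 < ip h v"
    using s by (auto simp: hemispherical_def)
  have "insert p t \<in> hemispherical \<inter> Pow (sph_hull s)" if t: "t \<in> hemispherical \<inter> Pow (sph_hull s)" for t
  proof -
    have t': "finite (insert p t)" "insert p t \<subseteq> sph_hull s"
      using t p(1) by (auto simp: hemispherical_def)
    have "insert p t \<in> hemispherical"
    proof (rule hemisphericalI [OF t'(1), of h])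
      show "insert p t \<subseteq> sph"
        using t'(2) sph_hull_sph [of s] by (rule subset_trans)
      show "0 < ip h v" if "v \<in> insert p t" for v
        using sph_hull_positive [OF s'(1) h] that t'(2) by blast
    qed
    then show ?thesis
      using t'(2) by simp
  qed
  then show "acyclic_complex (hemispherical \<inter> Pow (sph_hull s))"
    by (rule acyclic_cone)
qed

end

lemma same_sign:
  fixes x y :: real
  assumes "(x - y)\<^sup>2 < y\<^sup>2"
  shows "0 < x * y"
proof -
  have "x\<^sup>2 < 2 * (x * y)"
    using assms by (simp add: power2_diff)
  then show ?thesis
    using zero_le_power2 [of x] by linarith
qed

context sphere
begin

subsection \<open>Homology of Rips complexes of spheres\<close>

definition axis :: "nat \<times> bool \<Rightarrow> nat \<Rightarrow> real" where
  "axis a = (\<lambda>j. if j = fst a then (if snd a then R else - R) else 0)"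

lemma ip_axis:
  assumes "fst a \<le> n"
  shows "ip h (axis a) = (if snd a then h (fst a) else - h (fst a)) / R"
proof -
  have "(\<Sum>i\<le>n. h i * axis a i) = (\<Sum>i\<le>n. if i = fst a then (if snd a then h i else - h i) * R else 0)"
    by (rule sum.cong) (auto simp: axis_def)
  also have "\<dots> = (if snd a then h (fst a) else - h (fst a)) * R"
    using assms by simp
  finally show ?thesis
    using R by (simp add: ip_def power2_eq_square)
qed

lemma axis_sph: "fst a \<le> n \<Longrightarrow> axis a \<in> sph"
  using R by (auto simp: sph_iff ip_axis) (auto simp: axis_def)

lemma axis_hemispherical:
  assumes t: "t \<in> cross_polytope (Suc n)"
  shows "axis ` t \<in> hemispherical"
proof -
  have le: "fst a \<le> n" if "a \<in> t" for a
    using t that by (auto simp: cross_polytope_def less_Suc_eq_le)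
  have inj: "inj_on fst t"
    using t by (simp add: cross_polytope_def)
  have "finite (fst ` t)"
    using t by (auto simp: cross_polytope_def intro: finite_subset)
  then have fin: "finite t"
    using inj by (rule finite_imageD)
  define h :: "nat \<Rightarrow> real" where "h i = (if (i, True) \<in> t then 1 else -1)" for i
  show ?thesis
  proof (rule hemisphericalI [of _ h])
    show "finite (axis ` t)" "axis ` t \<subseteq> sph"
      using fin le axis_sph by auto
    fix v assume "v \<in> axis ` t"
    then obtain i c where v: "(i, c) \<in> t" "v = axis (i, c)" by auto
    have "h i = (if c then 1 else -1)"
      using v(1) inj_onD [OF inj, of "(i, True)" "(i, c)"] by (auto simp: h_def)
    then show "0 < ip h v"
      using le [OF v(1)] R by (simp add: v(2) ip_axis)
  qed
qed

definition big_index :: "(nat \<Rightarrow> real) \<Rightarrow> nat" where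
  "big_index x = (SOME i. i \<le> n \<and> R\<^sup>2 \<le> (real n + 1) * (x i)\<^sup>2)"

text \<open>Not literally the nearest axis: any coordinate of absolute value at least
  \<open>R / sqrt (n + 1)\<close> is accepted, because points that are \<open>close\<close> share
  its sign.\<close>

definition nearest_axis :: "(nat \<Rightarrow> real) \<Rightarrow> nat \<times> bool" where
  "nearest_axis x = (big_index x, x (big_index x) > 0)"

lemma big_index:
  assumes "x \<in> sph"
  shows "big_index x \<le> n" "R\<^sup>2 \<le> (real n + 1) * (x (big_index x))\<^sup>2" "x (big_index x) \<noteq> 0"
proof -
  have "big_index x \<le> n \<and> R\<^sup>2 \<le> (real n + 1) * (x (big_index x))\<^sup>2"
    unfolding big_index_def using big_coordinate [OF assms] by (rule someI_ex)
  then show "big_index x \<le> n" "R\<^sup>2 \<le> (real n + 1) * (x (big_index x))\<^sup>2" "x (big_index x) \<noteq> 0"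
    using R by auto
qed

text \<open>For inner products above this value the squared chord is below
  \<open>R\<^sup>2 / (n + 1)\<close>, hence below the square of the selected coordinate, whose sign
  therefore cannot change.\<close>

definition close :: real where
  "close = 1 - 1 / (2 * (real n + 1))"

lemma close_bounds: "0 < close" "close < 1"
  by (auto simp: close_def field_simps)

lemma close_same_sign:
  assumes x: "x \<in> sph" and y: "y \<in> sph" and near: "close < ip x y"
    and i: "i \<le> n" "R\<^sup>2 \<le> (real n + 1) * (y i)\<^sup>2"
  shows "0 < x i * y i"
proof (rule same_sign)
  have "2 - 2 * ip x y < 1 / (real n + 1)"
    using near by (simp add: close_def field_simps)
  then have "R\<^sup>2 * (2 - 2 * ip x y) < R\<^sup>2 * (1 / (real n + 1))"
    using R by (intro mult_strict_left_mono) auto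
  also have "\<dots> \<le> (y i)\<^sup>2"
    using i(2) by (simp add: divide_le_eq mult.commute)
  finally show "(x i - y i)\<^sup>2 < (y i)\<^sup>2"
    using coordinate_diff [OF x y i(1)] by linarith
qed

lemma nearest_axis_simplicial:
  assumes s: "s \<in> Rips sph close"
  shows "nearest_axis ` s \<in> cross_polytope (Suc n)"
proof -
  have sub: "\<And>x. x \<in> s \<Longrightarrow> x \<in> sph" and near: "\<And>x y. x \<in> s \<Longrightarrow> y \<in> s \<Longrightarrow> close < ip x y"
    using s by (auto simp: clique_def)
  have "nearest_axis x = nearest_axis y" if "x \<in> s" "y \<in> s" "big_index x = big_index y" for x y
    using close_same_sign [OF sub [OF that(1)] sub [OF that(2)] near [OF that(1,2)] big_index(1,2) [OF sub [OF that(2)]]]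
    that(3) by (auto simp: nearest_axis_def zero_less_mult_iff)
  note eq = this
  have "inj_on fst (nearest_axis ` s)"
  proof (rule inj_onI)
    fix a b assume "a \<in> nearest_axis ` s" "b \<in> nearest_axis ` s" and ab: "fst a = fst b"
    then obtain x y where xy: "x \<in> s" "y \<in> s" "a = nearest_axis x" "b = nearest_axis y"
      by auto
    then have "big_index x = big_index y"
      using ab by (simp add: nearest_axis_def)
    then show "a = b"
      using eq [OF xy(1,2)] xy by simp
  qed
  then show ?thesis
    using big_index(1) sub by (auto simp: cross_polytope_def nearest_axis_def less_Suc_eq_le)
qed

lemma nearest_axis_hemispherical:
  assumes s: "s \<in> Rips sph close"
  shows "s \<union> (\<lambda>x. axis (nearest_axis x)) ` s \<in> hemispherical"
proof (cases "s = {}")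
  case True
  then show ?thesis by (simp add: hemispherical_def)
next
  case False
  then obtain x where x: "x \<in> s" by auto
  have sub: "\<And>x. x \<in> s \<Longrightarrow> x \<in> sph" and near: "\<And>x y. x \<in> s \<Longrightarrow> y \<in> s \<Longrightarrow> close < ip x y"
    using s by (auto simp: clique_def)
  show ?thesis
  \<comment> \<open>\<open>x\<close> itself serves as the pole: in the coordinate selected for a
    vertex \<open>y\<close> it has the same sign as \<open>y\<close>.\<close>
  proof (rule hemisphericalI [of _ x])
    show "finite (s \<union> (\<lambda>x. axis (nearest_axis x)) ` s)"
      using s by (simp add: clique_def)
    show "s \<union> (\<lambda>x. axis (nearest_axis x)) ` s \<subseteq> sph"
      using sub big_index(1) axis_sph by (auto simp: nearest_axis_def)
    fix v assume "v \<in> s \<union> (\<lambda>x. axis (nearest_axis x)) ` s"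
    then show "0 < ip x v"
    proof
      assume "v \<in> s"
      then show ?thesis
        using near [OF x] close_bounds by fastforce
    next
      assume "v \<in> (\<lambda>x. axis (nearest_axis x)) ` s"
      then obtain y where y: "y \<in> s" "v = axis (nearest_axis y)" by auto
      show ?thesis
        using close_same_sign [OF sub [OF x] sub [OF y(1)] near [OF x y(1)] big_index(1,2) [OF sub [OF y(1)]]] R
          big_index(1) [OF sub [OF y(1)]]
        by (auto simp: y(2) ip_axis nearest_axis_def zero_less_mult_iff zero_less_divide_iff divide_less_0_iff)
    qed
  qed
qed

text \<open>A coordinate of a point of the hull comes only from vertices of \<open>t\<close> on that
  axis. There is at most one, so it determines the sign. Passing to the sphere and back is thus
  carried by the simplices themselves.\<close>

lemma nearest_axis_hull:
  assumes t: "t \<in> cross_polytope (Suc n)" and y: "y \<in> sph_hull (axis ` t)"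
  shows "nearest_axis y \<in> t"
proof -
  obtain c where c: "y \<in> sph" "\<And>v. v \<in> axis ` t \<Longrightarrow> 0 \<le> c v" "y = combination c (axis ` t)"
    using y by (auto simp: sph_hull_def)
  define i where "i = big_index y"
  have yi: "y i = (\<Sum>v\<in>axis ` t. c v * v i)"
    by (simp add: c(3) combination_def)
  have "y i \<noteq> 0"
    using big_index(3) [OF c(1)] by (simp add: i_def)
  then obtain v where "v \<in> axis ` t" "v i \<noteq> 0"
    unfolding yi by (metis (no_types, lifting) mult_zero_right sum.neutral)
  then obtain b where b: "(i, b) \<in> t"
    by (auto simp: axis_def split: if_splits)
  have inj: "inj_on fst t"
    using t by (simp add: cross_polytope_def)
  have vi: "v i = (if b then R else - R) \<or> v i = 0" if v: "v \<in> axis ` t" for v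
  proof -
    obtain j b' where jb: "(j, b') \<in> t" "v = axis (j, b')"
      using v by auto
    show ?thesis
    proof (cases "j = i")
      case True
      then have "b' = b"
        using inj_onD [OF inj, of "(j, b')" "(i, b)"] jb(1) b by simp
      then show ?thesis
        using True by (simp add: jb(2) axis_def)
    qed (simp add: jb(2) axis_def)
  qed
  have "b = (y i > 0)"
  proof (cases b)
    case True
    have "0 \<le> y i"
      unfolding yi by (rule sum_nonneg) (use vi c(2) R True in force)
    then show ?thesis
      using True \<open>y i \<noteq> 0\<close> by simp
  next
    case False
    have "y i \<le> 0"
      unfolding yi by (rule sum_nonpos) (use vi c(2) R False in \<open>force simp: mult_nonneg_nonpos\<close>)
    then show ?thesis
      using False by simp
  qed
  then show ?thesis
    using b by (simp add: nearest_axis_def i_def)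
qed

text \<open>The inverse first retracts to the Rips complex at scale \<open>close\<close> and then
  moves vertices to axes. One composite is carried by \<open>Pow\<close>; the other is contiguous to
  the retraction, because a simplex and its axes share an open hemisphere.\<close>

lemma hemispherical_iso_cross_polytope:
  "homology_iso (push axis) (cross_polytope (Suc n)) hemispherical p"
proof -
  let ?X = "cross_polytope (Suc n)" and ?K0 = "Rips sph close"
  have "- 1 / (real n + 1) \<le> 0" by simp
  then have c1: "- 1 / (real n + 1) \<le> close" "close < 1"
    using close_bounds by linarith+
  interpret hull_carrier ?K0 hemispherical sph_hull
    by (rule hull_carrier_Rips [OF c1])
  show ?thesis
    unfolding homology_iso_def
  proof (intro conjI ballI allI)
    show "push axis (z + w) = push axis z + push axis w" for z w
      by (rule lin_add)
    fix z assume z: "z \<in> cycles ?X p"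
    show az: "push axis z \<in> cycles hemispherical p"
      using axis_hemispherical z by (rule push_cycles)
    show "push axis z \<in> boundaries hemispherical p \<longleftrightarrow> z \<in> boundaries ?X p"
    proof
      assume b: "push axis z \<in> boundaries hemispherical p"
      let ?f = "\<lambda>xs. push nearest_axis (\<rho> (map axis xs))"
      have "push nearest_axis (lin \<rho> (push axis z)) \<in> boundaries ?X p"
        using nearest_axis_simplicial \<rho>_boundaries [OF b] by (rule push_boundaries)
      then have 1: "lin ?f z \<in> boundaries ?X p"
        by (simp add: lin_lin)
      have "lin gen z + lin ?f z \<in> boundaries ?X p"
      proof (rule carried_homologous [OF simplicial_complex_cross_polytope, of _ Pow])
        show "carrier_on ?X Pow"
          by (auto simp: carrier_on_def simplicial_complex_def intro: acyclic_Pow)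
        show "carried ?X Pow gen"
          by (rule carried_gen) simp
        show "Pow s \<subseteq> ?X" if "s \<in> ?X" for s
          using that simplicial_complex_cross_polytope [of "Suc n"] by (auto simp: simplicial_complex_def)
        show "z \<in> cycles ?X p" by (rule z)
        show "carried ?X Pow ?f"
          unfolding carried_def
        proof (intro conjI allI impI)
          show "?f [] = gen []"
            by simp
          fix xs assume xs: "set xs \<in> ?X"
          have m: "set (map axis xs) \<in> hemispherical"
            using axis_hemispherical [OF xs] by simp
          have r: "\<rho> (map axis xs) \<in> chain_space (osimplices (?K0 \<inter> Pow (sph_hull (axis ` set xs))) (length xs))"
            "bd (\<rho> (map axis xs)) = lin \<rho> (faces (map axis xs))"
            using carried_\<rho> [unfolded carried_def, THEN conjunct2, rule_format, OF m] by simp_all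
          show "?f xs \<in> chain_space (osimplices (Pow (set xs)) (length xs))"
          proof (rule push_chains [OF _ r(1)])
            fix s assume "s \<in> ?K0 \<inter> Pow (sph_hull (axis ` set xs))"
            then show "nearest_axis ` s \<in> Pow (set xs)"
              using nearest_axis_hull [OF xs] by auto
          qed
          show "bd (?f xs) = lin ?f (faces xs)"
            unfolding bd_push r(2) faces_map by (simp add: lin_lin)
        qed
      qed
      then have "z + lin ?f z \<in> boundaries ?X p" by simp
      from boundaries_add [OF this 1] show "z \<in> boundaries ?X p"
        by (simp add: add.assoc)
    next
      assume "z \<in> boundaries ?X p"
      with axis_hemispherical show "push axis z \<in> boundaries hemispherical p"
        by (rule push_boundaries)
    qed
  next
    fix z assume z: "z \<in> cycles hemispherical p"
    let ?y = "lin \<rho> z"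
    have y: "?y \<in> cycles ?K0 p"
      by (rule \<rho>_cycles [OF z])
    have "push (\<lambda>x. x) ?y + push (\<lambda>x. axis (nearest_axis x)) ?y \<in> boundaries hemispherical p"
    proof (rule contiguous_homologous [OF simplicial_complex_clique simplicial_complex_hemispherical _ y])
      show "(\<lambda>x. x) ` s \<union> (\<lambda>x. axis (nearest_axis x)) ` s \<in> hemispherical" if "s \<in> ?K0" for s
        using nearest_axis_hemispherical [OF that] by simp
    qed
    then have "?y + push axis (push nearest_axis ?y) \<in> boundaries hemispherical p"
      by (simp add: push_push)
    with \<rho>_homologous [OF z] have "z + push axis (push nearest_axis ?y) \<in> boundaries hemispherical p"
      by (rule boundaries_trans)
    moreover have "push nearest_axis ?y \<in> cycles ?X p"
      using nearest_axis_simplicial y by (rule push_cycles)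
    ultimately show "\<exists>w\<in>cycles ?X p. z + push axis w \<in> boundaries hemispherical p"
      by blast
  qed
qed

lemma Rips_iso_hemispherical:
  "- 1 / (real n + 1) \<le> \<kappa> \<Longrightarrow> \<kappa> < 1 \<Longrightarrow> homology_iso (\<lambda>z. z) (Rips sph \<kappa>) hemispherical p"
  by (rule hull_carrier.inclusion_iso [OF hull_carrier_Rips])

lemma Rips_homology:
  assumes "- 1 / (real n + 1) \<le> \<kappa>" "\<kappa> < 1"
  shows "hom_line (Rips sph \<kappa>) (Suc n)" and "p \<noteq> Suc n \<Longrightarrow> hom_zero (Rips sph \<kappa>) p"
proof -
  show "hom_line (Rips sph \<kappa>) (Suc n)"
    using homology_iso_hom_line [OF hemispherical_iso_cross_polytope] cross_polytope_homology
      hom_line_inverse [OF Rips_iso_hemispherical [OF assms]] by blast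
  show "hom_zero (Rips sph \<kappa>) p" if "p \<noteq> Suc n"
    using homology_iso_hom_zero [OF hemispherical_iso_cross_polytope [of p]] cross_polytope_homology that
      homology_iso_hom_zero [OF Rips_iso_hemispherical [OF assms, of p]] by blast
qed

lemma Rips_mono: "\<kappa> \<le> \<kappa>' \<Longrightarrow> Rips sph \<kappa>' \<subseteq> Rips sph \<kappa>"
  by (rule clique_mono) auto

lemma Rips_iso:
  assumes "- 1 / (real n + 1) \<le> \<kappa>" "\<kappa> \<le> \<kappa>'" "\<kappa>' < 1"
  shows "homology_iso (\<lambda>z. z) (Rips sph \<kappa>') (Rips sph \<kappa>) p"
proof (rule homology_iso_id [OF Rips_mono [OF assms(2)]])
  have sub: "Rips sph \<kappa> \<subseteq> hemispherical"
    by (rule Rips_hemispherical [OF assms(1)])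
  have iso: "homology_iso (\<lambda>z. z) (Rips sph \<kappa>) hemispherical p"
    and iso': "homology_iso (\<lambda>z. z) (Rips sph \<kappa>') hemispherical p"
    using assms by (auto intro: Rips_iso_hemispherical)
  show "z \<in> boundaries (Rips sph \<kappa>') p" if "z \<in> cycles (Rips sph \<kappa>') p" "z \<in> boundaries (Rips sph \<kappa>) p" for z
    using iso' that(1) boundaries_mono [OF that(2) sub] by (auto simp: homology_iso_def)
  show "\<exists>w\<in>cycles (Rips sph \<kappa>') p. z + w \<in> boundaries (Rips sph \<kappa>) p" if z: "z \<in> cycles (Rips sph \<kappa>) p" for z
  proof -
    obtain w where w: "w \<in> cycles (Rips sph \<kappa>') p" "z + w \<in> boundaries hemispherical p"
      using iso' cycles_mono [OF z sub] by (auto simp: homology_iso_def)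
    have "z + w \<in> cycles (Rips sph \<kappa>) p"
      using cycles_add [OF z cycles_mono [OF w(1) Rips_mono [OF assms(2)]]] .
    then have "z + w \<in> boundaries (Rips sph \<kappa>) p"
      using iso w(2) by (auto simp: homology_iso_def)
    then show ?thesis using w(1) by blast
  qed
qed

end

context sphere
begin

subsection \<open>Caps\<close>

lemma perpendicular_exists:
  assumes "0 < n" "p \<in> sph"
  shows "\<exists>u\<in>sph. ip u p = 0"
proof -
  have "\<exists>j\<le>n. (p j)\<^sup>2 < R\<^sup>2"
  proof (rule ccontr)
    assume "\<not> ?thesis"
    then have "(\<Sum>j\<le>n. R\<^sup>2) \<le> (\<Sum>j\<le>n. (p j)\<^sup>2)"
      by (intro sum_mono) (auto simp: not_less)
    moreover have "(\<Sum>j\<le>n. (p j)\<^sup>2) = R\<^sup>2"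
      using assms(2) by (simp add: round_sphere_def)
    ultimately show False
      using assms(1) R by (simp add: mult_le_cancel_right1)
  qed
  then obtain j where j: "j \<le> n" "(p j)\<^sup>2 < R\<^sup>2" by blast
  define e where "e = axis (j, True)"
  define c where "c = p j / R"
  have e: "e \<in> sph" "ip p e = c" "ip e p = c"
    using j(1) ip_axis [of "(j, True)" p] axis_sph [of "(j, True)"] ip_commute [of p e] by (simp_all add: e_def c_def)
  have c1: "c\<^sup>2 < 1"
    using j(2) R by (simp add: c_def power_divide)
  let ?w = "\<lambda>i. 1 * e i + (- c) * p i"
  have ww: "ip ?w ?w = 1 - c\<^sup>2" and wp: "ip ?w p = 0"
    unfolding ip_combine_left ip_combine_right using e assms(2) by (simp_all add: sphD power2_eq_square)
  have "normalize ?w \<in> sph"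
    by (rule normalize_sph) (use ww c1 sphD(2) [OF e(1)] sphD(2) [OF assms(2)] in simp_all)
  moreover have "ip (normalize ?w) p = 0"
    unfolding ip_normalize_left wp by simp
  ultimately show ?thesis by blast
qed

lemma perpendicular_direction:
  assumes n: "0 < n" and x: "x \<in> sph" and p: "p \<in> sph"
  shows "\<exists>u\<in>sph. ip u p = 0 \<and> ip x u = sqrt (1 - (ip x p)\<^sup>2)"
proof -
  let ?w = "\<lambda>i. 1 * x i + (- ip x p) * p i"
  have ww: "ip ?w ?w = 1 - (ip x p)\<^sup>2" and wp: "ip ?w p = 0" and xw: "ip x ?w = 1 - (ip x p)\<^sup>2"
    unfolding ip_combine_left ip_combine_right using x p ip_commute [of p x]
    by (simp_all add: sphD power2_eq_square)
  show ?thesis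
  proof (cases "0 < ip ?w ?w")
    case True
    have "normalize ?w \<in> sph"
      by (rule normalize_sph [OF True]) (use sphD(2) [OF x] sphD(2) [OF p] in simp)
    moreover have "ip (normalize ?w) p = 0"
      unfolding ip_normalize_left wp by simp
    moreover have "ip x (normalize ?w) = sqrt (1 - (ip x p)\<^sup>2)"
      unfolding ip_normalize_right ww xw using True [unfolded ww] by (simp add: real_div_sqrt)
    ultimately show ?thesis by blast
  next
    case False
    then have 0: "ip ?w ?w = 0"
      using ip_nonneg [of ?w] by linarith
    obtain u where u: "u \<in> sph" "ip u p = 0"
      using perpendicular_exists [OF n p] by blast
    have "(ip ?w u)\<^sup>2 \<le> 0"
      using ip_Cauchy_Schwarz [of ?w u] unfolding 0 by simp
    moreover have "ip ?w u = ip x u"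
      unfolding ip_combine_left using u(2) ip_commute [of p u] by simp
    ultimately have "ip x u = 0" by simp
    then show ?thesis
      using u ww 0 by (intro bexI [of _ u]) auto
  qed
qed

text \<open>The point at angle \<open>arccos C\<close> from \<open>p\<close> on a great circle from
  \<open>p\<close> through \<open>x\<close>; its inner product with \<open>x\<close> is the cosine
  of a difference of angles.\<close>

lemma cap_point:
  assumes "0 < n" "x \<in> sph" "p \<in> sph" "0 \<le> C" "C \<le> 1"
  shows "\<exists>w\<in>sph. ip w p = C \<and> ip x w = C * ip x p + sqrt (1 - C\<^sup>2) * sqrt (1 - (ip x p)\<^sup>2)"
proof -
  obtain u where u: "u \<in> sph" "ip u p = 0" "ip x u = sqrt (1 - (ip x p)\<^sup>2)"
    using perpendicular_direction [OF assms(1-3)] by blast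
  have pu: "ip p u = 0"
    using u(2) ip_commute [of p u] by simp
  let ?w = "\<lambda>i. C * p i + sqrt (1 - C\<^sup>2) * u i"
  have C: "C\<^sup>2 \<le> 1"
    using assms by (simp add: abs_square_le_1)
  have "ip ?w ?w = C * C + sqrt (1 - C\<^sup>2) * sqrt (1 - C\<^sup>2)"
    unfolding ip_combine_left ip_combine_right using u pu assms(3) by (simp add: sphD)
  also have "\<dots> = 1"
    using C by (simp add: power2_eq_square)
  finally have "?w \<in> sph"
    using sphD(2) [OF assms(3)] sphD(2) [OF u(1)] by (simp add: sph_iff)
  moreover have "ip ?w p = C"
    unfolding ip_combine_left using u(2) assms(3) by (simp add: sphD)
  moreover have "ip x ?w = C * ip x p + sqrt (1 - C\<^sup>2) * sqrt (1 - (ip x p)\<^sup>2)"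
    unfolding ip_combine_right u(3) ..
  ultimately show ?thesis by blast
qed

text \<open>
  Every point is within angle \<open>2\<pi>/3\<close> of the cap of angular radius \<open>\<pi>/3\<close>, whose diameter
  is \<open>2\<pi>/3\<close>.
\<close>

lemma Rips_cycle_dies:
  assumes n: "0 < n" and \<kappa>: "98/100 \<le> \<kappa>" "\<kappa>' \<le> - (7/10)" and z: "z \<in> cycles (Rips sph \<kappa>) k"
  shows "z \<in> boundaries (Rips sph \<kappa>') k"
proof -
  define p where "p = axis (0, True)"
  have p: "p \<in> sph"
    by (simp add: p_def axis_sph)
  have "\<exists>w. w \<in> sph \<and> 1/2 \<le> ip w p \<and> - (1/2) \<le> ip x w" if x: "x \<in> sph" for x
  proof -
    obtain w where w: "w \<in> sph" "ip w p = 1/2" "ip x w = 1/2 * ip x p + sqrt (1 - (1/2)\<^sup>2) * sqrt (1 - (ip x p)\<^sup>2)"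
      using cap_point [OF n x p, of "1/2"] by auto
    have "0 \<le> sqrt (1 - (1/2)\<^sup>2) * sqrt (1 - (ip x p)\<^sup>2)"
      using ip_bounds(1) [OF x p] by (intro mult_nonneg_nonneg real_sqrt_ge_zero) (simp_all add: abs_square_le_1 power_divide)
    then have "- (1/2) \<le> ip x w"
      unfolding w(3) using ip_bounds(3) [OF x p] by linarith
    then show ?thesis using w by auto
  qed
  then obtain g where g: "\<And>x. x \<in> sph \<Longrightarrow> g x \<in> sph" "\<And>x. x \<in> sph \<Longrightarrow> 1/2 \<le> ip (g x) p"
    "\<And>x. x \<in> sph \<Longrightarrow> - (1/2) \<le> ip x (g x)"
    by metis
  have gg: "\<kappa>' < ip (g x) (g y)" if "x \<in> sph" "y \<in> sph" for x y
    using ip_cap [OF g(1) [OF that(1)] g(1) [OF that(2)] p, of "1/2"] g(2) that \<kappa>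
    by (fastforce simp: power2_eq_square)
  have xg: "\<kappa>' < ip x (g y)" if xy: "x \<in> sph" "y \<in> sph" "\<kappa> < ip x y" for x y
  proof -
    \<comment> \<open>\<open>2 - 2 * (98/100) = (2/10)\<^sup>2\<close>, so replacing
      \<open>y\<close> by \<open>x\<close> costs less than 2/10, and
      \<open>- (1/2) - 2/10 = - (7/10)\<close>, which still exceeds cos (3\<pi>/4).\<close>
    have "sqrt (2 - 2 * ip x y) \<le> sqrt ((2/10)\<^sup>2)"
      using xy(3) \<kappa> by (intro real_sqrt_le_mono) (simp add: power2_eq_square)
    then have "sqrt (2 - 2 * ip x y) \<le> 2/10" by simp
    moreover have "sqrt (2 - 2 * ip x y) \<noteq> 2/10"
    proof
      assume "sqrt (2 - 2 * ip x y) = 2/10"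
      then have "2 - 2 * ip x y = (2/10)\<^sup>2"
        using ip_bounds(2) [OF xy(1,2)] by (metis diff_ge_0_iff_ge mult_2 add_mono one_add_one real_sqrt_pow2)
      then show False
        using xy(3) \<kappa> by (simp add: power2_eq_square)
    qed
    ultimately show ?thesis
      using ip_diff [OF xy(1,2) g(1) [OF xy(2)]] g(3) [OF xy(2)] \<kappa>(2) by linarith
  qed
  have "push (\<lambda>x. x) z + push g z \<in> boundaries (Rips sph \<kappa>') k"
  proof (rule contiguous_homologous [OF simplicial_complex_clique simplicial_complex_clique _ z])
    fix s assume s: "s \<in> Rips sph \<kappa>"
    have s': "x \<in> sph" "\<kappa> < ip x y" if "x \<in> s" "y \<in> s" for x y
      using cliqueD [OF s] that by auto
    have "\<kappa>' < ip x y" if "x \<in> s" "y \<in> s" for x y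
      using s'(2) [OF that] \<kappa> by linarith
    then show "(\<lambda>x. x) ` s \<union> g ` s \<in> Rips sph \<kappa>'"
      using s s' g(1) gg xg ip_commute by (auto simp: clique_def)
  qed
  \<comment> \<open>Any two points of the image of \<open>g\<close> are adjacent, so their Rips
    complex is a cone.\<close>
  moreover have "push g z \<in> boundaries (Rips sph \<kappa>') k"
  proof -
    have "g ` s \<in> Rips (g ` sph) \<kappa>'" if "s \<in> Rips sph \<kappa>" for s
      by (rule clique_image [OF that imageI]) (assumption, rule gg)
    then have "push g z \<in> cycles (Rips (g ` sph) \<kappa>') k"
      by (rule push_cycles [OF _ z])
    moreover have "insert (g p) s \<in> Rips (g ` sph) \<kappa>'" if "s \<in> Rips (g ` sph) \<kappa>'" for s
      using that p gg by (auto simp: clique_def)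
    then have "acyclic_complex (Rips (g ` sph) \<kappa>')"
      by (rule acyclic_cone)
    ultimately have "push g z \<in> boundaries (Rips (g ` sph) \<kappa>') k"
      by (auto simp: acyclic_complex_def)
    then show ?thesis
      by (rule boundaries_mono) (rule clique_mono, use g(1) in auto)
  qed
  ultimately show ?thesis
    using boundaries_add_cancel [of "push g z" _ k z] by (simp add: add.commute)
qed

subsection \<open>Projective spaces\<close>

definition antipode :: "(nat \<Rightarrow> real) \<Rightarrow> nat \<Rightarrow> real" where
  "antipode x = (\<lambda>i. - x i)"

definition line :: "(nat \<Rightarrow> real) \<Rightarrow> (nat \<Rightarrow> real) set" where
  "line x = {x, antipode x}"

definition closer_lift :: "(nat \<Rightarrow> real) \<Rightarrow> (nat \<Rightarrow> real) set \<Rightarrow> nat \<Rightarrow> real" where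
  "closer_lift x v = (SOME y. y \<in> v \<and> 0 < ip x y)"

definition line_near :: "real \<Rightarrow> (nat \<Rightarrow> real) set \<Rightarrow> (nat \<Rightarrow> real) set \<Rightarrow> bool" where
  "line_near \<kappa> u v \<longleftrightarrow> (\<exists>x\<in>u. \<exists>y\<in>v. \<kappa> < ip x y)"

lemma antipode_antipode [simp]: "antipode (antipode x) = x"
  by (simp add: antipode_def)

lemma antipode_sph: "x \<in> sph \<Longrightarrow> antipode x \<in> sph"
  by (simp add: sph_iff antipode_def ip_minus_left ip_minus_right)

lemma ip_antipode: "ip (antipode x) y = - ip x y" "ip x (antipode y) = - ip x y"
  by (simp_all add: antipode_def ip_minus_left ip_minus_right)

lemma line_eq_iff: "line x = line y \<longleftrightarrow> y = x \<or> y = antipode x"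
  by (auto simp: line_def doubleton_eq_iff)

lemma line_near_line: "line_near \<kappa> (line x) (line y) \<longleftrightarrow> \<kappa> < ip x y \<or> \<kappa> < - ip x y"
  by (auto simp: line_near_def line_def ip_antipode)

text \<open>Two neighbours \<open>x\<close>, \<open>z\<close> of \<open>y\<close> have inner product
  at least \<open>2 * \<kappa>\<^sup>2 - 1\<close>, and this is at least \<open>- \<kappa>\<close>
  because \<open>\<kappa> \<ge> 1/2\<close>; so \<open>x\<close> cannot be near the antipode of
  \<open>z\<close>. This is the one condition that limits the scale.\<close>

lemma double_cover_line:
  assumes \<kappa>: "1/2 \<le> \<kappa>" "\<kappa> < 1"
  shows "double_cover sph antipode line closer_lift (\<lambda>x y. \<kappa> < ip x y) (line_near \<kappa>)"
proof
  fix x y z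
  assume x: "x \<in> sph"
  show "antipode x \<in> sph" "antipode (antipode x) = x" "\<kappa> < ip x x"
    using x \<kappa> by (simp_all add: antipode_sph sphD)
  assume y: "y \<in> sph"
  show "line x = line y \<longleftrightarrow> y = x \<or> y = antipode x"
    by (rule line_eq_iff)
  show "line_near \<kappa> (line x) (line y) \<longleftrightarrow> \<kappa> < ip x y \<or> \<kappa> < ip x (antipode y)"
    by (simp add: line_near_line ip_antipode)
  assume xy: "\<kappa> < ip x y"
  show "\<kappa> < ip y x" "\<kappa> < ip (antipode x) (antipode y)" "\<not> \<kappa> < ip x (antipode y)"
    using xy \<kappa> ip_commute [of x y] by (simp_all add: ip_antipode)
  assume z: "z \<in> sph" "\<kappa> < ip y z" and xz: "\<kappa> < ip x z \<or> \<kappa> < ip x (antipode z)"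
  have "2 * \<kappa>\<^sup>2 - 1 \<le> ip x z"
    by (rule ip_cap [OF x z(1) y]) (use xy z(2) \<kappa> ip_commute [of y z] in auto)
  moreover have "0 \<le> (2 * \<kappa> - 1) * (\<kappa> + 1)"
    using \<kappa> by simp
  then have "- \<kappa> \<le> 2 * \<kappa>\<^sup>2 - 1"
    by (simp add: algebra_simps power2_eq_square)
  ultimately show "\<kappa> < ip x z"
    using xz by (auto simp: ip_antipode)
next
  fix x v assume x: "x \<in> sph" and v: "v \<in> line ` sph" "line_near \<kappa> (line x) v"
  obtain y where y: "y \<in> sph" "v = line y" using v(1) by auto
  have b: "\<kappa> < ip x y \<or> \<kappa> < - ip x y"
    using v(2) by (simp add: y line_near_line)
  have "\<exists>y'. y' \<in> v \<and> 0 < ip x y'"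
    using b \<kappa> by (auto simp: y(2) line_def ip_antipode)
  then have *: "closer_lift x v \<in> v \<and> 0 < ip x (closer_lift x v)"
    unfolding closer_lift_def by (rule someI_ex)
  then have "closer_lift x v = y \<or> closer_lift x v = antipode y"
    by (auto simp: y(2) line_def)
  then show "closer_lift x v \<in> sph \<and> line (closer_lift x v) = v \<and> \<kappa> < ip x (closer_lift x v)"
    using * b \<kappa> y antipode_sph by (auto simp: ip_antipode line_eq_iff)
qed

text \<open>It trivializes the double cover over the affine chart where the \<open>i\<close>-th
  coordinate is nonzero; elsewhere the choice is arbitrary.\<close>

definition sign_section :: "nat \<Rightarrow> (nat \<Rightarrow> real) set \<Rightarrow> nat \<Rightarrow> real" where
  "sign_section i v = (SOME x. x \<in> v \<and> ((\<exists>y\<in>v. 0 < y i) \<longrightarrow> 0 < x i))"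

lemma sign_section:
  assumes "x \<in> sph"
  shows "sign_section i (line x) \<in> line x" "x i \<noteq> 0 \<Longrightarrow> 0 < sign_section i (line x) i"
proof -
  have "\<exists>y. y \<in> line x \<and> ((\<exists>y\<in>line x. 0 < y i) \<longrightarrow> 0 < y i)"
    by (auto simp: line_def)
  then have *: "sign_section i (line x) \<in> line x \<and> ((\<exists>y\<in>line x. 0 < y i) \<longrightarrow> 0 < sign_section i (line x) i)"
    unfolding sign_section_def by (rule someI_ex)
  then show "sign_section i (line x) \<in> line x" by simp
  show "0 < sign_section i (line x) i" if "x i \<noteq> 0"
  proof -
    have "\<exists>y\<in>line x. 0 < y i"
      using that by (cases "0 < x i") (auto simp: line_def antipode_def)
    then show ?thesis using * by simp
  qed
qed

lemma sign_section_sect: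
  assumes "1/2 \<le> (\<kappa> :: real)" "\<kappa> < 1"
  shows "double_cover.sect sph line (sign_section i)"
  unfolding double_cover.sect_def [OF double_cover_line [OF assms]]
proof
  fix v assume "v \<in> line ` sph"
  then obtain x where x: "x \<in> sph" "v = line x" by auto
  then show "sign_section i v \<in> sph \<and> line (sign_section i v) = v"
    using sign_section(1) [OF x(1), of i] antipode_sph by (auto simp: line_def)
qed

abbreviation "Lines \<kappa> \<equiv> clique (line ` sph) (line_near \<kappa>)"

lemma Lines_mono: "\<kappa> \<le> \<kappa>' \<Longrightarrow> Lines \<kappa>' \<subseteq> Lines \<kappa>"
  by (rule clique_mono) (force simp: line_near_def)+

lemma close_half: "1/2 \<le> close"
  by (simp add: close_def field_simps)

text \<open>Take a coordinate that is big at one vertex. At scale \<open>close\<close> it is nonzero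
  on all the others, and representatives with positive coordinate are near the one of the first
  vertex, hence near each other by \<open>N_triangle\<close>.\<close>

lemma sign_section_cover:
  assumes t: "t \<in> Lines close"
  shows "\<exists>i\<le>n. \<forall>u\<in>t. \<forall>v\<in>t. closer_lift (sign_section i u) v = sign_section i v"
proof (cases "t = {}")
  case False
  interpret double_cover sph antipode line closer_lift "\<lambda>x y. close < ip x y" "line_near close"
    by (rule double_cover_line [OF close_half close_bounds(2)])
  obtain u0 where u0: "u0 \<in> t" using False by auto
  then obtain x0 where x0: "x0 \<in> sph" "u0 = line x0"
    using cliqueD(1) [OF t] by auto
  define i where "i = big_index x0"
  define x where "x = sign_section i u0"
  have s: "sect (sign_section i)"
    by (rule sign_section_sect [OF close_half close_bounds(2)])
  have i: "i \<le> n" "R\<^sup>2 \<le> (real n + 1) * (x0 i)\<^sup>2" "x0 i \<noteq> 0"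
    using big_index [OF x0(1)] by (auto simp: i_def)
  have "x = x0 \<or> x = antipode x0"
    using sign_section(1) [OF x0(1), of i] by (auto simp: x_def x0(2) line_def)
  then have xi: "R\<^sup>2 \<le> (real n + 1) * (x i)\<^sup>2" and x: "x \<in> sph" "line x = u0"
    using i(2) x0 antipode_sph by (auto simp: antipode_def line_eq_iff [symmetric]) 
      (auto simp: line_def antipode_def)
  have xpos: "0 < x i"
    using sign_section(2) [OF x0(1) i(3)] by (simp add: x_def x0(2))
  have near: "sign_section i v \<in> sph \<and> line (sign_section i v) = v \<and> close < ip x (sign_section i v)" if v: "v \<in> t" for v
  proof -
    obtain y where y: "y \<in> sph" "v = line y"
      using cliqueD(1) [OF t v] by auto
    have sv: "sign_section i v \<in> sph" "line (sign_section i v) = v"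
      using s cliqueD(1) [OF t v] by (auto simp: sect_def)
    have "line_near close (line x) (line (sign_section i v))"
      using cliqueD(2) [OF t u0 v] by (simp add: x sv)
    then have b: "close < ip x (sign_section i v) \<or> close < ip x (antipode (sign_section i v))"
      by (simp add: line_near_line ip_antipode)
    have nz: "sign_section i v i \<noteq> 0"
      using b close_same_sign [OF sv(1) x(1) _ i(1) xi] close_same_sign [OF antipode_sph [OF sv(1)] x(1) _ i(1) xi]
      by (auto simp: antipode_def ip_commute)
    have "0 < sign_section i v i"
    proof -
      have "y = sign_section i v \<or> y = antipode (sign_section i v)"
        using sv(2) y(2) by (simp add: line_eq_iff)
      then have "y i \<noteq> 0"
        using nz by (auto simp: antipode_def)
      then show ?thesis
        using sign_section(2) [OF y(1)] y(2) by simp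
    qed
    moreover have "\<not> close < ip x (antipode (sign_section i v)) \<or> 0 < antipode (sign_section i v) i"
      using close_same_sign [OF antipode_sph [OF sv(1)] x(1) _ i(1) xi] xpos
      by (auto simp: ip_commute zero_less_mult_iff)
    ultimately show ?thesis
      using b sv by (auto simp: antipode_def)
  qed
  have "closer_lift (sign_section i u) v = sign_section i v" if u: "u \<in> t" and v: "v \<in> t" for u v
  proof -
    let ?a = "sign_section i u" and ?b = "sign_section i v"
    have a: "?a \<in> sph" "line ?a = u" "close < ip x ?a" and b: "?b \<in> sph" "line ?b = v" "close < ip x ?b"
      using near u v by auto
    have "close < ip ?a ?b \<or> close < ip ?a (antipode ?b)"
      using cliqueD(2) [OF t u v] line_near_line [of close ?a ?b] a b by (simp add: ip_antipode)
    then have "close < ip ?a ?b"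
      using N_triangle [OF a(1) x(1) b(1)] a(3) b(3) ip_commute by metis
    then show ?thesis
      using nr_eqI [OF a(1) b(1)] b(2) by simp
  qed
  then show ?thesis using i(1) by blast
qed auto

lemma sph_nonempty: "sph \<noteq> {}"
  using axis_sph [of "(0, True)"] by auto

lemma minus_inverse_le_half: "- 1 / (real n + 1) \<le> 1/2"
proof -
  have "- 1 / (real n + 1) \<le> 0" by simp
  then show ?thesis by linarith
qed

text \<open>At scales finer than \<open>close\<close> the \<open>n + 1\<close> sign sections lift
  all simplices. Coarser scales inherit the vanishing through \<open>hom_zero_big\<close>, since the
  inclusion of the Rips complexes of the sphere is an isomorphism on homology.\<close>

lemma Lines_hom_zero_above:
  assumes n: "0 < n" and \<kappa>: "1/2 \<le> \<kappa>" "\<kappa> < 1" and m: "n < m"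
  shows "hom_zero (Lines \<kappa>) (Suc m)"
proof -
  have *: "hom_zero (Lines \<mu>) (Suc m)" if \<mu>: "close \<le> \<mu>" "\<mu> < 1" for \<mu>
  proof -
    have \<mu>2: "1/2 \<le> \<mu>" using close_half \<mu> by linarith
    interpret double_cover sph antipode line closer_lift "\<lambda>x y. \<mu> < ip x y" "line_near \<mu>"
      by (rule double_cover_line [OF \<mu>2 \<mu>(2)])
    show ?thesis
    proof (rule cover_hom_zero_above [of m "map sign_section [0..<Suc n]"])
      show "hom_zero (Rips sph \<mu>) (Suc k)" if "m \<le> k" for k
        using Rips_homology(2) [of \<mu> "Suc k"] \<mu>2 \<mu>(2) minus_inverse_le_half m that by simp
      show "sect s" if "s \<in> set (map sign_section [0..<Suc n])" for s
        using that sign_section_sect [OF \<mu>2 \<mu>(2)] by auto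
      show "\<exists>s\<in>set (map sign_section [0..<Suc n]). \<forall>u\<in>t. \<forall>v\<in>t. closer_lift (s u) v = s v" if "t \<in> Lines \<mu>" for t
      proof -
        have "t \<in> Lines close"
          using Lines_mono [OF \<mu>(1)] that by blast
        then obtain i where "i \<le> n" "\<forall>u\<in>t. \<forall>v\<in>t. closer_lift (sign_section i u) v = sign_section i v"
          using sign_section_cover by blast
        then show ?thesis
          by (intro bexI [of _ "sign_section i"]) (simp_all add: less_Suc_eq_le del: upt_Suc)
      qed
    qed
  qed
  show ?thesis
  proof (cases "close \<le> \<kappa>")
    case False
    interpret double_cover_pair sph antipode line closer_lift "\<lambda>x y. close < ip x y" "line_near close"
      "\<lambda>x y. \<kappa> < ip x y" "line_near \<kappa>"
    proof -
      interpret a: double_cover sph antipode line closer_lift "\<lambda>x y. close < ip x y" "line_near close"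
        by (rule double_cover_line [OF close_half close_bounds(2)])
      interpret b: double_cover sph antipode line closer_lift "\<lambda>x y. \<kappa> < ip x y" "line_near \<kappa>"
        by (rule double_cover_line [OF \<kappa>])
      show "double_cover_pair sph antipode line closer_lift (\<lambda>x y. close < ip x y) (line_near close)
          (\<lambda>x y. \<kappa> < ip x y) (line_near \<kappa>)"
        by standard (use False in auto)
    qed
    obtain k where k: "m = Suc k" using m by (cases m) auto
    show ?thesis
      unfolding k
    proof (rule hom_zero_big)
      show "homology_iso (\<lambda>z. z) (Rips sph close) (Rips sph \<kappa>) p" for p
        by (rule Rips_iso) (use False \<kappa> close_bounds minus_inverse_le_half in auto)
      show "small.sect (sign_section 0)"
        by (rule sign_section_sect [OF close_half close_bounds(2)])
      show "hom_zero (Lines close) (Suc (Suc k))"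
        using * [of close] close_bounds k by simp
    qed
  qed (use * \<kappa> in simp)
qed

abbreviation "line_ev \<equiv> ev closer_lift (sign_section 0)"

lemma Lines_homology:
  assumes n: "0 < n" and \<kappa>: "1/2 \<le> \<kappa>" "\<kappa> < 1" and m: "0 < m" "m \<le> n"
  shows "hom_line (Lines \<kappa>) (Suc m)"
    and "z \<in> cycles (Lines \<kappa>) (Suc m) \<Longrightarrow> z \<in> boundaries (Lines \<kappa>) (Suc m) \<longleftrightarrow> line_ev m z = 0"
proof -
  interpret double_cover sph antipode line closer_lift "\<lambda>x y. \<kappa> < ip x y" "line_near \<kappa>"
    by (rule double_cover_line [OF \<kappa>])
  have \<kappa>': "- 1 / (real n + 1) \<le> \<kappa>"
    using minus_inverse_le_half \<kappa> by linarith
  have S: "hom_zero (Rips sph \<kappa>) (Suc k)" if "k < n" for k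
    using Rips_homology(2) [OF \<kappa>' \<kappa>(2), of "Suc k"] that by simp
  note * = cover_homology [OF sign_section_sect [OF \<kappa>] sph_nonempty S Rips_homology(1) [OF \<kappa>' \<kappa>(2)]
      Lines_hom_zero_above [OF n \<kappa>] m]
  show "hom_line (Lines \<kappa>) (Suc m)"
    using * by blast
  show "z \<in> boundaries (Lines \<kappa>) (Suc m) \<longleftrightarrow> line_ev m z = 0" if "z \<in> cycles (Lines \<kappa>) (Suc m)"
    using * that by blast
qed

lemma Lines_hom_zero_1:
  assumes "0 < n" "1/2 \<le> \<kappa>" "\<kappa> < 1"
  shows "hom_zero (Lines \<kappa>) (Suc 0)"
proof -
  interpret double_cover sph antipode line closer_lift "\<lambda>x y. \<kappa> < ip x y" "line_near \<kappa>"
    by (rule double_cover_line [OF assms(2,3)])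
  have "- 1 / (real n + 1) \<le> \<kappa>"
    using minus_inverse_le_half assms by linarith
  then show ?thesis
    using cover_hom_zero_1 [OF sign_section_sect [OF assms(2,3)]] Rips_homology(2) [of \<kappa> "Suc 0"] assms by simp
qed

text \<open>
  Here the cap around a line has angular radius \<open>\<pi>/6\<close>, and every line is within angle \<open>\<pi>/3\<close>
  of it.
\<close>

lemma Lines_cycle_dies:
  assumes n: "0 < n" and \<kappa>: "995/1000 \<le> \<kappa>" "\<kappa>' < 4/10" and z: "z \<in> cycles (Lines \<kappa>) k"
  shows "z \<in> boundaries (Lines \<kappa>') k"
proof -
  define p where "p = axis (0, True)"
  have p: "p \<in> sph"
    by (simp add: p_def axis_sph)
  let ?C = "sqrt 3 / 2"
  have C: "0 \<le> ?C" "?C \<le> 1" "?C\<^sup>2 = 3/4" "1/2 \<le> ?C"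
    by (auto simp: power_divide real_sqrt_ge_1_iff intro: real_le_lsqrt)
  have "\<exists>w x. w \<in> sph \<and> x \<in> sph \<and> v = line x \<and> ?C \<le> ip w p \<and> 1/2 \<le> ip x w" if v: "v \<in> line ` sph" for v
  proof -
    obtain y where y: "y \<in> sph" "v = line y" using v by auto
    define x where "x = (if 0 \<le> ip y p then y else antipode y)"
    have x: "x \<in> sph" "v = line x" "0 \<le> ip x p"
      using y antipode_sph by (auto simp: x_def ip_antipode line_eq_iff)
    obtain w where w: "w \<in> sph" "ip w p = ?C" "ip x w = ?C * ip x p + sqrt (1 - ?C\<^sup>2) * sqrt (1 - (ip x p)\<^sup>2)"
      using cap_point [OF n x(1) p C(1,2)] by blast
    have x1: "ip x p \<le> 1"
      using ip_bounds [OF x(1) p] by simp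
    have "sqrt (1 - ?C\<^sup>2) = sqrt ((1/2)\<^sup>2)"
      unfolding C(3) by (simp add: power2_eq_square)
    then have S: "sqrt (1 - ?C\<^sup>2) = 1/2"
      by simp
    \<comment> \<open>With \<open>c = ip x p\<close> the inner product of \<open>x\<close> and
      \<open>w\<close> becomes at least \<open>c / 2 + (1 - c) / 2 = 1/2\<close>.\<close>
    have "1 - ip x p \<le> sqrt (1 - (ip x p)\<^sup>2)"
    proof (rule real_le_rsqrt)
      have "0 \<le> 2 * (ip x p * (1 - ip x p))"
        using x(3) x1 by simp
      then show "(1 - ip x p)\<^sup>2 \<le> 1 - (ip x p)\<^sup>2"
        by (simp add: power2_eq_square algebra_simps)
    qed
    moreover have "1/2 * ip x p \<le> ?C * ip x p"
      using C(4) x(3) by (intro mult_right_mono)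
    ultimately have "1/2 \<le> ip x w"
      unfolding w(3) S by linarith
    then show ?thesis
      using w(1) x(1,2) eq_refl [OF w(2) [symmetric]] by (intro exI [of _ w] exI [of _ x] conjI)
  qed
  then obtain g l where g: "\<And>v. v \<in> line ` sph \<Longrightarrow> g v \<in> sph" "\<And>v. v \<in> line ` sph \<Longrightarrow> l v \<in> sph"
    "\<And>v. v \<in> line ` sph \<Longrightarrow> line (l v) = v" "\<And>v. v \<in> line ` sph \<Longrightarrow> ?C \<le> ip (g v) p"
    "\<And>v. v \<in> line ` sph \<Longrightarrow> 1/2 \<le> ip (l v) (g v)"
    by metis
  let ?G = "\<lambda>v. line (g v)"
  have sym: "line_near \<mu> u v \<longleftrightarrow> line_near \<mu> v u" for \<mu> u v
    unfolding line_near_def by (metis ip_commute)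
  have gg: "line_near \<kappa>' (?G u) (?G v)" if "u \<in> line ` sph" "v \<in> line ` sph" for u v
  proof -
    have "2 * ?C\<^sup>2 - 1 \<le> ip (g u) (g v)"
      using ip_cap [OF g(1) [OF that(1)] g(1) [OF that(2)] p C(1)] g(4) that by blast
    then show ?thesis
      unfolding C(3) line_near_line using \<kappa> by auto
  qed
  have xg: "line_near \<kappa>' u (?G v)" if uv: "u \<in> line ` sph" "v \<in> line ` sph" "line_near \<kappa> u v" for u v
  proof -
    have "line_near \<kappa> (line (l u)) (line (l v))"
      using uv g(3) by simp
    then obtain x where x: "x \<in> sph" "line x = u" "\<kappa> < ip x (l v)"
      using g(2,3) [OF uv(1)] antipode_sph line_eq_iff unfolding line_near_line by (metis ip_antipode(1))
    \<comment> \<open>\<open>2 - 2 * (995/1000) = (1/10)\<^sup>2\<close>, and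
      \<open>1/2 - 1/10 = 4/10\<close> still exceeds cos (3\<pi>/8), the cosine that belongs to the
      scale 3\<pi>/4.\<close>
    have "sqrt (2 - 2 * ip x (l v)) \<le> sqrt ((1/10)\<^sup>2)"
      using x(3) \<kappa> by (intro real_sqrt_le_mono) (simp add: power2_eq_square)
    then have "sqrt (2 - 2 * ip x (l v)) \<le> 1/10" by simp
    then have "\<kappa>' < ip x (g v)"
      using ip_diff [OF x(1) g(2) [OF uv(2)] g(1) [OF uv(2)]] g(5) [OF uv(2)] \<kappa>(2) by linarith
    then show ?thesis
      using x(2) line_near_line by blast
  qed
  have "push (\<lambda>x. x) z + push ?G z \<in> boundaries (Lines \<kappa>') k"
  proof (rule contiguous_homologous [OF simplicial_complex_clique simplicial_complex_clique _ z])
    fix s assume s: "s \<in> Lines \<kappa>"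
    have s': "u \<in> line ` sph" "line_near \<kappa> u v" if "u \<in> s" "v \<in> s" for u v
      using cliqueD [OF s] that by auto
    have low: "line_near \<kappa>' u v" if "u \<in> s" "v \<in> s" for u v
      using s'(2) [OF that] \<kappa> unfolding line_near_def by force
    show "(\<lambda>x. x) ` s \<union> ?G ` s \<in> Lines \<kappa>'"
      unfolding clique_def
    proof (intro CollectI conjI ballI)
      show "finite ((\<lambda>x. x) ` s \<union> ?G ` s)"
        using s by (simp add: clique_def)
      show "(\<lambda>x. x) ` s \<union> ?G ` s \<subseteq> line ` sph"
        using s' g(1) by auto
      fix a b assume "a \<in> (\<lambda>x. x) ` s \<union> ?G ` s" "b \<in> (\<lambda>x. x) ` s \<union> ?G ` s"
      then show "line_near \<kappa>' a b"
        using low s' gg xg sym by (elim UnE imageE) (metis (full_types))+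
    qed
  qed
  moreover have "push ?G z \<in> boundaries (Lines \<kappa>') k"
  proof -
    have lp: "line p \<in> line ` sph" using p by simp
    have "?G ` s \<in> clique (?G ` line ` sph) (line_near \<kappa>')" if "s \<in> Lines \<kappa>" for s
      by (rule clique_image [OF that imageI]) (assumption, rule gg)
    then have "push ?G z \<in> cycles (clique (?G ` line ` sph) (line_near \<kappa>')) k"
      by (rule push_cycles [OF _ z])
    moreover have "insert (?G (line p)) s \<in> clique (?G ` line ` sph) (line_near \<kappa>')"
      if "s \<in> clique (?G ` line ` sph) (line_near \<kappa>')" for s
      using that lp gg unfolding clique_def by auto
    then have "acyclic_complex (clique (?G ` line ` sph) (line_near \<kappa>'))"
      by (rule acyclic_cone)
    ultimately have "push ?G z \<in> boundaries (clique (?G ` line ` sph) (line_near \<kappa>')) k"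
      by (auto simp: acyclic_complex_def)
    then show ?thesis
      by (rule boundaries_mono) (rule clique_mono, use g(1) in auto)
  qed
  ultimately show ?thesis
    using boundaries_add_cancel [of "push ?G z" _ k z] by (simp add: add.commute)
qed

end


section \<open>Persistence modules as filtered quotients, and their interleavings\<close>

section \<open>Quotients of spaces of functions\<close>

definition fadd :: "('i \<Rightarrow> bit) \<Rightarrow> ('i \<Rightarrow> bit) \<Rightarrow> 'i \<Rightarrow> bit" (infixl "\<boxplus>" 65) where
  "x \<boxplus> y = (\<lambda>i. x i + y i)"

abbreviation fzero :: "'i \<Rightarrow> bit" where "fzero \<equiv> \<lambda>i. 0"

lemma fadd_self [simp]: "x \<boxplus> x = fzero"
  by (simp add: fadd_def)

lemma fadd_zero [simp]: "x \<boxplus> fzero = x" "fzero \<boxplus> x = x"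
  unfolding fadd_def by (rule ext, rule add_0_right add_0_left)+

lemma fadd_commute: "x \<boxplus> y = y \<boxplus> x"
  unfolding fadd_def by (rule ext) (rule add.commute)

lemma fadd_assoc: "x \<boxplus> y \<boxplus> z = x \<boxplus> (y \<boxplus> z)"
  unfolding fadd_def by (rule ext) (rule add.assoc)

lemma fadd_left_commute: "x \<boxplus> (y \<boxplus> z) = y \<boxplus> (x \<boxplus> z)"
  unfolding fadd_def by (rule ext) (rule add.left_commute)

lemma fadd_left_cancel [simp]: "x \<boxplus> (x \<boxplus> y) = y"
  by (simp add: fadd_assoc [symmetric])

text \<open>Over the field with two elements, closure under scalars is automatic.\<close>

definition F2_subspace :: "('i \<Rightarrow> bit) set \<Rightarrow> bool" where
  "F2_subspace N \<longleftrightarrow> fzero \<in> N \<and> (\<forall>x\<in>N. \<forall>y\<in>N. x \<boxplus> y \<in> N)"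

lemma subspace_zero: "F2_subspace N \<Longrightarrow> fzero \<in> N"
  and subspace_add: "F2_subspace N \<Longrightarrow> x \<in> N \<Longrightarrow> y \<in> N \<Longrightarrow> x \<boxplus> y \<in> N"
  by (auto simp: F2_subspace_def)

lemma subspace_add_cancel: "F2_subspace N \<Longrightarrow> x \<in> N \<Longrightarrow> x \<boxplus> y \<in> N \<longleftrightarrow> y \<in> N"
  by (metis subspace_add fadd_left_cancel)

lemma subspace_trans: "F2_subspace N \<Longrightarrow> x \<boxplus> y \<in> N \<Longrightarrow> y \<boxplus> z \<in> N \<Longrightarrow> x \<boxplus> z \<in> N"
  using subspace_add [of N "x \<boxplus> y" "y \<boxplus> z"] by (simp add: fadd_assoc)

definition coset :: "('i \<Rightarrow> bit) set \<Rightarrow> ('i \<Rightarrow> bit) \<Rightarrow> ('i \<Rightarrow> bit) set" where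
  "coset N z = (\<lambda>b. b \<boxplus> z) ` N"

lemma coset_mem: "x \<in> coset N z \<longleftrightarrow> x \<boxplus> z \<in> N"
proof
  show "x \<in> coset N z" if "x \<boxplus> z \<in> N"
    unfolding coset_def by (rule image_eqI [OF _ that]) (simp add: fadd_assoc)
qed (auto simp: coset_def fadd_assoc)

lemma coset_eq_iff:
  assumes "F2_subspace N"
  shows "coset N x = coset N y \<longleftrightarrow> x \<boxplus> y \<in> N"
proof
  assume "coset N x = coset N y"
  moreover have "x \<in> coset N x"
    using subspace_zero [OF assms] by (simp add: coset_mem)
  ultimately show "x \<boxplus> y \<in> N" by (simp add: coset_mem)
next
  assume "x \<boxplus> y \<in> N"
  then show "coset N x = coset N y"
    using subspace_trans [OF assms] by (auto simp: coset_mem) (metis fadd_commute)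
qed

lemma coset_zero [simp]: "coset N fzero = N"
  by (simp add: coset_def)

lemma coset_eq_zero_iff:
  assumes "F2_subspace N"
  shows "coset N x = N \<longleftrightarrow> x \<in> N"
  using coset_eq_iff [OF assms, of x fzero] by simp

lemma r_coset_F2: "N +>\<^bsub>F2_functions S\<^esub> z = coset N z"
  by (auto simp: a_r_coset_def r_coset_def coset_def F2_functions_def fadd_def)

lemma carrier_quotient: "carrier (quotient_space (F2_functions S) N) = coset N ` S"
  by (auto simp: quotient_space_def A_RCOSETS_def RCOSETS_def F2_functions_def)
    (auto simp: r_coset_def coset_def fadd_def)

lemma add_quotient:
  assumes N: "F2_subspace N"
  shows "coset N x \<oplus>\<^bsub>quotient_space (F2_functions S) N\<^esub> coset N y = coset N (x \<boxplus> y)"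
proof -
  have "coset N x \<oplus>\<^bsub>quotient_space (F2_functions S) N\<^esub> coset N y = {a \<boxplus> b |a b. a \<in> coset N x \<and> b \<in> coset N y}"
    by (auto simp: quotient_space_def set_add_def set_mult_def F2_functions_def fadd_def)
  also have "\<dots> = coset N (x \<boxplus> y)"
  proof (intro equalityI subsetI)
    fix c assume "c \<in> {a \<boxplus> b |a b. a \<in> coset N x \<and> b \<in> coset N y}"
    then obtain a b where "c = a \<boxplus> b" "a \<boxplus> x \<in> N" "b \<boxplus> y \<in> N" by (auto simp: coset_mem)
    then show "c \<in> coset N (x \<boxplus> y)"
      using subspace_add [OF N, of "a \<boxplus> x" "b \<boxplus> y"] by (simp add: coset_mem fadd_assoc fadd_left_commute)
  next
    fix c assume c: "c \<in> coset N (x \<boxplus> y)"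
    have "c = (c \<boxplus> y) \<boxplus> y" by (simp add: fadd_assoc)
    moreover have "c \<boxplus> y \<in> coset N x" "y \<in> coset N y"
      using c subspace_zero [OF N] by (simp_all add: coset_mem fadd_assoc fadd_commute [of x y])
    ultimately show "c \<in> {a \<boxplus> b |a b. a \<in> coset N x \<and> b \<in> coset N y}" by blast
  qed
  finally show ?thesis .
qed

lemma smult_quotient:
  assumes N: "F2_subspace N"
  shows "c \<odot>\<^bsub>quotient_space (F2_functions S) N\<^esub> coset N x = (if c = 0 then N else coset N x)"
proof -
  have *: "c \<odot>\<^bsub>quotient_space (F2_functions S) N\<^esub> coset N x = (\<Union>a\<in>coset N x. coset N (\<lambda>i. c * a i))"
    unfolding quotient_space_def by (simp add: r_coset_F2) (simp add: F2_functions_def)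
  have x: "x \<in> coset N x"
    using subspace_zero [OF N] by (simp add: coset_mem)
  show ?thesis
  proof (cases "c = 0")
    case True
    then show ?thesis using x unfolding * by auto
  next
    case False
    then have c: "c = 1" by (cases c) auto
    have "coset N a = coset N x" if "a \<in> coset N x" for a
      using that by (simp add: coset_mem coset_eq_iff [OF N])
    then have "(\<Union>a\<in>coset N x. coset N a) = coset N x"
      using x by blast
    then show ?thesis
      unfolding * unfolding c mult_1 by simp
  qed
qed

lemma quotient_map_coset:
  assumes N: "F2_subspace N" and N': "F2_subspace N'"
    and g: "\<And>b. b \<in> N \<Longrightarrow> g (b \<boxplus> z) \<boxplus> g z \<in> N'"
  shows "quotient_map_induced (F2_functions S) N' g (coset N z) = coset N' (g z)"
proof -
  have "coset N' (g a) = coset N' (g z)" if "a \<in> coset N z" for a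
    using that g by (auto simp: coset_def [of N] coset_eq_iff [OF N'])
  moreover have "z \<in> coset N z"
    using subspace_zero [OF N] by (simp add: coset_mem)
  ultimately show ?thesis
    unfolding quotient_map_induced_def r_coset_F2 by blast
qed


section \<open>Interleavings of filtered quotients\<close>

text \<open>All spaces lie in one space of functions, and the structure maps come from inclusions,
  as for the homology of an increasing family of subcomplexes.\<close>

locale filtered_quotient =
  fixes Z B :: "real \<Rightarrow> ('i \<Rightarrow> bit) set" and F :: "('i \<Rightarrow> bit) set real_functor"
  assumes Z: "F2_subspace (Z r)" and B: "F2_subspace (B r)" and BZ: "B r \<subseteq> Z r"
    and B_mono: "r \<le> s \<Longrightarrow> B r \<subseteq> B s"
    and Z_mono: "r \<le> s \<Longrightarrow> Z r \<subseteq> Z s"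
    and obj: "obj F r = quotient_space (F2_functions (Z r)) (B r)"
    and structure_map: "r \<le> s \<Longrightarrow> z \<in> Z r \<Longrightarrow> structure_map F r s (coset (B r) z) = coset (B s) z"
begin

lemma carrier_obj: "carrier (obj F r) = coset (B r) ` Z r"
  by (simp add: obj carrier_quotient)

lemma structure_map_zero: "r \<le> s \<Longrightarrow> structure_map F r s (B r) = B s"
  using structure_map [of r s fzero] subspace_zero [OF Z] by simp

lemma coset_dies:
  assumes "r \<le> s" "Z r \<subseteq> B s" "x \<in> carrier (obj F r)"
  shows "structure_map F r s x = B s"
proof -
  obtain z where "x = coset (B r) z" "z \<in> Z r"
    using assms(3) unfolding carrier_obj by blast
  then show ?thesis
    using assms(2) structure_map [OF assms(1), of z] coset_eq_zero_iff [OF B] by auto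
qed

lemma zero_in_carrier: "B r \<in> carrier (obj F r)"
  using imageI [OF subspace_zero [OF Z [of r]], of "coset (B r)"] by (simp add: carrier_obj)

end

lemma interleaved_zero:
  assumes "filtered_quotient Z B F" "filtered_quotient Z' B' G"
    and "0 \<le> \<delta>" "\<And>r. Z r \<subseteq> B (r + 2 * \<delta>)" "\<And>r. Z' r \<subseteq> B' (r + 2 * \<delta>)"
  shows "interleaved \<delta> F G"
proof -
  interpret F: filtered_quotient Z B F by fact
  interpret G: filtered_quotient Z' B' G by fact
  have lin: "(\<lambda>_. B' s) \<in> linear_maps (obj F r) (obj G s)" for r s
    using add_quotient [OF G.B [of s], where x = fzero and y = fzero] smult_quotient [OF G.B [of s], where x = fzero]
      G.zero_in_carrier
    by (auto simp: linear_maps_def G.obj)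
  have lin': "(\<lambda>_. B s) \<in> linear_maps (obj G r) (obj F s)" for r s
    using add_quotient [OF F.B [of s], where x = fzero and y = fzero] smult_quotient [OF F.B [of s], where x = fzero]
      F.zero_in_carrier
    by (auto simp: linear_maps_def F.obj)
  show ?thesis
    unfolding interleaved_def
  proof (rule exI [of _ "\<lambda>r _. B' (r + \<delta>)"], rule exI [of _ "\<lambda>r _. B (r + \<delta>)"], intro conjI allI impI ballI)
    fix r
    have e: "r + 2 * \<delta> = r + \<delta> + \<delta>" "r \<le> r + 2 * \<delta>"
      using assms(3) by auto
    show "B (r + \<delta> + \<delta>) = structure_map F r (r + 2 * \<delta>) x" if "x \<in> carrier (obj F r)" for x
      unfolding F.coset_dies [OF e(2) assms(4) that] unfolding e(1) ..
    show "B' (r + \<delta> + \<delta>) = structure_map G r (r + 2 * \<delta>) x" if "x \<in> carrier (obj G r)" for x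
      unfolding G.coset_dies [OF e(2) assms(5) that] unfolding e(1) ..
  qed (simp_all add: lin lin' F.structure_map_zero G.structure_map_zero)
qed

text \<open>The line is constant on \<open>(0, a]\<close>. Between \<open>a\<close> and
  \<open>a + 2 * \<delta>\<close> nothing is prescribed except that the generator dies beyond the
  midpoint; further classes may appear and disappear there.\<close>

locale line_barcode = filtered_quotient +
  fixes a \<delta> :: real and f :: "real \<Rightarrow> 'a \<Rightarrow> bit"
  assumes \<delta>: "0 \<le> \<delta>" and a: "0 < a"
    and low: "r \<le> 0 \<Longrightarrow> Z r \<subseteq> B r"
    and f: "0 < r \<Longrightarrow> f r \<in> Z r" "0 < r \<Longrightarrow> r \<le> a \<Longrightarrow> f r \<notin> B r"
    and line: "0 < r \<Longrightarrow> r \<le> a \<Longrightarrow> z \<in> Z r \<Longrightarrow> z \<in> B r \<or> z \<boxplus> f r \<in> B r"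
    and f_natural: "0 < r \<Longrightarrow> r \<le> s \<Longrightarrow> f r \<boxplus> f s \<in> B s"
    and f_dies: "a + \<delta> < r \<Longrightarrow> f r \<in> B r"
    and high: "a + 2 * \<delta> < r \<Longrightarrow> Z r \<subseteq> B r"
begin

lemma carrier_line:
  assumes "0 < r" "r \<le> a"
  shows "carrier (obj F r) = {B r, coset (B r) (f r)}"
proof -
  have "coset (B r) z \<in> {B r, coset (B r) (f r)}" if "z \<in> Z r" for z
    using line [OF assms that] coset_eq_zero_iff [OF B, of r z] coset_eq_iff [OF B, of r z "f r"] by blast
  then show ?thesis
    using zero_in_carrier f(1) [OF assms(1)] unfolding carrier_obj by auto
qed

lemma f_nonzero: "0 < r \<Longrightarrow> r \<le> a \<Longrightarrow> coset (B r) (f r) \<noteq> B r"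
  using f(2) by (simp add: coset_eq_zero_iff [OF B])

lemma structure_map_f:
  assumes "0 < r" "r \<le> s"
  shows "structure_map F r s (coset (B r) (f r)) = coset (B s) (f s)"
  using structure_map [OF assms(2) f(1)] f_natural [OF assms] assms by (simp add: coset_eq_iff [OF B])

lemma carrier_zero:
  assumes "Z r \<subseteq> B r"
  shows "carrier (obj F r) = {B r}"
  using assms zero_in_carrier [of r] coset_eq_zero_iff [OF B, of r] unfolding carrier_obj by blast

end

text \<open>Generator to generator up to scale \<open>a\<close>, and zero on everything found at
  later scales. On a space with two elements, the test \<open>x \<noteq> B r\<close> is
  linear.\<close>

definition line_map ::
    "real \<Rightarrow> real \<Rightarrow> (real \<Rightarrow> 'v) \<Rightarrow> (real \<Rightarrow> ('i \<Rightarrow> bit) set) \<Rightarrow> (real \<Rightarrow> 'i \<Rightarrow> bit) \<Rightarrow> real \<Rightarrow> 'v \<Rightarrow> ('i \<Rightarrow> bit) set" where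
  "line_map a \<delta> B B' f' r x =
     (if 0 < r \<and> r \<le> a \<and> x \<noteq> B r then coset (B' (r + \<delta>)) (f' (r + \<delta>)) else B' (r + \<delta>))"

locale line_barcode_pair = F: line_barcode Z B F a \<delta> f + G: line_barcode Z' B' G a \<delta> f'
  for Z B F a \<delta> f Z' B' G f'
begin

abbreviation "\<phi> \<equiv> line_map a \<delta> B B' f'"

lemma line_map_carrier: "\<phi> r x \<in> carrier (obj G (r + \<delta>))"
  using G.zero_in_carrier G.f(1) F.\<delta> by (auto simp: line_map_def G.carrier_obj)

lemma line_map_zero [simp]: "\<phi> r (B r) = B' (r + \<delta>)"
  by (simp add: line_map_def)

lemma line_map_linear: "\<phi> r \<in> linear_maps (obj F r) (obj G (r + \<delta>))"
proof -
  let ?B = "B' (r + \<delta>)"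
  have Bz: "?B \<oplus>\<^bsub>obj G (r + \<delta>)\<^esub> ?B = ?B" "c \<odot>\<^bsub>obj G (r + \<delta>)\<^esub> ?B = ?B" for c
    using add_quotient [OF G.B [of "r + \<delta>"], where x = fzero and y = fzero] smult_quotient [OF G.B [of "r + \<delta>"], where x = fzero]
    by (simp_all add: G.obj)
  show ?thesis
  proof (cases "0 < r \<and> r \<le> a")
    case False
    then have "\<phi> r x = ?B" for x
      by (auto simp: line_map_def)
    then show ?thesis
      using line_map_carrier [of r] Bz by (simp add: linear_maps_def)
  next
    case True
    let ?f = "coset (B r) (f r)" and ?f' = "coset ?B (f' (r + \<delta>))"
    have F: "x \<oplus>\<^bsub>obj F r\<^esub> y = (if x = B r then y else if y = B r then x else B r)"
      "c \<odot>\<^bsub>obj F r\<^esub> x = (if c = 0 then B r else x)"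
      if "x \<in> {B r, ?f}" "y \<in> {B r, ?f}" for x y c
      using that add_quotient [OF F.B [of r], where x = fzero and y = fzero] add_quotient [OF F.B [of r], where x = fzero and y = "f r"]
        add_quotient [OF F.B [of r], where x = "f r" and y = fzero] add_quotient [OF F.B [of r], where x = "f r" and y = "f r"]
        smult_quotient [OF F.B [of r], where x = fzero] smult_quotient [OF F.B [of r], where x = "f r"]
      by (auto simp: F.obj)
    have G: "x \<oplus>\<^bsub>obj G (r + \<delta>)\<^esub> y = (if x = ?B then y else if y = ?B then x else ?B)"
      "c \<odot>\<^bsub>obj G (r + \<delta>)\<^esub> x = (if c = 0 then ?B else x)"
      if "x \<in> {?B, ?f'}" "y \<in> {?B, ?f'}" for x y c
      using that add_quotient [OF G.B [of "r + \<delta>"], where x = fzero and y = fzero] add_quotient [OF G.B [of "r + \<delta>"], where x = fzero and y = "f' (r + \<delta>)"]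
        add_quotient [OF G.B [of "r + \<delta>"], where x = "f' (r + \<delta>)" and y = fzero]
        add_quotient [OF G.B [of "r + \<delta>"], where x = "f' (r + \<delta>)" and y = "f' (r + \<delta>)"]
        smult_quotient [OF G.B [of "r + \<delta>"], where x = fzero] smult_quotient [OF G.B [of "r + \<delta>"], where x = "f' (r + \<delta>)"]
      by (auto simp: G.obj)
    have v: "\<phi> r x \<in> {?B, ?f'}" for x
      by (simp add: line_map_def)
    have val: "\<phi> r x = (if x = B r then ?B else ?f')" for x
      using True by (simp add: line_map_def)
    have n: "?f \<noteq> B r"
      using F.f_nonzero True by blast
    have "\<phi> r (x \<oplus>\<^bsub>obj F r\<^esub> y) = \<phi> r x \<oplus>\<^bsub>obj G (r + \<delta>)\<^esub> \<phi> r y" if xy: "x \<in> {B r, ?f}" "y \<in> {B r, ?f}" for x y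
      unfolding F(1) [OF xy] G(1) [OF v v] unfolding val using xy n by (cases "x = B r"; cases "y = B r"; simp)
    moreover have "\<phi> r (c \<odot>\<^bsub>obj F r\<^esub> x) = c \<odot>\<^bsub>obj G (r + \<delta>)\<^esub> \<phi> r x" if xy: "x \<in> {B r, ?f}" for x c
      unfolding F(2) [OF xy xy] G(2) [OF v v] unfolding val by simp
    moreover have "carrier (obj F r) = {B r, ?f}"
      using F.carrier_line True by blast
    ultimately show ?thesis
      using line_map_carrier [of r] unfolding linear_maps_def
      by (intro CollectI conjI ballI allI Pi_I) (simp_all only:)
  qed
qed

lemma line_map_natural:
  assumes rs: "r \<le> s" and x: "x \<in> carrier (obj F r)"
  shows "\<phi> s (structure_map F r s x) = structure_map G (r + \<delta>) (s + \<delta>) (\<phi> r x)"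
proof (cases "x = B r")
  case True
  then show ?thesis
    using rs F.structure_map_zero [OF rs] G.structure_map_zero [of "r + \<delta>" "s + \<delta>"] by simp
next
  case False
  then have r: "0 < r"
    using F.carrier_zero [OF F.low, of r] x by fastforce
  have rs': "r + \<delta> \<le> s + \<delta>" "0 < r + \<delta>"
    using rs r F.\<delta> by auto
  show ?thesis
  proof (cases "s \<le> a")
    case True
    then have xf: "x = coset (B r) (f r)"
      using F.carrier_line [of r] r rs x False by auto
    have "coset (B s) (f s) \<noteq> B s"
      using F.f_nonzero True r rs by simp
    then show ?thesis
      unfolding xf F.structure_map_f [OF r rs] using True r rs rs' False xf
      by (simp add: line_map_def G.structure_map_f)
  next
    \<comment> \<open>Here \<open>\<phi>\<close> is zero at \<open>s\<close>. The other way round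
      agrees, because \<open>f'\<close> bounds at
      \<open>s + \<delta> > a + \<delta>\<close>.\<close>
    case s: False
    have "coset (B' (s + \<delta>)) (f' (s + \<delta>)) = B' (s + \<delta>)"
      using G.f_dies [of "s + \<delta>"] s by (simp add: coset_eq_zero_iff [OF G.B])
    then have "structure_map G (r + \<delta>) (s + \<delta>) (\<phi> r x) = B' (s + \<delta>)"
      using rs' by (auto simp: line_map_def G.structure_map_f G.structure_map_zero)
    then show ?thesis
      using s by (simp add: line_map_def)
  qed
qed

lemma line_map_back:
  assumes x: "x \<in> carrier (obj F r)"
  shows "line_map a \<delta> B' B f (r + \<delta>) (\<phi> r x) = structure_map F r (r + 2 * \<delta>) x"
proof -
  define t where "t = r + 2 * \<delta>"
  have e: "r + \<delta> + \<delta> = t" and le: "r \<le> t"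
    using F.\<delta> by (auto simp: t_def)
  have val: "line_map a \<delta> B' B f (r + \<delta>) y =
      (if 0 < r + \<delta> \<and> r + \<delta> \<le> a \<and> y \<noteq> B' (r + \<delta>) then coset (B t) (f t) else B t)" for y
    unfolding line_map_def e ..
  have "line_map a \<delta> B' B f (r + \<delta>) (\<phi> r x) = structure_map F r t x" (is ?goal)
  proof (cases "x = B r")
    case True
    then show ?goal
      using F.structure_map_zero [OF le] by (simp add: val)
  next
    case False
    then have r: "0 < r"
      using F.carrier_zero [OF F.low, of r] x by fastforce
    show ?goal
    proof (cases "r \<le> a")
      case True
      then have xf: "x = coset (B r) (f r)"
        using F.carrier_line [of r] r x False by auto
      have S: "structure_map F r t x = coset (B t) (f t)"
        unfolding xf by (rule F.structure_map_f [OF r le])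
      have \<phi>: "\<phi> r x = coset (B' (r + \<delta>)) (f' (r + \<delta>))"
        using True r False by (simp add: line_map_def)
      show ?goal
      proof (cases "r + \<delta> \<le> a")
        case True
        then have "coset (B' (r + \<delta>)) (f' (r + \<delta>)) \<noteq> B' (r + \<delta>)"
          using G.f_nonzero r F.\<delta> by simp
        then show ?goal
          unfolding S \<phi> using True r F.\<delta> by (simp add: val)
      next
        \<comment> \<open>The second map is zero as \<open>r + \<delta> > a\<close>, and so is the
          structure map on the generator, since \<open>t > a + \<delta>\<close>.\<close>
        case False
        then have "coset (B t) (f t) = B t"
          using F.f_dies [of t] e by (simp add: coset_eq_zero_iff [OF F.B])
        then show ?goal
          unfolding S using False by (simp add: val)
      qed
    next
      \<comment> \<open>At \<open>r > a\<close> the class is arbitrary, but the whole module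
        vanishes at \<open>t > a + 2 * \<delta>\<close>.\<close>
      case False
      then have "a + 2 * \<delta> < t" by (simp add: t_def)
      then have "Z r \<subseteq> B t"
        using F.high F.Z_mono [OF le] by blast
      then show ?goal
        using F.coset_dies [OF le _ x] False F.\<delta> by (simp add: val)
    qed
  qed
  then show ?thesis
    unfolding t_def .
qed

end

lemma interleaved_line_barcodes:
  assumes "line_barcode Z B F a \<delta> f" "line_barcode Z' B' G a \<delta> f'"
  shows "interleaved \<delta> F G"
proof -
  interpret F: line_barcode Z B F a \<delta> f by fact
  interpret G: line_barcode Z' B' G a \<delta> f' by fact
  interpret FG: line_barcode_pair Z B F a \<delta> f Z' B' G f' ..
  interpret GF: line_barcode_pair Z' B' G a \<delta> f' Z B F f ..
  show ?thesis
    unfolding interleaved_def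
    by (rule exI [of _ FG.\<phi>], rule exI [of _ GF.\<phi>])
      (simp add: FG.line_map_linear GF.line_map_linear FG.line_map_natural GF.line_map_natural
        FG.line_map_back GF.line_map_back)
qed


section \<open>Vietoris--Rips homology from simplicial homology\<close>

lemma vietoris_rips_complex_eq:
  "vietoris_rips_complex M d r = clique M (\<lambda>x y. d x y < r) - {{}}"
proof -
  have "Max {d x y |x y. x \<in> s \<and> y \<in> s} < r \<longleftrightarrow> (\<forall>x\<in>s. \<forall>y\<in>s. d x y < r)" if s: "finite s" "s \<noteq> {}" for s
  proof -
    have eq: "{d x y |x y. x \<in> s \<and> y \<in> s} = (\<lambda>(x, y). d x y) ` (s \<times> s)"
      by auto
    show ?thesis
      unfolding eq using s by (subst Max_less_iff) auto
  qed
  then show ?thesis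
    by (auto simp: vietoris_rips_complex_def clique_def)
qed

text \<open>The empty simplex, added for the augmentation, has an empty closed simplex and leaves
  the topology unchanged.\<close>

lemma VR_eq: "VR M d r = geometric_realization (clique M (\<lambda>x y. d x y < r))"
proof -
  have e: "closed_simplex {} = {}"
    by (auto simp: closed_simplex_def)
  have "geometric_realization (K - {{}}) = geometric_realization K" for K :: "'a set set"
    unfolding topology_eq openin_geometric_realization
    using e by (intro allI conj_cong) auto
  then show ?thesis
    by (simp add: VR_def vietoris_rips_complex_eq)
qed

lemma continuous_map_realization_mono:
  assumes "K \<subseteq> L"
  shows "continuous_map (geometric_realization K) (geometric_realization L) id"
  unfolding continuous_map_def
proof (intro conjI allI impI)
  show "id \<in> topspace (geometric_realization K) \<rightarrow> topspace (geometric_realization L)"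
    using assms by (auto simp: topspace_geometric_realization)
  fix U assume U: "openin (geometric_realization L) U"
  show "openin (geometric_realization K) {x \<in> topspace (geometric_realization K). id x \<in> U}"
    unfolding openin_geometric_realization
  proof (intro conjI ballI)
    fix s assume s: "s \<in> K"
    then have "{x \<in> topspace (geometric_realization K). id x \<in> U} \<inter> closed_simplex s = U \<inter> closed_simplex s"
      by (auto simp: topspace_geometric_realization)
    then show "openin (subtopology (powertop_real UNIV) (closed_simplex s))
        ({x \<in> topspace (geometric_realization K). id x \<in> U} \<inter> closed_simplex s)"
      using U s assms by (auto simp: openin_geometric_realization)
  qed (auto simp: topspace_geometric_realization)
qed

lemma simplex_map_id_singular: "singular_simplex p X \<sigma> \<Longrightarrow> simplex_map p id \<sigma> = \<sigma>"
  by (rule simplex_map_id_gen) auto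

lemma singular_simplex_mono:
  assumes "K \<subseteq> L" "singular_simplex p (geometric_realization K) \<sigma>"
  shows "singular_simplex p (geometric_realization L) \<sigma>"
  using singular_simplex_simplex_map [OF assms(2) continuous_map_realization_mono [OF assms(1)]]
  unfolding simplex_map_id_singular [OF assms(2)] .

lemma F2_chains_mono:
  "K \<subseteq> L \<Longrightarrow> F2_chains p (geometric_realization K) \<subseteq> F2_chains p (geometric_realization L)"
  unfolding F2_chains_def using singular_simplex_mono by blast

lemma F2_cycles_mono:
  "K \<subseteq> L \<Longrightarrow> F2_cycles p (geometric_realization K) \<subseteq> F2_cycles p (geometric_realization L)"
  unfolding F2_cycles_def using F2_chains_mono by blast

lemma F2_boundaries_mono:
  "K \<subseteq> L \<Longrightarrow> F2_boundaries p (geometric_realization K) \<subseteq> F2_boundaries p (geometric_realization L)"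
  unfolding F2_boundaries_def using F2_chains_mono by blast

lemma lookup_add_fadd: "Poly_Mapping.lookup (c + d) = Poly_Mapping.lookup c \<boxplus> Poly_Mapping.lookup d"
  unfolding fadd_def by (rule ext) (rule lookup_add)

lemma lookup_zero_fzero: "Poly_Mapping.lookup (0 :: 'i mod2) = fzero"
  by (rule ext) (rule lookup_zero)

lemma subspace_lookup:
  assumes "0 \<in> S" "\<And>c d. c \<in> S \<Longrightarrow> d \<in> S \<Longrightarrow> c + d \<in> S"
  shows "F2_subspace (Poly_Mapping.lookup ` (S :: 'i mod2 set))"
  unfolding F2_subspace_def lookup_zero_fzero [symmetric]
  by (auto simp only: lookup_add_fadd [symmetric] intro!: imageI assms)

lemma F2_subspace_cycles: "F2_subspace (F2_cycles p X)"
  unfolding F2_cycles_eq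
proof (rule subspace_lookup)
  fix c d assume "c \<in> {c \<in> schains p X. if p = 0 then lin (\<lambda>\<sigma>. 1::bit) c = 0 else sbd p c = 0}"
    "d \<in> {c \<in> schains p X. if p = 0 then lin (\<lambda>\<sigma>. 1::bit) c = 0 else sbd p c = 0}"
  then show "c + d \<in> {c \<in> schains p X. if p = 0 then lin (\<lambda>\<sigma>. 1::bit) c = 0 else sbd p c = 0}"
    by (cases "p = 0") (simp_all add: chains_add lin_add)
qed simp

lemma F2_subspace_boundaries: "F2_subspace (F2_boundaries p X)"
  unfolding F2_boundaries_eq
proof (rule subspace_lookup)
  show "0 \<in> sbd (Suc p) ` schains (Suc p) X"
    by (rule image_eqI [of _ _ 0]) simp_all
qed (auto simp: chains_add simp flip: lin_add)

lemma F2_boundaries_subset_cycles: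
  "F2_boundaries p (geometric_realization K) \<subseteq> F2_cycles p (geometric_realization K)"
  unfolding F2_boundaries_eq F2_cycles_eq
proof (intro image_mono subsetI)
  fix z assume "z \<in> sbd (Suc p) ` schains (Suc p) (geometric_realization K)"
  then obtain c where c: "c \<in> schains (Suc p) (geometric_realization K)" "z = sbd (Suc p) c"
    by blast
  have "lin (\<lambda>\<sigma>. gen []) (sbd (Suc 0) c) = (0 :: 'a list mod2)"
    unfolding lin_lin lin_const_sface by (rule lin_fun_0)
  then have "lin (\<lambda>\<sigma>. 1::bit) (sbd (Suc 0) c) = 0"
    by (simp only: lin_gen_Nil)
  then show "z \<in> {c \<in> schains p (geometric_realization K). if p = 0 then lin (\<lambda>\<sigma>. 1::bit) c = 0 else sbd p c = 0}"
    using c(2) sbd_schains [OF c(1)] sbd_sbd [OF c(1)] by (cases p) auto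
qed

lemma induced_id:
  assumes "z \<in> F2_chains p X"
  shows "linear_extension (\<lambda>\<sigma>. basis_chain (simplex_map p id \<sigma>)) z = z"
proof -
  obtain c where c: "z = Poly_Mapping.lookup c" "c \<in> schains p X"
    using assms by (auto simp: F2_chains_eq)
  have "lin (\<lambda>\<sigma>. gen (simplex_map p id \<sigma>)) c = lin gen c"
    using c(2) by (rule lin_cong_chains) (simp only: mem_Collect_eq simplex_map_id_singular)
  then show ?thesis
    unfolding c(1) lookup_gen [symmetric] linear_extension_lookup by simp
qed

abbreviation "VR_cycles m M d r \<equiv> F2_cycles m (VR M d r)"

abbreviation "VR_boundaries m M d r \<equiv> F2_boundaries m (VR M d r)"

lemma clique_less_mono: "r \<le> s \<Longrightarrow> clique M (\<lambda>x y. d x y < r) \<subseteq> clique M (\<lambda>x y. d x y < (s::real))"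
  by (rule clique_mono) auto

lemma filtered_quotient_VR:
  "filtered_quotient (VR_cycles m M d) (VR_boundaries m M d) (VR_homology m M d)"
proof
  fix r s :: real
  show "F2_subspace (VR_cycles m M d r)" "F2_subspace (VR_boundaries m M d r)"
    by (rule F2_subspace_cycles F2_subspace_boundaries)+
  show "VR_boundaries m M d r \<subseteq> VR_cycles m M d r"
    unfolding VR_eq by (rule F2_boundaries_subset_cycles)
  show "obj (VR_homology m M d) r = quotient_space (F2_functions (VR_cycles m M d r)) (VR_boundaries m M d r)"
    by (simp add: VR_homology_def F2_homology_def)
  assume rs: "r \<le> s"
  show "VR_boundaries m M d r \<subseteq> VR_boundaries m M d s" "VR_cycles m M d r \<subseteq> VR_cycles m M d s"
    unfolding VR_eq by (rule F2_boundaries_mono F2_cycles_mono, rule clique_less_mono [OF rs])+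
  fix z assume z: "z \<in> VR_cycles m M d r"
  let ?h = "linear_extension (\<lambda>\<sigma>. basis_chain (simplex_map m id \<sigma>)) ::
      (((nat \<Rightarrow> real) \<Rightarrow> 'a \<Rightarrow> real) \<Rightarrow> bit) \<Rightarrow> _"
  have h: "?h y = y" if "y \<in> VR_cycles m M d r" for y
    using that by (intro induced_id [of _ _ "VR M d r"]) (simp add: F2_cycles_def)
  have "?h (b \<boxplus> z) \<boxplus> ?h z \<in> VR_boundaries m M d s" if b: "b \<in> VR_boundaries m M d r" for b
  proof -
    have b': "b \<in> VR_cycles m M d r"
      using b F2_boundaries_subset_cycles unfolding VR_eq by blast
    have "?h (b \<boxplus> z) \<boxplus> ?h z = b"
      unfolding h [OF subspace_add [OF F2_subspace_cycles b' z]] h [OF z] by (simp add: fadd_assoc)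
    then show ?thesis
      using b F2_boundaries_mono [OF clique_less_mono [OF rs, of M d], of m] unfolding VR_eq by auto
  qed
  then have "quotient_map_induced (F2_functions (VR_cycles m M d s)) (VR_boundaries m M d s) ?h
      (coset (VR_boundaries m M d r) z) = coset (VR_boundaries m M d s) (?h z)"
    by (rule quotient_map_coset [OF F2_subspace_boundaries F2_subspace_boundaries])
  then show "structure_map (VR_homology m M d) r s (coset (VR_boundaries m M d r) z) = coset (VR_boundaries m M d s) z"
    unfolding h [OF z] by (simp add: VR_homology_def F2_homology_induced_def)
qed

lemma affine_cycle_add: "affine_cycle (c + d) = affine_cycle c \<boxplus> affine_cycle d"
  by (simp add: lin_add lookup_add_fadd)

lemma F2_cycles_die:
  assumes K: "simplicial_complex K" and L: "simplicial_complex L" and KL: "K \<subseteq> L"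
    and *: "cycles K (Suc m) \<subseteq> boundaries L (Suc m)"
  shows "F2_cycles m (geometric_realization K) \<subseteq> F2_boundaries m (geometric_realization L)"
proof
  fix z assume "z \<in> F2_cycles m (geometric_realization K)"
  then obtain c where c: "c \<in> cycles K (Suc m)"
    "(\<lambda>\<sigma>. z \<sigma> + affine_cycle c \<sigma>) \<in> F2_boundaries m (geometric_realization K)"
    by (rule F2_cycle_homologous_affine [OF K])
  have "z \<boxplus> affine_cycle c \<in> F2_boundaries m (geometric_realization L)"
    using c(2) F2_boundaries_mono [OF KL] unfolding fadd_def by blast
  moreover have "affine_cycle c \<in> F2_boundaries m (geometric_realization L)"
    using affine_cycle_F2_boundaries [OF L cycles_mono [OF c(1) KL]] c(1) * by blast
  ultimately show "z \<in> F2_boundaries m (geometric_realization L)"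
    using subspace_add_cancel [OF F2_subspace_boundaries] fadd_commute by metis
qed

lemma VR_cycles_die:
  assumes "r \<le> s"
    and "cycles (clique M (\<lambda>x y. d x y < r)) (Suc m) \<subseteq> boundaries (clique M (\<lambda>x y. d x y < s)) (Suc m)"
  shows "VR_cycles m M d r \<subseteq> VR_boundaries m M d s"
  unfolding VR_eq
  by (rule F2_cycles_die [OF simplicial_complex_clique simplicial_complex_clique clique_less_mono [OF assms(1)] assms(2)])

text \<open>Generators are chosen independently at each scale up to \<open>a\<close> and frozen
  beyond. By \<open>inj\<close> a generator does not bound at any later scale up to
  \<open>a\<close>, so in a line it must agree with the one chosen there. Hence it is enough to let
  the cycles of one early scale \<open>r0\<close> die.\<close>

lemma VR_line_barcode:
  fixes M :: "'a set" and d :: "'a \<Rightarrow> 'a \<Rightarrow> real"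
  defines "C \<equiv> \<lambda>r. clique M (\<lambda>x y. d x y < r)"
  assumes \<delta>: "0 \<le> \<delta>" and a: "0 < a"
    and line: "\<And>r. 0 < r \<Longrightarrow> r \<le> a \<Longrightarrow> hom_line (C r) (Suc m)"
    and inj: "\<And>r s z. 0 < r \<Longrightarrow> r \<le> s \<Longrightarrow> s \<le> a \<Longrightarrow> z \<in> cycles (C r) (Suc m) \<Longrightarrow>
      z \<in> boundaries (C s) (Suc m) \<Longrightarrow> z \<in> boundaries (C r) (Suc m)"
    and dies: "0 < r0" "r0 \<le> a" "\<And>t. a + \<delta> < t \<Longrightarrow> cycles (C r0) (Suc m) \<subseteq> boundaries (C t) (Suc m)"
    and zero: "\<And>r. r \<le> 0 \<or> a + 2 * \<delta> < r \<Longrightarrow> hom_zero (C r) (Suc m)"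
  shows "\<exists>f. line_barcode (VR_cycles m M d) (VR_boundaries m M d) (VR_homology m M d) a \<delta> f"
proof -
  have SC: "simplicial_complex (C r)" for r
    unfolding C_def by (rule simplicial_complex_clique)
  have VR: "VR M d r = geometric_realization (C r)" for r
    unfolding C_def by (rule VR_eq)
  have mono: "C r \<subseteq> C s" if "r \<le> s" for r s
    unfolding C_def by (rule clique_less_mono [OF that])
  have "\<exists>g. \<forall>r. 0 < r \<and> r \<le> a \<longrightarrow> g r \<in> cycles (C r) (Suc m) \<and> g r \<notin> boundaries (C r) (Suc m) \<and>
      (\<forall>z'\<in>cycles (C r) (Suc m). z' \<in> boundaries (C r) (Suc m) \<or> z' + g r \<in> boundaries (C r) (Suc m))"
    using line unfolding hom_line_def by (intro choice) blast
  then obtain g where g: "\<And>r. 0 < r \<Longrightarrow> r \<le> a \<Longrightarrow> g r \<in> cycles (C r) (Suc m)"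
    "\<And>r. 0 < r \<Longrightarrow> r \<le> a \<Longrightarrow> g r \<notin> boundaries (C r) (Suc m)"
    "\<And>r z. 0 < r \<Longrightarrow> r \<le> a \<Longrightarrow> z \<in> cycles (C r) (Suc m) \<Longrightarrow>
       z \<in> boundaries (C r) (Suc m) \<or> z + g r \<in> boundaries (C r) (Suc m)"
    by blast
  have gg: "g r + g s \<in> boundaries (C s) (Suc m)" if "0 < r" "r \<le> s" "s \<le> a" for r s
  proof -
    have r: "g r \<in> cycles (C r) (Suc m)" "g r \<notin> boundaries (C r) (Suc m)"
      using g(1,2) [of r] that by auto
    have "g r \<notin> boundaries (C s) (Suc m)"
      using inj [OF that r(1)] r(2) by blast
    then show ?thesis
      using g(3) [of s "g r"] cycles_mono [OF r(1) mono [OF that(2)]] that by auto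
  qed
  have ga: "g a \<in> boundaries (C t) (Suc m)" if t: "a + \<delta> < t" for t
  proof -
    have "g r0 + g a \<in> boundaries (C t) (Suc m)"
      by (rule boundaries_mono [OF gg mono]) (use dies t \<delta> in auto)
    moreover have "g r0 \<in> boundaries (C t) (Suc m)"
      using dies(3) [OF t] g(1) [OF dies(1,2)] by blast
    ultimately show ?thesis
      by (simp add: boundaries_add_cancel)
  qed
  interpret filtered_quotient "VR_cycles m M d" "VR_boundaries m M d" "VR_homology m M d"
    by (rule filtered_quotient_VR)
  let ?f = "\<lambda>r. affine_cycle (g (min r a))"
  have gC: "g (min r a) \<in> cycles (C r) (Suc m)" if "0 < r" for r
    by (rule cycles_mono [OF g(1) mono]) (use that a in auto)
  have "line_barcode (VR_cycles m M d) (VR_boundaries m M d) (VR_homology m M d) a \<delta> ?f"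
  proof
    show "0 \<le> \<delta>" "0 < a" by fact+
    fix r
    have "VR_cycles m M d r \<subseteq> VR_boundaries m M d r" if "r \<le> 0 \<or> a + 2 * \<delta> < r"
      by (rule VR_cycles_die) (use zero [OF that] in \<open>simp_all add: hom_zero_def C_def\<close>)
    then show "r \<le> 0 \<Longrightarrow> VR_cycles m M d r \<subseteq> VR_boundaries m M d r"
      "a + 2 * \<delta> < r \<Longrightarrow> VR_cycles m M d r \<subseteq> VR_boundaries m M d r"
      by blast+
    show "?f r \<in> VR_cycles m M d r" if "0 < r"
      unfolding VR by (rule affine_cycle_F2_cycles [OF gC [OF that]])
    show "?f r \<notin> VR_boundaries m M d r" if "0 < r" "r \<le> a"
      unfolding VR affine_cycle_F2_boundaries [OF SC gC [OF that(1)]] using g(2) that by simp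
    show "z \<in> VR_boundaries m M d r \<or> z \<boxplus> ?f r \<in> VR_boundaries m M d r"
      if r: "0 < r" "r \<le> a" and z: "z \<in> VR_cycles m M d r" for z
    proof -
      obtain c where c: "c \<in> cycles (C r) (Suc m)"
        "(\<lambda>\<sigma>. z \<sigma> + affine_cycle c \<sigma>) \<in> F2_boundaries m (geometric_realization (C r))"
        using F2_cycle_homologous_affine [OF SC z [unfolded VR]] by blast
      have zc: "z \<boxplus> affine_cycle c \<in> VR_boundaries m M d r"
        using c(2) unfolding VR fadd_def .
      consider "c \<in> boundaries (C r) (Suc m)" | "c + g r \<in> boundaries (C r) (Suc m)"
        using g(3) [OF r c(1)] by blast
      then show ?thesis
      proof cases
        case 1
        then have "affine_cycle c \<in> VR_boundaries m M d r"
          unfolding VR affine_cycle_F2_boundaries [OF SC c(1)] .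
        then show ?thesis
          using zc subspace_add_cancel [OF B] fadd_commute by metis
      next
        case 2
        have "affine_cycle c \<boxplus> affine_cycle (g r) \<in> VR_boundaries m M d r"
          unfolding VR affine_cycle_add [symmetric] affine_cycle_F2_boundaries [OF SC cycles_add [OF c(1) g(1) [OF r]]]
          by (rule 2)
        then have "z \<boxplus> affine_cycle (g r) \<in> VR_boundaries m M d r"
          by (rule subspace_trans [OF B zc])
        then show ?thesis
          using r by simp
      qed
    qed
    show "?f r \<boxplus> ?f s \<in> VR_boundaries m M d s" if r: "0 < r" "r \<le> s" for s
    proof -
      have s: "0 < s" using r by simp
      have "g (min r a) + g (min s a) \<in> boundaries (C s) (Suc m)"
        by (rule boundaries_mono [OF gg mono]) (use r a in auto)
      moreover have "g (min r a) + g (min s a) \<in> cycles (C s) (Suc m)"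
        by (rule cycles_add [OF cycles_mono [OF gC [OF r(1)] mono [OF r(2)]] gC [OF s]])
      ultimately show ?thesis
        unfolding VR affine_cycle_add [symmetric] by (simp only: affine_cycle_F2_boundaries [OF SC])
    qed
    show "?f r \<in> VR_boundaries m M d r" if "a + \<delta> < r"
    proof -
      have "0 < r" using that \<delta> a by simp
      moreover have "min r a = a" using that \<delta> by simp
      ultimately show ?thesis
        using ga [OF that] affine_cycle_F2_boundaries [OF SC gC] unfolding VR by metis
    qed
  qed
  then show ?thesis by blast
qed


section \<open>Homology of spheres, projective space and the wedge scale by scale, and the upper
  bound\<close>

section \<open>Vietoris--Rips complexes of spheres and projective spaces\<close>

lemma arccos_less_iff:
  assumes "\<bar>u\<bar> \<le> 1" "0 \<le> t" "t \<le> pi"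
  shows "arccos u < t \<longleftrightarrow> cos t < u"
  using assms arccos_lbound [of u] arccos_ubound [of u] cos_mono_less_eq [of t "arccos u"]
  by (simp add: abs_le_iff)

lemma (in sphere) geodesic_dist_eq: "geodesic_dist R n x y = R * arccos (ip x y)"
  by (simp add: geodesic_dist_def ip_def)

lemma acyclic_full:
  assumes "p \<in> M" "\<And>x y. x \<in> M \<Longrightarrow> y \<in> M \<Longrightarrow> N x y"
  shows "hom_zero (clique M N) k"
proof -
  have "insert p s \<in> clique M N" if "s \<in> clique M N" for s
    using that assms by (auto simp: clique_def)
  then have "acyclic_complex (clique M N)"
    by (rule acyclic_cone)
  then show ?thesis
    by (simp add: acyclic_complex_def hom_zero_def)
qed

lemma hom_zero_no_vertices:
  assumes "\<And>x. x \<in> M \<Longrightarrow> \<not> N x x"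
  shows "hom_zero (clique M N) (Suc m)"
proof -
  have "osimplices (clique M N) (Suc m) = {}"
    using assms by (auto simp: osimplices_def clique_def length_Suc_conv)
  then have "cycles (clique M N) (Suc m) \<subseteq> {0}"
    by (auto simp: cycles_def chain_space_def)
  then show ?thesis
    by (auto simp: hom_zero_def)
qed

lemma cos_ge: "1 - x\<^sup>2 / 2 \<le> cos (x :: real)"
proof -
  have "cos x = 1 - 2 * (sin (x / 2))\<^sup>2"
    using cos_double_sin [of "x / 2"] by simp
  moreover have "(sin (x / 2))\<^sup>2 \<le> (x / 2)\<^sup>2"
    using abs_sin_x_le_abs_x [of "x / 2"] by (simp add: abs_le_square_iff [symmetric])
  ultimately show ?thesis
    by (simp add: power_divide)
qed

lemma seven_tenths_le_cos: "7/10 \<le> cos (pi / 4)"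
proof -
  have "(14/10) \<le> sqrt 2"
    by (rule real_le_rsqrt) (simp add: power2_eq_square)
  then show ?thesis
    by (simp add: cos_45)
qed

lemma cos_3pi4: "cos (3 * pi / 4) = - cos (pi / 4)"
proof -
  have "cos (3 * pi / 4) = cos (pi - pi / 4)"
    by (rule arg_cong [of _ _ cos]) simp
  then show ?thesis
    by (simp only: cos_diff) simp
qed

lemma cos_3pi8: "cos (3 * pi / 8) < 4/10"
proof -
  have "2 * (cos (3 * pi / 8))\<^sup>2 - 1 = - cos (pi / 4)"
    using cos_double_cos [of "3 * pi / 8"] cos_3pi4 by simp
  then have "(cos (3 * pi / 8))\<^sup>2 < (4/10)\<^sup>2"
    using seven_tenths_le_cos by (simp add: power2_eq_square)
  then show ?thesis
    by (rule power_less_imp_less_base) simp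
qed

text \<open>The edge length of the regular simplex inscribed in the unit \<open>n\<close>-sphere.\<close>

definition simplex_angle :: "nat \<Rightarrow> real" where
  "simplex_angle n = arccos (- 1 / (real n + 1))"

lemma simplex_angle:
  assumes "1 < n"
  shows "cos (simplex_angle n) = - 1 / (real n + 1)" "pi / 2 < simplex_angle n" "simplex_angle n < 2 * pi / 3"
proof -
  have b: "- (1/2) < - 1 / (real n + 1)" "- 1 / (real n + 1) < 0"
    using assms by (auto simp: field_simps)
  have "- 1 \<le> - 1 / (real n + 1)"
    using b by linarith
  then show c: "cos (simplex_angle n) = - 1 / (real n + 1)"
    unfolding simplex_angle_def using b(2) by (intro cos_arccos) linarith+
  have 0: "0 \<le> simplex_angle n" "simplex_angle n \<le> pi"
    using b unfolding simplex_angle_def by (intro arccos_lbound arccos_ubound; linarith)+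
  show "pi / 2 < simplex_angle n"
    using cos_mono_less_eq [of "simplex_angle n" "pi / 2"] 0 b c by simp
  show "simplex_angle n < 2 * pi / 3"
    using cos_mono_less_eq [of "2 * pi / 3" "simplex_angle n"] 0 b c cos_120 by simp
qed

interpretation S: sphere 1 n for n
  by standard simp

abbreviation "sphere_clique i r \<equiv> clique (round_sphere 1 i) (\<lambda>x y. geodesic_dist 1 i x y < r)"

lemma sphere_clique_eq:
  assumes "0 \<le> r" "r \<le> pi"
  shows "sphere_clique i r = S.Rips i (round_sphere 1 i) (cos r)"
proof -
  have "geodesic_dist 1 i x y < r \<longleftrightarrow> cos r < S.ip i x y" if "x \<in> round_sphere 1 i" "y \<in> round_sphere 1 i" for x y
    unfolding S.geodesic_dist_eq mult_1 by (rule arccos_less_iff [OF S.ip_bounds(1) [OF that] assms])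
  then show ?thesis
    unfolding clique_def by blast
qed

lemma sphere_clique_hom_zero_full:
  assumes "pi < r"
  shows "hom_zero (sphere_clique i r) k"
proof (rule acyclic_full)
  show "S.axis (0, True) \<in> round_sphere 1 i"
    by (simp add: S.axis_sph)
  show "geodesic_dist 1 i x y < r" if "x \<in> round_sphere 1 i" "y \<in> round_sphere 1 i" for x y
    using arccos_ubound [of "S.ip i x y"] S.ip_bounds(2,3) [OF that] assms by (simp add: S.geodesic_dist_eq)
qed

text \<open>The critical cosine \<open>- 1 / (real i + 1)\<close> increases with the dimension, so
  the angle for \<open>n\<close> serves for all spheres of the wedge.\<close>

lemma sphere_clique_homology:
  assumes "1 < n" "i \<le> n" "0 < r" "r \<le> simplex_angle n"
  shows "hom_line (sphere_clique i r) (Suc i)" "k \<noteq> Suc i \<Longrightarrow> hom_zero (sphere_clique i r) k"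
    and "r \<le> s \<Longrightarrow> s \<le> simplex_angle n \<Longrightarrow> homology_iso (\<lambda>z. z) (sphere_clique i r) (sphere_clique i s) k"
proof -
  have *: "- 1 / (real i + 1) \<le> cos t" "cos t < 1" "0 \<le> t" "t \<le> pi" if t: "0 < t" "t \<le> simplex_angle n" for t
  proof -
    show le: "0 \<le> t" "t \<le> pi"
      using t simplex_angle(3) [OF assms(1)] by auto
    have "- 1 / (real i + 1) \<le> - 1 / (real n + 1)"
      using assms(2) by (simp add: frac_le)
    also have "\<dots> \<le> cos t"
      unfolding simplex_angle(1) [OF assms(1), symmetric]
      using t simplex_angle(3) [OF assms(1)] by (subst cos_mono_le_eq) auto
    finally show "- 1 / (real i + 1) \<le> cos t" .
    show "cos t < 1"
      using cos_monotone_0_pi [of 0 t] t le by simp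
  qed
  show "hom_line (sphere_clique i r) (Suc i)" "k \<noteq> Suc i \<Longrightarrow> hom_zero (sphere_clique i r) k"
    using S.Rips_homology [of i "cos r"] * [of r] assms by (auto simp: sphere_clique_eq)
  assume s: "r \<le> s" "s \<le> simplex_angle n"
  then have "cos s \<le> cos r"
    using * [of s] assms by (subst cos_mono_le_eq) auto
  then show "homology_iso (\<lambda>z. z) (sphere_clique i r) (sphere_clique i s) k"
    using S.Rips_iso [of i "cos s" "cos r"] * [of r] * [of s] assms s by (auto simp: sphere_clique_eq)
qed

text \<open>The scale \<open>1/10\<close> is an arbitrary early one with cosine at least 98/100. Its
  smallness fits into the gap between 2\<pi>/3, where the cap argument takes place, and
  3\<pi>/4.\<close>

lemma sphere_clique_dies:
  assumes "0 < i" "3 * pi / 4 \<le> t" "z \<in> cycles (sphere_clique i (1/10)) k"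
  shows "z \<in> boundaries (sphere_clique i t) k"
proof (cases "t \<le> pi")
  case True
  have "cos t \<le> cos (3 * pi / 4)"
    using assms(2) True by (subst cos_mono_le_eq) auto
  then have t: "cos t \<le> - (7/10)"
    using cos_3pi4 seven_tenths_le_cos by simp
  have "98/100 \<le> cos (1/10 :: real)"
    using cos_ge [of "1/10"] by (simp add: power2_eq_square)
  have e: "sphere_clique i (1/10) = S.Rips i (round_sphere 1 i) (cos (1/10))"
    "sphere_clique i t = S.Rips i (round_sphere 1 i) (cos t)"
    by (rule sphere_clique_eq; use True assms(2) pi_ge_two in linarith)+
  show ?thesis
    using assms(3) unfolding e by (rule S.Rips_cycle_dies [OF assms(1) \<open>98/100 \<le> cos (1/10)\<close> t])
next
  case False
  have "z \<in> cycles (sphere_clique i t) k"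
    by (rule cycles_mono [OF assms(3) clique_less_mono]) (use False pi_ge_two in simp)
  then show ?thesis
    using sphere_clique_hom_zero_full [of t i k] False by (auto simp: hom_zero_def)
qed

interpretation RP: sphere 2 n for n
  by standard simp

lemma projective_space_eq: "projective_space n = RP.line ` round_sphere 2 n"
  by (auto simp: projective_space_def RP.line_def RP.antipode_def)

lemma projective_dist_line:
  "projective_dist n (RP.line x) (RP.line y) = min (2 * arccos (RP.ip n x y)) (2 * arccos (- RP.ip n x y))"
  by (simp add: RP.line_def RP.antipode_def projective_dist_eq RP.geodesic_dist_eq RP.ip_minus_right)

abbreviation "projective_clique n r \<equiv> clique (projective_space n) (\<lambda>x y. projective_dist n x y < r)"

text \<open>The covering sphere has radius 2, so distance \<open>r\<close> is the angle
  \<open>r / 2\<close>; the minimum over representatives turns into a disjunction.\<close>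

lemma projective_clique_eq:
  assumes "0 \<le> r" "r \<le> 2 * pi"
  shows "projective_clique n r = RP.Lines n (cos (r / 2))"
proof -
  have "projective_dist n (RP.line x) (RP.line y) < r \<longleftrightarrow> RP.line_near n (cos (r / 2)) (RP.line x) (RP.line y)"
    if "x \<in> round_sphere 2 n" "y \<in> round_sphere 2 n" for x y
    unfolding projective_dist_line RP.line_near_line
    using arccos_less_iff [of "RP.ip n x y" "r / 2"] arccos_less_iff [of "- RP.ip n x y" "r / 2"]
      RP.ip_bounds(1) [OF that] assms by (simp add: min_less_iff_disj field_simps)
  then show ?thesis
    unfolding projective_space_eq clique_def by blast
qed

lemma projective_dist_le_pi:
  assumes "u \<in> projective_space n" "v \<in> projective_space n"
  shows "projective_dist n u v \<le> pi" "0 \<le> projective_dist n u v"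
proof -
  obtain x y where xy: "x \<in> round_sphere 2 n" "y \<in> round_sphere 2 n" "u = RP.line x" "v = RP.line y"
    using assms unfolding projective_space_eq by blast
  have b: "\<bar>RP.ip n x y\<bar> \<le> 1"
    by (rule RP.ip_bounds(1) [OF xy(1,2)])
  have "arccos (RP.ip n x y) + arccos (- RP.ip n x y) = pi"
    using arccos_minus [of "RP.ip n x y"] b by (simp add: abs_le_iff)
  then show "projective_dist n u v \<le> pi"
    unfolding xy projective_dist_line by linarith
  show "0 \<le> projective_dist n u v"
    unfolding xy projective_dist_line using b by (auto simp: abs_le_iff intro!: arccos_lbound)
qed

lemma projective_clique_hom_zero:
  assumes "r \<le> 0 \<or> pi < r"
  shows "hom_zero (projective_clique n r) (Suc m)"
  using assms
proof
  assume "r \<le> 0"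
  then show ?thesis
    using projective_dist_le_pi(2) by (intro hom_zero_no_vertices) fastforce
next
  assume "pi < r"
  moreover have "RP.line (RP.axis (0, True)) \<in> projective_space n"
    unfolding projective_space_eq by (simp add: RP.axis_sph)
  ultimately show ?thesis
    using projective_dist_le_pi(1) by (intro acyclic_full) fastforce+
qed

lemma cos_half_bounds:
  assumes "0 < r" "r \<le> 2 * pi / 3"
  shows "1/2 \<le> cos (r / 2)" "cos (r / 2) < 1"
proof -
  have "cos (pi / 3) \<le> cos (r / 2)"
    using assms by (subst cos_mono_le_eq) auto
  then show "1/2 \<le> cos (r / 2)"
    by (simp add: cos_60)
  show "cos (r / 2) < 1"
    using cos_monotone_0_pi [of 0 "r / 2"] assms by simp
qed

lemma projective_clique_homology:
  assumes "0 < n" "0 < r" "r \<le> 2 * pi / 3"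
  shows "1 \<le> m \<Longrightarrow> m \<le> n \<Longrightarrow> hom_line (projective_clique n r) (Suc m)"
    and "1 \<le> m \<Longrightarrow> m \<le> n \<Longrightarrow> z \<in> cycles (projective_clique n r) (Suc m) \<Longrightarrow>
      z \<in> boundaries (projective_clique n r) (Suc m) \<longleftrightarrow> RP.line_ev n m z = 0"
    and "m = 0 \<or> n < m \<Longrightarrow> hom_zero (projective_clique n r) (Suc m)"
proof -
  have e: "projective_clique n r = RP.Lines n (cos (r / 2))"
    by (rule projective_clique_eq) (use assms in auto)
  note c = cos_half_bounds [OF assms(2,3)]
  show "hom_line (projective_clique n r) (Suc m)" if "1 \<le> m" "m \<le> n"
    unfolding e using RP.Lines_homology(1) [OF assms(1) c] that by simp
  show "z \<in> boundaries (projective_clique n r) (Suc m) \<longleftrightarrow> RP.line_ev n m z = 0"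
    if "1 \<le> m" "m \<le> n" "z \<in> cycles (projective_clique n r) (Suc m)"
    using RP.Lines_homology(2) [OF assms(1) c] that unfolding e by simp
  show "hom_zero (projective_clique n r) (Suc m)" if "m = 0 \<or> n < m"
    unfolding e using that RP.Lines_hom_zero_1 [OF assms(1) c] RP.Lines_hom_zero_above [OF assms(1) c] by auto
qed

lemma projective_clique_dies:
  assumes "0 < n" "3 * pi / 4 \<le> t" "z \<in> cycles (projective_clique n (1/10)) (Suc m)"
  shows "z \<in> boundaries (projective_clique n t) (Suc m)"
proof (cases "t \<le> pi")
  case True
  have "cos (t / 2) \<le> cos (3 * pi / 8)"
    using assms(2) True by (subst cos_mono_le_eq) auto
  then have t: "cos (t / 2) < 4/10"
    using cos_3pi8 by simp
  have "995/1000 \<le> cos (1/20 :: real)"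
    using cos_ge [of "1/20"] by (simp add: power2_eq_square)
  have e: "projective_clique n (1/10) = RP.Lines n (cos (1/20))" "projective_clique n t = RP.Lines n (cos (t / 2))"
    using projective_clique_eq [of "1/10" n] projective_clique_eq [of t n] True assms(2) pi_ge_two by simp_all
  show ?thesis
    using assms(3) unfolding e by (rule RP.Lines_cycle_dies [OF assms(1) \<open>995/1000 \<le> cos (1/20)\<close> t])
next
  case False
  have "z \<in> cycles (projective_clique n t) (Suc m)"
    by (rule cycles_mono [OF assms(3) clique_less_mono]) (use False pi_ge_two in simp)
  then show ?thesis
    using projective_clique_hom_zero [of t n m] False by (auto simp: hom_zero_def)
qed


section \<open>Vietoris--Rips complexes of the wedge of spheres\<close>

lemma homology_iso_push:
  assumes f: "\<And>s. s \<in> K \<Longrightarrow> f ` s \<in> L" and g: "\<And>s. s \<in> L \<Longrightarrow> g ` s \<in> K"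
    and gf: "\<And>s x. s \<in> K \<Longrightarrow> x \<in> s \<Longrightarrow> g (f x) = x" and fg: "\<And>s y. s \<in> L \<Longrightarrow> y \<in> s \<Longrightarrow> f (g y) = y"
  shows "homology_iso (push f) K L p"
proof -
  have gfz: "push g (push f z) = z" if "z \<in> cycles K p" for z
  proof -
    have "push (\<lambda>x. g (f x)) z = push (\<lambda>x. x) z"
      by (rule push_cong [of z K p]) (use that gf in \<open>auto simp: cycles_def\<close>)
    then show ?thesis
      unfolding push_push by (simp only: push_id)
  qed
  have fgz: "push f (push g z) = z" if "z \<in> cycles L p" for z
  proof -
    have "push (\<lambda>x. f (g x)) z = push (\<lambda>x. x) z"
      by (rule push_cong [of z L p]) (use that fg in \<open>auto simp: cycles_def\<close>)
    then show ?thesis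
      unfolding push_push by (simp only: push_id)
  qed
  show ?thesis
    unfolding homology_iso_def
  proof (intro conjI allI ballI)
    fix z assume z: "z \<in> cycles K p"
    show "push f z \<in> cycles L p"
      by (rule push_cycles [OF f z])
    show "push f z \<in> boundaries L p \<longleftrightarrow> z \<in> boundaries K p"
    proof
      assume "push f z \<in> boundaries L p"
      then have "push g (push f z) \<in> boundaries K p"
        by (rule push_boundaries [OF g, rotated])
      then show "z \<in> boundaries K p"
        by (simp only: gfz [OF z])
    qed (rule push_boundaries [OF f, rotated])
  next
    fix z assume z: "z \<in> cycles L p"
    show "\<exists>w\<in>cycles K p. z + push f w \<in> boundaries L p"
      by (rule bexI [OF _ push_cycles [OF g z]]) (simp only: fgz [OF z] add_self boundaries_0)
  qed (rule lin_add)
qed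

definition wedge_point :: "nat \<Rightarrow> nat \<Rightarrow> (nat \<Rightarrow> real) \<Rightarrow> (nat \<times> (nat \<Rightarrow> real)) set" where
  "wedge_point n i x = wedge_rel {1..n} (round_sphere 1) sphere_base_point `` {(i, x)}"

definition base :: "nat \<Rightarrow> real" where
  "base = (\<lambda>j. if j = 0 then 1 else 0)"

lemma sphere_base_point_eq: "sphere_base_point i = base"
  by (simp add: sphere_base_point_def base_def)

lemma base_sphere: "base \<in> round_sphere 1 i"
  by (auto simp: round_sphere_def base_def if_distrib [of "\<lambda>t. t\<^sup>2"] cong: if_cong)

lemma wedge_point_eq:
  assumes "i \<in> {1..n}" "x \<in> round_sphere 1 i"
  shows "wedge_point n i x = (if x = base then {1..n} \<times> {base} else {(i, x)})"
  using assms base_sphere by (auto simp: wedge_point_def wedge_rel_def sphere_base_point_eq)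

lemma wedge_point_eq_iff:
  assumes "i \<in> {1..n}" "x \<in> round_sphere 1 i" "j \<in> {1..n}" "y \<in> round_sphere 1 j"
  shows "wedge_point n i x = wedge_point n j y \<longleftrightarrow> i = j \<and> x = y \<or> x = base \<and> y = base"
proof -
  have "{1..n} \<times> {base} \<noteq> {(k, z)}" if "z \<noteq> base" for k z
    using that assms(1) by blast
  then show ?thesis
    unfolding wedge_point_eq [OF assms(1,2)] wedge_point_eq [OF assms(3,4)] by (metis Pair_inject singleton_inject)
qed

lemma sphere_wedge_eq: "sphere_wedge n = (\<Union>i\<in>{1..n}. wedge_point n i ` round_sphere 1 i)"
  by (auto simp: sphere_wedge_def wedge_def quotient_def wedge_point_def)

lemma sphere_wedge_dist_points:
  assumes "i \<in> {1..n}" "x \<in> round_sphere 1 i" "j \<in> {1..n}" "y \<in> round_sphere 1 j"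
  shows "sphere_wedge_dist (wedge_point n i x) (wedge_point n j y) =
    (if i = j then geodesic_dist 1 i x y else geodesic_dist 1 i x base + geodesic_dist 1 j y base)"
proof -
  have "sphere_wedge_dist (wedge_point n i x) (wedge_point n j y) = gluing_dist (geodesic_dist 1) sphere_base_point (i, x) (j, y)"
    unfolding sphere_wedge_dist_def wedge_point_def
  proof (rule wedge_dist_eq)
    show "geodesic_dist 1 k (sphere_base_point k) (sphere_base_point k) = 0" for k
      unfolding S.geodesic_dist_eq sphere_base_point_eq using S.sphD(1) [OF base_sphere, of k] by simp
    show "geodesic_dist 1 k u v = geodesic_dist 1 k v u" for k u v
      by (simp add: S.geodesic_dist_eq S.ip_commute)
  qed (use assms in auto)
  then show ?thesis
    by (simp add: gluing_dist_def sphere_base_point_eq)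
qed

lemma sphere_wedge_dist_sym: "sphere_wedge_dist u v = sphere_wedge_dist v u"
  by (simp add: sphere_wedge_dist_def wedge_dist_def gluing_dist_def S.geodesic_dist_eq S.ip_commute)

abbreviation "wedge_clique n r \<equiv> clique (sphere_wedge n) (\<lambda>u v. sphere_wedge_dist u v < r)"

abbreviation "summand n i \<equiv> wedge_point n i ` round_sphere 1 i"

abbreviation "summand_clique n i r \<equiv> clique (summand n i) (\<lambda>u v. sphere_wedge_dist u v < r)"

lemma geodesic_dist_nonneg:
  assumes "x \<in> round_sphere 1 i" "y \<in> round_sphere 1 i"
  shows "0 \<le> geodesic_dist 1 i x y"
  using S.ip_bounds [OF assms] by (simp add: S.geodesic_dist_eq arccos_lbound)

text \<open>\<open>N_cross\<close> is the gluing metric: a distance across two summands contains the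
  distance to the base point as a nonnegative part.\<close>

lemma wedge_complex_sphere_wedge:
  assumes n: "0 < n" and r: "0 < r"
  shows "wedge_complex {1..n} (summand n) (wedge_point n 1 base) (\<lambda>u v. sphere_wedge_dist u v < r)"
proof
  have b: "wedge_point n 1 base = wedge_point n i base" if "i \<in> {1..n}" for i
    using wedge_point_eq_iff [of 1 n base i base] that base_sphere n by simp
  show "finite {1..n}" "{1..n} \<noteq> {}"
    using n by auto
  show "wedge_point n 1 base \<in> summand n i" if "i \<in> {1..n}" for i
    using b [OF that] base_sphere by auto
  show "u = wedge_point n 1 base"
    if ij: "i \<in> {1..n}" "j \<in> {1..n}" "i \<noteq> j" and u: "u \<in> summand n i" "u \<in> summand n j" for i j u
  proof -
    obtain x y where xy: "x \<in> round_sphere 1 i" "u = wedge_point n i x" "y \<in> round_sphere 1 j" "u = wedge_point n j y"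
      using u by blast
    then have "x = base"
      using wedge_point_eq_iff [OF ij(1) xy(1) ij(2) xy(3)] ij(3) by auto
    then show ?thesis
      using xy b [OF ij(1)] by simp
  qed
  have 1: "1 \<in> {1..n}" using n by simp
  show "sphere_wedge_dist (wedge_point n 1 base) (wedge_point n 1 base) < r"
    unfolding sphere_wedge_dist_points [OF 1 base_sphere 1 base_sphere]
    using r S.sphD(1) [OF base_sphere, of 1] by (simp add: S.geodesic_dist_eq)
  show "sphere_wedge_dist v u < r" if "sphere_wedge_dist u v < r" for u v
    using that by (simp add: sphere_wedge_dist_sym)
  show "sphere_wedge_dist u (wedge_point n 1 base) < r"
    if ij: "i \<in> {1..n}" "j \<in> {1..n}" "i \<noteq> j" and u: "u \<in> summand n i" and v: "v \<in> summand n j"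
      and uv: "sphere_wedge_dist u v < r" for i j u v
  proof -
    obtain x y where xy: "x \<in> round_sphere 1 i" "u = wedge_point n i x" "y \<in> round_sphere 1 j" "v = wedge_point n j y"
      using u v by blast
    have "sphere_wedge_dist u (wedge_point n 1 base) = geodesic_dist 1 i x base"
      unfolding b [OF ij(1)] xy sphere_wedge_dist_points [OF ij(1) xy(1) ij(1) base_sphere] by simp
    also have "\<dots> \<le> sphere_wedge_dist u v"
      unfolding xy sphere_wedge_dist_points [OF ij(1) xy(1) ij(2) xy(3)]
      using ij(3) geodesic_dist_nonneg [OF xy(3) base_sphere] by simp
    finally show ?thesis using uv by simp
  qed
qed

lemma summand_clique_iso:
  assumes i: "i \<in> {1..n}"
  shows "homology_iso (push (wedge_point n i)) (sphere_clique i r) (summand_clique n i r) p"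
proof (rule homology_iso_push)
  let ?q = "wedge_point n i" and ?g = "the_inv_into (round_sphere 1 i) (wedge_point n i)"
  have inj: "inj_on ?q (round_sphere 1 i)"
    using wedge_point_eq_iff [OF i _ i] by (auto simp: inj_on_def)
  have d: "sphere_wedge_dist (?q x) (?q y) = geodesic_dist 1 i x y" if "x \<in> round_sphere 1 i" "y \<in> round_sphere 1 i" for x y
    by (simp add: sphere_wedge_dist_points [OF i that(1) i that(2)])
  show "?q ` s \<in> summand_clique n i r" if s: "s \<in> sphere_clique i r" for s
    by (rule clique_image [OF s]) (simp_all add: d)
  show "?g ` s \<in> sphere_clique i r" if s: "s \<in> summand_clique n i r" for s
    by (rule clique_image [OF s]) (auto simp: d the_inv_into_f_f [OF inj])
  show "?g (?q x) = x" if "s \<in> sphere_clique i r" "x \<in> s" for s x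
    using cliqueD(1) [OF that] by (rule the_inv_into_f_f [OF inj])
  show "?q (?g u) = u" if "s \<in> summand_clique n i r" "u \<in> s" for s u
    using cliqueD(1) [OF that] by (rule f_the_inv_into_f [OF inj])
qed

lemma summand_clique_reflects:
  assumes i: "i \<in> {1..n}" and rs: "r \<le> s" and z: "z \<in> cycles (summand_clique n i r) k"
    and *: "\<And>w. w \<in> cycles (sphere_clique i r) k \<Longrightarrow> w \<in> boundaries (sphere_clique i s) k \<Longrightarrow> w \<in> boundaries (sphere_clique i r) k"
    and "z \<in> boundaries (summand_clique n i s) k"
  shows "z \<in> boundaries (summand_clique n i r) k"
proof -
  note iso = summand_clique_iso [OF i]
  let ?f = "push (wedge_point n i)"
  obtain w where w: "w \<in> cycles (sphere_clique i r) k" "z + ?f w \<in> boundaries (summand_clique n i r) k"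
    using iso [of r k] z by (auto simp: homology_iso_def)
  have "z + ?f w \<in> boundaries (summand_clique n i s) k"
    by (rule boundaries_mono [OF w(2) clique_less_mono [OF rs]])
  then have "?f w \<in> boundaries (summand_clique n i s) k"
    using boundaries_add_cancel assms(5) by blast
  moreover have "w \<in> cycles (sphere_clique i s) k"
    by (rule cycles_mono [OF w(1) clique_less_mono [OF rs]])
  ultimately have "w \<in> boundaries (sphere_clique i s) k"
    using iso [of s k] by (auto simp: homology_iso_def)
  then have "?f w \<in> boundaries (summand_clique n i r) k"
    using * w(1) iso [of r k] by (auto simp: homology_iso_def)
  then show ?thesis
    using w(2) boundaries_add_cancel [of "?f w"] by (metis add.commute)
qed

lemma summand_clique_dies:
  assumes i: "i \<in> {1..n}" and t: "3 * pi / 4 \<le> t" and z: "z \<in> cycles (summand_clique n i (1/10)) k"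
  shows "z \<in> boundaries (summand_clique n i t) k"
proof -
  note iso = summand_clique_iso [OF i]
  let ?f = "push (wedge_point n i)"
  have rt: "1/10 \<le> t" using t pi_ge_two by simp
  obtain w where w: "w \<in> cycles (sphere_clique i (1/10)) k" "z + ?f w \<in> boundaries (summand_clique n i (1/10)) k"
    using iso [of "1/10" k] z by (auto simp: homology_iso_def)
  have "w \<in> boundaries (sphere_clique i t) k"
    by (rule sphere_clique_dies [OF _ t w(1)]) (use i in simp)
  moreover have "w \<in> cycles (sphere_clique i t) k"
    by (rule cycles_mono [OF w(1) clique_less_mono [OF rt]])
  ultimately have "?f w \<in> boundaries (summand_clique n i t) k"
    using iso [of t k] by (auto simp: homology_iso_def)
  then show ?thesis
    using boundaries_mono [OF w(2) clique_less_mono [OF rt]] boundaries_add_cancel [of "?f w"] by (metis add.commute)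
qed

lemma summand_clique_hom_zero:
  "i \<in> {1..n} \<Longrightarrow> hom_zero (summand_clique n i r) k \<longleftrightarrow> hom_zero (sphere_clique i r) k"
  using homology_iso_hom_zero [OF summand_clique_iso] by blast

lemma wedge_clique_hom_zero:
  assumes "0 < n" "r \<le> 0 \<or> pi < r"
  shows "hom_zero (wedge_clique n r) (Suc m)"
  using assms(2)
proof
  assume r: "r \<le> 0"
  have "0 \<le> sphere_wedge_dist u u" if "u \<in> sphere_wedge n" for u
    using that geodesic_dist_nonneg unfolding sphere_wedge_eq by (auto simp: sphere_wedge_dist_points)
  then show ?thesis
    using r by (intro hom_zero_no_vertices) fastforce
next
  assume r: "pi < r"
  then have "0 < r" using pi_gt_zero by linarith
  then interpret wedge_complex "{1..n}" "summand n" "wedge_point n 1 base" "\<lambda>u v. sphere_wedge_dist u v < r"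
    by (rule wedge_complex_sphere_wedge [OF assms(1)])
  have "hom_zero K (Suc m)"
    by (rule wedge_hom_zero) (use summand_clique_hom_zero sphere_clique_hom_zero_full [OF r] in blast)
  then show ?thesis
    by (simp add: sphere_wedge_eq)
qed

lemma wedge_clique_homology:
  assumes n: "1 < n" and r: "0 < r" "r \<le> simplex_angle n"
  shows "1 \<le> m \<Longrightarrow> m \<le> n \<Longrightarrow> hom_line (wedge_clique n r) (Suc m)"
    and "m = 0 \<or> n < m \<Longrightarrow> hom_zero (wedge_clique n r) (Suc m)"
proof -
  interpret wedge_complex "{1..n}" "summand n" "wedge_point n 1 base" "\<lambda>u v. sphere_wedge_dist u v < r"
    by (rule wedge_complex_sphere_wedge) (use n r in auto)
  have zero: "hom_zero (S i) (Suc m)" if "i \<in> {1..n}" "m \<noteq> i" for i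
    using summand_clique_hom_zero [OF that(1), of r "Suc m"] sphere_clique_homology(2) [OF n _ r, of i "Suc m"] that by simp
  show "hom_line (wedge_clique n r) (Suc m)" if m: "1 \<le> m" "m \<le> n"
  proof -
    have "hom_line (S m) (Suc m)"
      by (rule homology_iso_hom_line [OF summand_clique_iso sphere_clique_homology(1)]) (use n m r in auto)
    then have "hom_line K (Suc m)"
      by (rule homology_iso_hom_line [OF summand_iso, rotated 2]) (use m zero in auto)
    then show ?thesis
      by (simp add: sphere_wedge_eq)
  qed
  show "hom_zero (wedge_clique n r) (Suc m)" if "m = 0 \<or> n < m"
  proof -
    have "hom_zero K (Suc m)"
      by (rule wedge_hom_zero [OF zero]) (use that in auto)
    then show ?thesis
      by (simp add: sphere_wedge_eq)
  qed
qed

lemma wedge_clique_reflects: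
  assumes n: "1 < n" and r: "0 < r" "r \<le> s" "s \<le> simplex_angle n"
    and z: "z \<in> cycles (wedge_clique n r) k" "z \<in> boundaries (wedge_clique n s) k"
  shows "z \<in> boundaries (wedge_clique n r) k"
proof -
  interpret r: wedge_complex "{1..n}" "summand n" "wedge_point n 1 base" "\<lambda>u v. sphere_wedge_dist u v < r"
    by (rule wedge_complex_sphere_wedge) (use n r in auto)
  interpret s: wedge_complex "{1..n}" "summand n" "wedge_point n 1 base" "\<lambda>u v. sphere_wedge_dist u v < s"
    by (rule wedge_complex_sphere_wedge) (use n r in auto)
  have z': "z \<in> cycles r.K k" "z \<in> boundaries s.K k"
    using z by (simp_all add: sphere_wedge_eq)
  have "push (r.ret i) z \<in> boundaries (r.S i) k" if i: "i \<in> {1..n}" for i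
  proof (rule summand_clique_reflects [OF i r(2) r.ret_cycles [OF i z'(1)] _ s.ret_boundaries [OF i z'(2)]])
    show "w \<in> boundaries (sphere_clique i r) k"
      if "w \<in> cycles (sphere_clique i r) k" "w \<in> boundaries (sphere_clique i s) k" for w
      using that sphere_clique_homology(3) [OF n _ r(1) _ r(2,3), of i k] i r by (simp add: homology_iso_def)
  qed
  then show ?thesis
    using r.boundary_iff [OF z'(1)] by (simp add: sphere_wedge_eq)
qed

lemma wedge_clique_dies:
  assumes n: "0 < n" and t: "3 * pi / 4 \<le> t" and z: "z \<in> cycles (wedge_clique n (1/10)) k"
  shows "z \<in> boundaries (wedge_clique n t) k"
proof -
  have rt: "1/10 \<le> t" using t pi_ge_two by simp
  interpret r: wedge_complex "{1..n}" "summand n" "wedge_point n 1 base" "\<lambda>u v. sphere_wedge_dist u v < 1/10"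
    by (rule wedge_complex_sphere_wedge) (use n in auto)
  interpret t: wedge_complex "{1..n}" "summand n" "wedge_point n 1 base" "\<lambda>u v. sphere_wedge_dist u v < t"
    by (rule wedge_complex_sphere_wedge) (use n rt in auto)
  have z': "z \<in> cycles r.K k" "z \<in> cycles t.K k"
    using z cycles_mono [OF z clique_less_mono [OF rt]] by (simp_all add: sphere_wedge_eq)
  have "push (t.ret i) z \<in> boundaries (t.S i) k" if i: "i \<in> {1..n}" for i
    using summand_clique_dies [OF i t r.ret_cycles [OF i z'(1)]] .
  then show ?thesis
    using t.boundary_iff [OF z'(2)] by (simp add: sphere_wedge_eq)
qed


section \<open>The homology interleaving\<close>

lemma VR_homology_interleaved:
  assumes n: "1 < n"
  shows "interleaved ((pi - simplex_angle n) / 2)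
    (VR_homology m (projective_space n) (projective_dist n)) (VR_homology m (sphere_wedge n) sphere_wedge_dist)"
proof -
  define a where "a = simplex_angle n"
  define \<delta> where "\<delta> = (pi - a) / 2"
  have a: "pi / 2 < a" "a < 2 * pi / 3" "0 < a" "1/10 \<le> a"
    using simplex_angle(2,3) [OF n] pi_ge_two by (auto simp: a_def)
  have \<delta>: "0 \<le> \<delta>" "a + 2 * \<delta> = pi" "3 * pi / 4 \<le> a + \<delta>"
    using a by (auto simp: \<delta>_def field_simps)
  have n0: "0 < n" using n by simp
  have r: "r \<le> 2 * pi / 3" if "r \<le> a" for r
    using that a by simp
  show ?thesis
    unfolding a_def [symmetric] \<delta>_def [symmetric]
  proof (cases "1 \<le> m \<and> m \<le> n")
    case True
    have "\<exists>f. line_barcode (VR_cycles m (projective_space n) (projective_dist n))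
        (VR_boundaries m (projective_space n) (projective_dist n)) (VR_homology m (projective_space n) (projective_dist n)) a \<delta> f"
    proof (rule VR_line_barcode [OF \<delta>(1) a(3), where ?r0.0 = "1/10"])
      show "hom_line (projective_clique n r) (Suc m)" if "0 < r" "r \<le> a" for r
        using projective_clique_homology(1) [OF n0 that(1) r [OF that(2)]] True by blast
      show "z \<in> boundaries (projective_clique n r) (Suc m)"
        if rs: "0 < r" "r \<le> s" "s \<le> a" and z: "z \<in> cycles (projective_clique n r) (Suc m)"
          "z \<in> boundaries (projective_clique n s) (Suc m)" for r s z
      proof -
        have s: "0 < s" "s \<le> 2 * pi / 3" "r \<le> 2 * pi / 3"
          using rs r [of s] by auto
        have "z \<in> cycles (projective_clique n s) (Suc m)"
          by (rule cycles_mono [OF z(1) clique_less_mono [OF rs(2)]])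
        then show ?thesis
          using projective_clique_homology(2) [OF n0 rs(1) s(3)] projective_clique_homology(2) [OF n0 s(1,2)] z True
          by blast
      qed
      show "hom_zero (projective_clique n r) (Suc m)" if "r \<le> 0 \<or> a + 2 * \<delta> < r" for r
        by (rule projective_clique_hom_zero) (use that \<delta>(2) in simp)
      show "cycles (projective_clique n (1/10)) (Suc m) \<subseteq> boundaries (projective_clique n t) (Suc m)" if "a + \<delta> < t" for t
        using projective_clique_dies [OF n0, of t] that \<delta>(3) by auto
    qed (use a in auto)
    moreover have "\<exists>f. line_barcode (VR_cycles m (sphere_wedge n) sphere_wedge_dist)
        (VR_boundaries m (sphere_wedge n) sphere_wedge_dist) (VR_homology m (sphere_wedge n) sphere_wedge_dist) a \<delta> f"
    proof (rule VR_line_barcode [OF \<delta>(1) a(3), where ?r0.0 = "1/10"])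
      show "hom_line (wedge_clique n r) (Suc m)" if "0 < r" "r \<le> a" for r
        using wedge_clique_homology(1) [OF n that [unfolded a_def]] True by blast
      show "z \<in> boundaries (wedge_clique n r) (Suc m)"
        if "0 < r" "r \<le> s" "s \<le> a" "z \<in> cycles (wedge_clique n r) (Suc m)" "z \<in> boundaries (wedge_clique n s) (Suc m)" for r s z
        using wedge_clique_reflects [OF n that [unfolded a_def]] .
      show "hom_zero (wedge_clique n r) (Suc m)" if "r \<le> 0 \<or> a + 2 * \<delta> < r" for r
        by (rule wedge_clique_hom_zero [OF n0]) (use that \<delta>(2) in simp)
      show "cycles (wedge_clique n (1/10)) (Suc m) \<subseteq> boundaries (wedge_clique n t) (Suc m)" if "a + \<delta> < t" for t
        using wedge_clique_dies [OF n0, of t] that \<delta>(3) by auto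
    qed (use a in auto)
    ultimately show "interleaved \<delta> (VR_homology m (projective_space n) (projective_dist n))
        (VR_homology m (sphere_wedge n) sphere_wedge_dist)"
      using interleaved_line_barcodes by blast
  next
    case False
    then have m: "m = 0 \<or> n < m" by auto
    have P: "hom_zero (projective_clique n r) (Suc m)" if "r \<le> a \<or> pi < r" for r
      using projective_clique_homology(3) [OF n0 _ r m, of r] projective_clique_hom_zero [of r n m] that
      by (cases "0 < r") auto
    have W: "hom_zero (wedge_clique n r) (Suc m)" if "r \<le> a \<or> pi < r" for r
      using wedge_clique_homology(2) [OF n _ _ m, of r] wedge_clique_hom_zero [OF n0, of r m] that
      by (cases "0 < r") (auto simp: a_def)
    have die: "cycles (clique M (\<lambda>x y. d x y < r)) (Suc m) \<subseteq> boundaries (clique M (\<lambda>x y. d x y < r + 2 * \<delta>)) (Suc m)"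
      if z: "\<And>r. r \<le> a \<or> pi < r \<Longrightarrow> hom_zero (clique M (\<lambda>x y. d x y < r)) (Suc m)"
      for M :: "'x set" and d and r
    proof -
      have le: "r \<le> r + 2 * \<delta>" using \<delta>(1) by simp
      \<comment> \<open>The window \<open>(a, \<pi>]\<close> has length \<open>2 * \<delta>\<close>:
        either the scale \<open>r\<close> has not entered it, or \<open>r + 2 * \<delta>\<close> has
        left it.\<close>
      consider "r \<le> a" | "pi < r + 2 * \<delta>" using \<delta>(2) by linarith
      then show ?thesis
      proof cases
        case 1
        then show ?thesis
          using z [of r] boundaries_mono [OF _ clique_less_mono [OF le]] unfolding hom_zero_def by blast
      next
        case 2
        then show ?thesis
          using z [of "r + 2 * \<delta>"] cycles_mono [OF _ clique_less_mono [OF le]] unfolding hom_zero_def by blast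
      qed
    qed
    show "interleaved \<delta> (VR_homology m (projective_space n) (projective_dist n))
        (VR_homology m (sphere_wedge n) sphere_wedge_dist)"
    proof (rule interleaved_zero [OF filtered_quotient_VR filtered_quotient_VR \<delta>(1)])
      show "VR_cycles m (projective_space n) (projective_dist n) r
          \<subseteq> VR_boundaries m (projective_space n) (projective_dist n) (r + 2 * \<delta>)" for r
        by (rule VR_cycles_die [OF _ die [OF P]]) (use \<delta>(1) in auto)
      show "VR_cycles m (sphere_wedge n) sphere_wedge_dist r
          \<subseteq> VR_boundaries m (sphere_wedge n) sphere_wedge_dist (r + 2 * \<delta>)" for r
        by (rule VR_cycles_die [OF _ die [OF W]]) (use \<delta>(1) in auto)
    qed
  qed
qed

lemma homology_interleaving_distance:
  assumes n: "1 < n"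
  shows "interleaving_distance (VR_homology m (projective_space n) (projective_dist n))
    (VR_homology m (sphere_wedge n) sphere_wedge_dist) < ereal (pi / 4)"
proof -
  let ?\<delta> = "(pi - simplex_angle n) / 2"
  have "0 \<le> ?\<delta>" "?\<delta> < pi / 4"
    using simplex_angle(2,3) [OF n] pi_gt_zero by simp_all
  have "interleaving_distance (VR_homology m (projective_space n) (projective_dist n))
      (VR_homology m (sphere_wedge n) sphere_wedge_dist) \<le> ereal ?\<delta>"
    unfolding interleaving_distance_def
    by (rule INF_lower) (use VR_homology_interleaved [OF n] \<open>0 \<le> ?\<delta>\<close> in simp)
  also have "\<dots> < ereal (pi / 4)"
    using \<open>?\<delta> < pi / 4\<close> by simp
  finally show ?thesis .
qed


section \<open>Squares of cohomology classes of degree one, and the lower bound\<close>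

section \<open>Extending functionals\<close>

text \<open>Every subspace has a complement, once chains are viewed as a vector space over
  \<open>bit\<close>.\<close>

lemma mod2_projection:
  fixes S :: "'a mod2 set"
  assumes "0 \<in> S" "\<And>x y. x \<in> S \<Longrightarrow> y \<in> S \<Longrightarrow> x + y \<in> S"
  shows "\<exists>g. (\<forall>x y. g (x + y) = g x + g y) \<and> range g \<subseteq> S \<and> (\<forall>x\<in>S. g x = x)"
proof -
  define s where "s = (\<lambda>(c::bit) (x::'a mod2). if c = 0 then 0 else x)"
  have s: "vector_space s"
  proof
    fix c d :: bit and x y :: "'a mod2"
    show "s c (x + y) = s c x + s c y" "s c (s d x) = s (c * d) x" "s 1 x = x"
      by (simp_all add: s_def)
    show "s (c + d) x = s c x + s d x"
      by (cases c; cases d) (simp_all add: s_def)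
  qed
  interpret vector_space_pair s s
    using s by (simp add: vector_space_pair_def)
  have "Vector_Spaces.linear s s (\<lambda>x. x)"
    using vs1.linear_id by (simp add: id_def)
  moreover have "vs1.subspace S"
    unfolding vs1.subspace_def using assms by (auto simp: s_def)
  ultimately obtain g where "range g \<subseteq> S" "Vector_Spaces.linear s s g" "\<forall>v\<in>S. g v = v"
    using linear_exists_left_inverse_on [of "\<lambda>x. x" S] by (auto simp: inj_on_def)
  moreover from this have "\<forall>x y. g (x + y) = g x + g y"
    using linear_add by blast
  ultimately show ?thesis by blast
qed

text \<open>A functional that vanishes on the kernel of \<open>D\<close> factors through the image
  of \<open>D\<close> and extends from there by a projection. With \<open>D\<close> the boundary
  operator this is the duality between homology and cohomology; with \<open>D\<close> the identity
  it extends a functional from a subspace.\<close>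

lemma factor_functional:
  fixes D :: "'a mod2 \<Rightarrow> 'b mod2" and c :: "'a mod2 \<Rightarrow> bit"
  assumes C: "0 \<in> C" "\<And>x y. x \<in> C \<Longrightarrow> y \<in> C \<Longrightarrow> x + y \<in> C"
    and D: "D 0 = 0" "\<And>x y. D (x + y) = D x + D y"
    and c: "\<And>x y. x \<in> C \<Longrightarrow> y \<in> C \<Longrightarrow> c (x + y) = c x + c y"
    and ker: "\<And>x. x \<in> C \<Longrightarrow> D x = 0 \<Longrightarrow> c x = 0"
  shows "\<exists>h. \<forall>x\<in>C. lin h (D x) = c x"
proof -
  define k where "k v = (SOME x. x \<in> C \<and> D x = v)" for v
  have k: "k v \<in> C" "D (k v) = v" if "v \<in> D ` C" for v
    unfolding k_def by (rule someI2_ex; use that in blast)+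
  have ck: "c (k (D x)) = c x" if x: "x \<in> C" for x
  proof -
    have kx: "k (D x) \<in> C" "D (k (D x)) = D x"
      using k [of "D x"] x by auto
    have "c (k (D x) + x) = 0"
      using ker [OF C(2) [OF kx(1) x]] kx(2) by (simp add: D(2))
    then show ?thesis
      using c [OF kx(1) x] by (simp only: add_eq_0_char2)
  qed
  have S: "0 \<in> D ` C" "\<And>v w. v \<in> D ` C \<Longrightarrow> w \<in> D ` C \<Longrightarrow> v + w \<in> D ` C"
    using C D by (force, auto simp flip: D(2))
  obtain g where "(\<forall>x y. g (x + y) = g x + g y) \<and> range g \<subseteq> D ` C \<and> (\<forall>x\<in>D ` C. g x = x)"
    using mod2_projection [OF S] ..
  then have g: "g (v + w) = g v + g w" "g v \<in> D ` C" "v \<in> D ` C \<Longrightarrow> g v = v" for v w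
    by auto
  have "c (k (g v)) = lin (\<lambda>x. c (k (g (gen x)))) v" for v
  proof (rule lin_unique)
    show "c (k (g 0)) = 0"
      using ck [OF C(1)] ker [OF C(1)] g(3) [OF S(1)] D(1) by simp
    show "c (k (g (v + w))) = c (k (g v)) + c (k (g w))" for v w
    proof -
      obtain x y where "x \<in> C" "y \<in> C" "g v = D x" "g w = D y"
        using g(2) [of v] g(2) [of w] by blast
      then show ?thesis
        using ck C(2) c by (simp add: g(1) flip: D(2))
    qed
  qed simp
  moreover have "c (k (g (D x))) = c x" if "x \<in> C" for x
    using ck [OF that] g(3) [of "D x"] that by simp
  ultimately show ?thesis by metis
qed


section \<open>The Steenrod square on classes of degree one\<close>

abbreviation "square \<equiv> steenrod_cochain 1 1"

text \<open>Here \<open>l - k = 0\<close>, so the sum is the cup product. Only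
  \<open>U = {0, 2}\<close> splits into two singletons: 2 is the second element and matches its
  position in parity, 0 is the first and does not. Deleting 2 and 0 leaves the front and the back
  edge.\<close>

lemma square_eq:
  "square X x \<sigma> = (if singular_simplex 2 X \<sigma> then x (singular_face 2 2 \<sigma>) * x (singular_face 2 0 \<sigma>) else 0)"
proof -
  have filter: "{u \<in> insert a A. P u} = (if P a then insert a {u \<in> A. P u} else {u \<in> A. P u})" for a :: nat and A P
    by auto
  have mp: "matching_parity {} = {}" "matching_parity {0} = {}" "matching_parity {1} = {1}" "matching_parity {2} = {}"
    "matching_parity {0, 1} = {}" "matching_parity {0, 2} = {2}" "matching_parity {1, 2} = {1, 2}"
    "matching_parity {0, 1, 2} = {}"
    unfolding matching_parity_def filter by simp_all
  have "U = {0, 2}" if U: "U \<subseteq> {0..2}" "card (matching_parity U) = 1" "card (U - matching_parity U) = 1" for U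
  proof -
    have "U = (if 0 \<in> U then {0} else {}) \<union> (if 1 \<in> U then {1} else {}) \<union> (if 2 \<in> U then {2} else {})"
      using U(1) by (auto simp: subset_iff le_Suc_eq numeral_2_eq_2)
    then have "U = {} \<or> U = {0} \<or> U = {1} \<or> U = {2} \<or> U = {0, 1} \<or> U = {0, 2} \<or> U = {1, 2} \<or> U = {0, 1, 2}"
      by (cases "0 \<in> U"; cases "1 \<in> U"; cases "2 \<in> U") (simp_all add: insert_commute)
    then show ?thesis
      using U(2,3) mp by (elim disjE) simp_all
  qed
  then have U: "{U. U \<subseteq> {0..2} \<and> card (matching_parity U) = 1 \<and> card (U - matching_parity U) = 1} = {{0, 2}}"
    using mp by auto
  have 1: "(1::nat) + 1 - (1 - 1) = 2" "(1::nat) - (1 - 1) = 1" "((1::nat) \<le> 1) = True"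
    by simp_all
  have "{0, 2} - {2} = {0::nat}"
    by auto
  then have 2: "delete_vertices 2 (matching_parity {0, 2}) \<sigma> = singular_face 2 2 \<sigma>"
    "delete_vertices 2 ({0, 2} - matching_parity {0, 2}) \<sigma> = singular_face 2 0 \<sigma>"
    unfolding mp by (simp_all add: delete_vertices_def)
  show ?thesis
    unfolding steenrod_cochain_def cup_i_def Let_def 1 if_True U
    by (simp only: sum.insert sum.empty finite.emptyI empty_iff not_False_eq_True add_0_right 2)
qed

lemma lin_coboundary:
  assumes "c \<in> schains (Suc p) X"
  shows "lin (F2_coboundary p X x) c = lin x (sbd (Suc p) c)"
  unfolding lin_lin using assms
  by (rule lin_cong_chains) (simp add: F2_coboundary_def sface_def lin_sum del: sum.atMost_Suc)

lemma F2_coboundary_eq: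
  "singular_simplex (Suc p) X \<sigma> \<Longrightarrow> F2_coboundary p X x \<sigma> = lin x (sface (Suc p) \<sigma>)"
  by (simp add: F2_coboundary_def sface_def lin_sum del: sum.atMost_Suc)

lemma cocycle_sface:
  assumes "x \<in> F2_cocycles p X" "singular_simplex (Suc p) X \<sigma>"
  shows "lin x (sface (Suc p) \<sigma>) = 0"
  using assms F2_coboundary_eq [OF assms(2), of x] by (simp add: F2_cocycles_def fun_eq_iff)

lemma coboundary_cocycle:
  assumes "x \<in> F2_coboundaries (Suc p) X"
  shows "x \<in> F2_cocycles (Suc p) X"
proof -
  obtain b where b: "x = F2_coboundary p X b"
    using assms by (auto simp: F2_coboundaries_def)
  have "F2_coboundary (Suc p) X x \<sigma> = 0" for \<sigma>
  proof (cases "singular_simplex (Suc (Suc p)) X \<sigma>")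
    case True
    then have g: "gen \<sigma> \<in> schains (Suc (Suc p)) X"
      by (simp add: chain_space_def)
    have "F2_coboundary (Suc p) X x \<sigma> = lin x (sbd (Suc (Suc p)) (gen \<sigma>))"
      using F2_coboundary_eq [OF True] by simp
    also have "\<dots> = lin b (sbd (Suc p) (sbd (Suc (Suc p)) (gen \<sigma>)))"
      unfolding b by (rule lin_coboundary [OF sbd_schains [OF g]])
    also have "\<dots> = 0"
      unfolding sbd_sbd [OF g] by (rule lin_0)
    finally show ?thesis .
  qed (simp add: F2_coboundary_def)
  then show ?thesis
    unfolding b by (auto simp: F2_cocycles_def F2_cochains_def F2_coboundary_def)
qed

lemma F2_coboundary_add: "F2_coboundary p X (x \<boxplus> y) = F2_coboundary p X x \<boxplus> F2_coboundary p X y"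
proof
  fix \<sigma>
  show "F2_coboundary p X (x \<boxplus> y) \<sigma> = (F2_coboundary p X x \<boxplus> F2_coboundary p X y) \<sigma>"
    by (cases "singular_simplex (Suc p) X \<sigma>")
      (simp_all only: F2_coboundary_def fadd_def if_True if_False sum.distrib add_0_right)
qed

lemma F2_subspace_cocycles: "F2_subspace (F2_cocycles p X)"
proof -
  have "fzero \<in> F2_cocycles p X"
    by (simp add: F2_cocycles_def F2_cochains_def F2_coboundary_def fun_eq_iff)
  moreover have "x \<boxplus> y \<in> F2_cocycles p X" if "x \<in> F2_cocycles p X" "y \<in> F2_cocycles p X" for x y
  proof -
    have "x \<boxplus> y \<in> F2_cochains p X"
      using that by (simp add: F2_cocycles_def F2_cochains_def fadd_def)
    moreover have "F2_coboundary p X (x \<boxplus> y) = fzero"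
      using that by (simp only: F2_cocycles_def mem_Collect_eq F2_coboundary_add fadd_zero)
    ultimately show ?thesis
      by (simp add: F2_cocycles_def)
  qed
  ultimately show ?thesis
    by (simp add: F2_subspace_def)
qed

lemma F2_subspace_coboundaries: "F2_subspace (F2_coboundaries (Suc p) X)"
  unfolding F2_subspace_def F2_coboundaries_def nat.case
proof (intro conjI ballI)
  show "fzero \<in> F2_coboundary p X ` F2_cochains p X"
    by (rule image_eqI [of _ _ fzero]) (simp_all add: F2_coboundary_def F2_cochains_def fun_eq_iff)
  fix x y assume "x \<in> F2_coboundary p X ` F2_cochains p X" "y \<in> F2_coboundary p X ` F2_cochains p X"
  then obtain a b where ab: "a \<in> F2_cochains p X" "x = F2_coboundary p X a" "b \<in> F2_cochains p X" "y = F2_coboundary p X b"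
    by blast
  show "x \<boxplus> y \<in> F2_coboundary p X ` F2_cochains p X"
    unfolding ab F2_coboundary_add [symmetric]
    by (rule imageI) (use ab in \<open>simp add: F2_cochains_def fadd_def\<close>)
qed

text \<open>A cochain that vanishes on all cycles is a functional of the boundary.\<close>

lemma coboundaryI:
  assumes x: "x \<in> F2_cochains (Suc p) X" and z: "\<And>z. z \<in> schains (Suc p) X \<Longrightarrow> sbd (Suc p) z = 0 \<Longrightarrow> lin x z = 0"
  shows "x \<in> F2_coboundaries (Suc p) X"
proof -
  have "\<exists>h. \<forall>c\<in>schains (Suc p) X. lin h (sbd (Suc p) c) = lin x c"
    by (rule factor_functional) (simp_all add: chains_add lin_add z)
  then obtain h where h: "\<And>c. c \<in> schains (Suc p) X \<Longrightarrow> lin h (sbd (Suc p) c) = lin x c"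
    by blast
  define b where "b \<sigma> = (if singular_simplex p X \<sigma> then h \<sigma> else 0)" for \<sigma>
  have "F2_coboundary p X b \<sigma> = x \<sigma>" for \<sigma>
  proof (cases "singular_simplex (Suc p) X \<sigma>")
    case True
    then have g: "gen \<sigma> \<in> schains (Suc p) X"
      by (simp add: chain_space_def)
    have "F2_coboundary p X b \<sigma> = lin b (sbd (Suc p) (gen \<sigma>))"
      using F2_coboundary_eq [OF True] by simp
    also have "\<dots> = lin h (sbd (Suc p) (gen \<sigma>))"
      using sbd_schains [OF g] by (rule lin_cong_chains) (simp add: b_def)
    also have "\<dots> = x \<sigma>"
      using h [OF g] by simp
    finally show ?thesis .
  qed (use x in \<open>simp add: F2_coboundary_def F2_cochains_def\<close>)
  then have "x = F2_coboundary p X b" by auto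
  moreover have "b \<in> F2_cochains p X"
    by (simp add: F2_cochains_def b_def)
  ultimately show ?thesis
    by (auto simp: F2_coboundaries_def)
qed

lemma square_cochain: "square X x \<in> F2_cochains 2 X"
  unfolding F2_cochains_def square_eq by simp

lemma singular_face_singular_face:
  assumes "i < j" "j \<le> Suc (Suc p)"
  shows "singular_face (Suc p) i (singular_face (Suc (Suc p)) j f) =
    singular_face (Suc p) (j - 1) (singular_face (Suc (Suc p)) i f)"
proof -
  have eq: "simplical_face j (simplical_face i t) = simplical_face i (simplical_face (j - 1) t)" for t :: "nat \<Rightarrow> real"
    using assms(1) by (auto simp: simplical_face_def fun_eq_iff)
  have "simplical_face k t \<in> standard_simplex (Suc p)" if "t \<in> standard_simplex p" "k \<le> Suc p" for k t
    using simplical_face_in_standard_simplex [of "Suc p" k t] that by simp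
  then show ?thesis
    unfolding singular_face_def restrict_def using assms by (intro ext) (auto simp: eq [simplified])
qed

text \<open>
  On a 3-simplex the square is computed from the values of the cocycle on three consecutive
  edges.
\<close>

lemma square_sface:
  assumes x: "x \<in> F2_cocycles 1 X" and \<tau>: "singular_simplex 3 X \<tau>"
  shows "lin (square X x) (sface 3 \<tau>) = 0"
proof -
  have f: "singular_simplex 2 X (singular_face 3 k \<tau>)" if "k \<le> 3" for k
    using singular_simplex_singular_face [OF \<tau>, of k] that by simp
  have ff: "singular_face 2 i (singular_face 3 j \<tau>) = singular_face 2 (j - 1) (singular_face 3 i \<tau>)" if "i < j" "j \<le> 3" for i j
    using singular_face_singular_face [of i j 1 \<tau>] that by (simp add: numeral_3_eq_3 numeral_2_eq_2)
  have c: "x (singular_face 2 0 (singular_face 3 k \<tau>)) + (x (singular_face 2 1 (singular_face 3 k \<tau>))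
      + x (singular_face 2 2 (singular_face 3 k \<tau>))) = 0" if "k \<le> 3" for k
  proof -
    have "sface 2 \<rho> = gen (singular_face 2 0 \<rho>) + (gen (singular_face 2 1 \<rho>) + gen (singular_face 2 2 \<rho>))"
      for \<rho> :: "(nat \<Rightarrow> real) \<Rightarrow> 'a"
      by (simp add: sface_def numeral_2_eq_2 add.assoc)
    moreover have "lin x (sface 2 (singular_face 3 k \<tau>)) = 0"
      using cocycle_sface [OF x, of "singular_face 3 k \<tau>"] f [OF that] by (simp add: numeral_2_eq_2)
    ultimately show ?thesis
      by (simp only: lin_add lin_gen)
  qed
  have s: "sface 3 \<tau> = gen (singular_face 3 0 \<tau>) + (gen (singular_face 3 1 \<tau>) +
      (gen (singular_face 3 2 \<tau>) + gen (singular_face 3 3 \<tau>)))"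
    by (simp add: sface_def numeral_3_eq_3 numeral_2_eq_2 add.assoc)
  have bits: "q = r + p" if "p + (q + r) = 0" for p q r :: bit
    using that by (cases p; cases q; cases r) simp_all
  \<comment> \<open>The values on the edges 01, 12 and 23 of the 3-simplex; the cocycle condition
    then gives \<open>a + b\<close> on 02 and \<open>b + c\<close> on 13.\<close>
  define a b c where "a = x (singular_face 2 2 (singular_face 3 3 \<tau>))"
    and "b = x (singular_face 2 0 (singular_face 3 3 \<tau>))" and "c = x (singular_face 2 0 (singular_face 3 0 \<tau>))"
  have e: "x (singular_face 2 2 (singular_face 3 2 \<tau>)) = a" "x (singular_face 2 2 (singular_face 3 0 \<tau>)) = b"
    "x (singular_face 2 0 (singular_face 3 1 \<tau>)) = c"
    using ff [of 2 3] ff [of 0 3] ff [of 0 1] by (simp_all add: a_def b_def c_def)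
  have "x (singular_face 2 2 (singular_face 3 1 \<tau>)) = a + b"
    using bits [OF c [of 3]] ff [of 1 3] by (simp only: a_def b_def) simp
  moreover have "x (singular_face 2 0 (singular_face 3 2 \<tau>)) = b + c"
    using bits [OF c [of 0]] ff [of 0 2] e(2) by (simp only: c_def) simp
  ultimately have "lin (square X x) (sface 3 \<tau>) = b * c + ((a + b) * c + (a * (b + c) + a * b))"
    unfolding s lin_add lin_gen square_eq using f e
    by (simp only: simp_thms if_True a_def [symmetric] b_def [symmetric] c_def [symmetric])
  also have "\<dots> = 0"
    by (cases a; cases b; cases c) simp_all
  finally show ?thesis .
qed

subsection \<open>Squares of simplicial cocycles\<close>

definition cup_square :: "('a list \<Rightarrow> bit) \<Rightarrow> 'a list \<Rightarrow> bit" where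
  "cup_square y xs = y (delete_nth 2 xs) * y (delete_nth 0 xs)"

definition simplicial_cocycle :: "('a list \<Rightarrow> bit) \<Rightarrow> 'a set set \<Rightarrow> nat \<Rightarrow> bool" where
  "simplicial_cocycle y K p \<longleftrightarrow> (\<forall>xs\<in>osimplices K (Suc p). lin y (faces xs) = 0)"

lemma simplicial_cocycle_boundaries:
  assumes y: "simplicial_cocycle y K p" and z: "z \<in> boundaries K p"
  shows "lin y z = 0"
proof -
  obtain e where e: "e \<in> chain_space (osimplices K (Suc p))" "z = bd e"
    using z by (auto simp: boundaries_def)
  have "lin y z = lin (\<lambda>xs. 0) e"
    unfolding e(2) lin_lin using e(1)
    by (rule lin_cong_chains) (use y in \<open>simp add: simplicial_cocycle_def\<close>)
  then show ?thesis by simp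
qed

lemma simplicial_cocycle_mono: "simplicial_cocycle y L p \<Longrightarrow> K \<subseteq> L \<Longrightarrow> simplicial_cocycle y K p"
  unfolding simplicial_cocycle_def using osimplices_mono by blast

lemma osimplices_3E:
  assumes "xs \<in> osimplices K (Suc (Suc (Suc 0)))"
  obtains a b c where "xs = [a, b, c]"
  using assms by (auto simp: osimplices_def length_Suc_conv)

text \<open>
  The difference of \<open>y\<close> and \<open>w\<close> is the coboundary of a function \<open>H\<close> of the vertices, and the
  difference of the squares is the coboundary of \<open>H \<union> y + w \<union> H\<close>.
\<close>

lemma cup_square_cong:
  assumes K: "simplicial_complex K" and y: "simplicial_cocycle y K 2" and w: "simplicial_cocycle w K 2"
    and yw: "\<And>z. z \<in> cycles K 2 \<Longrightarrow> lin y z = lin w z" and z: "z \<in> cycles K 3"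
  shows "lin (cup_square y) z = lin (cup_square w) z"
proof -
  have "\<exists>h. \<forall>x\<in>chain_space (osimplices K 2). lin h (bd x) = lin y x + lin w x"
  proof (rule factor_functional)
    show "lin y (u + v) + lin w (u + v) = lin y u + lin w u + (lin y v + lin w v)" for u v
      by (simp only: lin_add ac_simps)
    show "lin y v + lin w v = 0" if "v \<in> chain_space (osimplices K 2)" "bd v = 0" for v
      using yw [of v] that by (simp only: cycles_def mem_Collect_eq add_self simp_thms)
  qed (simp_all add: chains_add lin_add)
  then obtain h where h: "\<And>x. x \<in> chain_space (osimplices K 2) \<Longrightarrow> lin h (bd x) = lin y x + lin w x"
    by blast
  define H where "H a = h [a]" for a
  have edge: "H b + H a = y [a, b] + w [a, b]" if "set [a, b] \<in> K" for a b
    using h [of "gen [a, b]"] that by (simp add: chain_space_def osimplices_def lin_add H_def)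
  define F where "F xs = H (xs ! 0) * y xs + w xs * H (xs ! 1)" for xs
  have F: "cup_square y xs + cup_square w xs = lin F (faces xs)" if xs: "xs \<in> osimplices K 3" for xs
  proof -
    obtain a b c where abc: "xs = [a, b, c]"
      using osimplices_3E xs unfolding numeral_3_eq_3 by blast
    have K': "set [a, b] \<in> K" "set [b, c] \<in> K" "set [a, c] \<in> K"
      using xs by (auto simp: abc osimplices_def intro: simplicial_complexD [OF K])
    have f: "faces [a, b, c] = gen [b, c] + (gen [a, c] + gen [a, b])"
      by (simp add: lin_add)
    have xs': "[a, b, c] \<in> osimplices K (Suc 2)"
      using xs by (simp add: abc osimplices_def)
    have "lin y (faces [a, b, c]) = 0" "lin w (faces [a, b, c]) = 0"
      using y w xs' by (auto simp: simplicial_cocycle_def)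
    then have cy: "y [b, c] + (y [a, c] + y [a, b]) = 0" and cw: "w [b, c] + (w [a, c] + w [a, b]) = 0"
      unfolding f lin_add lin_gen .
    have bits: "yab * ybc + wab * wbc = (Hb * ybc + wbc * Hc) + ((Ha * yac + wac * Hc) + (Ha * yab + wab * Hb))"
      if "Hb + Ha = yab + wab" "Hc + Hb = ybc + wbc" "ybc + (yac + yab) = 0" "wbc + (wac + wab) = 0"
      for Ha Hb Hc yab ybc yac wab wbc wac :: bit
      using that by (cases Ha; cases Hb; cases Hc; cases yab; cases ybc; cases yac; cases wab; cases wbc; cases wac) simp_all
    have "cup_square y xs + cup_square w xs = y [a, b] * y [b, c] + w [a, b] * w [b, c]"
      by (simp only: abc cup_square_def delete_nth_simps numeral_2_eq_2)
    also have "\<dots> = F [b, c] + (F [a, c] + F [a, b])"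
      using bits [OF edge [OF K'(1)] edge [OF K'(2)] cy cw] by (simp only: F_def nth_Cons_0 One_nat_def nth_Cons_Suc)
    finally show ?thesis
      unfolding abc f lin_add lin_gen .
  qed
  have z': "z \<in> chain_space (osimplices K 3)" "bd z = 0"
    using z by (auto simp: cycles_def)
  have "lin (cup_square y) z + lin (cup_square w) z = lin (\<lambda>xs. lin F (faces xs)) z"
    unfolding lin_fun_add [symmetric] using z'(1) by (rule lin_cong_chains) (rule F)
  also have "\<dots> = lin F (bd z)"
    by (rule lin_lin [symmetric])
  also have "\<dots> = 0"
    unfolding z'(2) by (rule lin_0)
  finally show ?thesis
    by (simp only: add_eq_0_char2)
qed

text \<open>Without homology in degree one, \<open>y\<close> agrees on cycles with the zero cocycle,
  whose square is zero.\<close>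

lemma cup_square_zero:
  fixes y :: "'a list \<Rightarrow> bit"
  assumes "simplicial_complex K" "simplicial_cocycle y K 2" "hom_zero K 2" "z \<in> cycles K 3"
  shows "lin (cup_square y) z = 0"
proof -
  have "lin (cup_square y) z = lin (cup_square (\<lambda>_. 0)) z"
  proof (rule cup_square_cong [OF assms(1,2) _ _ assms(4)])
    show "simplicial_cocycle (\<lambda>_. 0) K 2"
      by (simp add: simplicial_cocycle_def)
    show "lin y z = lin (\<lambda>_. 0) z" if "z \<in> cycles K 2" for z
      using simplicial_cocycle_boundaries [OF assms(2), of z] assms(3) that by (auto simp: hom_zero_def)
  qed
  moreover have "cup_square (\<lambda>_. 0) = (\<lambda>_ :: 'a list. 0)"
    by (simp add: cup_square_def fun_eq_iff)
  ultimately show ?thesis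
    by simp
qed

abbreviation "simplicial_restriction x \<equiv> \<lambda>xs. x (affine_simplex xs)"

lemma lin_affine_chain: "lin x (affine_chain c) = lin (simplicial_restriction x) c"
  by (simp add: lin_lin)

lemma simplicial_restriction_cocycle:
  assumes "x \<in> F2_cocycles (Suc p) (geometric_realization K)"
  shows "simplicial_cocycle (simplicial_restriction x) K (Suc (Suc p))"
  unfolding simplicial_cocycle_def
proof
  fix xs assume xs: "xs \<in> osimplices K (Suc (Suc (Suc p)))"
  then have "singular_simplex (Suc (Suc p)) (geometric_realization K) (affine_simplex xs)"
    using singular_simplex_affine_simplex [of xs K] by (cases "xs = []") (auto simp: osimplices_def)
  then have "lin x (sface (Suc (Suc p)) (affine_simplex xs)) = 0"
    by (rule cocycle_sface [OF assms])
  then show "lin (simplicial_restriction x) (faces xs) = 0"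
    using xs by (simp add: osimplices_def sface_affine_simplex lin_affine_chain)
qed

lemma square_affine_simplex:
  assumes "xs \<in> osimplices K 3"
  shows "square (geometric_realization K) x (affine_simplex xs) = cup_square (simplicial_restriction x) xs"
proof -
  have l: "length xs = Suc (Suc 1)" "set xs \<in> K" "xs \<noteq> []"
    using assms by (auto simp: osimplices_def)
  then have "singular_simplex 2 (geometric_realization K) (affine_simplex xs)"
    using singular_simplex_affine_simplex [of xs K] by (simp add: numeral_2_eq_2)
  moreover have "singular_face 2 2 (affine_simplex xs) = affine_simplex (delete_nth 2 xs)"
    "singular_face 2 0 (affine_simplex xs) = affine_simplex (delete_nth 0 xs)"
    using singular_face_affine_simplex [OF l(1), of 2] singular_face_affine_simplex [OF l(1), of 0]
    by (simp_all add: numeral_2_eq_2)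
  ultimately show ?thesis
    by (simp only: square_eq if_True cup_square_def)
qed

lemma lin_square_affine_chain:
  assumes "c \<in> chain_space (osimplices K 3)"
  shows "lin (square (geometric_realization K) x) (affine_chain c) = lin (cup_square (simplicial_restriction x)) c"
  unfolding lin_affine_chain using assms by (rule lin_cong_chains) (rule square_affine_simplex)

lemma square_sbd:
  assumes x: "x \<in> F2_cocycles 1 X" and d: "d \<in> schains 3 X"
  shows "lin (square X x) (sbd 3 d) = 0"
proof -
  have "lin (square X x) (sbd 3 d) = lin (\<lambda>\<tau>. 0) d"
    unfolding lin_lin using d by (rule lin_cong_chains) (simp only: mem_Collect_eq square_sface [OF x])
  then show ?thesis by simp
qed

text \<open>By \<open>coboundaryI\<close> the square has to be evaluated on singular cycles; these
  are homologous to affine ones, and the square of a cocycle vanishes on boundaries.\<close>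

lemma square_coboundaryI:
  assumes K: "simplicial_complex K" and x: "x \<in> F2_cocycles 1 (geometric_realization K)"
    and c: "\<And>c. c \<in> cycles K 3 \<Longrightarrow> lin (cup_square (simplicial_restriction x)) c = 0"
  shows "square (geometric_realization K) x \<in> F2_coboundaries 2 (geometric_realization K)"
  unfolding numeral_2_eq_2
proof (rule coboundaryI)
  let ?X = "geometric_realization K"
  show "square ?X x \<in> F2_cochains (Suc (Suc 0)) ?X"
    using square_cochain unfolding numeral_2_eq_2 .
  fix z assume z: "z \<in> schains (Suc (Suc 0)) ?X" "sbd (Suc (Suc 0)) z = 0"
  obtain a d where a: "a \<in> cycles K (Suc (Suc (Suc 0)))" and d: "d \<in> schains (Suc (Suc (Suc 0))) ?X"
    and zd: "z + affine_chain a = sbd (Suc (Suc (Suc 0))) d"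
    using singular_cycle_affine [OF K z] by auto
  have 3: "Suc (Suc (Suc 0)) = 3" by simp
  have "lin (square ?X x) (z + affine_chain a) = 0"
    unfolding zd using square_sbd [OF x] d unfolding 3 by blast
  moreover have "lin (square ?X x) (affine_chain a) = 0"
    using lin_square_affine_chain [of a K x] c [of a] a unfolding 3 cycles_def by auto
  ultimately show "lin (square ?X x) z = 0"
    by (simp only: lin_add add_0_right)
qed

lemma cup_square_boundaries:
  assumes x: "x \<in> F2_cocycles 1 (geometric_realization K)" and z: "z \<in> boundaries K 3"
    and K: "simplicial_complex K"
  shows "lin (cup_square (simplicial_restriction x)) z = 0"
proof -
  obtain e where e: "e \<in> chain_space (osimplices K (Suc 3))" "z = bd e"
    using z by (auto simp: boundaries_def)
  have 3: "Suc (Suc (Suc 0)) = 3" by simp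
  have e': "e \<in> chain_space (osimplices K (Suc (Suc (Suc (Suc 0)))))"
    using e(1) by (simp add: numeral_3_eq_3)
  have "lin (square (geometric_realization K) x) (affine_chain z) = 0"
    unfolding e(2) sbd_affine_chain [OF e', symmetric] 3
    by (rule square_sbd [OF x]) (use affine_chain_schains [OF e'] in \<open>simp only: 3\<close>)
  moreover have "z \<in> chain_space (osimplices K 3)"
    using boundaries_subset_cycles [OF K] z by (auto simp: cycles_def)
  ultimately show ?thesis
    using lin_square_affine_chain by metis
qed

text \<open>The circle has no homology in degree two and the other spheres have none in degree one,
  so either the cycle or the cocycle is trivial on each summand. The decomposition of cycles of a
  wedge adds these up.\<close>

lemma wedge_square_coboundary:
  assumes n: "1 < n" and t: "0 < t" "t \<le> simplex_angle n"
    and x: "x \<in> F2_cocycles 1 (VR (sphere_wedge n) sphere_wedge_dist t)"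
  shows "square (VR (sphere_wedge n) sphere_wedge_dist t) x \<in> F2_coboundaries 2 (VR (sphere_wedge n) sphere_wedge_dist t)"
proof -
  interpret wedge_complex "{1..n}" "summand n" "wedge_point n 1 base" "\<lambda>u v. sphere_wedge_dist u v < t"
    by (rule wedge_complex_sphere_wedge) (use n t in auto)
  have VR: "VR (sphere_wedge n) sphere_wedge_dist t = geometric_realization K"
    by (simp add: VR_eq sphere_wedge_eq)
  note K = simplicial_complex_clique [of "\<Union>i\<in>{1..n}. summand n i" "\<lambda>u v. sphere_wedge_dist u v < t"]
  let ?y = "simplicial_restriction x"
  have x': "x \<in> F2_cocycles 1 (geometric_realization K)"
    using x unfolding VR .
  have y: "simplicial_cocycle ?y K 2"
    using simplicial_restriction_cocycle [of x 0 K] x' by (simp add: numeral_2_eq_2)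
  have zero: "hom_zero (S i) k" if "i \<in> {1..n}" "k \<noteq> Suc i" for i k
    using summand_clique_hom_zero [OF that(1), of t k] sphere_clique_homology(2) [OF n _ t, of i k] that by simp
  have i: "lin (cup_square ?y) z = 0" if i: "i \<in> {1..n}" and z: "z \<in> cycles (S i) 3" for i z
  proof (cases "i = 1")
    case True
    then have "z \<in> boundaries (S i) 3"
      using zero [OF i, of 3] z by (auto simp: hom_zero_def)
    then have "z \<in> boundaries K 3"
      by (rule boundaries_mono [OF _ S_subset [OF i]])
    then show ?thesis
      by (rule cup_square_boundaries [OF x' _ K])
  next
    case False
    then have "hom_zero (S i) 2"
      using zero [OF i, of 2] by simp
    then show ?thesis
      by (rule cup_square_zero [OF simplicial_complex_clique simplicial_cocycle_mono [OF y S_subset [OF i]] _ z])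
  qed
  show ?thesis
    unfolding VR
  proof (rule square_coboundaryI [OF K x'])
    fix c assume c: "c \<in> cycles K 3"
    have "lin (cup_square ?y) (c + (\<Sum>i\<in>{1..n}. push (ret i) c)) = 0"
      by (rule cup_square_boundaries [OF x' wedge_decomposition [OF c] K])
    moreover have "lin (cup_square ?y) (\<Sum>i\<in>{1..n}. push (ret i) c) = 0"
      unfolding lin_sum by (rule sum.neutral) (use i ret_cycles [OF _ c] in blast)
    ultimately show "lin (cup_square ?y) c = 0"
      by (simp only: lin_add add_0_right)
  qed
qed

subsection \<open>The square of the first Stiefel--Whitney class\<close>

text \<open>The Stiefel-Whitney class is given on simplicial chains, whereas a singular cocycle is
  wanted. On singular cycles it is the functional \<open>f\<close> that detects nonbounding ones,
  additive because it agrees with \<open>RP.line_ev n 1\<close> on homologous affine cycles. Its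
  extension to all chains is a cocycle since \<open>f\<close> is zero on boundaries.\<close>

lemma projective_class:
  assumes n: "1 < n" and s: "0 < s" "s \<le> 2 * pi / 3"
  shows "\<exists>x\<in>F2_cocycles 1 (geometric_realization (projective_clique n s)).
    \<forall>c\<in>cycles (projective_clique n s) 2. lin (simplicial_restriction x) c = RP.line_ev n 1 c"
proof -
  let ?K = "projective_clique n s"
  let ?X = "geometric_realization ?K"
  let ?B = "sbd (Suc (Suc 0)) ` schains (Suc (Suc 0)) ?X"
  define Z where "Z = {z \<in> schains (Suc 0) ?X. sbd (Suc 0) z = 0}"
  define f :: "((nat \<Rightarrow> real) \<Rightarrow> (nat \<Rightarrow> real) set \<Rightarrow> real) mod2 \<Rightarrow> bit"
    where "f z = (if z \<in> ?B then 0 else 1)" for z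
  have K: "simplicial_complex ?K"
    by (rule simplicial_complex_clique)
  have B_add: "u + v \<in> ?B" if "u \<in> ?B" "v \<in> ?B" for u v
    using that by (auto simp: chains_add simp flip: lin_add)
  have f: "f z = RP.line_ev n 1 a" if a: "a \<in> cycles ?K (Suc (Suc 0))" and za: "z + affine_chain a \<in> ?B" for z a
  proof -
    have "z \<in> ?B \<longleftrightarrow> affine_chain a \<in> ?B"
      using B_add [OF za, of "affine_chain a"] B_add [OF za, of z] by (auto simp: add.assoc add.commute [of z])
    also have "\<dots> \<longleftrightarrow> a \<in> boundaries ?K (Suc (Suc 0))"
    proof
      show "a \<in> boundaries ?K (Suc (Suc 0))" if "affine_chain a \<in> ?B"
        using affine_boundary_imp_boundary [OF K a] that by force
      assume "a \<in> boundaries ?K (Suc (Suc 0))"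
      then obtain e where e: "e \<in> chain_space (osimplices ?K (Suc (Suc (Suc 0))))" "a = bd e"
        by (auto simp: boundaries_def)
      show "affine_chain a \<in> ?B"
        unfolding e(2) sbd_affine_chain [OF e(1), symmetric] by (rule imageI [OF affine_chain_schains [OF e(1)]])
    qed
    also have "\<dots> \<longleftrightarrow> RP.line_ev n 1 a = 0"
      using projective_clique_homology(2) [of n s 1 a] n s a by simp
    finally have "f z = (if RP.line_ev n 1 a = 0 then 0 else 1)"
      unfolding f_def by (rule if_cong) (rule refl)+
    then show ?thesis
      by (cases "RP.line_ev n 1 a") (simp_all only: if_True if_False bit.distinct one_neq_zero simp_thms)
  qed
  have "\<exists>h. \<forall>z\<in>Z. lin h z = f z"
  proof (rule factor_functional [where D = "\<lambda>z. z"])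
    show "f (u + v) = f u + f v" if u: "u \<in> Z" and v: "v \<in> Z" for u v
    proof -
      obtain a d where a: "a \<in> cycles ?K (Suc (Suc 0))" "d \<in> schains (Suc (Suc 0)) ?X" "u + affine_chain a = sbd (Suc (Suc 0)) d"
        using singular_cycle_affine [OF K, of u "Suc 0"] u by (auto simp: Z_def)
      obtain b e where b: "b \<in> cycles ?K (Suc (Suc 0))" "e \<in> schains (Suc (Suc 0)) ?X" "v + affine_chain b = sbd (Suc (Suc 0)) e"
        using singular_cycle_affine [OF K, of v "Suc 0"] v by (auto simp: Z_def)
      have ub: "u + affine_chain a \<in> ?B" "v + affine_chain b \<in> ?B"
        unfolding a(3) b(3) using a(2) b(2) by blast+
      have eq: "u + v + affine_chain (a + b) = (u + affine_chain a) + (v + affine_chain b)"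
        by (simp only: lin_add ac_simps)
      have "u + v + affine_chain (a + b) \<in> ?B"
        unfolding eq by (rule B_add [OF ub])
      then show ?thesis
        using f [OF a(1) ub(1)] f [OF b(1) ub(2)] f [OF cycles_add [OF a(1) b(1)]] by (simp only: ev_add)
    qed
    show "f z = 0" if "z = 0" for z
      unfolding that f_def if_True
      by (rule if_P) (rule image_eqI [of _ _ 0], simp_all)
  qed (auto simp: Z_def chains_add lin_add)
  then obtain h where h: "\<And>z. z \<in> Z \<Longrightarrow> lin h z = f z"
    by blast
  define x where "x \<sigma> = (if singular_simplex (Suc 0) ?X \<sigma> then h \<sigma> else 0)" for \<sigma>
  have xh: "lin x z = lin h z" if "z \<in> schains (Suc 0) ?X" for z
    using that by (rule lin_cong_chains) (simp add: x_def)
  have "F2_coboundary (Suc 0) ?X x \<tau> = 0" for \<tau>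
  proof (cases "singular_simplex (Suc (Suc 0)) ?X \<tau>")
    case True
    then have g: "gen \<tau> \<in> schains (Suc (Suc 0)) ?X"
      by (simp add: chain_space_def)
    have "F2_coboundary (Suc 0) ?X x \<tau> = lin x (sbd (Suc (Suc 0)) (gen \<tau>))"
      using F2_coboundary_eq [OF True] by simp
    also have "\<dots> = f (sbd (Suc (Suc 0)) (gen \<tau>))"
      unfolding xh [OF sbd_schains [OF g]]
      by (rule h) (use sbd_schains [OF g] sbd_sbd [OF g] in \<open>simp add: Z_def\<close>)
    also have "\<dots> = 0"
      unfolding f_def by (rule if_P) (rule imageI [OF g])
    finally show ?thesis .
  qed (simp add: F2_coboundary_def)
  then have x: "x \<in> F2_cocycles 1 ?X"
    by (auto simp: F2_cocycles_def F2_cochains_def x_def)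
  have "lin (simplicial_restriction x) c = RP.line_ev n 1 c" if c: "c \<in> cycles ?K 2" for c
  proof -
    have c': "c \<in> chain_space (osimplices ?K (Suc (Suc 0)))" "bd c = 0" "c \<in> cycles ?K (Suc (Suc 0))"
      using c by (auto simp: cycles_def numeral_2_eq_2)
    have "sbd (Suc 0) (affine_chain c) = 0"
      unfolding sbd_affine_chain [OF c'(1)] c'(2) by (rule lin_0)
    then have Z: "affine_chain c \<in> Z"
      using affine_chain_schains [OF c'(1)] by (simp add: Z_def)
    have B: "affine_chain c + affine_chain c \<in> ?B"
      unfolding add_self by (rule image_eqI [of _ _ 0]) simp_all
    have "lin (simplicial_restriction x) c = lin x (affine_chain c)"
      by (rule lin_affine_chain [symmetric])
    also have "\<dots> = lin h (affine_chain c)"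
      by (rule xh [OF affine_chain_schains [OF c'(1)]])
    also have "\<dots> = f (affine_chain c)"
      by (rule h [OF Z])
    also have "\<dots> = RP.line_ev n 1 c"
      by (rule f [OF c'(3) B])
    finally show ?thesis .
  qed
  then show ?thesis
    using x by blast
qed

text \<open>Each cap product evaluates the class on the first edge and drops the first vertex; two
  of them multiply the values on the front and the back edge.\<close>

lemma line_ev_cup_square:
  assumes "c \<in> chain_space (osimplices K 3)"
  shows "RP.line_ev n 2 c = lin (cup_square (\<lambda>xs. RP.line_ev n 1 (gen xs))) c"
proof -
  have ev: "RP.line_ev n m c = lin (\<lambda>xs. RP.line_ev n m (gen xs)) c" for m c
    by (rule lin_unique) (simp_all add: ev_add)
  have "RP.line_ev n 2 c = lin (\<lambda>xs. RP.line_ev n 2 (gen xs)) c"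
    by (rule ev)
  also have "\<dots> = lin (cup_square (\<lambda>xs. RP.line_ev n 1 (gen xs))) c"
    using assms
  proof (rule lin_cong_chains)
    fix xs assume "xs \<in> osimplices K 3"
    then obtain u v w where xs: "xs = [u, v, w]"
      using osimplices_3E unfolding numeral_3_eq_3 by blast
    have 0: "RP.line_ev n 0 (gen [a]) = 1" for a
      by simp
    show "RP.line_ev n 2 (gen xs) = cup_square (\<lambda>xs. RP.line_ev n 1 (gen xs)) xs"
      by (simp add: xs cup_square_def numeral_2_eq_2)
  qed
  finally show ?thesis .
qed

text \<open>The restricted square is evaluated on a generator \<open>z\<close> of the degree two
  homology at scale \<open>r\<close>, which exists as \<open>n > 1\<close>. The value is the second
  power of the Stiefel-Whitney class on \<open>z\<close> and hence nonzero, whereas coboundaries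
  vanish on cycles.\<close>

lemma projective_square_nonzero:
  assumes n: "1 < n" and r: "0 < r" "r \<le> s" and s: "s \<le> 2 * pi / 3"
    and x: "x \<in> F2_cocycles 1 (geometric_realization (projective_clique n s))"
    and xe: "\<And>c. c \<in> cycles (projective_clique n s) 2 \<Longrightarrow> lin (simplicial_restriction x) c = RP.line_ev n 1 c"
  defines "X \<equiv> \<lambda>r. geometric_realization (projective_clique n r)"
  shows "(\<lambda>\<sigma>. if singular_simplex 2 (X r) \<sigma> then square (X s) x \<sigma> else 0) \<notin> F2_coboundaries 2 (X r)"
proof
  let ?\<rho> = "\<lambda>\<sigma>. if singular_simplex 2 (X r) \<sigma> then square (X s) x \<sigma> else 0"
  let ?w = "\<lambda>xs. RP.line_ev n 1 (gen xs)"
  let ?Ks = "projective_clique n s" and ?Kr = "projective_clique n r"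
  have Ks: "simplicial_complex ?Ks"
    by (rule simplicial_complex_clique)
  have sub: "?Kr \<subseteq> ?Ks"
    by (rule clique_less_mono [OF r(2)])
  have s0: "0 < s" and r1: "r \<le> 2 * pi / 3" and n0: "0 < n"
    using r s n by auto
  obtain z where z: "z \<in> cycles ?Kr (Suc 2)" "z \<notin> boundaries ?Kr (Suc 2)"
    using projective_clique_homology(1) [OF n0 r(1) r1, of 2] n unfolding hom_line_def by auto
  then have z1: "RP.line_ev n 2 z \<noteq> 0"
    using projective_clique_homology(2) [OF n0 r(1) r1, of 2 z] n by auto
  have z3: "z \<in> cycles ?Kr 3"
    using z(1) by simp
  then have zc: "z \<in> chain_space (osimplices ?Kr 3)" "bd z = 0"
    by (auto simp: cycles_def)
  have w: "lin ?w c = RP.line_ev n 1 c" for c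
    by (rule lin_unique [symmetric]) (simp_all add: ev_add)
  have w_cocycle: "simplicial_cocycle ?w ?Ks 2"
    unfolding simplicial_cocycle_def w
  proof
    fix xs assume xs: "xs \<in> osimplices ?Ks (Suc 2)"
    then have "faces xs \<in> boundaries ?Ks 2"
      by (intro boundariesI [of "gen xs"]) (simp_all add: chain_space_def)
    then show "RP.line_ev n 1 (faces xs) = 0"
      using projective_clique_homology(2) [OF n0 s0 s, of 1 "faces xs"] boundaries_subset_cycles [OF Ks] n
      by (auto simp: numeral_2_eq_2)
  qed
  have y_cocycle: "simplicial_cocycle (simplicial_restriction x) ?Ks 2"
    using simplicial_restriction_cocycle [of x 0 ?Ks] x by (simp add: numeral_2_eq_2)
  have "lin ?\<rho> (affine_chain z) = lin (cup_square (simplicial_restriction x)) z"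
    unfolding lin_affine_chain using zc(1)
  proof (rule lin_cong_chains)
    fix xs assume xs: "xs \<in> osimplices ?Kr 3"
    then have "singular_simplex 2 (X r) (affine_simplex xs)"
      using singular_simplex_affine_simplex [of xs ?Kr] by (cases "xs = []") (auto simp: osimplices_def X_def)
    moreover have "xs \<in> osimplices ?Ks 3"
      using xs osimplices_mono [OF sub] by blast
    ultimately show "?\<rho> (affine_simplex xs) = cup_square (simplicial_restriction x) xs"
      using square_affine_simplex [of xs ?Ks x] by (simp only: if_True X_def)
  qed
  also have "\<dots> = lin (cup_square ?w) z"
    by (rule cup_square_cong [OF Ks y_cocycle w_cocycle _ cycles_mono [OF z3 sub]]) (simp only: xe w)
  also have "\<dots> = RP.line_ev n 2 z"
    by (rule line_ev_cup_square [OF zc(1), symmetric])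
  finally have 1: "lin ?\<rho> (affine_chain z) \<noteq> 0"
    using z1 by simp
  assume "?\<rho> \<in> F2_coboundaries 2 (X r)"
  then obtain b where b: "?\<rho> = F2_coboundary (Suc 0) (X r) b"
    by (auto simp: F2_coboundaries_def numeral_2_eq_2)
  have zc': "z \<in> chain_space (osimplices ?Kr (Suc (Suc (Suc 0))))"
    using zc(1) by (simp add: numeral_3_eq_3)
  have "lin ?\<rho> (affine_chain z) = lin b (sbd (Suc (Suc 0)) (affine_chain z))"
    unfolding b by (rule lin_coboundary) (use affine_chain_schains [OF zc'] in \<open>simp add: X_def\<close>)
  also have "\<dots> = 0"
    unfolding sbd_affine_chain [OF zc'] zc(2) lin_0 ..
  finally show False
    using 1 by simp
qed


section \<open>The distance between the images of the Steenrod square\<close>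

text \<open>Stated for any nonempty \<open>A\<close>, since the elements of the image of the square
  are met below as unions of cosets over representatives.\<close>

lemma smult_zero_quotient:
  assumes "A \<noteq> {}"
  shows "0 \<odot>\<^bsub>quotient_space (F2_functions S) N\<^esub> A = N"
proof -
  have "0 \<odot>\<^bsub>quotient_space (F2_functions S) N\<^esub> A = (\<Union>a\<in>A. coset N (\<lambda>i. 0 * a i))"
    unfolding quotient_space_def by (simp add: r_coset_F2) (simp add: F2_functions_def)
  then show ?thesis
    using assms by simp
qed

lemma steenrod_square_coset:
  "steenrod_square 1 1 X A = (\<Union>a\<in>A. coset (F2_coboundaries 2 X) (square X a))"
  unfolding steenrod_square_def quotient_map_induced_def r_coset_F2 one_add_one ..

lemma Sq_image_simps:
  "carrier (obj (VR_Sq_image 1 1 M d) r) =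
     (\<lambda>x. steenrod_square 1 1 (VR M d r) (coset (F2_coboundaries 1 (VR M d r)) x)) ` F2_cocycles 1 (VR M d r)"
  "smult (obj (VR_Sq_image 1 1 M d) r) =
     smult (quotient_space (F2_functions (F2_cocycles 2 (VR M d r))) (F2_coboundaries 2 (VR M d r)))"
  "structure_map (VR_Sq_image 1 1 M d) r s A = (\<Union>y\<in>A. coset (F2_coboundaries 2 (VR M d r))
     (\<lambda>\<sigma>. if singular_simplex 2 (VR M d r) \<sigma> then y (simplex_map 2 id \<sigma>) else 0))"
  unfolding VR_Sq_image_def one_add_one
  by (simp_all add: F2_cohomology_def carrier_quotient image_image F2_cohomology_induced_def
      quotient_map_induced_def r_coset_F2)

lemma self_in_coset: "F2_subspace N \<Longrightarrow> x \<in> coset N x"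
  using subspace_zero by (simp add: coset_mem)

lemma op_interleavedE:
  assumes "op_interleaved \<delta> F G"
  obtains \<phi> \<psi> where "\<And>r. \<phi> r \<in> linear_maps (obj F (r + \<delta>)) (obj G r)"
    "\<And>r. \<psi> r \<in> linear_maps (obj G (r + \<delta>)) (obj F r)"
    "\<And>r x. x \<in> carrier (obj F (r + 2 * \<delta>)) \<Longrightarrow> \<psi> r (\<phi> (r + \<delta>) x) = structure_map F r (r + 2 * \<delta>) x"
  using assms unfolding op_interleaved_def
proof (elim exE conjE)
  fix \<phi> \<psi> assume *: "\<forall>r. \<phi> r \<in> linear_maps (obj F (r + \<delta>)) (obj G r)"
    "\<forall>r. \<psi> r \<in> linear_maps (obj G (r + \<delta>)) (obj F r)"
    "\<forall>r. \<forall>x\<in>carrier (obj F (r + 2 * \<delta>)). \<psi> r (\<phi> (r + \<delta>) x) = structure_map F r (r + 2 * \<delta>) x"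
  show thesis
    by (rule that [of \<phi> \<psi>]) (use * in simp_all)
qed

lemma not_op_interleaved:
  assumes n: "1 < n" and \<delta>: "0 \<le> \<delta>" "\<delta> < pi / 3"
  shows "\<not> op_interleaved \<delta> (VR_Sq_image 1 1 (projective_space n) (projective_dist n))
    (VR_Sq_image 1 1 (sphere_wedge n) sphere_wedge_dist)"
proof (intro notI, elim op_interleavedE)
  let ?F = "VR_Sq_image 1 1 (projective_space n) (projective_dist n)"
    and ?G = "VR_Sq_image 1 1 (sphere_wedge n) sphere_wedge_dist"
  fix \<phi> \<psi> assume \<phi>: "\<And>r. \<phi> r \<in> linear_maps (obj ?F (r + \<delta>)) (obj ?G r)"
    and \<psi>: "\<And>r. \<psi> r \<in> linear_maps (obj ?G (r + \<delta>)) (obj ?F r)"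
    and comp: "\<And>r x. x \<in> carrier (obj ?F (r + 2 * \<delta>)) \<Longrightarrow> \<psi> r (\<phi> (r + \<delta>) x) = structure_map ?F r (r + 2 * \<delta>) x"
  \<comment> \<open>The first bound keeps \<open>r + 2 * \<delta>\<close> in the range where the
    projective square is nonzero; the second, with \<open>\<delta> < pi / 3\<close>, puts
    \<open>r + \<delta>\<close> where the square on the wedge is zero. Both are positive.\<close>
  define r where "r = min (2 * pi / 3 - 2 * \<delta>) (pi / 6)"
  define t s where "t = r + \<delta>" and "s = r + 2 * \<delta>"
  have r: "0 < r" "r \<le> s" "s \<le> 2 * pi / 3" "0 < t" "t \<le> pi / 2"
    using \<delta> pi_gt_zero by (auto simp: r_def t_def s_def min_def)
  have ts: "t + \<delta> = s" "r + \<delta> = t" "r + 2 * \<delta> = s"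
    by (simp_all add: t_def s_def)
  let ?X = "VR (projective_space n) (projective_dist n)" and ?Y = "VR (sphere_wedge n) sphere_wedge_dist"
  obtain x where x: "x \<in> F2_cocycles 1 (?X s)"
    and xe: "\<And>c. c \<in> cycles (projective_clique n s) 2 \<Longrightarrow> lin (simplicial_restriction x) c = RP.line_ev n 1 c"
    using projective_class [OF n, of s] r unfolding VR_eq by auto
  let ?B = "\<lambda>p r. F2_coboundaries p (?X r)" and ?C = "\<lambda>p. F2_coboundaries p (?Y t)"
  have sub: "F2_subspace (?B 1 r)" "F2_subspace (?B 2 r)" "F2_subspace (?C 1)" "F2_subspace (?C 2)" for r
    using F2_subspace_coboundaries [of 0] F2_subspace_coboundaries [of 1]
    by (simp_all add: numeral_2_eq_2)
  define S where "S = steenrod_square 1 1 (?X s) (coset (?B 1 s) x)"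
  have S: "S \<in> carrier (obj ?F s)"
    unfolding Sq_image_simps S_def using x by blast
  have zero: "A = ?C 2" if "A \<in> carrier (obj ?G t)" for A
  proof -
    obtain y where y: "y \<in> F2_cocycles 1 (?Y t)" "A = (\<Union>a\<in>coset (?C 1) y. coset (?C 2) (square (?Y t) a))"
      using \<open>A \<in> carrier (obj ?G t)\<close> unfolding Sq_image_simps steenrod_square_coset by blast
    have "coset (?C 2) (square (?Y t) a) = ?C 2" if a: "a \<in> coset (?C 1) y" for a
    proof -
      have "a \<boxplus> y \<in> F2_cocycles 1 (?Y t)"
        using a coboundary_cocycle [of "a \<boxplus> y" 0 "?Y t"] by (simp add: coset_mem)
      then have "a \<in> F2_cocycles 1 (?Y t)"
        using subspace_add_cancel [OF F2_subspace_cocycles y(1), of a] by (simp add: fadd_commute)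
      then have "square (?Y t) a \<in> ?C 2"
        by (rule wedge_square_coboundary [OF n r(4), rotated]) (use r(5) simplex_angle(2) [OF n] in simp)
      then show ?thesis
        by (simp only: coset_eq_zero_iff [OF sub(4)])
    qed
    then show ?thesis
      using self_in_coset [OF sub(3), of y] unfolding y(2) by blast
  qed
  have "\<phi> t S \<in> carrier (obj ?G t)"
    using \<phi> [of t] S unfolding ts linear_maps_def by blast
  then have C: "\<phi> t S = ?C 2" "?C 2 \<in> carrier (obj ?G t)"
    using zero by auto
  \<comment> \<open>Linearity of \<open>\<psi>\<close> enters as preservation of zero, expressed by
    multiplication with the scalar 0.\<close>
  have \<psi>r: "\<psi> r (0 \<odot>\<^bsub>obj ?G t\<^esub> ?C 2) = 0 \<odot>\<^bsub>obj ?F r\<^esub> \<psi> r (?C 2)" "\<psi> r (?C 2) \<in> carrier (obj ?F r)"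
    using \<psi> [of r] C(2) unfolding ts linear_maps_def by blast+
  have "0 \<odot>\<^bsub>obj ?G t\<^esub> ?C 2 = ?C 2"
    unfolding Sq_image_simps by (rule smult_zero_quotient) (use subspace_zero [OF sub(4)] in blast)
  moreover have "\<psi> r (?C 2) \<noteq> {}"
    using \<psi>r(2) self_in_coset [OF sub(1) [of r]] self_in_coset [OF sub(2) [of r]]
    unfolding Sq_image_simps steenrod_square_coset by blast
  then have "0 \<odot>\<^bsub>obj ?F r\<^esub> \<psi> r (?C 2) = ?B 2 r"
    unfolding Sq_image_simps by (rule smult_zero_quotient)
  ultimately have "structure_map ?F r s S = ?B 2 r"
    using comp [of S r] S \<psi>r(1) C(1) unfolding ts by simp
  \<comment> \<open>The restriction of this representative lies in the image of \<open>S\<close>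
    under the structure map, which has just been identified with the set of coboundaries.\<close>
  moreover have "square (?X s) x \<in> S"
    unfolding S_def steenrod_square_coset using self_in_coset [OF sub(1)] self_in_coset [OF sub(2)] by blast
  then have "(\<lambda>\<sigma>. if singular_simplex 2 (?X r) \<sigma> then square (?X s) x (simplex_map 2 id \<sigma>) else 0) \<in> structure_map ?F r s S"
    unfolding Sq_image_simps using self_in_coset [OF sub(2)] by blast
  moreover have "(\<lambda>\<sigma>. if singular_simplex 2 (?X r) \<sigma> then square (?X s) x (simplex_map 2 id \<sigma>) else 0) =
      (\<lambda>\<sigma>. if singular_simplex 2 (?X r) \<sigma> then square (?X s) x \<sigma> else 0)"
    using simplex_map_id_singular by fastforce
  ultimately show False
    using projective_square_nonzero [OF n r(1,2,3) x [unfolded VR_eq] xe] unfolding VR_eq by simp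
qed

lemma Sq_image_op_interleaving_distance:
  assumes "1 < n"
  shows "ereal (pi / 3) \<le> op_interleaving_distance (VR_Sq_image 1 1 (projective_space n) (projective_dist n))
    (VR_Sq_image 1 1 (sphere_wedge n) sphere_wedge_dist)"
  unfolding op_interleaving_distance_def
  by (rule INF_greatest) (use not_op_interleaved [OF assms] not_le in auto)

theorem theorem4:
  fixes n :: nat
  assumes "n > 1"
  shows "(\<forall>m :: nat.
            interleaving_distance
              (VR_homology m (projective_space n) (projective_dist n))
              (VR_homology m (sphere_wedge n) sphere_wedge_dist) < ereal (pi / 4))
       \<and> (\<exists>k l :: nat.
            ereal (pi / 3) \<le> op_interleaving_distance
              (VR_Sq_image k l (projective_space n) (projective_dist n))
              (VR_Sq_image k l (sphere_wedge n) sphere_wedge_dist))"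
  using homology_interleaving_distance [OF assms] Sq_image_op_interleaving_distance [OF assms] by blast

end
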